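(* Let $G$ be a Polish group and $H\le G$ a closed subgroup. Then $H$ is amenable if and only if $\mathrm{RUC}^b(G/H)$ is $G$-injective with respect to $G$-equivariant unital positive maps, i.e. injective in the category of $G$-function systems with $G$-equivariant unital positive maps as morphisms.
   Context: A function system is a norm closed unital self-adjoint subspace of a unital commutative $C^*$-algebra. A linear map between function systems is positive if it sends nonnegative elements to nonnegative elements; a unital order isomorphism is a unital linear bijection $\phi$ with $x\ge0\iff\phi(x)\ge0$. A $G$-function system is a function system with a continuous action of $G$ by unital order isomorphisms. A $G$-function system $A$ is injective if for all $G$-function systems $E_1\subseteq E_2$ (with $E_1$ a $G$-invariant function subsystem of $E_2$, containing the unit) every $G$-equivariant unital positive map $E_1\to A$ extends to a $G$-equivariant unital positive map $E_2\to A$. $\mathrm{RUC}^b(G/H)$ is the unital commutative $C^*$-algebra (supremum norm) of bounded right uniformly continuous functions on $G/H$, i.e. bounded $f\colon G/H\to\mathbb{C}$ such that for every $\varepsilon>0$ there is an open neighbourhood $U$ of $1_G$ with $|f(ux)-f(x)|<\varepsilon$ for all $u\in U$, $x\in G/H$, with the $G$-action $(g\cdot f)(x)=f(g^{-1}x)$. A flow of a topological group is a (nonempty) compact Hausdorff space with a continuous action of the group. A flow $X$ is proximal if for all $x,y\in X$ there is a net $(g_\lambda)$ in the group with $\lim g_\lambda x=\lim g_\lambda y$, and strongly proximal if the flow $P(X)$ of regular Borel probability measures (weak$^*$ topology) is proximal. A topological group is amenable if every strongly proximal flow of it has a fixed point. *)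

theory Defs
  imports
    "HOL-Probability.Probability"
    "HOL-Algebra.Module"
    "HOL-Algebra.Group_Action"
    "HOL-Algebra.Left_Coset"
begin

section \<open>Topological groups\<close>

definition topological_group :: "('a, 'm) monoid_scheme \<Rightarrow> 'a topology \<Rightarrow> bool" where
  "topological_group G T \<longleftrightarrow>
     group G \<and> topspace T = carrier G \<and>
     continuous_map (prod_topology T T) T (\<lambda>(x, y). x \<otimes>\<^bsub>G\<^esub> y) \<and>
     continuous_map T T (\<lambda>x. inv\<^bsub>G\<^esub> x)"

definition polish_group :: "('a, 'm) monoid_scheme \<Rightarrow> 'a topology \<Rightarrow> bool" where
  "polish_group G T \<longleftrightarrow>
     topological_group G T \<and> separable_space T \<and> completely_metrizable_space T"

definition continuous_action ::
    "('a, 'm) monoid_scheme \<Rightarrow> 'a topology \<Rightarrow> 'x topology \<Rightarrow> ('a \<Rightarrow> 'x \<Rightarrow> 'x) \<Rightarrow> bool" where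
  "continuous_action G T X \<phi> \<longleftrightarrow>
     group_action G (topspace X) \<phi> \<and>
     continuous_map (prod_topology T X) X (\<lambda>(g, x). \<phi> g x)"


section \<open>Flows and amenability\<close>

definition flow ::
    "('a, 'm) monoid_scheme \<Rightarrow> 'a topology \<Rightarrow> 'x topology \<Rightarrow> ('a \<Rightarrow> 'x \<Rightarrow> 'x) \<Rightarrow> bool" where
  "flow G T X \<phi> \<longleftrightarrow>
     topspace X \<noteq> {} \<and> compact_space X \<and> Hausdorff_space X \<and> continuous_action G T X \<phi>"

text \<open>A net in the group is rendered by a proper filter on its carrier.\<close>

definition proximal ::
    "('a, 'm) monoid_scheme \<Rightarrow> 'x topology \<Rightarrow> ('a \<Rightarrow> 'x \<Rightarrow> 'x) \<Rightarrow> bool" where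
  "proximal G X \<phi> \<longleftrightarrow>
     (\<forall>x \<in> topspace X. \<forall>y \<in> topspace X. \<exists>(F :: 'a filter) z.
        F \<noteq> bot \<and> eventually (\<lambda>g. g \<in> carrier G) F \<and>
        limitin X (\<lambda>g. \<phi> g x) z F \<and> limitin X (\<lambda>g. \<phi> g y) z F)"

definition borel_of :: "'x topology \<Rightarrow> 'x measure" where
  "borel_of X = sigma (topspace X) {U. openin X U}"

definition regular_borel_prob_measures :: "'x topology \<Rightarrow> 'x measure set" where
  "regular_borel_prob_measures X =
     {\<mu>. sets \<mu> = sets (borel_of X) \<and> prob_space \<mu> \<and>
         (\<forall>A \<in> sets \<mu>.
            emeasure \<mu> A = (INF U \<in> {U. openin X U \<and> A \<subseteq> U}. emeasure \<mu> U) \<and>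
            emeasure \<mu> A = (SUP K \<in> {K. compactin X K \<and> K \<subseteq> A}. emeasure \<mu> K))}"

text \<open>The weak* topology: the coarsest one making integration against each continuous function
  continuous. Real-valued functions give the same topology as complex-valued ones.\<close>

definition prob_topology :: "'x topology \<Rightarrow> 'x measure topology" where
  "prob_topology X =
     pullback_topology (regular_borel_prob_measures X)
       (\<lambda>\<mu>. \<lambda>f \<in> {f. continuous_map X euclideanreal f}. \<integral>x. f x \<partial>\<mu>)
       (product_topology (\<lambda>_. euclideanreal) {f. continuous_map X euclideanreal f})"

definition prob_action ::
    "'x topology \<Rightarrow> ('a \<Rightarrow> 'x \<Rightarrow> 'x) \<Rightarrow> 'a \<Rightarrow> 'x measure \<Rightarrow> 'x measure" where
  "prob_action X \<phi> g =
     (\<lambda>\<mu> \<in> regular_borel_prob_measures X. distr \<mu> (borel_of X) (\<phi> g))"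

definition strongly_proximal ::
    "('a, 'm) monoid_scheme \<Rightarrow> 'x topology \<Rightarrow> ('a \<Rightarrow> 'x \<Rightarrow> 'x) \<Rightarrow> bool" where
  "strongly_proximal G X \<phi> \<longleftrightarrow> proximal G (prob_topology X) (prob_action X \<phi>)"

text \<open>Definitions cannot quantify over types, so the universe \<open>'x\<close> from which the
  points of the flows are taken is a parameter. For a group on \<open>'a\<close>, the universe
  \<open>('a \<Rightarrow> complex) \<Rightarrow> complex\<close> loses nothing: a strongly proximal flow contains a minimal one, and a
  minimal flow \<open>X\<close> embeds, via the orbit of a point, as characters of a copy of \<open>C(X)\<close> inside the
  bounded functions on the group.\<close>

definition amenable ::
    "'x itself \<Rightarrow> ('a, 'm) monoid_scheme \<Rightarrow> 'a topology \<Rightarrow> bool" where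
  "amenable (_ :: 'x itself) G T \<longleftrightarrow>
     (\<forall>(X :: 'x topology) \<phi>.
        flow G T X \<phi> \<and> strongly_proximal G X \<phi> \<longrightarrow>
        (\<exists>x \<in> topspace X. \<forall>g \<in> carrier G. \<phi> g x = x))"


section \<open>Unital commutative C*-algebras\<close>

definition complex_ring :: "complex ring" where
  "complex_ring = \<lparr>carrier = UNIV, mult = (*), one = 1, zero = 0, add = (+)\<rparr>"

record 'e cstar_algebra = "(complex, 'e) module" +
  cnorm :: "'e \<Rightarrow> real"
  cstar :: "'e \<Rightarrow> 'e"

text \<open>The locale \<open>Metric_space\<close> asks for non-negativity and symmetry on the whole type, whence
  the value 0 off the carrier.\<close>

definition cdist :: "('e, 'm) cstar_algebra_scheme \<Rightarrow> 'e \<Rightarrow> 'e \<Rightarrow> real" where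
  "cdist B x y =
     (if x \<in> carrier B \<and> y \<in> carrier B then cnorm B (x \<ominus>\<^bsub>B\<^esub> y) else 0)"

abbreviation norm_topology :: "('e, 'm) cstar_algebra_scheme \<Rightarrow> 'e topology" where
  "norm_topology B \<equiv> Metric_space.mtopology (carrier B) (cdist B)"

locale normed_star_algebra = Module.algebra complex_ring B
  for B :: "('e, 'm) cstar_algebra_scheme" (structure) +
  assumes cnorm_nonneg: "x \<in> carrier B \<Longrightarrow> 0 \<le> cnorm B x"
    and cnorm_eq_0: "x \<in> carrier B \<Longrightarrow> cnorm B x = 0 \<longleftrightarrow> x = \<zero>"
    and cnorm_triangle:
      "\<lbrakk>x \<in> carrier B; y \<in> carrier B\<rbrakk> \<Longrightarrow> cnorm B (x \<oplus> y) \<le> cnorm B x + cnorm B y"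
    and cnorm_smult: "x \<in> carrier B \<Longrightarrow> cnorm B (c \<odot> x) = cmod c * cnorm B x"
    and cnorm_mult:
      "\<lbrakk>x \<in> carrier B; y \<in> carrier B\<rbrakk> \<Longrightarrow> cnorm B (x \<otimes> y) \<le> cnorm B x * cnorm B y"
    and cstar_closed: "x \<in> carrier B \<Longrightarrow> cstar B x \<in> carrier B"
    and cstar_cstar: "x \<in> carrier B \<Longrightarrow> cstar B (cstar B x) = x"
    and cstar_add:
      "\<lbrakk>x \<in> carrier B; y \<in> carrier B\<rbrakk> \<Longrightarrow> cstar B (x \<oplus> y) = cstar B x \<oplus> cstar B y"
    and cstar_smult: "x \<in> carrier B \<Longrightarrow> cstar B (c \<odot> x) = cnj c \<odot> cstar B x"
    and cstar_mult:
      "\<lbrakk>x \<in> carrier B; y \<in> carrier B\<rbrakk> \<Longrightarrow> cstar B (x \<otimes> y) = cstar B y \<otimes> cstar B x"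
    and cstar_identity:
      "x \<in> carrier B \<Longrightarrow> cnorm B (cstar B x \<otimes> x) = (cnorm B x)\<^sup>2"
begin

lemma cnorm_minus_commute:
  assumes "x \<in> carrier B" "y \<in> carrier B"
  shows "cnorm B (x \<ominus> y) = cnorm B (y \<ominus> x)"
proof -
  have one: "\<one>\<^bsub>complex_ring\<^esub> = 1" "carrier complex_ring = UNIV"
    by (simp_all add: complex_ring_def)
  have "\<ominus>\<^bsub>complex_ring\<^esub> 1 = (-1 :: complex)"
    by (rule R.minus_equality) (simp_all add: complex_ring_def)
  then have "(-1) \<odot> (x \<ominus> y) = \<ominus> (x \<ominus> y)"
    using smult_l_minus[of 1 "x \<ominus> y"] smult_one[of "x \<ominus> y"] assms one by simp
  also have "\<dots> = y \<ominus> x"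
    using assms by (simp add: M.minus_eq M.minus_add M.a_comm)
  finally have "cnorm B (y \<ominus> x) = cnorm B ((-1) \<odot> (x \<ominus> y))" by simp
  then show ?thesis using cnorm_smult[of "x \<ominus> y" "-1"] assms by simp
qed

sublocale Metric_space "carrier B" "cdist B"
proof
  fix x y z
  show "0 \<le> cdist B x y" by (simp add: cdist_def cnorm_nonneg)
  show "cdist B x y = cdist B y x" by (simp add: cdist_def cnorm_minus_commute)
  show "cdist B x y = 0 \<longleftrightarrow> x = y" if xy: "x \<in> carrier B" "y \<in> carrier B"
  proof -
    have "x = y" if "x \<ominus> y = \<zero>"
    proof -
      have "x = (x \<ominus> y) \<oplus> y"
        using xy by (simp add: M.minus_eq M.a_assoc M.l_neg)
      then show ?thesis using that xy by simp
    qed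
    moreover have "x \<ominus> x = \<zero>" using xy by (simp add: M.minus_eq M.r_neg)
    ultimately show ?thesis using xy by (auto simp: cdist_def cnorm_eq_0)
  qed
  show "cdist B x z \<le> cdist B x y + cdist B y z"
    if xyz: "x \<in> carrier B" "y \<in> carrier B" "z \<in> carrier B"
  proof -
    have "x \<ominus> z = (x \<ominus> y) \<oplus> (y \<ominus> z)"
      using xyz by (simp add: M.minus_eq M.a_assoc M.r_neg1)
    then show ?thesis
      using xyz cnorm_triangle[of "x \<ominus> y" "y \<ominus> z"] by (simp add: cdist_def)
  qed
qed

end

locale comm_cstar_algebra = normed_star_algebra +
  assumes complete: "Metric_space.mcomplete (carrier B) (cdist B)"

definition cstar_nonneg :: "('e, 'm) cstar_algebra_scheme \<Rightarrow> 'e \<Rightarrow> bool" where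
  "cstar_nonneg B x \<longleftrightarrow> (\<exists>y \<in> carrier B. x = cstar B y \<otimes>\<^bsub>B\<^esub> y)"


section \<open>Function systems\<close>

text \<open>A function system is a pair of a C*-algebra \<open>B\<close> and a subspace \<open>E\<close> of it.\<close>

definition function_system :: "('e, 'm) cstar_algebra_scheme \<Rightarrow> 'e set \<Rightarrow> bool" where
  "function_system B E \<longleftrightarrow>
     comm_cstar_algebra B \<and> submodule E complex_ring B \<and> \<one>\<^bsub>B\<^esub> \<in> E \<and>
     (\<forall>x \<in> E. cstar B x \<in> E) \<and> closedin (norm_topology B) E"

definition unital_linear_map ::
    "('e, 'm) cstar_algebra_scheme \<Rightarrow> 'e set \<Rightarrow> ('f, 'n) cstar_algebra_scheme \<Rightarrow> 'f set \<Rightarrow>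
     ('e \<Rightarrow> 'f) \<Rightarrow> bool" where
  "unital_linear_map B E C A \<psi> \<longleftrightarrow>
     \<psi> \<in> E \<rightarrow> A \<and> \<psi> \<one>\<^bsub>B\<^esub> = \<one>\<^bsub>C\<^esub> \<and>
     (\<forall>x \<in> E. \<forall>y \<in> E. \<psi> (x \<oplus>\<^bsub>B\<^esub> y) = \<psi> x \<oplus>\<^bsub>C\<^esub> \<psi> y) \<and>
     (\<forall>c. \<forall>x \<in> E. \<psi> (c \<odot>\<^bsub>B\<^esub> x) = c \<odot>\<^bsub>C\<^esub> \<psi> x)"

definition unital_positive_map ::
    "('e, 'm) cstar_algebra_scheme \<Rightarrow> 'e set \<Rightarrow> ('f, 'n) cstar_algebra_scheme \<Rightarrow> 'f set \<Rightarrow>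
     ('e \<Rightarrow> 'f) \<Rightarrow> bool" where
  "unital_positive_map B E C A \<psi> \<longleftrightarrow>
     unital_linear_map B E C A \<psi> \<and> (\<forall>x \<in> E. cstar_nonneg B x \<longrightarrow> cstar_nonneg C (\<psi> x))"

definition unital_order_iso ::
    "('e, 'm) cstar_algebra_scheme \<Rightarrow> 'e set \<Rightarrow> ('f, 'n) cstar_algebra_scheme \<Rightarrow> 'f set \<Rightarrow>
     ('e \<Rightarrow> 'f) \<Rightarrow> bool" where
  "unital_order_iso B E C A \<psi> \<longleftrightarrow>
     unital_linear_map B E C A \<psi> \<and> bij_betw \<psi> E A \<and>
     (\<forall>x \<in> E. cstar_nonneg B x \<longleftrightarrow> cstar_nonneg C (\<psi> x))"

definition G_function_system ::
    "('a, 'k) monoid_scheme \<Rightarrow> 'a topology \<Rightarrow> ('e, 'm) cstar_algebra_scheme \<Rightarrow> 'e set \<Rightarrow>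
     ('a \<Rightarrow> 'e \<Rightarrow> 'e) \<Rightarrow> bool" where
  "G_function_system G T B E \<alpha> \<longleftrightarrow>
     function_system B E \<and>
     continuous_action G T (subtopology (norm_topology B) E) \<alpha> \<and>
     (\<forall>g \<in> carrier G. unital_order_iso B E B E (\<alpha> g))"

definition equivariant_map ::
    "('a, 'k) monoid_scheme \<Rightarrow> 'e set \<Rightarrow> ('a \<Rightarrow> 'e \<Rightarrow> 'e) \<Rightarrow> ('a \<Rightarrow> 'f \<Rightarrow> 'f) \<Rightarrow>
     ('e \<Rightarrow> 'f) \<Rightarrow> bool" where
  "equivariant_map G E \<alpha> \<beta> \<psi> \<longleftrightarrow>
     (\<forall>g \<in> carrier G. \<forall>x \<in> E. \<psi> (\<alpha> g x) = \<beta> g (\<psi> x))"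

text \<open>As with \<open>amenable\<close>, the universe \<open>'e\<close> of the test systems \<open>E1 \<subseteq> E2\<close> is a parameter. Both lie
  in the C*-algebra \<open>B\<close> that witnesses that \<open>E2\<close> is a function system; the restriction of the
  action to an invariant function subsystem \<open>E1\<close> is again one by unital order isomorphisms.\<close>

definition G_injective ::
    "'e itself \<Rightarrow> ('a, 'k) monoid_scheme \<Rightarrow> 'a topology \<Rightarrow>
     ('f, 'n) cstar_algebra_scheme \<Rightarrow> 'f set \<Rightarrow> ('a \<Rightarrow> 'f \<Rightarrow> 'f) \<Rightarrow> bool" where
  "G_injective (_ :: 'e itself) G T C A \<beta> \<longleftrightarrow>
     G_function_system G T C A \<beta> \<and>
     (\<forall>(B :: 'e cstar_algebra) E1 E2 \<alpha> \<psi>.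
        G_function_system G T B E2 \<alpha> \<and> function_system B E1 \<and> E1 \<subseteq> E2 \<and>
        (\<forall>g \<in> carrier G. \<forall>x \<in> E1. \<alpha> g x \<in> E1) \<and>
        unital_positive_map B E1 C A \<psi> \<and> equivariant_map G E1 \<alpha> \<beta> \<psi> \<longrightarrow>
        (\<exists>\<Psi>. unital_positive_map B E2 C A \<Psi> \<and> equivariant_map G E2 \<alpha> \<beta> \<Psi> \<and>
             (\<forall>x \<in> E1. \<Psi> x = \<psi> x)))"


section \<open>Bounded right uniformly continuous functions on the space of left cosets\<close>

definition RUC_set ::
    "('a, 'm) monoid_scheme \<Rightarrow> 'a topology \<Rightarrow> 'a set \<Rightarrow> ('a set \<Rightarrow> complex) set" where
  "RUC_set G T H =
     {f \<in> extensional (lcosets\<^bsub>G\<^esub> H). bounded (f ` (lcosets\<^bsub>G\<^esub> H)) \<and>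
        (\<forall>\<epsilon>>0. \<exists>U. openin T U \<and> \<one>\<^bsub>G\<^esub> \<in> U \<and>
           (\<forall>u \<in> U. \<forall>x \<in> lcosets\<^bsub>G\<^esub> H. cmod (f (u <#\<^bsub>G\<^esub> x) - f x) < \<epsilon>))}"

definition RUC ::
    "('a, 'm) monoid_scheme \<Rightarrow> 'a topology \<Rightarrow> 'a set \<Rightarrow> ('a set \<Rightarrow> complex) cstar_algebra" where
  "RUC G T H =
     \<lparr>carrier = RUC_set G T H,
      mult = (\<lambda>f f'. \<lambda>x \<in> lcosets\<^bsub>G\<^esub> H. f x * f' x),
      one = (\<lambda>x \<in> lcosets\<^bsub>G\<^esub> H. 1),
      zero = (\<lambda>x \<in> lcosets\<^bsub>G\<^esub> H. 0),
      add = (\<lambda>f f'. \<lambda>x \<in> lcosets\<^bsub>G\<^esub> H. f x + f' x),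
      smult = (\<lambda>c f. \<lambda>x \<in> lcosets\<^bsub>G\<^esub> H. c * f x),
      cnorm = (\<lambda>f. SUP x \<in> lcosets\<^bsub>G\<^esub> H. cmod (f x)),
      cstar = (\<lambda>f. \<lambda>x \<in> lcosets\<^bsub>G\<^esub> H. cnj (f x))\<rparr>"

definition RUC_action ::
    "('a, 'm) monoid_scheme \<Rightarrow> 'a topology \<Rightarrow> 'a set \<Rightarrow>
     'a \<Rightarrow> ('a set \<Rightarrow> complex) \<Rightarrow> ('a set \<Rightarrow> complex)" where
  "RUC_action G T H g =
     (\<lambda>f \<in> RUC_set G T H. \<lambda>x \<in> lcosets\<^bsub>G\<^esub> H. f (inv\<^bsub>G\<^esub> g <#\<^bsub>G\<^esub> x))"

end

theory Submission
  imports Defs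
begin

text \<open>Amenability of \<open>H\<close> and injectivity of \<open>RUC(G/H)\<close> are both equivalent to the existence of an
  invariant mean on \<open>H\<close>: an \<open>H\<close>-invariant state on the bounded right uniformly continuous functions
  on \<open>H\<close>. That condition involves no universe of flows or of function systems, so all parts of the
  theorem follow from four implications.

  \<^item> A mean yields fixed points (\<open>amenable_of_invariant_mean\<close>). Transported along an orbit map, a mean
    becomes an invariant regular Borel probability measure, by the Riesz representation theorem.
    Strong proximality moves this measure and a point mass to a common limit. The invariant measure
    does not move, so it is itself a point mass, at a fixed point.

  \<^item> Fixed points yield a mean (\<open>invariant_mean_of_amenable\<close>). The states on the uniformly continuous
    functions on the group form a compact convex set on which the group acts affinely and
    continuously. A minimal nonempty closed convex invariant subset is a strongly proximal flow,
    because two measures can be contracted simultaneously to an extreme point. A fixed point of this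
    flow is an invariant mean.

  \<^item> A mean yields injectivity (\<open>injective_of_invariant_mean\<close>). An equivariant map \<open>\<psi>\<close> into \<open>RUC(G/H)\<close>
    is determined by the state \<open>x \<mapsto> \<psi> x H\<close>, the value at the base coset. This state extends to the
    larger system by a Hahn-Banach argument, the mean makes the extension \<open>H\<close>-invariant, and
    \<open>\<Psi> x (gH) = \<Phi> (g\<inverse> x)\<close> is then the required map. Hahn-Banach needs the sum of two positive elements
    to be positive; in an abstract commutative C*-algebra, where positive means of the form \<open>y* y\<close>,
    this is proved with square roots obtained by iteration.

  \<^item> Injectivity yields a mean (\<open>invariant_mean_of_injective\<close>). Functions on \<open>G/H\<close> are the
    right \<open>H\<close>-invariant functions on \<open>G\<close>. Extending this identification from \<open>RUC(G/H)\<close> to \<open>RUC(G)\<close>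
    and evaluating at the base coset gives an \<open>H\<close>-invariant state on \<open>RUC(G)\<close>. Bump functions on
    \<open>G/H\<close> show that it depends only on the restriction of a function to \<open>H\<close>, and a McShane extension,
    based on a Birkhoff-Kakutani length function, shows that every uniformly continuous function on
    \<open>H\<close> is such a restriction. So the state descends to a mean on \<open>H\<close>.\<close>


section \<open>Regular Borel probability measures and the Riesz representation theorem\<close>

lemma space_borel_of [simp]: "space (borel_of X) = topspace X"
  by (auto simp: borel_of_def space_measure_of_conv)

lemma sets_borel_of: "sets (borel_of X) = sigma_sets (topspace X) {U. openin X U}"
  unfolding borel_of_def by (rule sets_measure_of) (auto dest: openin_subset)

lemma openin_borel_of: "openin X U \<Longrightarrow> U \<in> sets (borel_of X)"
  by (simp add: sets_borel_of sigma_sets.Basic)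

lemma closedin_borel_of: "closedin X K \<Longrightarrow> K \<in> sets (borel_of X)"
  using sets.compl_sets[OF openin_borel_of[of X "topspace X - K"]]
  by (simp add: closedin_def Diff_Diff_Int Int_absorb1)

lemma continuous_map_measurable_borel_of:
  assumes "continuous_map X euclidean f"
  shows "f \<in> borel_measurable (borel_of X)"
proof (rule borel_measurableI)
  fix S :: "'b set" assume "open S"
  then have "openin X {x \<in> topspace X. f x \<in> S}"
    using assms openin_continuous_map_preimage by fastforce
  moreover have "f -` S \<inter> space (borel_of X) = {x \<in> topspace X. f x \<in> S}" by auto
  ultimately show "f -` S \<inter> space (borel_of X) \<in> sets (borel_of X)"
    by (simp add: openin_borel_of)
qed

lemma continuous_map_measurable_borel_of_borel_of:
  assumes "continuous_map X Y f"
  shows "f \<in> measurable (borel_of X) (borel_of Y)"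
  unfolding borel_of_def[of Y]
proof (rule measurable_measure_of)
  fix U assume "U \<in> {U. openin Y U}"
  then have "openin X {x \<in> topspace X. f x \<in> U}"
    using assms openin_continuous_map_preimage by fastforce
  moreover have "f -` U \<inter> space (borel_of X) = {x \<in> topspace X. f x \<in> U}" by auto
  ultimately show "f -` U \<inter> space (borel_of X) \<in> sets (borel_of X)"
    by (simp add: openin_borel_of)
qed (use assms in \<open>auto dest: openin_subset simp: continuous_map_def\<close>)

lemma regular_borel_prob_measuresD:
  assumes \<mu>: "\<mu> \<in> regular_borel_prob_measures X" and A: "A \<in> sets \<mu>" and \<epsilon>: "(\<epsilon>::real) > 0"
  shows "\<exists>U. openin X U \<and> A \<subseteq> U \<and> measure \<mu> U \<le> measure \<mu> A + \<epsilon>"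
proof -
  interpret prob_space \<mu> using \<mu> by (simp add: regular_borel_prob_measures_def)
  have "emeasure \<mu> A = (INF U \<in> {U. openin X U \<and> A \<subseteq> U}. emeasure \<mu> U)"
    using \<mu> A by (auto simp: regular_borel_prob_measures_def)
  moreover have "emeasure \<mu> A < ennreal (measure \<mu> A + \<epsilon>)"
    using \<epsilon> by (simp add: emeasure_eq_measure ennreal_lessI add_nonneg_pos)
  ultimately obtain U where U: "openin X U" "A \<subseteq> U" "emeasure \<mu> U < ennreal (measure \<mu> A + \<epsilon>)"
    by (auto simp: INF_less_iff)
  then have "measure \<mu> U < measure \<mu> A + \<epsilon>"
    by (intro ennreal_less_iff[THEN iffD1]) (simp_all add: emeasure_eq_measure)
  then show ?thesis using U less_imp_le by blast
qed

text \<open>For a finite measure on a compact space, outer regularity gives inner regularity by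
  passing to complements: a complement of an open set is compact.\<close>

lemma regular_borel_prob_measuresI:
  assumes X: "compact_space X" "Hausdorff_space X"
    and sets: "sets \<mu> = sets (borel_of X)" and prob: "prob_space \<mu>"
    and outer: "\<And>A \<epsilon>. A \<in> sets \<mu> \<Longrightarrow> (\<epsilon>::real) > 0 \<Longrightarrow>
      \<exists>U. openin X U \<and> A \<subseteq> U \<and> measure \<mu> U \<le> measure \<mu> A + \<epsilon>"
  shows "\<mu> \<in> regular_borel_prob_measures X"
proof -
  interpret prob_space \<mu> by fact
  have sp: "space \<mu> = topspace X" using sets_eq_imp_space_eq[OF sets] by simp
  have op: "U \<in> sets \<mu>" if "openin X U" for U using that by (simp add: sets openin_borel_of)
  have "emeasure \<mu> A = (INF U \<in> {U. openin X U \<and> A \<subseteq> U}. emeasure \<mu> U)"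
    if A: "A \<in> sets \<mu>" for A
  proof (rule antisym)
    show "emeasure \<mu> A \<le> (INF U \<in> {U. openin X U \<and> A \<subseteq> U}. emeasure \<mu> U)"
      using op by (intro INF_greatest emeasure_mono) auto
    show "(INF U \<in> {U. openin X U \<and> A \<subseteq> U}. emeasure \<mu> U) \<le> emeasure \<mu> A"
    proof (rule ennreal_le_epsilon)
      fix \<epsilon> :: real assume \<epsilon>: "\<epsilon> > 0"
      obtain U where U: "openin X U" "A \<subseteq> U" "measure \<mu> U \<le> measure \<mu> A + \<epsilon>"
        using outer[OF A \<epsilon>] by blast
      have "(INF U \<in> {U. openin X U \<and> A \<subseteq> U}. emeasure \<mu> U) \<le> emeasure \<mu> U"
        using U by (intro INF_lower) auto
      also have "\<dots> \<le> emeasure \<mu> A + ennreal \<epsilon>"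
        using U(3) \<epsilon> by (simp add: emeasure_eq_measure flip: ennreal_plus)
      finally show "(INF U \<in> {U. openin X U \<and> A \<subseteq> U}. emeasure \<mu> U) \<le> emeasure \<mu> A + ennreal \<epsilon>" .
    qed
  qed
  moreover have "emeasure \<mu> A = (SUP K \<in> {K. compactin X K \<and> K \<subseteq> A}. emeasure \<mu> K)"
    if A: "A \<in> sets \<mu>" for A
  proof (rule antisym)
    show "(SUP K \<in> {K. compactin X K \<and> K \<subseteq> A}. emeasure \<mu> K) \<le> emeasure \<mu> A"
      using A by (intro SUP_least emeasure_mono) auto
    show "emeasure \<mu> A \<le> (SUP K \<in> {K. compactin X K \<and> K \<subseteq> A}. emeasure \<mu> K)"
    proof (rule ennreal_le_epsilon)
      fix \<epsilon> :: real assume \<epsilon>: "\<epsilon> > 0"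
      have "topspace X - A \<in> sets \<mu>" using A sp by (metis sets.compl_sets)
      then obtain U where U: "openin X U" "topspace X - A \<subseteq> U"
          "measure \<mu> U \<le> measure \<mu> (topspace X - A) + \<epsilon>"
        using outer \<epsilon> by blast
      define K where "K = topspace X - U"
      have sub: "A \<subseteq> topspace X" using A sets.sets_into_space sp by blast
      have K: "compactin X K" "K \<subseteq> A"
        using closedin_compact_space[OF X(1), of K] U sub by (auto simp: K_def)
      have "measure \<mu> K = 1 - measure \<mu> U" "measure \<mu> (topspace X - A) = 1 - measure \<mu> A"
        using prob_compl[OF op[OF U(1)]] prob_compl[OF A] by (simp_all add: K_def sp)
      then have "emeasure \<mu> A \<le> emeasure \<mu> K + ennreal \<epsilon>"
        using U(3) \<epsilon> by (simp add: emeasure_eq_measure flip: ennreal_plus)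
      also have "\<dots> \<le> (SUP K \<in> {K. compactin X K \<and> K \<subseteq> A}. emeasure \<mu> K) + ennreal \<epsilon>"
        using K by (intro add_right_mono SUP_upper) auto
      finally show "emeasure \<mu> A \<le> (SUP K \<in> {K. compactin X K \<and> K \<subseteq> A}. emeasure \<mu> K) + ennreal \<epsilon>" .
    qed
  qed
  ultimately show ?thesis using sets prob by (auto simp: regular_borel_prob_measures_def)
qed

locale state_on_compact =
  fixes X :: "'x topology" and L :: "('x \<Rightarrow> real) \<Rightarrow> real"
  assumes compact: "compact_space X" and Hausdorff: "Hausdorff_space X"
    and L_add: "\<lbrakk>continuous_map X euclideanreal f; continuous_map X euclideanreal g\<rbrakk>
                \<Longrightarrow> L (\<lambda>x. f x + g x) = L f + L g"
    and L_scale: "continuous_map X euclideanreal f \<Longrightarrow> L (\<lambda>x. c * f x) = c * L f"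
    and L_nonneg: "\<lbrakk>continuous_map X euclideanreal f; \<And>x. x \<in> topspace X \<Longrightarrow> 0 \<le> f x\<rbrakk> \<Longrightarrow> 0 \<le> L f"
    and L_one: "L (\<lambda>x. 1) = 1"
begin

abbreviation cont :: "('x \<Rightarrow> real) \<Rightarrow> bool" where
  "cont f \<equiv> continuous_map X euclideanreal f"

lemma L_mono:
  assumes "cont f" "cont g" "\<And>x. x \<in> topspace X \<Longrightarrow> f x \<le> g x"
  shows "L f \<le> L g"
proof -
  have c: "cont (\<lambda>x. - 1 * f x)" "cont (\<lambda>x. g x + - 1 * f x)"
    using assms by (intro continuous_intros; simp)+
  have "L (\<lambda>x. g x + - 1 * f x) = L g + - 1 * L f"
    using L_add[OF assms(2) c(1)] L_scale[OF assms(1), of "-1"] by simp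
  moreover have "0 \<le> L (\<lambda>x. g x + - 1 * f x)"
    using c(2) assms(3) by (intro L_nonneg) auto
  ultimately show ?thesis by simp
qed

lemma L_const: "L (\<lambda>x. c) = c"
  using L_scale[of "\<lambda>x. 1" c] L_one by simp

lemma L_sum:
  assumes "finite I" "\<And>i. i \<in> I \<Longrightarrow> cont (f i)"
  shows "L (\<lambda>x. \<Sum>i\<in>I. f i x) = (\<Sum>i\<in>I. L (f i))"
  using assms
proof (induction I rule: finite_induct)
  case empty
  then show ?case using L_const[of 0] by simp
next
  case (insert i I)
  have "cont (\<lambda>x. \<Sum>i\<in>I. f i x)" using insert by (intro continuous_intros) auto
  then show ?case using insert L_add[of "f i" "\<lambda>x. \<Sum>i\<in>I. f i x"] by simp
qed

text \<open>The measure of an open set will be the supremum of \<open>L\<close> over the functions with values in the unit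
  interval that vanish outside it. Demanding that they merely vanish outside \<open>U\<close>, instead of having
  support inside \<open>U\<close>, gives the same supremum, because subtracting \<open>\<epsilon>\<close> shrinks the support (see
  \<open>shrink\<close> below) at the cost of \<open>\<epsilon>\<close>.\<close>

definition test :: "'x set \<Rightarrow> ('x \<Rightarrow> real) set" where
  "test U = {f. cont f \<and> (\<forall>x \<in> topspace X. 0 \<le> f x \<and> f x \<le> 1) \<and> (\<forall>x \<in> topspace X - U. f x = 0)}"

definition mass :: "'x set \<Rightarrow> real" where
  "mass U = Sup (L ` test U)"

lemma test_bounds:
  assumes "f \<in> test U" shows "0 \<le> L f" "L f \<le> 1"
  using assms L_mono[of f "\<lambda>x. 1"] L_const[of 1] by (auto simp: test_def intro: L_nonneg)

lemma zero_test: "(\<lambda>x. 0) \<in> test U"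
  by (simp add: test_def)

lemma mass_upper: "f \<in> test U \<Longrightarrow> L f \<le> mass U"
  unfolding mass_def by (rule cSUP_upper) (auto intro: bdd_aboveI2 test_bounds)

lemma mass_least: "(\<And>f. f \<in> test U \<Longrightarrow> L f \<le> c) \<Longrightarrow> mass U \<le> c"
  unfolding mass_def using zero_test by (intro cSUP_least) auto

lemma mass_nonneg: "0 \<le> mass U"
  using mass_upper[OF zero_test] L_const[of 0] by simp

lemma mass_le_1: "mass U \<le> 1"
  by (rule mass_least) (rule test_bounds)

lemma mass_mono: "U \<subseteq> V \<Longrightarrow> mass U \<le> mass V"
  by (rule mass_least, rule mass_upper) (auto simp: test_def)

lemma mass_empty: "mass {} = 0"
proof (rule antisym[OF mass_least mass_nonneg])
  fix f assume "f \<in> test {}"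
  then show "L f \<le> 0" using L_mono[of f "\<lambda>x. 0"] L_const[of 0] by (auto simp: test_def)
qed

lemma mass_space: "mass (topspace X) = 1"
proof (rule antisym[OF mass_le_1])
  show "1 \<le> mass (topspace X)" using mass_upper[of "\<lambda>x. 1"] L_one by (auto simp: test_def)
qed

lemma shrink:
  assumes "f \<in> test U" "\<epsilon> > 0"
  shows "(\<lambda>x. max 0 (f x - \<epsilon>)) \<in> test {x \<in> topspace X. \<epsilon> \<le> f x}"
    and "L f \<le> L (\<lambda>x. max 0 (f x - \<epsilon>)) + \<epsilon>"
    and "closedin X {x \<in> topspace X. \<epsilon> \<le> f x}"
    and "{x \<in> topspace X. \<epsilon> \<le> f x} \<subseteq> U"
proof -
  have c: "cont f" using assms by (simp add: test_def)
  then have c': "cont (\<lambda>x. max 0 (f x - \<epsilon>))" by (intro continuous_intros) auto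
  show "(\<lambda>x. max 0 (f x - \<epsilon>)) \<in> test {x \<in> topspace X. \<epsilon> \<le> f x}"
    using assms c' by (auto simp: test_def)
  have "L f \<le> L (\<lambda>x. max 0 (f x - \<epsilon>) + \<epsilon>)"
    using c c' by (intro L_mono continuous_map_add) auto
  also have "\<dots> = L (\<lambda>x. max 0 (f x - \<epsilon>)) + \<epsilon>"
    using L_add[OF c', of "\<lambda>x. \<epsilon>"] L_const by simp
  finally show "L f \<le> L (\<lambda>x. max 0 (f x - \<epsilon>)) + \<epsilon>" .
  have "closedin X {x \<in> topspace X. f x \<in> {\<epsilon>..}}"
    using c by (rule closedin_continuous_map_preimage) simp
  then show "closedin X {x \<in> topspace X. \<epsilon> \<le> f x}" by simp
  show "{x \<in> topspace X. \<epsilon> \<le> f x} \<subseteq> U"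
    using assms by (force simp: test_def)
qed

lemma normal: "normal_space X"
  using compact Hausdorff compact_Hausdorff_or_regular_imp_normal_space by blast

text \<open>A test function for the union, shrunk to live on a closed subset \<open>K\<close>, is split by a Urysohn
  function that is 0 off \<open>U\<close> and 1 on \<open>K - V\<close>.\<close>

lemma mass_Un:
  assumes "openin X U" "openin X V"
  shows "mass (U \<union> V) \<le> mass U + mass V"
proof (rule field_le_epsilon, rule mass_least)
  fix \<epsilon> :: real and f assume \<epsilon>: "\<epsilon> > 0" and f: "f \<in> test (U \<union> V)"
  define K where "K = {x \<in> topspace X. \<epsilon> \<le> f x}"
  define f' where "f' = (\<lambda>x. max 0 (f x - \<epsilon>))"
  have f': "f' \<in> test K" and Lf: "L f \<le> L f' + \<epsilon>" and K: "closedin X K" "K \<subseteq> U \<union> V"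
    using shrink[OF f \<epsilon>] by (simp_all add: K_def f'_def)
  have "closedin X (K - V)" using K assms by (simp add: closedin_diff)
  moreover have "closedin X (topspace X - U)" using assms by blast
  moreover have "disjnt (topspace X - U) (K - V)" using K by (auto simp: disjnt_def)
  ultimately obtain g where g: "continuous_map X (top_of_set {0..1::real}) g"
      "g ` (topspace X - U) \<subseteq> {0}" "g ` (K - V) \<subseteq> {1}"
    using Urysohn_lemma[OF normal, of "topspace X - U" "K - V" 0 1] by auto
  have gc: "cont g" and g01: "\<And>x. x \<in> topspace X \<Longrightarrow> 0 \<le> g x \<and> g x \<le> 1"
    using g(1) by (auto simp: continuous_map_in_subtopology Pi_iff)
  have f'c: "cont f'" and f'01: "\<And>x. x \<in> topspace X \<Longrightarrow> 0 \<le> f' x \<and> f' x \<le> 1"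
      and f'0: "\<And>x. x \<in> topspace X - K \<Longrightarrow> f' x = 0"
    using f' by (auto simp: test_def)
  have 1: "(\<lambda>x. f' x * g x) \<in> test U"
    using gc f'c g01 f'01 g(2) by (auto simp: test_def mult_le_one intro!: continuous_intros)
  have c1: "cont (\<lambda>x. 1 - g x)" using gc by (intro continuous_intros) auto
  have 2: "(\<lambda>x. f' x * (1 - g x)) \<in> test V"
    using gc f'c g01 f'01 g(3) f'0 c1
    by (auto simp: test_def mult_le_one intro!: continuous_intros)
      (metis Diff_iff imageI singletonD subsetD)
  have "L f' = L (\<lambda>x. f' x * g x + f' x * (1 - g x))" by (simp add: algebra_simps)
  also have "\<dots> = L (\<lambda>x. f' x * g x) + L (\<lambda>x. f' x * (1 - g x))"
    using 1 2 by (intro L_add) (auto simp: test_def)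
  also have "\<dots> \<le> mass U + mass V" using 1 2 mass_upper by (intro add_mono) auto
  finally show "L f \<le> mass U + mass V + \<epsilon>" using Lf by simp
qed

lemma mass_UN_finite:
  assumes "\<And>i. openin X (U i)"
  shows "mass (\<Union>i<n. U i) \<le> (\<Sum>i<(n::nat). mass (U i))"
proof (induction n)
  case 0
  then show ?case by (simp add: mass_empty)
next
  case (Suc n)
  have "mass (\<Union>i<Suc n. U i) = mass (U n \<union> (\<Union>i<n. U i))"
    by (rule arg_cong[where f = mass]) (auto simp: less_Suc_eq)
  also have "\<dots> \<le> mass (U n) + mass (\<Union>i<n. U i)"
    using assms by (intro mass_Un) auto
  finally show ?case using Suc by simp
qed

text \<open>After shrinking, a test function for the union lives on a compact set, which finitely many of
  the open sets cover.\<close>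

lemma mass_UN:
  assumes "\<And>i::nat. openin X (U i)"
  shows "ennreal (mass (\<Union>i. U i)) \<le> (\<Sum>i. ennreal (mass (U i)))"
proof (rule ennreal_le_epsilon)
  fix \<epsilon> :: real assume \<epsilon>: "\<epsilon> > 0" and fin: "suminf (\<lambda>i. ennreal (mass (U i))) < \<top>"
  then obtain s where s: "(\<Sum>i. ennreal (mass (U i))) = ennreal s" "s \<ge> 0"
    by (metis ennreal_cases less_irrefl top.extremum_strict)
  have "mass (\<Union>i. U i) \<le> s + \<epsilon>"
  proof (rule mass_least)
    fix f assume f: "f \<in> test (\<Union>i. U i)"
    define K where "K = {x \<in> topspace X. \<epsilon> \<le> f x}"
    define f' where "f' = (\<lambda>x. max 0 (f x - \<epsilon>))"
    have f': "f' \<in> test K" and Lf: "L f \<le> L f' + \<epsilon>" and K: "closedin X K" "K \<subseteq> (\<Union>i. U i)"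
      using shrink[OF f \<epsilon>] by (simp_all add: K_def f'_def)
    have "compactin X K" using K compact by (simp add: closedin_compact_space)
    then obtain F where F: "finite F" "F \<subseteq> range U" "K \<subseteq> \<Union>F"
      using compactinD[of X K "range U"] K(2) assms by auto
    then obtain I where I: "finite I" "F = U ` I" by (meson finite_subset_image)
    then obtain n where n: "I \<subseteq> {..<n}" by (meson finite_nat_iff_bounded)
    have "K \<subseteq> (\<Union>i<n. U i)" using F(3) I n by auto
    then have "f' \<in> test (\<Union>i<n. U i)" using f' by (auto simp: test_def)
    then have "L f' \<le> (\<Sum>i<n. mass (U i))"
      using mass_upper mass_UN_finite[where U=U] assms order_trans by blast
    also have "\<dots> \<le> s"
    proof -
      have "ennreal (\<Sum>i<n. mass (U i)) = (\<Sum>i<n. ennreal (mass (U i)))"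
        by (simp add: mass_nonneg sum_ennreal)
      also have "\<dots> \<le> ennreal s" unfolding s(1)[symmetric] by (rule sum_le_suminf) auto
      finally show ?thesis using s(2) by (simp add: ennreal_le_iff)
    qed
    finally show "L f \<le> s + \<epsilon>" using Lf by simp
  qed
  then show "ennreal (mass (\<Union>i. U i)) \<le> (\<Sum>i. ennreal (mass (U i))) + ennreal \<epsilon>"
    unfolding s(1) using s(2) \<epsilon> by (metis ennreal_leI ennreal_plus less_imp_le)
qed

definition outer :: "'x set \<Rightarrow> ennreal" where
  "outer A = (INF U \<in> {U. openin X U \<and> A \<subseteq> U}. ennreal (mass U))"

lemma outer_open: "openin X U \<Longrightarrow> outer U = ennreal (mass U)"
  unfolding outer_def
  by (intro antisym INF_lower2[of U] INF_greatest) (auto intro: mass_mono ennreal_leI)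

lemma outer_lower: "openin X U \<Longrightarrow> A \<subseteq> U \<Longrightarrow> outer A \<le> ennreal (mass U)"
  unfolding outer_def by (rule INF_lower) auto

lemma outer_mono: "A \<subseteq> B \<Longrightarrow> outer A \<le> outer B"
  unfolding outer_def by (rule INF_superset_mono) auto

lemma outer_approx:
  assumes "A \<subseteq> topspace X" "\<epsilon> > 0"
  obtains U where "openin X U" "A \<subseteq> U" "ennreal (mass U) \<le> outer A + ennreal \<epsilon>"
proof -
  have "outer A \<le> ennreal (mass (topspace X))" by (rule outer_lower) (use assms in auto)
  then have "outer A < \<top>" by (rule order_le_less_trans) simp
  then have "outer A < outer A + ennreal \<epsilon>" using assms(2) by (simp add: ennreal_less_zero_iff)
  then obtain U where "openin X U" "A \<subseteq> U" "ennreal (mass U) < outer A + ennreal \<epsilon>"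
    unfolding outer_def[of A] INF_less_iff by auto
  then show ?thesis using that by (meson less_imp_le)
qed

lemma outer_measure_space: "outer_measure_space (Pow (topspace X)) outer"
  unfolding outer_measure_space_def
proof (intro conjI)
  show "positive (Pow (topspace X)) outer"
    by (simp add: positive_def outer_open mass_empty)
  show "increasing (Pow (topspace X)) outer"
    unfolding increasing_def by (intro ballI impI outer_mono)
  show "countably_subadditive (Pow (topspace X)) outer"
    unfolding countably_subadditive_def
  proof (intro allI impI)
    fix A :: "nat \<Rightarrow> 'x set" assume A: "range A \<subseteq> Pow (topspace X)"
    show "outer (\<Union>i. A i) \<le> (\<Sum>i. outer (A i))"
    proof (rule ennreal_le_epsilon)
      fix \<epsilon> :: real assume \<epsilon>: "\<epsilon> > 0"
      have "\<exists>U. openin X U \<and> A i \<subseteq> U \<and> ennreal (mass U) \<le> outer (A i) + ennreal (\<epsilon> * (1/2)^Suc i)" for i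
      proof -
        have "A i \<subseteq> topspace X" "\<epsilon> * (1/2)^Suc i > 0" using A \<epsilon> by auto
        then show ?thesis by (rule outer_approx) blast
      qed
      then obtain U where U: "\<And>i. openin X (U i)" "\<And>i. A i \<subseteq> U i"
          "\<And>i. ennreal (mass (U i)) \<le> outer (A i) + ennreal (\<epsilon> * (1/2)^Suc i)"
        by metis
      have "outer (\<Union>i. A i) \<le> ennreal (mass (\<Union>i. U i))"
        using U by (intro outer_lower) auto
      also have "\<dots> \<le> (\<Sum>i. ennreal (mass (U i)))" using U(1) by (rule mass_UN)
      also have "\<dots> \<le> (\<Sum>i. outer (A i) + ennreal (\<epsilon> * (1/2)^Suc i))"
        using U(3) by (intro suminf_le) auto
      also have "\<dots> = (\<Sum>i. outer (A i)) + (\<Sum>i. ennreal (\<epsilon> * (1/2)^Suc i))"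
        by (intro suminf_add[symmetric]) auto
      also have "(\<Sum>i. ennreal (\<epsilon> * (1/2)^Suc i)) = ennreal \<epsilon>"
        using sums_mult[OF power_half_series, of \<epsilon>] \<epsilon> by (intro suminf_ennreal_eq) auto
      finally show "outer (\<Union>i. A i) \<le> (\<Sum>i. outer (A i)) + ennreal \<epsilon>" .
    qed
  qed
qed

text \<open>The Caratheodory condition on open sets. Nearly optimal test functions for \<open>V \<inter> U\<close> and for the
  open set \<open>V - K\<close>, where \<open>K\<close> is the closed set that carries the first one, add up to a test function
  for \<open>V\<close>; moreover \<open>V - K\<close> contains \<open>V - U\<close>.\<close>

lemma outer_split_open:
  assumes U: "openin X U" and V: "openin X V"
  shows "outer (V \<inter> U) + outer (V - U) \<le> outer V"
proof (rule ennreal_le_epsilon)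
  fix \<epsilon> :: real assume \<epsilon>: "\<epsilon> > 0"
  have VU: "openin X (V \<inter> U)" using U V by blast
  have lt: "mass (V \<inter> U) - \<epsilon>/3 < mass (V \<inter> U)" using \<epsilon> by simp
  obtain f where f: "f \<in> test (V \<inter> U)" "mass (V \<inter> U) - \<epsilon>/3 < L f"
    using lt mass_least[of "V \<inter> U" "mass (V \<inter> U) - \<epsilon>/3"] by force
  define K where "K = {x \<in> topspace X. \<epsilon>/3 \<le> f x}"
  define f' where "f' = (\<lambda>x. max 0 (f x - \<epsilon>/3))"
  have e3: "\<epsilon>/3 > 0" using \<epsilon> by simp
  have f': "f' \<in> test K" and Lf: "L f \<le> L f' + \<epsilon>/3" and K: "closedin X K" "K \<subseteq> V \<inter> U"
    using shrink[OF f(1) e3] by (simp_all add: K_def f'_def)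
  have VK: "openin X (V - K)" using V K by blast
  have lt: "mass (V - K) - \<epsilon>/3 < mass (V - K)" using \<epsilon> by simp
  obtain g where g: "g \<in> test (V - K)" "mass (V - K) - \<epsilon>/3 < L g"
    using lt mass_least[of "V - K" "mass (V - K) - \<epsilon>/3"] by force
  have "f' x + g x \<le> 1" if "x \<in> topspace X" for x
    using f' g(1) that by (cases "x \<in> K") (auto simp: test_def)
  then have "(\<lambda>x. f' x + g x) \<in> test V"
    using f' g(1) K(2) by (auto simp: test_def intro!: continuous_intros)
  then have "L (\<lambda>x. f' x + g x) \<le> mass V" by (rule mass_upper)
  moreover have "L (\<lambda>x. f' x + g x) = L f' + L g"
    using f' g(1) by (intro L_add) (auto simp: test_def)
  ultimately have "L f' + L g \<le> mass V" by simp
  then have *: "mass (V \<inter> U) + mass (V - K) \<le> mass V + \<epsilon>" using f(2) g(2) Lf by simp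
  have "outer (V - U) \<le> ennreal (mass (V - K))" using K by (intro outer_lower VK) auto
  then have "outer (V \<inter> U) + outer (V - U) \<le> ennreal (mass (V \<inter> U)) + ennreal (mass (V - K))"
    by (simp add: outer_open[OF VU] add_left_mono)
  also have "\<dots> \<le> ennreal (mass V) + ennreal \<epsilon>"
    using * \<epsilon> by (simp add: mass_nonneg ennreal_leI flip: ennreal_plus)
  finally show "outer (V \<inter> U) + outer (V - U) \<le> outer V + ennreal \<epsilon>" by (simp add: outer_open[OF V])
qed

lemma open_in_lambda_system:
  assumes U: "openin X U"
  shows "U \<in> lambda_system (topspace X) (Pow (topspace X)) outer"
proof -
  interpret sigma_algebra "topspace X" "Pow (topspace X)" by (rule sigma_algebra_Pow)
  have sub: "subadditive (Pow (topspace X)) outer"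
    using countably_subadditive_subadditive outer_measure_space
    by (simp add: outer_measure_space_def)
  have "outer (A \<inter> U) + outer (A - U) = outer A" if A: "A \<subseteq> topspace X" for A
  proof (rule antisym)
    show "outer (A \<inter> U) + outer (A - U) \<le> outer A"
    proof (rule ennreal_le_epsilon)
      fix \<epsilon> :: real assume \<epsilon>: "\<epsilon> > 0"
      obtain V where V: "openin X V" "A \<subseteq> V" "ennreal (mass V) \<le> outer A + ennreal \<epsilon>"
        using outer_approx[OF A \<epsilon>] by blast
      have "outer (A \<inter> U) + outer (A - U) \<le> outer (V \<inter> U) + outer (V - U)"
        using V(2) by (intro add_mono outer_mono) auto
      also have "\<dots> \<le> outer V" using U V(1) by (rule outer_split_open)
      finally show "outer (A \<inter> U) + outer (A - U) \<le> outer A + ennreal \<epsilon>"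
        using V by (simp add: outer_open)
    qed
    have "outer A = outer ((A \<inter> U) \<union> (A - U))" by (rule arg_cong[where f = outer]) auto
    also have "\<dots> \<le> outer (A \<inter> U) + outer (A - U)"
      using A by (intro subadditiveD[OF sub]) auto
    finally show "outer A \<le> outer (A \<inter> U) + outer (A - U)" .
  qed
  then show ?thesis using openin_subset[OF U] by (auto simp: lambda_system_eq)
qed

definition riesz :: "'x measure" where
  "riesz = measure_of (topspace X) {U. openin X U} outer"

lemma sets_riesz: "sets riesz = sets (borel_of X)" and space_riesz: "space riesz = topspace X"
  by (auto simp: riesz_def borel_of_def sets_measure_of_conv space_measure_of_conv)

lemma emeasure_riesz:
  assumes A: "A \<in> sets riesz"
  shows "emeasure riesz A = outer A"
proof -
  interpret sigma_algebra "topspace X" "Pow (topspace X)" by (rule sigma_algebra_Pow)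
  let ?L = "lambda_system (topspace X) (Pow (topspace X)) outer"
  have ms: "measure_space (topspace X) ?L outer"
    using outer_measure_space by (rule caratheodory_lemma)
  then interpret L: sigma_algebra "topspace X" ?L by (simp add: measure_space_def)
  have sub: "sigma_sets (topspace X) {U. openin X U} \<subseteq> ?L"
    by (rule L.sigma_sets_subset) (auto intro: open_in_lambda_system)
  show ?thesis
    unfolding riesz_def
  proof (rule emeasure_measure_of[OF refl])
    show "{U. openin X U} \<subseteq> Pow (topspace X)" by (auto dest: openin_subset)
    show "positive (sets (measure_of (topspace X) {U. openin X U} outer)) outer"
      using ms by (auto simp: measure_space_def positive_def)
    have "sets (measure_of (topspace X) {U. openin X U} outer) \<subseteq> ?L"
      using sub sets_riesz by (simp add: riesz_def sets_borel_of)
    then show "countably_additive (sets (measure_of (topspace X) {U. openin X U} outer)) outer"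
      using ms unfolding measure_space_def countably_additive_def by blast
    show "A \<in> sets (measure_of (topspace X) {U. openin X U} outer)"
      using A by (simp add: riesz_def)
  qed
qed

lemma measure_riesz_open:
  assumes "openin X U" shows "measure riesz U = mass U"
  using assms emeasure_riesz[of U] outer_open[of U] openin_borel_of[of X U] mass_nonneg
  by (simp add: measure_def sets_riesz)

lemma prob_space_riesz: "prob_space riesz"
proof
  show "emeasure riesz (space riesz) = 1"
    using emeasure_riesz[of "topspace X"] outer_open[of "topspace X"] openin_borel_of[of X "topspace X"]
    by (simp add: space_riesz sets_riesz mass_space)
qed

lemma riesz_regular: "riesz \<in> regular_borel_prob_measures X"
proof (rule regular_borel_prob_measuresI[OF compact Hausdorff sets_riesz prob_space_riesz])
  fix A and \<epsilon> :: real assume A: "A \<in> sets riesz" and \<epsilon>: "\<epsilon> > 0"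
  interpret prob_space riesz by (rule prob_space_riesz)
  have sub: "A \<subseteq> topspace X" using A sets.sets_into_space space_riesz by blast
  obtain U where U: "openin X U" "A \<subseteq> U" "ennreal (mass U) \<le> outer A + ennreal \<epsilon>"
    using outer_approx[OF sub \<epsilon>] by blast
  have "ennreal (mass U) \<le> ennreal (measure riesz A + \<epsilon>)"
    using U(3) \<epsilon> emeasure_riesz[OF A] by (simp add: emeasure_eq_measure)
  then have "measure riesz U \<le> measure riesz A + \<epsilon>"
    using \<epsilon> ennreal_le_iff[of "measure riesz A + \<epsilon>" "mass U"] measure_riesz_open[OF U(1)]
    by (simp del: ennreal_plus)
  then show "\<exists>U. openin X U \<and> A \<subseteq> U \<and> measure riesz U \<le> measure riesz A + \<epsilon>" using U by blast
qed

lemma cont_bounded: "cont f \<Longrightarrow> \<exists>M>0. \<forall>x \<in> topspace X. \<bar>f x\<bar> \<le> M"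
proof -
  assume "cont f"
  then have "compact (f ` topspace X)"
    using image_compactin[of X "topspace X" euclideanreal f] compact by (simp add: compact_space_def)
  then show ?thesis using bounded_pos[of "f ` topspace X"] compact_imp_bounded by (auto simp: real_norm_def)
qed

lemma cont_integrable: "cont f \<Longrightarrow> integrable riesz f"
proof -
  interpret prob_space riesz by (rule prob_space_riesz)
  assume f: "cont f"
  then obtain M where "\<forall>x \<in> topspace X. \<bar>f x\<bar> \<le> M" using cont_bounded by blast
  moreover have "f \<in> borel_measurable riesz"
    using continuous_map_measurable_borel_of[OF f] by (simp add: measurable_cong_sets[OF sets_riesz refl])
  ultimately show ?thesis
    by (intro integrable_const_bound[of _ M]) (auto simp: space_riesz)
qed

lemma sum_clip: "0 \<le> t \<Longrightarrow> (\<Sum>k<n. min 1 (max 0 (t - real k))) = min t (real n)"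
  by (induction n) auto

text \<open>Cut \<open>n f\<close> into the slices \<open>F k\<close> of height 1 between the levels \<open>k\<close> and \<open>k + 1\<close>. The open set
  \<open>{f > (k+1)/n}\<close> carries \<open>F (k+1)\<close>, and \<open>F k = 1\<close> on it, so \<open>L (F (k+1)) \<le> \<integral> F k\<close>. Summing over \<open>k\<close>
  loses only the bottom slice, which contributes at most \<open>1/n\<close> after division by \<open>n\<close>.\<close>

lemma integral_riesz_ge:
  assumes f: "cont f" and f01: "\<And>x. x \<in> topspace X \<Longrightarrow> 0 \<le> f x \<and> f x \<le> 1"
  shows "L f \<le> (\<integral>x. f x \<partial>riesz)"
proof (rule field_le_epsilon)
  interpret prob_space riesz by (rule prob_space_riesz)
  fix \<epsilon> :: real assume "\<epsilon> > 0"
  then obtain n :: nat where n: "n > 0" "1 / real n < \<epsilon>"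
    by (metis inverse_eq_divide reals_Archimedean zero_less_Suc)
  define F where "F k = (\<lambda>x. min 1 (max 0 (real n * f x - real k)))" for k :: nat
  have F: "cont (F k)" for k
    unfolding F_def using f by (intro continuous_intros continuous_map_real_mult_left) auto
  have sumF: "(\<Sum>k<n. F k x) = real n * f x" if "x \<in> topspace X" for x
  proof -
    have "real n * f x \<le> real n" using f01[OF that] by (simp add: mult_left_le)
    then show ?thesis using f01[OF that] unfolding F_def by (simp add: sum_clip)
  qed
  have LF: "(\<Sum>k<n. L (F k)) = real n * L f"
  proof -
    have "(\<Sum>k<n. L (F k)) = L (\<lambda>x. \<Sum>k<n. F k x)" using F by (simp add: L_sum)
    also have "\<dots> = L (\<lambda>x. real n * f x)"
      using sumF F f by (intro antisym L_mono continuous_intros continuous_map_real_mult_left) auto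
    finally show ?thesis using f by (simp add: L_scale)
  qed
  have step: "L (F (Suc k)) \<le> (\<integral>x. F k x \<partial>riesz)" for k
  proof -
    define U where "U = {x \<in> topspace X. f x \<in> {real (Suc k) / real n <..}}"
    have U: "openin X U" unfolding U_def using f by (rule openin_continuous_map_preimage) simp
    have "F (Suc k) x = 0" if "x \<in> topspace X - U" for x
      using that n(1) by (auto simp: F_def U_def field_simps)
    moreover have "0 \<le> F (Suc k) x \<and> F (Suc k) x \<le> 1" for x by (simp add: F_def)
    ultimately have "F (Suc k) \<in> test U" using F by (simp add: test_def)
    then have "L (F (Suc k)) \<le> measure riesz U" by (simp add: mass_upper measure_riesz_open[OF U])
    also have "\<dots> = (\<integral>x. indicator U x \<partial>riesz)"
      using openin_borel_of[OF U] by (simp add: sets_riesz)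
    also have "\<dots> \<le> (\<integral>x. F k x \<partial>riesz)"
      using openin_borel_of[OF U] F n(1)
      by (intro integral_mono cont_integrable integrable_real_indicator)
         (auto simp: sets_riesz U_def F_def indicator_def space_riesz field_simps emeasure_eq_measure)
    finally show ?thesis .
  qed
  have F0: "L (F 0) \<le> 1" using L_mono[OF F[of 0], of "\<lambda>x. 1"] L_one by (simp add: F_def)
  have Fn: "0 \<le> L (F n)" by (rule L_nonneg[OF F]) (simp add: F_def)
  have "real n * L f - 1 \<le> (\<Sum>k<n. L (F (Suc k)))"
    using sum.lessThan_Suc_shift[of "\<lambda>k. L (F k)" n] sum.lessThan_Suc[of "\<lambda>k. L (F k)" n] F0 Fn LF
    by simp
  also have "\<dots> \<le> (\<Sum>k<n. \<integral>x. F k x \<partial>riesz)" by (intro sum_mono step)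
  also have "\<dots> = (\<integral>x. (\<Sum>k<n. F k x) \<partial>riesz)" using F by (simp add: cont_integrable)
  also have "\<dots> = (\<integral>x. real n * f x \<partial>riesz)"
    by (rule Bochner_Integration.integral_cong) (simp_all add: sumF space_riesz)
  finally have "real n * (L f - (\<integral>x. f x \<partial>riesz)) \<le> 1" by (simp add: algebra_simps)
  then have "L f - (\<integral>x. f x \<partial>riesz) \<le> 1 / real n" using n(1) by (simp add: field_simps)
  then show "L f \<le> (\<integral>x. f x \<partial>riesz) + \<epsilon>" using n(2) by simp
qed

text \<open>An affine rescaling brings any continuous function into the unit interval; applying the
  resulting inequality to \<open>f\<close> and \<open>- f\<close> gives equality.\<close>

theorem integral_riesz:
  assumes f: "cont f"
  shows "(\<integral>x. f x \<partial>riesz) = L f"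
proof -
  interpret prob_space riesz by (rule prob_space_riesz)
  obtain M where M: "M > 0" "\<forall>x \<in> topspace X. \<bar>f x\<bar> \<le> M" using cont_bounded[OF f] by blast
  have ge: "L g \<le> (\<integral>x. g x \<partial>riesz)" if g: "cont g" "\<And>x. x \<in> topspace X \<Longrightarrow> \<bar>g x\<bar> \<le> M" for g
  proof -
    define h where "h = (\<lambda>x. 1 / (2 * M) * g x + 1 / 2)"
    have c: "cont (\<lambda>x. 1 / (2 * M) * g x)" using g(1) by (rule continuous_map_real_mult_left)
    then have h: "cont h" unfolding h_def by (rule continuous_map_add) simp
    have "0 \<le> h x \<and> h x \<le> 1" if "x \<in> topspace X" for x
      using g(2)[OF that] M(1) by (auto simp: h_def field_simps abs_le_iff)
    then have "L h \<le> (\<integral>x. h x \<partial>riesz)" by (intro integral_riesz_ge h)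
    moreover have "L h = 1 / (2 * M) * L g + 1 / 2"
      unfolding h_def using L_add[OF c, of "\<lambda>x. 1/2"] L_const[of "1/2"] L_scale[OF g(1), of "1 / (2 * M)"] by simp
    moreover have "(\<integral>x. h x \<partial>riesz) = 1 / (2 * M) * (\<integral>x. g x \<partial>riesz) + 1 / 2"
      using cont_integrable[OF g(1)] by (simp add: h_def prob_space)
    ultimately show ?thesis using M(1) by (simp add: divide_le_cancel)
  qed
  have "cont (\<lambda>x. - 1 * f x)" using f by (rule continuous_map_real_mult_left)
  then have "L (\<lambda>x. - 1 * f x) \<le> (\<integral>x. - 1 * f x \<partial>riesz)" using M by (intro ge) auto
  then show ?thesis using ge[OF f] M(2) L_scale[OF f, of "-1"] by simp
qed

end

theorem Riesz_representation_compact: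
  assumes "state_on_compact X L"
  obtains \<mu> where "\<mu> \<in> regular_borel_prob_measures X"
    "\<And>f. continuous_map X euclideanreal f \<Longrightarrow> (\<integral>x. f x \<partial>\<mu>) = L f"
  using state_on_compact.riesz_regular[OF assms] state_on_compact.integral_riesz[OF assms] by blast

lemma return_regular:
  assumes X: "compact_space X" "Hausdorff_space X" and x: "x \<in> topspace X"
  shows "return (borel_of X) x \<in> regular_borel_prob_measures X"
proof (rule regular_borel_prob_measuresI[OF X])
  show "prob_space (return (borel_of X) x)" using x by (intro prob_space_return) simp
  fix A and \<epsilon> :: real assume A: "A \<in> sets (return (borel_of X) x)" and \<epsilon>: "\<epsilon> > 0"
  have A': "A \<in> sets (borel_of X)" "A \<subseteq> topspace X" using A sets.sets_into_space by force+
  show "\<exists>U. openin X U \<and> A \<subseteq> U \<and> measure (return (borel_of X) x) U \<le> measure (return (borel_of X) x) A + \<epsilon>"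
  proof (cases "x \<in> A")
    case True
    then show ?thesis using A' \<epsilon>
      by (intro exI[of _ "topspace X"]) (auto simp: measure_return openin_borel_of)
  next
    case False
    have "openin X (topspace X - {x})"
      using X x by (simp add: closedin_Hausdorff_singleton openin_diff)
    moreover have "A \<subseteq> topspace X - {x}" using A' False by auto
    ultimately show ?thesis using \<epsilon>
      by (intro exI[of _ "topspace X - {x}"]) (auto simp: measure_return openin_borel_of)
  qed
qed simp

text \<open>The image of an open set under a homeomorphism is open, so outer regularity of \<open>\<mu>\<close> is
  transported directly.\<close>

lemma distr_regular:
  assumes X: "compact_space X" "Hausdorff_space X" and \<mu>: "\<mu> \<in> regular_borel_prob_measures X"
    and f: "homeomorphic_map X X f"
  shows "distr \<mu> (borel_of X) f \<in> regular_borel_prob_measures X"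
proof (rule regular_borel_prob_measuresI[OF X])
  have s: "sets \<mu> = sets (borel_of X)" and p: "prob_space \<mu>"
    using \<mu> by (auto simp: regular_borel_prob_measures_def)
  have sp: "space \<mu> = topspace X" using sets_eq_imp_space_eq[OF s] by simp
  have m: "f \<in> measurable \<mu> (borel_of X)"
    using continuous_map_measurable_borel_of_borel_of[OF homeomorphic_imp_continuous_map[OF f]]
    by (simp add: measurable_cong_sets[OF s refl])
  interpret prob_space \<mu> by fact
  show "prob_space (distr \<mu> (borel_of X) f)" using m by (rule prob_space_distr)
  fix A and \<epsilon> :: real assume A: "A \<in> sets (distr \<mu> (borel_of X) f)" and \<epsilon>: "\<epsilon> > 0"
  define B where "B = f -` A \<inter> space \<mu>"
  have B: "B \<in> sets \<mu>" unfolding B_def using m A by (simp add: measurable_sets)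
  obtain V where V: "openin X V" "B \<subseteq> V" "measure \<mu> V \<le> measure \<mu> B + \<epsilon>"
    using regular_borel_prob_measuresD[OF \<mu> B \<epsilon>] by blast
  have V': "f ` V \<subseteq> topspace X" "openin X (f ` V)"
    using V(1) f homeomorphic_map_openness_eq openin_subset by (metis, metis)
  have inj: "inj_on f (topspace X)" and im: "f ` topspace X = topspace X"
    using f by (auto simp: homeomorphic_eq_everything_map)
  have "f -` (f ` V) \<inter> space \<mu> = V"
    using inj openin_subset[OF V(1)] by (auto simp: sp inj_on_def)
  then have "measure (distr \<mu> (borel_of X) f) (f ` V) = measure \<mu> V"
    using measure_distr[OF m, of "f ` V"] openin_borel_of[OF V'(2)] by simp
  moreover have "measure (distr \<mu> (borel_of X) f) A = measure \<mu> B"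
    using measure_distr[OF m, of A] A by (simp add: B_def)
  moreover have "A \<subseteq> f ` V"
  proof
    fix y assume y: "y \<in> A"
    have "A \<subseteq> topspace X" using A sets.sets_into_space by force
    then have "y \<in> f ` topspace X" using y im by auto
    then obtain x where "x \<in> topspace X" "y = f x" by (rule imageE)
    then show "y \<in> f ` V" using y V(2) by (auto simp: B_def sp)
  qed
  ultimately show "\<exists>U. openin X U \<and> A \<subseteq> U \<and>
      measure (distr \<mu> (borel_of X) f) U \<le> measure (distr \<mu> (borel_of X) f) A + \<epsilon>"
    using V(3) V'(2) by metis
qed simp

section \<open>Bounded right uniformly continuous functions on a set with an action\<close>

text \<open>The action is a parameter because two instances are used: the group acting on itself by left
  multiplication and on the left cosets of a subgroup. Functions are extensional, so that they are
  determined by their values on \<open>S\<close>.\<close>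

definition ruc_on ::
    "('a, 'm) monoid_scheme \<Rightarrow> 'a topology \<Rightarrow> 'b set \<Rightarrow> ('a \<Rightarrow> 'b \<Rightarrow> 'b) \<Rightarrow> ('b \<Rightarrow> complex) set" where
  "ruc_on G T S act =
     {f \<in> extensional S. bounded (f ` S) \<and>
        (\<forall>\<epsilon>>0. \<exists>U. openin T U \<and> \<one>\<^bsub>G\<^esub> \<in> U \<and>
           (\<forall>u \<in> U. \<forall>x \<in> S. cmod (f (act u x) - f x) < \<epsilon>))}"

definition ruc_algebra ::
    "('a, 'm) monoid_scheme \<Rightarrow> 'a topology \<Rightarrow> 'b set \<Rightarrow> ('a \<Rightarrow> 'b \<Rightarrow> 'b) \<Rightarrow> ('b \<Rightarrow> complex) cstar_algebra" where
  "ruc_algebra G T S act =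
     \<lparr>carrier = ruc_on G T S act,
      mult = (\<lambda>f f'. \<lambda>x \<in> S. f x * f' x),
      one = (\<lambda>x \<in> S. 1),
      zero = (\<lambda>x \<in> S. 0),
      add = (\<lambda>f f'. \<lambda>x \<in> S. f x + f' x),
      smult = (\<lambda>c f. \<lambda>x \<in> S. c * f x),
      cnorm = (\<lambda>f. SUP x \<in> S. cmod (f x)),
      cstar = (\<lambda>f. \<lambda>x \<in> S. cnj (f x))\<rparr>"

definition ruc_action ::
    "('a, 'm) monoid_scheme \<Rightarrow> 'a topology \<Rightarrow> 'b set \<Rightarrow> ('a \<Rightarrow> 'b \<Rightarrow> 'b) \<Rightarrow>
     'a \<Rightarrow> ('b \<Rightarrow> complex) \<Rightarrow> ('b \<Rightarrow> complex)" where
  "ruc_action G T S act g = (\<lambda>f \<in> ruc_on G T S act. \<lambda>x \<in> S. f (act (inv\<^bsub>G\<^esub> g) x))"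

definition state_on :: "'b set \<Rightarrow> ('b \<Rightarrow> complex) set \<Rightarrow> (('b \<Rightarrow> complex) \<Rightarrow> complex) \<Rightarrow> bool" where
  "state_on S A m \<longleftrightarrow>
     m (\<lambda>x\<in>S. 1) = 1 \<and>
     (\<forall>f\<in>A. \<forall>g\<in>A. m (\<lambda>x\<in>S. f x + g x) = m f + m g) \<and>
     (\<forall>c. \<forall>f\<in>A. m (\<lambda>x\<in>S. c * f x) = c * m f) \<and>
     (\<forall>f\<in>A. (\<forall>x\<in>S. f x \<in> \<real>\<^sub>\<ge>\<^sub>0) \<longrightarrow> m f \<in> \<real>\<^sub>\<ge>\<^sub>0)"

lemma RUC_set_eq: "RUC_set G T H = ruc_on G T (lcosets\<^bsub>G\<^esub> H) (\<lambda>u x. u <#\<^bsub>G\<^esub> x)"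
  by (simp add: RUC_set_def ruc_on_def)

lemma RUC_eq: "RUC G T H = ruc_algebra G T (lcosets\<^bsub>G\<^esub> H) (\<lambda>u x. u <#\<^bsub>G\<^esub> x)"
  by (simp add: RUC_def ruc_algebra_def RUC_set_eq)

lemma RUC_action_eq: "RUC_action G T H = ruc_action G T (lcosets\<^bsub>G\<^esub> H) (\<lambda>u x. u <#\<^bsub>G\<^esub> x)"
  by (simp add: fun_eq_iff RUC_action_def ruc_action_def RUC_set_eq)

locale top_group =
  fixes G :: "('a, 'm) monoid_scheme" (structure) and T :: "'a topology"
  assumes topological_group: "topological_group G T"
begin

sublocale group G using topological_group by (simp add: topological_group_def)

lemma topspace_eq: "topspace T = carrier G"
  using topological_group by (simp add: topological_group_def)

lemma continuous_mult: "continuous_map (prod_topology T T) T (\<lambda>(x, y). x \<otimes> y)"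
  and continuous_inv: "continuous_map T T (\<lambda>x. inv x)"
  using topological_group by (simp_all add: topological_group_def)

lemma continuous_mult':
  assumes "continuous_map X T f" "continuous_map X T g"
  shows "continuous_map X T (\<lambda>x. f x \<otimes> g x)"
  using continuous_map_compose[OF continuous_map_pairedI[OF assms] continuous_mult]
  by (simp add: o_def)

lemma nhd_mult:
  assumes "openin T U" "\<one> \<in> U"
  obtains V where "openin T V" "\<one> \<in> V" "\<And>x y. x \<in> V \<Longrightarrow> y \<in> V \<Longrightarrow> x \<otimes> y \<in> U"
proof -
  have "openin (prod_topology T T) {p \<in> topspace (prod_topology T T). (case p of (x, y) \<Rightarrow> x \<otimes> y) \<in> U}"
    using continuous_mult assms(1) by (rule openin_continuous_map_preimage)
  moreover have "(\<one>, \<one>) \<in> {p \<in> topspace (prod_topology T T). (case p of (x, y) \<Rightarrow> x \<otimes> y) \<in> U}"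
    using assms by (simp add: topspace_eq)
  ultimately obtain V W where VW: "openin T V" "openin T W" "\<one> \<in> V" "\<one> \<in> W"
      "V \<times> W \<subseteq> {p \<in> topspace (prod_topology T T). (case p of (x, y) \<Rightarrow> x \<otimes> y) \<in> U}"
    unfolding openin_prod_topology_alt by meson
  show ?thesis using VW by (intro that[of "V \<inter> W"]) auto
qed

lemma nhd_inv:
  assumes "openin T U" "\<one> \<in> U"
  obtains V where "openin T V" "\<one> \<in> V" "\<And>x. x \<in> V \<Longrightarrow> inv x \<in> U"
proof (rule that)
  show "openin T {x \<in> topspace T. inv x \<in> U}"
    using continuous_inv assms(1) by (rule openin_continuous_map_preimage)
qed (use assms in \<open>auto simp: topspace_eq\<close>)

lemma nhd_conj:
  assumes "openin T U" "\<one> \<in> U" "g \<in> carrier G"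
  obtains V where "openin T V" "\<one> \<in> V" "\<And>x. x \<in> V \<Longrightarrow> g \<otimes> x \<otimes> inv g \<in> U"
proof (rule that)
  show "openin T {x \<in> topspace T. g \<otimes> x \<otimes> inv g \<in> U}"
    using assms by (intro openin_continuous_map_preimage[OF _ assms(1)] continuous_mult') (auto simp: topspace_eq)
qed (use assms in \<open>auto simp: topspace_eq\<close>)

lemma nhd_subset: "openin T U \<Longrightarrow> u \<in> U \<Longrightarrow> u \<in> carrier G"
  using openin_subset topspace_eq by blast

lemma openin_carrier: "openin T (carrier G)"
  using openin_topspace[of T] by (simp add: topspace_eq)

end

locale top_group_on_set = top_group G T for G :: "('a, 'm) monoid_scheme" (structure) and T +
  fixes S :: "'b set" and act :: "'a \<Rightarrow> 'b \<Rightarrow> 'b"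
  assumes nonempty: "S \<noteq> {}"
    and act_closed [simp, intro]: "\<lbrakk>g \<in> carrier G; x \<in> S\<rbrakk> \<Longrightarrow> act g x \<in> S"
    and act_one [simp]: "x \<in> S \<Longrightarrow> act \<one> x = x"
    and act_mult: "\<lbrakk>g \<in> carrier G; h \<in> carrier G; x \<in> S\<rbrakk> \<Longrightarrow> act (g \<otimes> h) x = act g (act h x)"
begin

abbreviation A :: "('b \<Rightarrow> complex) set" where
  "A \<equiv> ruc_on G T S act"

abbreviation alg :: "('b \<Rightarrow> complex) cstar_algebra" where
  "alg \<equiv> ruc_algebra G T S act"

lemma ruc_extensional: "f \<in> A \<Longrightarrow> f \<in> extensional S"
  by (simp add: ruc_on_def)

lemma ruc_undefined: "f \<in> A \<Longrightarrow> x \<notin> S \<Longrightarrow> f x = undefined"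
  using ruc_extensional by (auto simp: extensional_def)

lemma ruc_eqI: "\<lbrakk>f \<in> A; g \<in> A; \<And>x. x \<in> S \<Longrightarrow> f x = g x\<rbrakk> \<Longrightarrow> f = g"
  by (rule extensionalityI[of _ S]) (auto intro: ruc_extensional)

lemma ruc_bounded: "f \<in> A \<Longrightarrow> \<exists>M>0. \<forall>x\<in>S. cmod (f x) \<le> M"
  using bounded_pos[of "f ` S"] by (auto simp: ruc_on_def)

lemma ruc_nhd:
  assumes "f \<in> A" "\<epsilon> > 0"
  obtains U where "openin T U" "\<one> \<in> U" "\<And>u x. u \<in> U \<Longrightarrow> x \<in> S \<Longrightarrow> cmod (f (act u x) - f x) < \<epsilon>"
proof -
  have "\<exists>U. openin T U \<and> \<one> \<in> U \<and> (\<forall>u \<in> U. \<forall>x \<in> S. cmod (f (act u x) - f x) < \<epsilon>)"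
    using assms by (simp add: ruc_on_def)
  then show ?thesis using that by metis
qed

lemma rucI:
  assumes "f \<in> extensional S" "\<And>x. x \<in> S \<Longrightarrow> cmod (f x) \<le> M"
    "\<And>\<epsilon>. \<epsilon> > 0 \<Longrightarrow> \<exists>U. openin T U \<and> \<one> \<in> U \<and> (\<forall>u\<in>U. \<forall>x\<in>S. cmod (f (act u x) - f x) < \<epsilon>)"
  shows "f \<in> A"
proof -
  have "bounded (f ` S)" using assms(2) by (auto intro!: boundedI)
  then show ?thesis using assms(1,3) by (simp add: ruc_on_def)
qed

text \<open>Two bounded functions take values in a compact set, on which \<open>\<phi>\<close> is uniformly continuous.\<close>

lemma ruc_compose2:
  assumes f: "f \<in> A" and g: "g \<in> A" and \<phi>: "continuous_on UNIV (\<lambda>(a, b). \<phi> a b :: complex)"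
  shows "(\<lambda>x\<in>S. \<phi> (f x) (g x)) \<in> A"
proof -
  obtain M N where M: "\<forall>x\<in>S. cmod (f x) \<le> M" and N: "\<forall>x\<in>S. cmod (g x) \<le> N"
    using ruc_bounded f g by metis
  define K where "K = cball (0::complex) M \<times> cball (0::complex) N"
  have K: "compact K" unfolding K_def by (intro compact_Times compact_cball)
  have fg: "(f x, g x) \<in> K" if "x \<in> S" for x using that M N by (simp add: K_def)
  have \<phi>K: "continuous_on K (\<lambda>(a, b). \<phi> a b)" using \<phi> continuous_on_subset by blast
  have "bounded ((\<lambda>(a, b). \<phi> a b) ` K)"
    using compact_continuous_image[OF \<phi>K K] by (rule compact_imp_bounded)
  then obtain B where B: "\<forall>p\<in>K. cmod (case p of (a, b) \<Rightarrow> \<phi> a b) \<le> B"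
    by (auto simp: bounded_iff)
  have uc: "uniformly_continuous_on K (\<lambda>(a, b). \<phi> a b)"
    using \<phi>K K by (rule compact_uniformly_continuous)
  show ?thesis
  proof (rule rucI[where M = B])
    show "cmod ((\<lambda>x\<in>S. \<phi> (f x) (g x)) x) \<le> B" if "x \<in> S" for x
      using B fg[OF that] that by force
    fix \<epsilon> :: real assume "\<epsilon> > 0"
    then obtain \<delta> where \<delta>: "\<delta> > 0" "\<And>p q. p \<in> K \<Longrightarrow> q \<in> K \<Longrightarrow> dist q p < \<delta> \<Longrightarrow>
        dist (case q of (a, b) \<Rightarrow> \<phi> a b) (case p of (a, b) \<Rightarrow> \<phi> a b) < \<epsilon>"
      using uc unfolding uniformly_continuous_on_def by metis
    obtain U where U: "openin T U" "\<one> \<in> U" "\<And>u x. u \<in> U \<Longrightarrow> x \<in> S \<Longrightarrow> cmod (f (act u x) - f x) < \<delta>/2"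
      using ruc_nhd[OF f, of "\<delta>/2"] \<delta>(1) by auto
    obtain V where V: "openin T V" "\<one> \<in> V" "\<And>u x. u \<in> V \<Longrightarrow> x \<in> S \<Longrightarrow> cmod (g (act u x) - g x) < \<delta>/2"
      using ruc_nhd[OF g, of "\<delta>/2"] \<delta>(1) by auto
    have "cmod (\<phi> (f (act u x)) (g (act u x)) - \<phi> (f x) (g x)) < \<epsilon>" if u: "u \<in> U \<inter> V" and x: "x \<in> S" for u x
    proof -
      have ux: "act u x \<in> S" using u x U(1) nhd_subset by auto
      have "dist (f (act u x), g (act u x)) (f x, g x)
          \<le> dist (f (act u x)) (f x) + dist (g (act u x)) (g x)"
        unfolding dist_Pair_Pair by (rule sqrt_sum_squares_le_sum) auto
      also have "\<dots> < \<delta>" using U(3)[of u x] V(3)[of u x] u x by (simp add: dist_norm)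
      finally show ?thesis using \<delta>(2)[OF fg[OF x] fg[OF ux]] by (simp add: dist_norm)
    qed
    then show "\<exists>U. openin T U \<and> \<one> \<in> U \<and> (\<forall>u\<in>U. \<forall>x\<in>S.
        cmod ((\<lambda>x\<in>S. \<phi> (f x) (g x)) (act u x) - (\<lambda>x\<in>S. \<phi> (f x) (g x)) x) < \<epsilon>)"
      using U(1,2) V(1,2) nhd_subset by (intro exI[of _ "U \<inter> V"]) auto
  qed simp
qed

lemma ruc_compose:
  assumes f: "f \<in> A" and \<phi>: "continuous_on UNIV (\<phi> :: complex \<Rightarrow> complex)"
  shows "(\<lambda>x\<in>S. \<phi> (f x)) \<in> A"
proof -
  have "continuous_on UNIV (\<lambda>p :: complex \<times> complex. \<phi> (fst p))"
    using \<phi> by (rule continuous_on_compose2) (auto intro: continuous_intros)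
  then show ?thesis using ruc_compose2[OF f f, of "\<lambda>a b. \<phi> a"] by (simp add: case_prod_unfold)
qed

lemma ruc_const: "(\<lambda>x\<in>S. c) \<in> A"
proof (rule rucI[where M = "cmod c"])
  fix \<epsilon> :: real assume "\<epsilon> > 0"
  then show "\<exists>U. openin T U \<and> \<one> \<in> U \<and> (\<forall>u\<in>U. \<forall>x\<in>S. cmod ((\<lambda>x\<in>S. c) (act u x) - (\<lambda>x\<in>S. c) x) < \<epsilon>)"
    by (intro exI[of _ "carrier G"]) (simp add: openin_carrier)
qed auto

lemma ruc_add: "f \<in> A \<Longrightarrow> g \<in> A \<Longrightarrow> (\<lambda>x\<in>S. f x + g x) \<in> A"
  by (rule ruc_compose2) (auto simp: case_prod_unfold intro!: continuous_intros)

lemma ruc_mult: "f \<in> A \<Longrightarrow> g \<in> A \<Longrightarrow> (\<lambda>x\<in>S. f x * g x) \<in> A"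
  by (rule ruc_compose2) (auto simp: case_prod_unfold intro!: continuous_intros)

lemma ruc_smult: "f \<in> A \<Longrightarrow> (\<lambda>x\<in>S. c * f x) \<in> A"
  by (rule ruc_compose) (auto intro!: continuous_intros)

lemma ruc_cnj: "f \<in> A \<Longrightarrow> (\<lambda>x\<in>S. cnj (f x)) \<in> A"
  by (rule ruc_compose) (auto intro!: continuous_intros)

lemma ruc_Re: "f \<in> A \<Longrightarrow> (\<lambda>x\<in>S. complex_of_real (Re (f x))) \<in> A"
  by (rule ruc_compose) (auto intro!: continuous_intros)

lemma ruc_Im: "f \<in> A \<Longrightarrow> (\<lambda>x\<in>S. complex_of_real (Im (f x))) \<in> A"
  by (rule ruc_compose) (auto intro!: continuous_intros)

text \<open>Translating by \<open>g\<close> replaces a neighbourhood of the identity by a conjugate of it.\<close>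

lemma ruc_shift:
  assumes f: "f \<in> A" and g: "g \<in> carrier G"
  shows "(\<lambda>x\<in>S. f (act g x)) \<in> A"
proof -
  obtain M where M: "\<forall>x\<in>S. cmod (f x) \<le> M" using ruc_bounded f by blast
  show ?thesis
  proof (rule rucI[where M = M])
    fix \<epsilon> :: real assume "\<epsilon> > 0"
    then obtain U where U: "openin T U" "\<one> \<in> U" "\<And>u x. u \<in> U \<Longrightarrow> x \<in> S \<Longrightarrow> cmod (f (act u x) - f x) < \<epsilon>"
      using ruc_nhd[OF f] by metis
    obtain V where V: "openin T V" "\<one> \<in> V" "\<And>x. x \<in> V \<Longrightarrow> g \<otimes> x \<otimes> inv g \<in> U"
      using nhd_conj[OF U(1,2) g] by blast
    have "cmod (f (act g (act v x)) - f (act g x)) < \<epsilon>" if v: "v \<in> V" and x: "x \<in> S" for v x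
    proof -
      have vc: "v \<in> carrier G" using V(1) v by (rule nhd_subset)
      have "act g (act v x) = act (g \<otimes> v \<otimes> inv g \<otimes> g) x"
        using g vc x by (simp add: act_mult m_assoc)
      also have "\<dots> = act (g \<otimes> v \<otimes> inv g) (act g x)" using g vc x by (intro act_mult) auto
      finally show ?thesis using U(3)[OF V(3)[OF v], of "act g x"] g x by simp
    qed
    then show "\<exists>U. openin T U \<and> \<one> \<in> U \<and> (\<forall>u\<in>U. \<forall>x\<in>S.
        cmod ((\<lambda>x\<in>S. f (act g x)) (act u x) - (\<lambda>x\<in>S. f (act g x)) x) < \<epsilon>)"
      using V(1,2) nhd_subset by (intro exI[of _ V]) auto
  qed (use M g in auto)
qed

lemma ruc_uniform_limit:
  assumes f: "\<And>n. f n \<in> A" and g: "g \<in> extensional S"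
    and lim: "\<And>\<epsilon>. \<epsilon> > 0 \<Longrightarrow> \<exists>n::nat. \<forall>x\<in>S. cmod (f n x - g x) \<le> \<epsilon>"
  shows "g \<in> A"
proof -
  obtain n where n: "\<forall>x\<in>S. cmod (f n x - g x) \<le> 1" using lim[of 1] by auto
  obtain M where M: "\<forall>x\<in>S. cmod (f n x) \<le> M" using ruc_bounded f by blast
  show ?thesis
  proof (rule rucI[where M = "M + 1"])
    show "cmod (g x) \<le> M + 1" if "x \<in> S" for x
    proof -
      have "cmod (g x) \<le> cmod (f n x) + cmod (f n x - g x)"
        by (metis add.commute diff_add_cancel norm_minus_commute norm_triangle_ineq)
      then show ?thesis using n M that by force
    qed
    fix \<epsilon> :: real assume "\<epsilon> > 0"
    then obtain k where k: "\<forall>x\<in>S. cmod (f k x - g x) \<le> \<epsilon>/4" using lim[of "\<epsilon>/4"] by auto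
    obtain U where U: "openin T U" "\<one> \<in> U" "\<And>u x. u \<in> U \<Longrightarrow> x \<in> S \<Longrightarrow> cmod (f k (act u x) - f k x) < \<epsilon>/2"
      using ruc_nhd[OF f[of k], of "\<epsilon>/2"] \<open>\<epsilon> > 0\<close> by auto
    have "cmod (g (act u x) - g x) < \<epsilon>" if u: "u \<in> U" and x: "x \<in> S" for u x
    proof -
      have ux: "act u x \<in> S" using u x U(1) nhd_subset by auto
      have "g (act u x) - g x = (f k (act u x) - f k x) - (f k (act u x) - g (act u x)) + (f k x - g x)"
        by simp
      also have "cmod \<dots> \<le> cmod (f k (act u x) - f k x) + cmod (f k (act u x) - g (act u x)) + cmod (f k x - g x)"
        by (meson add_mono_thms_linordered_semiring(3) norm_triangle_ineq norm_triangle_ineq4 order_trans)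
      also have "\<dots> < \<epsilon>/2 + \<epsilon>/4 + \<epsilon>/4"
        using U(3)[OF u x] k x ux by (intro add_less_le_mono) auto
      finally show ?thesis by simp
    qed
    then show "\<exists>U. openin T U \<and> \<one> \<in> U \<and> (\<forall>u\<in>U. \<forall>x\<in>S. cmod (g (act u x) - g x) < \<epsilon>)"
      using U by blast
  qed (rule g)
qed

lemma sup_norm_upper: "f \<in> A \<Longrightarrow> x \<in> S \<Longrightarrow> cmod (f x) \<le> (SUP x\<in>S. cmod (f x))"
proof -
  assume f: "f \<in> A" and x: "x \<in> S"
  obtain M where "\<forall>x\<in>S. cmod (f x) \<le> M" using ruc_bounded f by blast
  then show ?thesis using x by (intro cSUP_upper) (auto intro!: bdd_aboveI2)
qed

lemma sup_norm_least: "(\<And>x. x \<in> S \<Longrightarrow> cmod (f x) \<le> c) \<Longrightarrow> (SUP x\<in>S. cmod (f x)) \<le> c"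
  using nonempty by (intro cSUP_least)

lemma sup_norm_nonneg: "f \<in> A \<Longrightarrow> 0 \<le> (SUP x\<in>S. cmod (f x))"
  using nonempty sup_norm_upper by (meson ex_in_conv norm_ge_zero order_trans)

lemma cring_alg: "cring alg"
proof (rule cringI)
  show "abelian_group alg"
  proof (rule abelian_groupI)
    fix f assume f: "f \<in> carrier alg"
    then have "(\<lambda>x\<in>S. -1 * f x) \<in> A" by (intro ruc_smult) (simp add: ruc_algebra_def)
    then show "\<exists>y\<in>carrier alg. y \<oplus>\<^bsub>alg\<^esub> f = \<zero>\<^bsub>alg\<^esub>"
      by (intro bexI[of _ "\<lambda>x\<in>S. -1 * f x"]) (auto simp: ruc_algebra_def)
  qed (auto simp: ruc_algebra_def ruc_add ruc_const fun_eq_iff ruc_undefined)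
  show "comm_monoid alg"
    by (rule comm_monoidI)
       (auto simp: ruc_algebra_def ruc_mult ruc_const fun_eq_iff ruc_undefined)
qed (auto simp: ruc_algebra_def algebra_simps fun_eq_iff)

lemma complex_ring_cring: "cring complex_ring"
  by (rule cringI; (rule abelian_groupI comm_monoidI)?)
     (auto simp: complex_ring_def algebra_simps intro: exI[of _ "- x" for x])

lemma algebra_alg: "Module.algebra complex_ring alg"
  by (rule algebraI[OF complex_ring_cring cring_alg])
     (auto simp: ruc_algebra_def complex_ring_def ruc_smult algebra_simps fun_eq_iff ruc_undefined)

lemma minus_alg:
  assumes "f \<in> A" "g \<in> A"
  shows "f \<ominus>\<^bsub>alg\<^esub> g = (\<lambda>x\<in>S. f x - g x)"
proof -
  interpret cring alg by (rule cring_alg)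
  have "(\<lambda>x\<in>S. -1 * g x) \<in> A" using assms by (intro ruc_smult)
  then have "\<ominus>\<^bsub>alg\<^esub> g = (\<lambda>x\<in>S. -1 * g x)"
    using assms by (intro minus_equality) (auto simp: ruc_algebra_def)
  then show ?thesis by (auto simp: a_minus_def ruc_algebra_def intro!: restrict_ext)
qed

lemma cnorm_alg: "cnorm alg f = (SUP x\<in>S. cmod (f x))"
  and carrier_alg: "carrier alg = A"
  by (simp_all add: ruc_algebra_def)

lemma normed_star_algebra_alg: "normed_star_algebra alg"
proof -
  interpret algebra complex_ring alg by (rule algebra_alg)
  show ?thesis
  proof
    fix f g :: "'b \<Rightarrow> complex" and c
    assume "f \<in> carrier alg"
    then have f: "f \<in> A" by (simp add: carrier_alg)
    show "0 \<le> cnorm alg f" using f by (simp add: cnorm_alg sup_norm_nonneg)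
    show "(cnorm alg f = 0) = (f = \<zero>\<^bsub>alg\<^esub>)"
    proof
      assume "cnorm alg f = 0"
      then have "f x = 0" if "x \<in> S" for x using sup_norm_upper[OF f that] by (simp add: cnorm_alg)
      then show "f = \<zero>\<^bsub>alg\<^esub>"
        using f ruc_const[of 0] by (intro ruc_eqI) (auto simp: ruc_algebra_def)
    next
      assume "f = \<zero>\<^bsub>alg\<^esub>"
      then have "f x = 0" if "x \<in> S" for x using that by (simp add: ruc_algebra_def)
      then show "cnorm alg f = 0"
        using sup_norm_least[of f 0] sup_norm_nonneg[OF f] by (simp add: cnorm_alg)
    qed
    show "cnorm alg (c \<odot>\<^bsub>alg\<^esub> f) = cmod c * cnorm alg f"
    proof (rule antisym)
      show "cnorm alg (c \<odot>\<^bsub>alg\<^esub> f) \<le> cmod c * cnorm alg f"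
        unfolding cnorm_alg using sup_norm_upper[OF f]
        by (intro sup_norm_least) (simp add: ruc_algebra_def norm_mult mult_left_mono)
      show "cmod c * cnorm alg f \<le> cnorm alg (c \<odot>\<^bsub>alg\<^esub> f)"
      proof (cases "c = 0")
        case True
        then show ?thesis using sup_norm_nonneg[OF ruc_smult[OF f, of c]]
          by (simp add: cnorm_alg) (simp add: ruc_algebra_def)
      next
        case False
        have "cnorm alg f \<le> cnorm alg (c \<odot>\<^bsub>alg\<^esub> f) / cmod c"
          unfolding cnorm_alg
        proof (rule sup_norm_least)
          fix x assume x: "x \<in> S"
          have "cmod ((\<lambda>x\<in>S. c * f x) x) \<le> (SUP x\<in>S. cmod ((\<lambda>x\<in>S. c * f x) x))"
            using ruc_smult[OF f] x by (rule sup_norm_upper)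
          then show "cmod (f x) \<le> (SUP x\<in>S. cmod ((c \<odot>\<^bsub>alg\<^esub> f) x)) / cmod c"
            using x False by (simp add: ruc_algebra_def norm_mult pos_le_divide_eq mult.commute)
        qed
        then show ?thesis using False by (simp add: pos_le_divide_eq mult.commute)
      qed
    qed
    show "cstar alg f \<in> carrier alg" "cstar alg (cstar alg f) = f"
      using f ruc_cnj by (auto simp: ruc_algebra_def fun_eq_iff ruc_undefined)
    show "cstar alg (c \<odot>\<^bsub>alg\<^esub> f) = cnj c \<odot>\<^bsub>alg\<^esub> cstar alg f"
      by (auto simp: ruc_algebra_def intro!: restrict_ext)
    show "cnorm alg (cstar alg f \<otimes>\<^bsub>alg\<^esub> f) = (cnorm alg f)\<^sup>2"
    proof -
      have f2: "(\<lambda>x\<in>S. cnj (f x) * f x) \<in> A"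
        using ruc_mult[OF ruc_cnj[OF f] f] by (simp cong: restrict_cong)
      have eq: "cstar alg f \<otimes>\<^bsub>alg\<^esub> f = (\<lambda>x\<in>S. cnj (f x) * f x)"
        by (auto simp: ruc_algebra_def intro!: restrict_ext)
      have sq: "cmod (cnj z * z) = (cmod z)\<^sup>2" for z by (simp add: norm_mult power2_eq_square)
      have "(cnorm alg f)\<^sup>2 \<le> cnorm alg (cstar alg f \<otimes>\<^bsub>alg\<^esub> f)"
      proof -
        have "cnorm alg f \<le> sqrt (cnorm alg (cstar alg f \<otimes>\<^bsub>alg\<^esub> f))"
          unfolding cnorm_alg eq
        proof (rule sup_norm_least)
          fix x assume x: "x \<in> S"
          show "cmod (f x) \<le> sqrt (SUP x\<in>S. cmod ((\<lambda>x\<in>S. cnj (f x) * f x) x))"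
            using sup_norm_upper[OF f2 x] x by (intro real_le_rsqrt) (simp add: sq)
        qed
        then show ?thesis
          using f sup_norm_nonneg[OF f] sup_norm_nonneg[OF f2] power_mono[of "cnorm alg f" "sqrt (cnorm alg (cstar alg f \<otimes>\<^bsub>alg\<^esub> f))" 2]
          by (simp add: cnorm_alg eq)
      qed
      moreover have "cnorm alg (cstar alg f \<otimes>\<^bsub>alg\<^esub> f) \<le> (cnorm alg f)\<^sup>2"
        unfolding cnorm_alg eq using sup_norm_upper[OF f]
        by (intro sup_norm_least) (simp add: sq power_mono)
      ultimately show ?thesis by simp
    qed
    assume "g \<in> carrier alg"
    then have g: "g \<in> A" by (simp add: carrier_alg)
    show "cnorm alg (f \<oplus>\<^bsub>alg\<^esub> g) \<le> cnorm alg f + cnorm alg g"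
      unfolding cnorm_alg
    proof (rule sup_norm_least)
      fix x assume x: "x \<in> S"
      then show "cmod ((f \<oplus>\<^bsub>alg\<^esub> g) x) \<le> (SUP x\<in>S. cmod (f x)) + (SUP x\<in>S. cmod (g x))"
        using sup_norm_upper[OF f x] sup_norm_upper[OF g x] norm_triangle_ineq[of "f x" "g x"]
        by (simp add: ruc_algebra_def)
    qed
    show "cnorm alg (f \<otimes>\<^bsub>alg\<^esub> g) \<le> cnorm alg f * cnorm alg g"
      unfolding cnorm_alg using sup_norm_upper[OF f] sup_norm_upper[OF g] sup_norm_nonneg[OF f]
      by (intro sup_norm_least) (simp add: ruc_algebra_def norm_mult mult_mono)
    show "cstar alg (f \<oplus>\<^bsub>alg\<^esub> g) = cstar alg f \<oplus>\<^bsub>alg\<^esub> cstar alg g"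
      and "cstar alg (f \<otimes>\<^bsub>alg\<^esub> g) = cstar alg g \<otimes>\<^bsub>alg\<^esub> cstar alg f"
      by (auto simp: ruc_algebra_def intro!: restrict_ext)
  qed
qed

sublocale alg: normed_star_algebra alg
  by (rule normed_star_algebra_alg)

lemma topspace_alg: "topspace alg.mtopology = A" "topspace (Metric_space.mtopology A (cdist alg)) = A"
  using alg.topspace_mtopology by (simp_all add: carrier_alg)

lemma mball_alg: "f' \<in> alg.mball f \<epsilon> \<longleftrightarrow> f \<in> A \<and> f' \<in> A \<and> cdist alg f f' < \<epsilon>"
  unfolding alg.in_mball by (simp flip: carrier_alg)

lemma cdist_alg: "\<lbrakk>f \<in> A; g \<in> A\<rbrakk> \<Longrightarrow> cdist alg f g = (SUP x\<in>S. cmod (f x - g x))"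
  by (simp add: cdist_def carrier_alg minus_alg cnorm_alg cong: SUP_cong_simp)

lemma ruc_diff: "\<lbrakk>f \<in> A; g \<in> A\<rbrakk> \<Longrightarrow> (\<lambda>x\<in>S. f x - g x) \<in> A"
  by (rule ruc_compose2) (auto simp: case_prod_unfold intro!: continuous_intros)

lemma cdist_alg_upper:
  assumes "f \<in> A" "g \<in> A" "x \<in> S"
  shows "cmod (f x - g x) \<le> cdist alg f g"
  using sup_norm_upper[OF ruc_diff[OF assms(1,2)] assms(3)] assms
  by (simp add: cdist_alg cong: SUP_cong_simp)

lemma cdist_alg_least:
  assumes "f \<in> A" "g \<in> A" "\<And>x. x \<in> S \<Longrightarrow> cmod (f x - g x) \<le> c"
  shows "cdist alg f g \<le> c"
  unfolding cdist_alg[OF assms(1,2)] using nonempty assms(3) by (rule cSUP_least)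

lemma comm_cstar_algebra_alg: "comm_cstar_algebra alg"
proof
  show "Metric_space.mcomplete (carrier alg) (cdist alg)"
    unfolding alg.mcomplete_def
  proof (intro allI impI)
    fix \<sigma> assume C: "alg.MCauchy \<sigma>"
    then have \<sigma>: "\<sigma> n \<in> A" for n by (auto simp: alg.MCauchy_def simp flip: carrier_alg)
    have ev: "\<exists>N. \<forall>n n'. N \<le> n \<longrightarrow> N \<le> n' \<longrightarrow> cdist alg (\<sigma> n) (\<sigma> n') < \<epsilon>" if "\<epsilon> > 0" for \<epsilon>
      using C that by (simp add: alg.MCauchy_def)
    have "Cauchy (\<lambda>n. \<sigma> n x)" if x: "x \<in> S" for x
    proof (rule CauchyI)
      fix \<epsilon> :: real assume "\<epsilon> > 0"
      then obtain N where N: "\<And>n n'. N \<le> n \<Longrightarrow> N \<le> n' \<Longrightarrow> cdist alg (\<sigma> n) (\<sigma> n') < \<epsilon>" using ev by meson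
      then show "\<exists>M. \<forall>m\<ge>M. \<forall>n\<ge>M. norm (\<sigma> m x - \<sigma> n x) < \<epsilon>"
        using cdist_alg_upper[OF \<sigma> \<sigma> x] by (intro exI[of _ N]) (meson order_le_less_trans)
    qed
    then have lim: "(\<lambda>n. \<sigma> n x) \<longlonglongrightarrow> lim (\<lambda>n. \<sigma> n x)" if "x \<in> S" for x
      using that by (simp add: Cauchy_convergent_iff convergent_LIMSEQ_iff)
    define l where "l = (\<lambda>x\<in>S. lim (\<lambda>n. \<sigma> n x))"
    have unif: "\<exists>N. \<forall>n\<ge>N. \<forall>x\<in>S. cmod (\<sigma> n x - l x) \<le> \<epsilon>" if \<epsilon>: "\<epsilon> > 0" for \<epsilon>
    proof -
      obtain N where N: "\<And>n n'. N \<le> n \<Longrightarrow> N \<le> n' \<Longrightarrow> cdist alg (\<sigma> n) (\<sigma> n') < \<epsilon>" using ev \<open>\<epsilon> > 0\<close> by meson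
      have "cmod (\<sigma> n x - l x) \<le> \<epsilon>" if n: "n \<ge> N" and x: "x \<in> S" for n x
      proof (rule LIMSEQ_le_const2)
        show "(\<lambda>k. cmod (\<sigma> n x - \<sigma> k x)) \<longlonglongrightarrow> cmod (\<sigma> n x - l x)"
          using lim[OF x] x by (intro tendsto_intros) (simp add: l_def)
        show "\<exists>N. \<forall>k\<ge>N. cmod (\<sigma> n x - \<sigma> k x) \<le> \<epsilon>"
          using cdist_alg_upper[OF \<sigma> \<sigma> x, of n] N[OF n] by (intro exI[of _ N]) (meson less_imp_le order_trans)
      qed
      then show ?thesis by blast
    qed
    have l: "l \<in> A"
    proof (rule ruc_uniform_limit[OF \<sigma>])
      show "l \<in> extensional S" by (simp add: l_def)
      show "\<exists>n. \<forall>x\<in>S. cmod (\<sigma> n x - l x) \<le> \<epsilon>" if "\<epsilon> > 0" for \<epsilon>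
        using unif[OF that] by (meson order_refl)
    qed
    have "limitin alg.mtopology \<sigma> l sequentially"
      unfolding alg.limit_metric_sequentially
    proof (intro conjI allI impI)
      fix \<epsilon> :: real assume "\<epsilon> > 0"
      then obtain N where "\<forall>n\<ge>N. \<forall>x\<in>S. cmod (\<sigma> n x - l x) \<le> \<epsilon>/2" using unif[of "\<epsilon>/2"] half_gt_zero by metis
      then have "cdist alg (\<sigma> n) l \<le> \<epsilon>/2" if "n \<ge> N" for n using that by (intro cdist_alg_least \<sigma> l) auto
      then show "\<exists>N. \<forall>n\<ge>N. \<sigma> n \<in> carrier alg \<and> cdist alg (\<sigma> n) l < \<epsilon>"
        using \<sigma> \<open>\<epsilon> > 0\<close> by (intro exI[of _ N]) (auto simp: carrier_alg intro: order_le_less_trans[of _ "\<epsilon>/2"])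
    qed (simp add: l carrier_alg)
    then show "\<exists>x. limitin alg.mtopology \<sigma> x sequentially" by blast
  qed
qed

text \<open>The pointwise square root of a nonnegative function is again right uniformly continuous,
  because it is the composition with a continuous function.\<close>

lemma cstar_nonneg_alg:
  assumes f: "f \<in> A"
  shows "cstar_nonneg alg f \<longleftrightarrow> (\<forall>x\<in>S. f x \<in> \<real>\<^sub>\<ge>\<^sub>0)"
proof
  assume "cstar_nonneg alg f"
  then obtain g where "g \<in> A" "f = cstar alg g \<otimes>\<^bsub>alg\<^esub> g" by (auto simp: cstar_nonneg_def carrier_alg)
  then show "\<forall>x\<in>S. f x \<in> \<real>\<^sub>\<ge>\<^sub>0"
    by (auto simp: ruc_algebra_def complex_nonneg_Reals_iff)
next
  assume nn: "\<forall>x\<in>S. f x \<in> \<real>\<^sub>\<ge>\<^sub>0"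
  define g where "g = (\<lambda>x\<in>S. complex_of_real (sqrt (Re (f x))))"
  have g: "g \<in> A" unfolding g_def by (rule ruc_compose[OF f]) (auto intro!: continuous_intros)
  have "f = (\<lambda>x\<in>S. cnj (g x) * g x)"
  proof (rule ruc_eqI[OF f])
    show "(\<lambda>x\<in>S. cnj (g x) * g x) \<in> A" using ruc_mult[OF ruc_cnj[OF g] g] by (simp cong: restrict_cong)
    show "f x = (\<lambda>x\<in>S. cnj (g x) * g x) x" if "x \<in> S" for x
    proof -
      have "Re (f x) \<ge> 0" "Im (f x) = 0" using nn that by (auto simp: complex_nonneg_Reals_iff)
      then show ?thesis using that by (simp add: g_def complex_eq_iff)
    qed
  qed
  then show "cstar_nonneg alg f"
    unfolding cstar_nonneg_def using g
    by (intro bexI[of _ g]) (auto simp: ruc_algebra_def intro!: restrict_ext)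
qed

lemma ruc_action_apply: "\<lbrakk>f \<in> A; x \<in> S\<rbrakk> \<Longrightarrow> ruc_action G T S act g f x = f (act (inv g) x)"
  by (simp add: ruc_action_def)

lemma ruc_action_closed: "\<lbrakk>f \<in> A; g \<in> carrier G\<rbrakk> \<Longrightarrow> ruc_action G T S act g f \<in> A"
  by (simp add: ruc_action_def ruc_shift)

lemma ruc_action_mult:
  assumes "f \<in> A" "g \<in> carrier G" "h \<in> carrier G"
  shows "ruc_action G T S act (g \<otimes> h) f = ruc_action G T S act g (ruc_action G T S act h f)"
  using assms by (intro ruc_eqI ruc_action_closed) (auto simp: ruc_action_apply ruc_action_closed inv_mult_group act_mult)

lemma ruc_action_one: "f \<in> A \<Longrightarrow> ruc_action G T S act \<one> f = f"
  by (intro ruc_eqI ruc_action_closed) (auto simp: ruc_action_apply)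

lemma ruc_action_inv:
  assumes "f \<in> A" "g \<in> carrier G"
  shows "ruc_action G T S act g (ruc_action G T S act (inv g) f) = f"
    and "ruc_action G T S act (inv g) (ruc_action G T S act g f) = f"
  using assms ruc_action_mult[of f g "inv g"] ruc_action_mult[of f "inv g" g] ruc_action_one by auto

lemma ruc_action_near:
  assumes f: "f \<in> A" and "\<epsilon> > 0"
  obtains U where "openin T U" "\<one> \<in> U"
    "\<And>u x. u \<in> U \<Longrightarrow> x \<in> S \<Longrightarrow> cmod (ruc_action G T S act u f x - f x) < \<epsilon>"
proof -
  obtain U where U: "openin T U" "\<one> \<in> U" "\<And>u x. u \<in> U \<Longrightarrow> x \<in> S \<Longrightarrow> cmod (f (act u x) - f x) < \<epsilon>"
    using ruc_nhd[OF assms] by metis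
  obtain V where "openin T V" "\<one> \<in> V" "\<And>x. x \<in> V \<Longrightarrow> inv x \<in> U" using nhd_inv[OF U(1,2)] by metis
  then show ?thesis using U(3) f by (intro that[of V]) (auto simp: ruc_action_apply)
qed

lemma translate_nhd:
  assumes "openin T U" "\<one> \<in> U" "g \<in> carrier G"
  shows "openin T {x \<in> carrier G. inv g \<otimes> x \<in> U}" "g \<in> {x \<in> carrier G. inv g \<otimes> x \<in> U}"
proof -
  have "openin T {x \<in> topspace T. inv g \<otimes> x \<in> U}"
    using assms by (intro openin_continuous_map_preimage[OF _ assms(1)] continuous_mult') (auto simp: topspace_eq)
  then show "openin T {x \<in> carrier G. inv g \<otimes> x \<in> U}" by (simp add: topspace_eq)
qed (use assms in auto)

text \<open>Continuity of the action for the supremum norm is what right uniform continuity means at a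
  single function; the action being isometric makes it jointly continuous.\<close>

lemma ruc_continuous_action:
  "continuous_map (prod_topology T alg.mtopology) alg.mtopology (\<lambda>(g, f). ruc_action G T S act g f)"
  unfolding continuous_map_def
proof (intro conjI allI impI)
  show "(\<lambda>(g, f). ruc_action G T S act g f) \<in> topspace (prod_topology T alg.mtopology) \<rightarrow> topspace alg.mtopology"
    by (auto simp: topspace_eq carrier_alg topspace_alg ruc_action_closed)
  fix W assume W: "openin alg.mtopology W"
  show "openin (prod_topology T alg.mtopology)
      {p \<in> topspace (prod_topology T alg.mtopology). (case p of (g, f) \<Rightarrow> ruc_action G T S act g f) \<in> W}"
    unfolding openin_prod_topology_alt
  proof (intro allI impI)
    fix g f assume "(g, f) \<in> {p \<in> topspace (prod_topology T alg.mtopology). (case p of (g, f) \<Rightarrow> ruc_action G T S act g f) \<in> W}"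
    then have g: "g \<in> carrier G" and f: "f \<in> A" and gf: "ruc_action G T S act g f \<in> W"
      by (auto simp: topspace_eq carrier_alg topspace_alg)
    obtain \<epsilon> where \<epsilon>: "\<epsilon> > 0" "alg.mball (ruc_action G T S act g f) \<epsilon> \<subseteq> W"
      using W gf by (auto simp: alg.openin_mtopology)
    obtain U where U: "openin T U" "\<one> \<in> U"
        "\<And>u x. u \<in> U \<Longrightarrow> x \<in> S \<Longrightarrow> cmod (ruc_action G T S act u f x - f x) < \<epsilon>/3"
      using ruc_action_near[OF f, of "\<epsilon>/3"] \<epsilon>(1) by auto
    have *: "ruc_action G T S act k f' \<in> W"
      if k: "k \<in> carrier G" "inv g \<otimes> k \<in> U" and f': "f' \<in> A" "cdist alg f f' < \<epsilon>/3" for k f'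
    proof -
      have "cmod (ruc_action G T S act g f x - ruc_action G T S act k f' x) \<le> \<epsilon>/3 + \<epsilon>/3" if x: "x \<in> S" for x
      proof -
        let ?y = "act (inv g) x"
        have y: "?y \<in> S" using g x by auto
        have "act (inv k) x = act (inv (inv g \<otimes> k)) ?y"
          using g k x by (simp add: inv_mult_group m_assoc flip: act_mult)
        then have "ruc_action G T S act k f x = ruc_action G T S act (inv g \<otimes> k) f ?y"
          using f x y by (simp add: ruc_action_apply)
        then have 1: "cmod (ruc_action G T S act k f x - ruc_action G T S act g f x) < \<epsilon>/3"
          using U(3)[OF k(2) y] f x by (simp add: ruc_action_apply)
        have "act (inv k) x \<in> S" using k x by auto
        then have 2: "cmod (ruc_action G T S act k f x - ruc_action G T S act k f' x) < \<epsilon>/3"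
          using order_le_less_trans[OF cdist_alg_upper[OF f f'(1)] f'(2)] x by (simp add: ruc_action_apply f f'(1))
        show ?thesis
          using 1 2 dist_triangle[of "ruc_action G T S act g f x" "ruc_action G T S act k f' x" "ruc_action G T S act k f x"]
          by (simp add: dist_norm norm_minus_commute)
      qed
      then have "cdist alg (ruc_action G T S act g f) (ruc_action G T S act k f') \<le> \<epsilon>/3 + \<epsilon>/3"
        using f f' g k by (intro cdist_alg_least ruc_action_closed)
      then show ?thesis using \<epsilon>(1) f f' g k by (intro subsetD[OF \<epsilon>(2)]) (simp add: mball_alg ruc_action_closed del: alg.in_mball)
    qed
    then show "\<exists>U V. openin T U \<and> openin alg.mtopology V \<and> g \<in> U \<and> f \<in> V \<and>
        U \<times> V \<subseteq> {p \<in> topspace (prod_topology T alg.mtopology). (case p of (g, f) \<Rightarrow> ruc_action G T S act g f) \<in> W}"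
    proof (intro exI conjI subsetI)
      show "openin T {x \<in> carrier G. inv g \<otimes> x \<in> U}" "g \<in> {x \<in> carrier G. inv g \<otimes> x \<in> U}"
        using translate_nhd[OF U(1,2) g] .
      show "openin alg.mtopology (alg.mball f (\<epsilon>/3))" by (rule alg.openin_mball)
      show "f \<in> alg.mball f (\<epsilon>/3)" using f \<epsilon>(1) by (simp flip: carrier_alg)
      fix p assume p: "p \<in> {x \<in> carrier G. inv g \<otimes> x \<in> U} \<times> alg.mball f (\<epsilon>/3)"
      then obtain k f' where "p = (k, f')" "k \<in> carrier G" "inv g \<otimes> k \<in> U" "f' \<in> A" "cdist alg f f' < \<epsilon>/3"
        by (cases p) (use p mball_alg in blast)
      then show "p \<in> {p \<in> topspace (prod_topology T alg.mtopology). (case p of (g, f) \<Rightarrow> ruc_action G T S act g f) \<in> W}"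
        using *[of k f'] by (simp add: topspace_eq flip: carrier_alg)
    qed
  qed
qed

lemma ruc_action_group_action: "group_action G A (ruc_action G T S act)"
proof (intro group_action.intro group_hom.intro group_hom_axioms.intro is_group group_BijGroup)
  have B: "ruc_action G T S act g \<in> Bij A" if g: "g \<in> carrier G" for g
    unfolding Bij_def
  proof
    show "ruc_action G T S act g \<in> extensional A" by (simp add: ruc_action_def)
    show "ruc_action G T S act g \<in> {f. bij_betw f A A}"
      using g by (auto intro!: bij_betw_byWitness[where f' = "ruc_action G T S act (inv g)"] simp: ruc_action_inv ruc_action_closed)
  qed
  show "ruc_action G T S act \<in> hom G (BijGroup A)"
  proof (rule homI)
    fix g h assume "g \<in> carrier G" "h \<in> carrier G"
    then show "ruc_action G T S act (g \<otimes> h) = ruc_action G T S act g \<otimes>\<^bsub>BijGroup A\<^esub> ruc_action G T S act h"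
      by (intro extensionalityI[of _ A])
         (auto simp: BijGroup_def B compose_def ruc_action_mult ruc_action_closed, auto simp: ruc_action_def)
  qed (simp add: BijGroup_def B)
qed

lemma ruc_unital_order_iso:
  assumes g: "g \<in> carrier G"
  shows "unital_order_iso alg A alg A (ruc_action G T S act g)"
  unfolding unital_order_iso_def unital_linear_map_def
proof (intro conjI ballI allI)
  interpret group_action G A "ruc_action G T S act" by (rule ruc_action_group_action)
  show "bij_betw (ruc_action G T S act g) A A" using bij_prop0[OF g] by (simp add: Bij_def)
  show "ruc_action G T S act g \<in> A \<rightarrow> A" using g ruc_action_closed by blast
  show "ruc_action G T S act g \<one>\<^bsub>alg\<^esub> = \<one>\<^bsub>alg\<^esub>"
    using g ruc_const by (auto simp: ruc_algebra_def ruc_action_def intro!: restrict_ext)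
  fix f assume f: "f \<in> A"
  show "ruc_action G T S act g (c \<odot>\<^bsub>alg\<^esub> f) = c \<odot>\<^bsub>alg\<^esub> ruc_action G T S act g f" for c
    using f g ruc_smult[OF f] by (auto simp: ruc_algebra_def ruc_action_def intro!: restrict_ext)
  show "ruc_action G T S act g (f \<oplus>\<^bsub>alg\<^esub> f') = ruc_action G T S act g f \<oplus>\<^bsub>alg\<^esub> ruc_action G T S act g f'"
    if "f' \<in> A" for f'
    using f g ruc_add[OF f that] that by (auto simp: ruc_algebra_def ruc_action_def intro!: restrict_ext)
  show "cstar_nonneg alg f = cstar_nonneg alg (ruc_action G T S act g f)"
    unfolding cstar_nonneg_alg[OF f] cstar_nonneg_alg[OF ruc_action_closed[OF f g]]
  proof
    assume *: "\<forall>x\<in>S. ruc_action G T S act g f x \<in> \<real>\<^sub>\<ge>\<^sub>0"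
    show "\<forall>x\<in>S. f x \<in> \<real>\<^sub>\<ge>\<^sub>0"
    proof
      fix x assume x: "x \<in> S"
      have "ruc_action G T S act g f (act g x) = f x"
        using f g x by (simp add: ruc_action_apply flip: act_mult)
      then show "f x \<in> \<real>\<^sub>\<ge>\<^sub>0" using * g x act_closed by metis
    qed
  qed (use g f in \<open>simp add: ruc_action_apply\<close>)
qed

text \<open>Closure under pointwise limits is stronger than norm closure, and easier to check.\<close>

lemma function_system_algI:
  assumes E: "E \<subseteq> A" "(\<lambda>x\<in>S. 1) \<in> E"
    and add: "\<And>f g. f \<in> E \<Longrightarrow> g \<in> E \<Longrightarrow> (\<lambda>x\<in>S. f x + g x) \<in> E"
    and smult: "\<And>f c. f \<in> E \<Longrightarrow> (\<lambda>x\<in>S. c * f x) \<in> E"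
    and cnj: "\<And>f. f \<in> E \<Longrightarrow> (\<lambda>x\<in>S. cnj (f x)) \<in> E"
    and lim: "\<And>\<sigma> l. (\<And>n::nat. \<sigma> n \<in> E) \<Longrightarrow> l \<in> A \<Longrightarrow> (\<And>x. x \<in> S \<Longrightarrow> (\<lambda>n. \<sigma> n x) \<longlonglongrightarrow> l x) \<Longrightarrow> l \<in> E"
  shows "function_system alg E"
  unfolding function_system_def
proof (intro conjI ballI)
  show "submodule E complex_ring alg"
  proof (rule alg.submoduleI)
    show "E \<subseteq> carrier alg" using E by (simp add: carrier_alg)
    show "\<zero>\<^bsub>alg\<^esub> \<in> E" using smult[OF E(2), of 0] by (simp add: ruc_algebra_def cong: restrict_cong)
    show "a \<odot>\<^bsub>alg\<^esub> f \<in> E" if "f \<in> E" for a f using smult[OF that] by (simp add: ruc_algebra_def)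
    show "f \<oplus>\<^bsub>alg\<^esub> g \<in> E" if "f \<in> E" "g \<in> E" for f g using add[OF that] by (simp add: ruc_algebra_def)
    show "\<ominus>\<^bsub>alg\<^esub> f \<in> E" if f: "f \<in> E" for f
    proof -
      have fA: "f \<in> A" using f E by auto
      have "\<ominus>\<^bsub>alg\<^esub> f = \<zero>\<^bsub>alg\<^esub> \<ominus>\<^bsub>alg\<^esub> f"
        using fA alg.M.a_inv_closed[of f] by (simp add: alg.M.minus_eq alg.M.l_zero flip: carrier_alg)
      also have "\<dots> = (\<lambda>x\<in>S. -1 * f x)"
        using minus_alg[OF ruc_const[of 0] fA] by (simp add: ruc_algebra_def fun_eq_iff)
      finally show ?thesis using smult[OF f, of "-1"] by simp
    qed
  qed
  show "closedin alg.mtopology E"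
    unfolding alg.metric_closedin_iff_sequentially_closed
  proof (intro conjI allI impI)
    fix \<sigma> l assume *: "range \<sigma> \<subseteq> E \<and> limitin alg.mtopology \<sigma> l sequentially"
    then have l: "l \<in> A" and \<sigma>: "\<And>n. \<sigma> n \<in> E" by (auto simp: alg.limit_metric_sequentially simp flip: carrier_alg)
    have "(\<lambda>n. \<sigma> n x) \<longlonglongrightarrow> l x" if x: "x \<in> S" for x
    proof (rule LIMSEQ_I)
      fix \<epsilon> :: real assume "\<epsilon> > 0"
      then obtain N where N: "\<And>n. n \<ge> N \<Longrightarrow> cdist alg (\<sigma> n) l < \<epsilon>"
        using * unfolding alg.limit_metric_sequentially by meson
      have "cmod (\<sigma> n x - l x) < \<epsilon>" if "n \<ge> N" for n
        using cdist_alg_upper[of "\<sigma> n" l x] \<sigma>[of n] E(1) l x N[OF that] by (auto intro: order_le_less_trans)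
      then show "\<exists>N. \<forall>n\<ge>N. norm (\<sigma> n x - l x) < \<epsilon>" by blast
    qed
    then show "l \<in> E" by (rule lim[OF \<sigma> l])
  qed (use E in \<open>simp add: carrier_alg\<close>)
  show "\<one>\<^bsub>alg\<^esub> \<in> E" using E by (simp add: ruc_algebra_def)
  show "cstar alg f \<in> E" if "f \<in> E" for f using cnj[OF that] by (simp add: ruc_algebra_def)
qed (rule comm_cstar_algebra_alg)

lemma G_function_system_alg: "G_function_system G T alg A (ruc_action G T S act)"
  unfolding G_function_system_def continuous_action_def
proof (intro conjI ballI)
  show "function_system alg A"
    by (rule function_system_algI) (auto intro: ruc_const ruc_add ruc_smult ruc_cnj)
  have sub: "subtopology alg.mtopology A = alg.mtopology"
    by (metis topspace_alg(1) subtopology_topspace)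
  show "group_action G (topspace (subtopology alg.mtopology A)) (ruc_action G T S act)"
    unfolding sub topspace_alg(1) by (rule ruc_action_group_action)
  show "continuous_map (prod_topology T (subtopology alg.mtopology A)) (subtopology alg.mtopology A)
      (\<lambda>(g, f). ruc_action G T S act g f)"
    unfolding sub by (rule ruc_continuous_action)
qed (rule ruc_unital_order_iso)

end

section \<open>States and invariant means\<close>

context top_group_on_set
begin

lemma state_onD:
  assumes "state_on S A m"
  shows "m (\<lambda>x\<in>S. 1) = 1"
    and "\<lbrakk>f \<in> A; g \<in> A\<rbrakk> \<Longrightarrow> m (\<lambda>x\<in>S. f x + g x) = m f + m g"
    and "f \<in> A \<Longrightarrow> m (\<lambda>x\<in>S. c * f x) = c * m f"
    and "\<lbrakk>f \<in> A; \<And>x. x \<in> S \<Longrightarrow> f x \<in> \<real>\<^sub>\<ge>\<^sub>0\<rbrakk> \<Longrightarrow> m f \<in> \<real>\<^sub>\<ge>\<^sub>0"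
  using assms by (simp_all add: state_on_def)

lemma state_on_const:
  assumes "state_on S A m" shows "m (\<lambda>x\<in>S. c) = c"
  using state_onD(3)[OF assms ruc_const[of 1], of c] state_onD(1)[OF assms]
  by (simp cong: restrict_cong)

lemma state_on_mono:
  assumes m: "state_on S A m" and fg: "f \<in> A" "g \<in> A" and le: "\<And>x. x \<in> S \<Longrightarrow> g x - f x \<in> \<real>\<^sub>\<ge>\<^sub>0"
  shows "Re (m f) \<le> Re (m g)" "Im (m f) = Im (m g)"
proof -
  have 1: "(\<lambda>x\<in>S. -1 * f x) \<in> A" using fg by (intro ruc_smult)
  have 2: "(\<lambda>x\<in>S. g x + (\<lambda>x\<in>S. -1 * f x) x) \<in> A" using fg 1 by (intro ruc_add)
  have "m (\<lambda>x\<in>S. g x + (\<lambda>x\<in>S. -1 * f x) x) = m g + -1 * m f"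
    using state_onD(2)[OF m fg(2) 1] state_onD(3)[OF m fg(1), of "-1"] by simp
  moreover have "m (\<lambda>x\<in>S. g x + (\<lambda>x\<in>S. -1 * f x) x) \<in> \<real>\<^sub>\<ge>\<^sub>0"
    using le by (intro state_onD(4)[OF m 2]) simp
  ultimately have "m g - m f \<in> \<real>\<^sub>\<ge>\<^sub>0" by simp
  then show "Re (m f) \<le> Re (m g)" "Im (m f) = Im (m g)" by (auto simp: complex_nonneg_Reals_iff)
qed

lemma state_on_real_bound:
  assumes m: "state_on S A m" and f: "f \<in> A" and c: "\<And>x. x \<in> S \<Longrightarrow> f x \<in> \<real>" "\<And>x. x \<in> S \<Longrightarrow> cmod (f x) \<le> c"
  shows "cmod (m f) \<le> c"
proof -
  have b: "\<bar>Re (f x)\<bar> \<le> c \<and> Im (f x) = 0" if "x \<in> S" for x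
    using c[OF that] by (metis Reals_cases Im_complex_of_real Re_complex_of_real norm_of_real)
  have "Re (m f) \<le> Re (m (\<lambda>x\<in>S. complex_of_real c))" "Im (m f) = Im (m (\<lambda>x\<in>S. complex_of_real c))"
    using b by (intro state_on_mono[OF m f ruc_const]; force simp: complex_nonneg_Reals_iff)+
  moreover have "Re (m (\<lambda>x\<in>S. complex_of_real (- c))) \<le> Re (m f)"
    using b by (intro state_on_mono(1)[OF m ruc_const f]) (force simp: complex_nonneg_Reals_iff)
  ultimately have "\<bar>Re (m f)\<bar> \<le> c" "Im (m f) = 0" by (simp_all add: state_on_const[OF m])
  then show ?thesis by (simp add: cmod_def)
qed

text \<open>Splitting into real and imaginary parts costs a factor 2, which is harmless: the bound only
  serves for compactness and continuity.\<close>

lemma state_on_bound: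
  assumes m: "state_on S A m" and f: "f \<in> A" and c: "\<And>x. x \<in> S \<Longrightarrow> cmod (f x) \<le> c"
  shows "cmod (m f) \<le> 2 * c"
proof -
  define a where "a = (\<lambda>x\<in>S. complex_of_real (Re (f x)))"
  define b where "b = (\<lambda>x\<in>S. complex_of_real (Im (f x)))"
  have a: "a \<in> A" and b: "b \<in> A" using f by (auto simp: a_def b_def ruc_Re ruc_Im)
  have "cmod (m a) \<le> c" using order_trans[OF abs_Re_le_cmod c]
    by (intro state_on_real_bound[OF m a]) (simp_all add: a_def)
  moreover have "cmod (m b) \<le> c" using order_trans[OF abs_Im_le_cmod c]
    by (intro state_on_real_bound[OF m b]) (simp_all add: b_def)
  moreover have "f = (\<lambda>x\<in>S. a x + (\<lambda>x\<in>S. \<i> * b x) x)"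
    by (rule ruc_eqI[OF f ruc_add[OF a ruc_smult[OF b]]]) (simp add: a_def b_def complex_eq_iff)
  then have "m f = m a + \<i> * m b"
    using state_onD(2)[OF m a ruc_smult[OF b, of \<i>]] state_onD(3)[OF m b, of \<i>] by simp
  ultimately show ?thesis using norm_triangle_ineq[of "m a" "\<i> * m b"] by (simp add: norm_mult)
qed

end

abbreviation ruc_group :: "('a, 'm) monoid_scheme \<Rightarrow> 'a topology \<Rightarrow> ('a \<Rightarrow> complex) set" where
  "ruc_group G T \<equiv> ruc_on G T (carrier G) (mult G)"

text \<open>Right uniform continuity is invariant under the left translations \<open>x \<mapsto> g x\<close>, and these are the
  ones under which the mean is invariant.\<close>

definition invariant_mean :: "('a, 'm) monoid_scheme \<Rightarrow> 'a topology \<Rightarrow> (('a \<Rightarrow> complex) \<Rightarrow> complex) \<Rightarrow> bool" where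
  "invariant_mean G T m \<longleftrightarrow>
     state_on (carrier G) (ruc_group G T) m \<and>
     (\<forall>g \<in> carrier G. \<forall>f \<in> ruc_group G T. m (\<lambda>x\<in>carrier G. f (g \<otimes>\<^bsub>G\<^esub> x)) = m f)"

sublocale top_group \<subseteq> self: top_group_on_set G T "carrier G" "mult G"
  by unfold_locales (auto simp: m_assoc)

section \<open>From invariant means to fixed points of strongly proximal flows\<close>

lemma limitin_pullback_topology:
  "limitin (pullback_topology A f T) a z F \<longleftrightarrow>
     z \<in> A \<and> eventually (\<lambda>g. a g \<in> A) F \<and> limitin T (\<lambda>g. f (a g)) (f z) F"
proof
  assume l: "limitin (pullback_topology A f T) a z F"
  then have z: "z \<in> A" "f z \<in> topspace T" by (auto simp: limitin_def topspace_pullback_topology)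
  have "openin (pullback_topology A f T) (f -` topspace T \<inter> A)"
    unfolding openin_pullback_topology by blast
  then have "eventually (\<lambda>g. a g \<in> f -` topspace T \<inter> A) F" using l z unfolding limitin_def by blast
  then have "eventually (\<lambda>g. a g \<in> A) F" by (rule eventually_mono) simp
  moreover have "limitin T (\<lambda>g. f (a g)) (f z) F"
    unfolding limitin_def
  proof (intro conjI allI impI)
    fix U assume "openin T U \<and> f z \<in> U"
    moreover have "openin (pullback_topology A f T) (f -` U \<inter> A)" if "openin T U"
      unfolding openin_pullback_topology using that by blast
    ultimately have "eventually (\<lambda>g. a g \<in> f -` U \<inter> A) F" using l z unfolding limitin_def by blast
    then show "eventually (\<lambda>g. f (a g) \<in> U) F" by (rule eventually_mono) simp
  qed (rule z)
  ultimately show "z \<in> A \<and> eventually (\<lambda>g. a g \<in> A) F \<and> limitin T (\<lambda>g. f (a g)) (f z) F"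
    using z by simp
next
  assume r: "z \<in> A \<and> eventually (\<lambda>g. a g \<in> A) F \<and> limitin T (\<lambda>g. f (a g)) (f z) F"
  show "limitin (pullback_topology A f T) a z F"
    unfolding limitin_def
  proof (intro conjI allI impI)
    show "z \<in> topspace (pullback_topology A f T)"
      using r by (simp add: topspace_pullback_topology limitin_def)
    fix U assume U: "openin (pullback_topology A f T) U \<and> z \<in> U"
    then obtain V where V: "openin T V" "U = f -` V \<inter> A" by (auto simp: openin_pullback_topology)
    then have "eventually (\<lambda>g. f (a g) \<in> V) F" using r U by (simp add: limitin_def)
    then have "eventually (\<lambda>g. f (a g) \<in> V \<and> a g \<in> A) F" using r by (simp add: eventually_conj)
    then show "eventually (\<lambda>g. a g \<in> U) F" by (rule eventually_mono) (simp add: V)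
  qed
qed

lemma limitin_prob_topology:
  "limitin (prob_topology X) a z F \<longleftrightarrow>
     z \<in> regular_borel_prob_measures X \<and> eventually (\<lambda>g. a g \<in> regular_borel_prob_measures X) F \<and>
     (\<forall>f. continuous_map X euclideanreal f \<longrightarrow> ((\<lambda>g. \<integral>x. f x \<partial>(a g)) \<longlongrightarrow> (\<integral>x. f x \<partial>z)) F)"
  by (auto simp: prob_topology_def limitin_pullback_topology limitin_componentwise)

lemma topspace_prob_topology: "topspace (prob_topology X) = regular_borel_prob_measures X"
  by (auto simp: prob_topology_def topspace_pullback_topology)

lemma integral_return_borel_of:
  assumes "continuous_map X euclideanreal f" "x \<in> topspace X"
  shows "(\<integral>y. f y \<partial>(return (borel_of X) x)) = f x"
  using assms by (intro integral_return) (auto intro: continuous_map_measurable_borel_of)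

lemma compact_space_cluster_point:
  assumes X: "compact_space X" and F: "F \<noteq> bot" and a: "eventually (\<lambda>g. a g \<in> topspace X) F"
  obtains y where "y \<in> topspace X" "\<And>U. openin X U \<Longrightarrow> y \<in> U \<Longrightarrow> frequently (\<lambda>g. a g \<in> U) F"
proof (rule ccontr)
  assume "\<not> thesis"
  then have "\<forall>y\<in>topspace X. \<exists>U. openin X U \<and> y \<in> U \<and> eventually (\<lambda>g. a g \<notin> U) F"
    using that by (auto simp: frequently_def)
  then obtain U where U: "\<And>y. y \<in> topspace X \<Longrightarrow> openin X (U y)" "\<And>y. y \<in> topspace X \<Longrightarrow> y \<in> U y"
      "\<And>y. y \<in> topspace X \<Longrightarrow> eventually (\<lambda>g. a g \<notin> U y) F"
    by metis
  have "\<exists>\<F>. finite \<F> \<and> \<F> \<subseteq> U ` topspace X \<and> topspace X \<subseteq> \<Union>\<F>"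
    using X U unfolding compact_space_def by (intro compactinD[of X]) auto
  then obtain I where I: "finite I" "I \<subseteq> topspace X" "topspace X \<subseteq> \<Union>(U ` I)"
    by (metis finite_subset_image)
  have "eventually (\<lambda>g. \<forall>y\<in>I. a g \<notin> U y) F"
    using I U(3) by (intro eventually_ball_finite) auto
  then have "eventually (\<lambda>g. False) F" using a
    by eventually_elim (use I in auto)
  then show False using F by (simp add: eventually_False)
qed

lemma continuous_map_separates_points:
  assumes X: "compact_space X" "Hausdorff_space X" and xy: "x \<in> topspace X" "y \<in> topspace X"
    and eq: "\<And>f. continuous_map X euclideanreal f \<Longrightarrow> f x = f y"
  shows "x = y"
proof (rule ccontr)
  assume "x \<noteq> y"
  have "normal_space X" using X compact_Hausdorff_or_regular_imp_normal_space by blast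
  then obtain f where "continuous_map X (top_of_set {0..1::real}) f" "f ` {x} \<subseteq> {0}" "f ` {y} \<subseteq> {1}"
    using Urysohn_lemma[of X "{x}" "{y}" 0 1] X xy \<open>x \<noteq> y\<close>
    by (auto simp: closedin_Hausdorff_singleton)
  then show False using eq[of f] by (auto simp: continuous_map_in_subtopology)
qed

locale group_flow = top_group G T for G :: "('a, 'm) monoid_scheme" (structure) and T +
  fixes X :: "'x topology" and \<phi> :: "'a \<Rightarrow> 'x \<Rightarrow> 'x"
  assumes flow: "flow G T X \<phi>"
begin

lemma X: "compact_space X" "Hausdorff_space X" "topspace X \<noteq> {}"
  and continuous_act: "continuous_map (prod_topology T X) X (\<lambda>(g, x). \<phi> g x)"
  using flow by (simp_all add: flow_def continuous_action_def)

sublocale act: group_action G "topspace X" \<phi>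
  using flow by (simp add: flow_def continuous_action_def)

lemma act_closed: "\<lbrakk>g \<in> carrier G; x \<in> topspace X\<rbrakk> \<Longrightarrow> \<phi> g x \<in> topspace X"
  using act.element_image by blast

lemma act_one: "x \<in> topspace X \<Longrightarrow> \<phi> \<one> x = x"
  using act.id_eq_one by (metis restrict_apply')

lemma act_mult: "\<lbrakk>g \<in> carrier G; h \<in> carrier G; x \<in> topspace X\<rbrakk> \<Longrightarrow> \<phi> (g \<otimes> h) x = \<phi> g (\<phi> h x)"
  using act.composition_rule by blast

lemma continuous_act_left: "g \<in> carrier G \<Longrightarrow> continuous_map X X (\<phi> g)"
  using continuous_map_compose[OF continuous_map_pairedI continuous_act, of X "\<lambda>x. g" "\<lambda>x. x"]
  by (simp add: o_def topspace_eq)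

lemma homeomorphic_act: "g \<in> carrier G \<Longrightarrow> homeomorphic_map X X (\<phi> g)"
  unfolding homeomorphic_map_maps homeomorphic_maps_def
  by (rule exI[of _ "\<phi> (inv g)"])
     (simp add: continuous_act_left act_one flip: act_mult)

text \<open>By the tube lemma, compactness of \<open>X\<close> makes \<open>f (u y)\<close> close to \<open>f y\<close> uniformly in \<open>y\<close>, in
  particular along the orbit of \<open>x\<close>.\<close>

lemma orbit_function_ruc:
  assumes f: "continuous_map X euclideanreal f" and x: "x \<in> topspace X"
  shows "(\<lambda>g\<in>carrier G. complex_of_real (f (\<phi> g x))) \<in> ruc_group G T"
proof -
  have "compact (f ` topspace X)"
    using image_compactin[of X "topspace X" euclideanreal f] X f by (simp add: compact_space_def)
  then obtain M where M: "\<forall>y\<in>topspace X. \<bar>f y\<bar> \<le> M"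
    using compact_imp_bounded by (force simp: bounded_iff)
  show ?thesis
  proof (rule self.rucI[where M = M])
    fix \<epsilon> :: real assume \<epsilon>: "\<epsilon> > 0"
    define D where "D = (\<lambda>(g, y). f (\<phi> g y) - f y)"
    have "continuous_map (prod_topology T X) euclideanreal D"
    proof -
      have "continuous_map (prod_topology T X) euclideanreal (f \<circ> (\<lambda>(g, y). \<phi> g y))"
        using continuous_act f by (rule continuous_map_compose)
      moreover have "continuous_map (prod_topology T X) euclideanreal (f \<circ> snd)"
        using continuous_map_snd f by (rule continuous_map_compose)
      ultimately have "continuous_map (prod_topology T X) euclideanreal
          (\<lambda>p. (f \<circ> (\<lambda>(g, y). \<phi> g y)) p - (f \<circ> snd) p)"
        by (rule continuous_map_diff)
      then show ?thesis by (simp add: D_def case_prod_unfold)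
    qed
    then have W: "openin (prod_topology T X) {p \<in> topspace (prod_topology T X). D p \<in> {-\<epsilon><..<\<epsilon>}}"
      by (rule openin_continuous_map_preimage) simp
    have "{\<one>} \<times> topspace X \<subseteq> {p \<in> topspace (prod_topology T X). D p \<in> {-\<epsilon><..<\<epsilon>}}"
      using \<epsilon> by (auto simp: D_def topspace_eq act_one)
    moreover have "compactin X (topspace X)" using X by (simp add: compact_space_def)
    ultimately obtain U V where U: "openin T U" "\<one> \<in> U" "topspace X \<subseteq> V"
        "U \<times> V \<subseteq> {p \<in> topspace (prod_topology T X). D p \<in> {-\<epsilon><..<\<epsilon>}}"
      using tube_lemma_right[OF W, of "topspace X" \<one>] by (auto simp: topspace_eq)
    have "\<bar>f (\<phi> (u \<otimes> g) x) - f (\<phi> g x)\<bar> < \<epsilon>" if u: "u \<in> U" and g: "g \<in> carrier G" for u g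
    proof -
      have "\<phi> g x \<in> V" using U(3) act_closed[OF g x] by blast
      then have "(u, \<phi> g x) \<in> {p \<in> topspace (prod_topology T X). D p \<in> {-\<epsilon><..<\<epsilon>}}" using U(4) u by blast
      then show ?thesis
        using nhd_subset[OF U(1) u] g x by (auto simp: D_def act_mult abs_less_iff)
    qed
    then show "\<exists>U. openin T U \<and> \<one> \<in> U \<and> (\<forall>u\<in>U. \<forall>g\<in>carrier G.
        cmod ((\<lambda>g\<in>carrier G. complex_of_real (f (\<phi> g x))) (u \<otimes> g)
            - (\<lambda>g\<in>carrier G. complex_of_real (f (\<phi> g x))) g) < \<epsilon>)"
      using U nhd_subset by (intro exI[of _ U]) (auto simp flip: of_real_diff)
  qed (use M x act_closed in auto)
qed

lemma prob_action_apply: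
  assumes "\<mu> \<in> regular_borel_prob_measures X" "g \<in> carrier G"
  shows "prob_action X \<phi> g \<mu> \<in> regular_borel_prob_measures X"
    and "continuous_map X euclideanreal f \<Longrightarrow> (\<integral>x. f x \<partial>(prob_action X \<phi> g \<mu>)) = (\<integral>x. f (\<phi> g x) \<partial>\<mu>)"
proof -
  show "prob_action X \<phi> g \<mu> \<in> regular_borel_prob_measures X"
    using distr_regular[OF X(1,2) assms(1) homeomorphic_act[OF assms(2)]] assms(1)
    by (simp add: prob_action_def)
  have s: "sets \<mu> = sets (borel_of X)"
    using assms by (auto simp: regular_borel_prob_measures_def)
  have "\<phi> g \<in> measurable \<mu> (borel_of X)"
    using continuous_map_measurable_borel_of_borel_of[OF continuous_act_left[OF assms(2)]]
    by (simp add: measurable_cong_sets[OF s refl])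
  then show "(\<integral>x. f x \<partial>(prob_action X \<phi> g \<mu>)) = (\<integral>x. f (\<phi> g x) \<partial>\<mu>)" if "continuous_map X euclideanreal f"
    using assms(1) continuous_map_measurable_borel_of[OF that] by (simp add: prob_action_def integral_distr)
qed

text \<open>The mean and the orbit map of a point \<open>x0\<close> define an invariant functional \<open>L\<close> on the continuous
  functions, represented by a measure \<open>\<mu>\<close>. Strong proximality gives a filter along which the translates
  of \<open>\<mu>\<close> and of the point mass at \<open>x0\<close> have the same limit. Since the integrals against the translates
  of \<open>\<mu>\<close> are constantly \<open>L f\<close>, the values \<open>f (g x0)\<close> converge to \<open>L f\<close>. A cluster point \<open>y\<close> of the
  points \<open>g x0\<close> thus satisfies \<open>f y = L f\<close> for all \<open>f\<close>, and invariance of \<open>L\<close> makes it a fixed point.\<close>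

theorem fixed_point_of_invariant_mean:
  assumes m: "invariant_mean G T m" and sp: "strongly_proximal G X \<phi>"
  shows "\<exists>x \<in> topspace X. \<forall>g \<in> carrier G. \<phi> g x = x"
proof -
  obtain x0 where x0: "x0 \<in> topspace X" using X(3) by blast
  define orb where "orb f = (\<lambda>g\<in>carrier G. complex_of_real (f (\<phi> g x0)))" for f
  define L where "L f = Re (m (orb f))" for f
  have orb: "orb f \<in> ruc_group G T" if "continuous_map X euclideanreal f" for f
    unfolding orb_def using that x0 by (rule orbit_function_ruc)
  have st: "state_on (carrier G) (ruc_group G T) m" using m by (simp add: invariant_mean_def)
  have "state_on_compact X L"
  proof
    fix f g c assume f: "continuous_map X euclideanreal f"
    have "orb (\<lambda>x. c * f x) = (\<lambda>g\<in>carrier G. complex_of_real c * orb f g)"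
      by (auto simp: orb_def)
    then show "L (\<lambda>x. c * f x) = c * L f"
      using self.state_onD(3)[OF st orb[OF f], of "complex_of_real c"] by (simp add: L_def)
    show "0 \<le> L f" if "\<And>x. x \<in> topspace X \<Longrightarrow> 0 \<le> f x"
      using self.state_onD(4)[OF st orb[OF f]] that act_closed x0
      by (simp add: L_def orb_def complex_nonneg_Reals_iff)
    assume g: "continuous_map X euclideanreal g"
    have "orb (\<lambda>x. f x + g x) = (\<lambda>h\<in>carrier G. orb f h + orb g h)" by (auto simp: orb_def)
    then show "L (\<lambda>x. f x + g x) = L f + L g"
      using self.state_onD(2)[OF st orb[OF f] orb[OF g]] by (simp add: L_def)
  qed (use X self.state_onD(1)[OF st] in \<open>simp_all add: L_def orb_def\<close>)
  then obtain \<mu> where \<mu>: "\<mu> \<in> regular_borel_prob_measures X"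
      and int: "\<And>f. continuous_map X euclideanreal f \<Longrightarrow> (\<integral>x. f x \<partial>\<mu>) = L f"
    using Riesz_representation_compact by blast
  have L_inv: "L (\<lambda>x. f (\<phi> h x)) = L f" if f: "continuous_map X euclideanreal f" and h: "h \<in> carrier G" for f h
  proof -
    have "orb (\<lambda>x. f (\<phi> h x)) = (\<lambda>g\<in>carrier G. orb f (h \<otimes> g))"
      using h x0 by (auto simp: orb_def act_mult)
    then show ?thesis using m h orb[OF f] by (simp add: L_def invariant_mean_def)
  qed
  have cf: "continuous_map X euclideanreal (\<lambda>x. f (\<phi> h x))"
    if "continuous_map X euclideanreal f" "h \<in> carrier G" for f h
    using continuous_map_compose[OF continuous_act_left[OF that(2)] that(1)] by (simp add: o_def)
  let ?\<delta> = "return (borel_of X) x0"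
  have \<delta>: "?\<delta> \<in> regular_borel_prob_measures X" using X(1,2) x0 by (rule return_regular)
  obtain F z where F: "F \<noteq> bot" "eventually (\<lambda>g. g \<in> carrier G) F"
      "limitin (prob_topology X) (\<lambda>g. prob_action X \<phi> g \<mu>) z F"
      "limitin (prob_topology X) (\<lambda>g. prob_action X \<phi> g ?\<delta>) z F"
    using sp \<mu> \<delta> unfolding strongly_proximal_def proximal_def topspace_prob_topology by blast
  have lim: "((\<lambda>g. f (\<phi> g x0)) \<longlongrightarrow> L f) F" if f: "continuous_map X euclideanreal f" for f
  proof -
    have "((\<lambda>g. \<integral>x. f x \<partial>(prob_action X \<phi> g \<mu>)) \<longlongrightarrow> (\<integral>x. f x \<partial>z)) F"
      using F(3) f by (simp add: limitin_prob_topology)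
    moreover have "eventually (\<lambda>g. (\<integral>x. f x \<partial>(prob_action X \<phi> g \<mu>)) = L f) F"
      using F(2) by (rule eventually_mono) (simp add: prob_action_apply[OF \<mu>] f int cf L_inv)
    ultimately have "((\<lambda>g. L f) \<longlongrightarrow> (\<integral>x. f x \<partial>z)) F" by (simp add: tendsto_cong)
    then have z: "(\<integral>x. f x \<partial>z) = L f" using F(1) by (simp add: tendsto_const_iff)
    have "((\<lambda>g. \<integral>x. f x \<partial>(prob_action X \<phi> g ?\<delta>)) \<longlongrightarrow> (\<integral>x. f x \<partial>z)) F"
      using F(4) f by (simp add: limitin_prob_topology)
    moreover have "eventually (\<lambda>g. (\<integral>x. f x \<partial>(prob_action X \<phi> g ?\<delta>)) = f (\<phi> g x0)) F"
      using F(2) by (rule eventually_mono)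
        (simp add: prob_action_apply[OF \<delta>] f integral_return_borel_of[OF cf] x0)
    ultimately show ?thesis by (simp add: z tendsto_cong)
  qed
  have "eventually (\<lambda>g. \<phi> g x0 \<in> topspace X) F"
    using F(2) by (rule eventually_mono) (simp add: act_closed x0)
  then obtain y where y: "y \<in> topspace X"
      "\<And>U. openin X U \<Longrightarrow> y \<in> U \<Longrightarrow> frequently (\<lambda>g. \<phi> g x0 \<in> U) F"
    using compact_space_cluster_point[OF X(1) F(1), of "\<lambda>g. \<phi> g x0"] by blast
  have fy: "f y = L f" if f: "continuous_map X euclideanreal f" for f
  proof (rule ccontr)
    assume ne: "f y \<noteq> L f"
    define \<epsilon> where "\<epsilon> = \<bar>f y - L f\<bar> / 2"
    have \<epsilon>: "\<epsilon> > 0" using ne by (simp add: \<epsilon>_def)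
    have "openin X {x \<in> topspace X. f x \<in> ball (f y) \<epsilon>}"
      using f by (rule openin_continuous_map_preimage) simp
    then have "frequently (\<lambda>g. \<phi> g x0 \<in> {x \<in> topspace X. f x \<in> ball (f y) \<epsilon>}) F"
      using y(1) \<epsilon> by (intro y(2)) simp_all
    moreover have "eventually (\<lambda>g. dist (f (\<phi> g x0)) (L f) < \<epsilon>) F" using lim[OF f] \<epsilon> by (rule tendstoD)
    ultimately have "frequently (\<lambda>g. dist (f (\<phi> g x0)) (L f) < \<epsilon> \<and>
        \<phi> g x0 \<in> {x \<in> topspace X. f x \<in> ball (f y) \<epsilon>}) F"
      by (rule frequently_eventually_conj)
    then obtain g where "dist (f y) (f (\<phi> g x0)) < \<epsilon>" "dist (f (\<phi> g x0)) (L f) < \<epsilon>"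
      by (auto dest: frequently_ex)
    then show False
      using dist_triangle[of "f y" "L f" "f (\<phi> g x0)"] by (simp add: \<epsilon>_def dist_real_def)
  qed
  have "\<phi> g y = y" if g: "g \<in> carrier G" for g
  proof (rule continuous_map_separates_points[OF X(1,2) act_closed[OF g y(1)] y(1)])
    show "f (\<phi> g y) = f y" if f: "continuous_map X euclideanreal f" for f
      using fy[OF cf[OF f g]] fy[OF f] L_inv[OF f g] by simp
  qed
  then show ?thesis using y(1) by blast
qed

end

theorem amenable_of_invariant_mean:
  assumes "topological_group G T" "invariant_mean G T m"
  shows "amenable TYPE('x) G T"
  unfolding amenable_def
proof (intro allI impI)
  fix X :: "'x topology" and \<phi> assume *: "flow G T X \<phi> \<and> strongly_proximal G X \<phi>"
  interpret group_flow G T X \<phi> using assms * by unfold_locales auto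
  show "\<exists>x\<in>topspace X. \<forall>g\<in>carrier G. \<phi> g x = x"
    using assms * by (intro fixed_point_of_invariant_mean) auto
qed

section \<open>Compact convex sets for the topology of pointwise convergence\<close>

text \<open>Zorn's lemma, applied to the complements: the intersection of a chain of nonempty compact
  sets is nonempty and compact. It is used for affine subflows and for faces.\<close>

lemma minimal_compact_subset:
  assumes X: "Hausdorff_space X" and K: "compactin X K" "K \<noteq> {}" "P K"
    and Inter: "\<And>\<D>. \<D> \<noteq> {} \<Longrightarrow> (\<And>D. D \<in> \<D> \<Longrightarrow> P D) \<Longrightarrow> P (\<Inter>\<D>)"
  obtains M where "compactin X M" "M \<noteq> {}" "P M" "M \<subseteq> K"
    "\<And>N. compactin X N \<Longrightarrow> N \<noteq> {} \<Longrightarrow> P N \<Longrightarrow> N \<subseteq> M \<Longrightarrow> N = M"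
proof -
  define good where "good C \<longleftrightarrow> compactin X C \<and> C \<noteq> {} \<and> P C \<and> C \<subseteq> K" for C
  define \<A> where "\<A> = (\<lambda>C. topspace X - C) ` Collect good"
  have sub: "C \<subseteq> topspace X" if "good C" for C
    using that compactin_subset_topspace by (auto simp: good_def)
  have "\<exists>M\<in>\<A>. \<forall>Y\<in>\<A>. M \<subseteq> Y \<longrightarrow> Y = M"
  proof (rule subset_Zorn_nonempty)
    show "\<A> \<noteq> {}" using K by (auto simp: \<A>_def good_def)
    fix \<C> assume \<C>: "\<C> \<noteq> {}" "subset.chain \<A> \<C>"
    then have \<C>\<A>: "\<C> \<subseteq> \<A>" by (simp add: subset_chain_def)
    define \<D> where "\<D> = {C. good C \<and> topspace X - C \<in> \<C>}"
    have \<D>: "\<D> \<noteq> {}" "\<And>D. D \<in> \<D> \<Longrightarrow> good D" using \<C> \<C>\<A> by (auto simp: \<D>_def \<A>_def)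
    have open\<C>: "openin X U" if "U \<in> \<C>" for U
      using that \<C>\<A> X by (auto simp: \<A>_def good_def intro!: openin_diff compactin_imp_closedin)
    have "\<Inter>\<D> \<noteq> {}"
    proof
      assume "\<Inter>\<D> = {}"
      then have "K \<subseteq> \<Union>\<C>" using compactin_subset_topspace[OF K(1)] by (auto simp: \<D>_def)
      then obtain \<F> where \<F>: "finite \<F>" "\<F> \<subseteq> \<C>" "K \<subseteq> \<Union>\<F>"
        using compactinD[OF K(1), of \<C>] open\<C> by blast
      then have "\<F> \<noteq> {}" using K(2) by auto
      moreover have "subset.chain \<A> \<F>" using \<C>(2) \<F>(2) unfolding subset_chain_def by (meson subset_iff)
      ultimately have "\<Union>\<F> \<in> \<F>" using \<F>(1) by (intro Union_in_chain)
      then obtain C where C: "good C" "\<Union>\<F> = topspace X - C" using \<F>(2) \<C>\<A> by (auto simp: \<A>_def)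
      then show False using \<F>(3) by (auto simp: good_def)
    qed
    moreover have "compactin X (\<Inter>\<D>)"
    proof -
      obtain D where D: "D \<in> \<D>" using \<D>(1) by blast
      have "closedin X D'" if "D' \<in> \<D>" for D'
        using \<D>(2)[OF that] X by (auto simp: good_def intro: compactin_imp_closedin)
      then show ?thesis using closed_compactin_Inter[of X D \<D>] D \<D>(2)[OF D] by (simp add: good_def)
    qed
    moreover have "P (\<Inter>\<D>)" using \<D> by (intro Inter) (auto simp: good_def)
    moreover have "\<Inter>\<D> \<subseteq> K" using \<D> by (auto simp: good_def)
    ultimately have "good (\<Inter>\<D>)" by (simp add: good_def)
    moreover have "\<Union>\<C> = topspace X - \<Inter>\<D>"
    proof
      show "\<Union>\<C> \<subseteq> topspace X - \<Inter>\<D>"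
      proof
        fix x assume "x \<in> \<Union>\<C>"
        then obtain C where C: "good C" "topspace X - C \<in> \<C>" "x \<in> topspace X - C"
          using \<C>\<A> by (auto simp: \<A>_def)
        then have "C \<in> \<D>" by (simp add: \<D>_def)
        then show "x \<in> topspace X - \<Inter>\<D>" using C(3) by blast
      qed
    qed (auto simp: \<D>_def)
    ultimately show "\<Union>\<C> \<in> \<A>" by (auto simp: \<A>_def)
  qed
  then obtain M where M: "good M" "\<And>N. good N \<Longrightarrow> topspace X - M \<subseteq> topspace X - N \<Longrightarrow> topspace X - N = topspace X - M"
    by (auto simp: \<A>_def)
  have "N = M" if N: "compactin X N" "N \<noteq> {}" "P N" "N \<subseteq> M" for N
  proof -
    have gN: "good N" using N M(1) by (auto simp: good_def)
    then have "topspace X - N = topspace X - M" using N(4) by (intro M(2)) auto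
    then show ?thesis using sub[OF gN] sub[OF M(1)] by blast
  qed
  then show ?thesis using M(1) that by (auto simp: good_def)
qed

text \<open>Functionals on an index set \<open>I\<close> of functions are regarded as points of a product, so convexity is
  coordinatewise; the restriction keeps the result in the underlying set of the product topology.\<close>

definition convex_comb :: "'i set \<Rightarrow> real \<Rightarrow> ('i \<Rightarrow> complex) \<Rightarrow> ('i \<Rightarrow> complex) \<Rightarrow> ('i \<Rightarrow> complex)" where
  "convex_comb I t p q = (\<lambda>f\<in>I. complex_of_real (1 - t) * p f + complex_of_real t * q f)"

definition convex_in :: "'i set \<Rightarrow> ('i \<Rightarrow> complex) set \<Rightarrow> bool" where
  "convex_in I Q \<longleftrightarrow> (\<forall>p\<in>Q. \<forall>q\<in>Q. \<forall>t\<in>{0..1}. convex_comb I t p q \<in> Q)"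

definition extreme_in :: "'i set \<Rightarrow> ('i \<Rightarrow> complex) set \<Rightarrow> ('i \<Rightarrow> complex) \<Rightarrow> bool" where
  "extreme_in I Q e \<longleftrightarrow> e \<in> Q \<and>
     (\<forall>p\<in>Q. \<forall>q\<in>Q. \<forall>t. 0 < t \<longrightarrow> t < 1 \<longrightarrow> convex_comb I t p q = e \<longrightarrow> p = e \<and> q = e)"

abbreviation pointwise_topology :: "'i set \<Rightarrow> ('i \<Rightarrow> complex) topology" where
  "pointwise_topology I \<equiv> product_topology (\<lambda>_. euclidean) I"

lemma pointwise_topspace: "topspace (pointwise_topology I) = extensional I"
  by (auto simp: PiE_def)

lemma pointwise_Hausdorff: "Hausdorff_space (pointwise_topology I)"
  by (simp add: Hausdorff_space_product_topology)

lemma pointwise_compact_extensional: "compactin (pointwise_topology I) Q \<Longrightarrow> Q \<subseteq> extensional I"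
  using compactin_subset_topspace pointwise_topspace by metis

lemma pointwise_neighbourhood:
  assumes "openin (pointwise_topology I) U" "e \<in> U"
  obtains F V where "finite F" "F \<subseteq> I" "\<And>i. i \<in> F \<Longrightarrow> open (V i) \<and> e i \<in> V i"
    "\<And>p. p \<in> extensional I \<Longrightarrow> (\<And>i. i \<in> F \<Longrightarrow> p i \<in> V i) \<Longrightarrow> p \<in> U"
proof -
  obtain V where V: "finite {i \<in> I. V i \<noteq> UNIV}" "\<forall>i\<in>I. open (V i)" "e \<in> PiE I V" "PiE I V \<subseteq> U"
    using bspec[OF assms(1)[unfolded openin_product_topology_alt] assms(2)] by auto
  show ?thesis
  proof (rule that)
    show "finite {i \<in> I. V i \<noteq> UNIV}" by (rule V)
    show "p \<in> U" if "p \<in> extensional I" "\<And>i. i \<in> {i \<in> I. V i \<noteq> UNIV} \<Longrightarrow> p i \<in> V i" for p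
      using that by (intro subsetD[OF V(4)]) (auto simp: PiE_iff)
  qed (use V(2,3) in auto)
qed

lemma convex_comb_0: "p \<in> extensional I \<Longrightarrow> convex_comb I 0 p q = p"
  and convex_comb_1: "q \<in> extensional I \<Longrightarrow> convex_comb I 1 p q = q"
  by (auto simp: convex_comb_def extensional_def fun_eq_iff)

lemma convex_comb_apply: "f \<in> I \<Longrightarrow> convex_comb I t p q f = p f + complex_of_real t * (q f - p f)"
  by (simp add: convex_comb_def algebra_simps)

lemma convex_inD: "\<lbrakk>convex_in I Q; p \<in> Q; q \<in> Q; 0 \<le> t; t \<le> 1\<rbrakk> \<Longrightarrow> convex_comb I t p q \<in> Q"
  by (simp add: convex_in_def)

lemma continuous_map_linear_functional:
  fixes c :: "'i \<Rightarrow> complex"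
  assumes "finite F" "F \<subseteq> I"
  shows "continuous_map (pointwise_topology I) euclideanreal (\<lambda>p. Re (\<Sum>f\<in>F. c f * p f))"
proof -
  have pr: "continuous_map (pointwise_topology I) euclidean (\<lambda>p. p f)" if "f \<in> F" for f
    using continuous_map_product_projection[of f I "\<lambda>_. euclidean"] that assms by auto
  have *: "continuous_map (pointwise_topology I) euclideanreal (\<lambda>p. Re (c f * p f))"
    if "continuous_map (pointwise_topology I) euclidean (\<lambda>p. p f)" for f
  proof -
    have "continuous_on UNIV (\<lambda>z. Re (c f * z))" by (intro continuous_intros)
    then have "continuous_map euclidean euclideanreal (\<lambda>z. Re (c f * z))" by (simp del: times_complex.sel)
    then show ?thesis
      using continuous_map_compose[OF that, of euclideanreal "\<lambda>z. Re (c f * z)"] by (simp add: o_def del: times_complex.sel)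
  qed
  show ?thesis
    unfolding Re_sum using assms(1) by (intro continuous_map_sum * pr)
qed

lemma compactin_attains_min:
  assumes "compactin X K" "K \<noteq> {}" "continuous_map X euclideanreal h"
  obtains p where "p \<in> K" "\<And>q. q \<in> K \<Longrightarrow> h p \<le> h q"
proof -
  have "compact (h ` K)" using image_compactin[OF assms(1,3)] by simp
  then obtain s where "s \<in> h ` K" "\<forall>t \<in> h ` K. s \<le> t" using compact_attains_inf assms(2) by (metis image_is_empty)
  then show ?thesis using that by auto
qed

text \<open>Hahn-Banach separation in this setting is finite-dimensional: finitely many coordinates \<open>F\<close>
  already separate \<open>e\<close> from \<open>C\<close>. Minimise the Euclidean distance \<open>d\<close> to \<open>e\<close> in these coordinates over
  \<open>C\<close>; the inner product with the vector from \<open>e\<close> to the nearest point separates.\<close>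

lemma separate_point_from_compact_convex:
  assumes C: "compactin (pointwise_topology I) C" "convex_in I C" and e: "e \<in> extensional I" "e \<notin> C"
  obtains F c \<gamma> where "finite F" "F \<subseteq> I" "Re (\<Sum>f\<in>F. c f * e f) < \<gamma>"
    "\<And>p. p \<in> C \<Longrightarrow> \<gamma> \<le> Re (\<Sum>f\<in>F. c f * p f)"
proof (cases "C = {}")
  case True
  show ?thesis by (rule that[of "{}" "\<lambda>f. 0" 1]) (use True in auto)
next
  case False
  have "openin (pointwise_topology I) (topspace (pointwise_topology I) - C)"
    by (rule openin_diff[OF openin_topspace compactin_imp_closedin[OF pointwise_Hausdorff C(1)]])
  moreover have "e \<in> topspace (pointwise_topology I) - C" using e pointwise_topspace by blast
  ultimately obtain F V where F: "finite F" "F \<subseteq> I" and V: "\<And>i. i \<in> F \<Longrightarrow> open (V i) \<and> e i \<in> V i"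
      "\<And>p. p \<in> extensional I \<Longrightarrow> (\<And>i. i \<in> F \<Longrightarrow> p i \<in> V i) \<Longrightarrow> p \<in> topspace (pointwise_topology I) - C"
    by (rule pointwise_neighbourhood) blast
  have ne: "\<exists>f\<in>F. q f \<noteq> e f" if q: "q \<in> C" for q
  proof (rule ccontr)
    assume "\<not> (\<exists>f\<in>F. q f \<noteq> e f)"
    then have "q f \<in> V f" if "f \<in> F" for f using V(1)[OF that] that by metis
    then show False using V(2)[of q] q pointwise_compact_extensional[OF C(1)] by blast
  qed
  define d where "d p = (\<Sum>f\<in>F. (cmod (p f - e f))\<^sup>2)" for p
  have "continuous_map (pointwise_topology I) euclideanreal (\<lambda>p. (cmod (p f - e f))\<^sup>2)" if "f \<in> F" for f
    using continuous_map_compose[OF continuous_map_product_projection[of f I "\<lambda>_. euclidean"],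
        of euclideanreal "\<lambda>z. (cmod (z - e f))\<^sup>2"] that F
    by (auto simp: o_def intro!: continuous_intros)
  then have "continuous_map (pointwise_topology I) euclideanreal d"
    unfolding d_def using F(1) by (intro continuous_map_sum) auto
  then obtain p0 where p0: "p0 \<in> C" "\<And>q. q \<in> C \<Longrightarrow> d p0 \<le> d q"
    using compactin_attains_min[OF C(1) False] by blast
  define c where "c f = cnj (p0 f - e f)" for f
  have gap: "Re (\<Sum>f\<in>F. c f * p0 f) = Re (\<Sum>f\<in>F. c f * e f) + d p0"
  proof -
    have "Re (c f * p0 f) = Re (c f * e f) + (cmod (p0 f - e f))\<^sup>2" for f
      unfolding cmod_power2 by (simp add: c_def power2_eq_square algebra_simps)
    then show ?thesis unfolding Re_sum d_def by (simp add: sum.distrib del: times_complex.sel)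
  qed
  have "Re (\<Sum>f\<in>F. c f * p0 f) \<le> Re (\<Sum>f\<in>F. c f * q f)" if q: "q \<in> C" for q
  proof (rule ccontr)
    define a where "a = Re (\<Sum>f\<in>F. c f * (q f - p0 f))"
    define b where "b = (\<Sum>f\<in>F. (cmod (q f - p0 f))\<^sup>2)"
    assume "\<not> Re (\<Sum>f\<in>F. c f * p0 f) \<le> Re (\<Sum>f\<in>F. c f * q f)"
    then have a: "a < 0" by (simp add: a_def algebra_simps sum_subtractf)
    have b: "b \<ge> 0" by (simp add: b_def sum_nonneg)
    have expand: "d (convex_comb I t p0 q) = d p0 + 2 * t * a + t\<^sup>2 * b" for t
    proof -
      have "(cmod (convex_comb I t p0 q f - e f))\<^sup>2
          = (cmod (p0 f - e f))\<^sup>2 + 2 * t * Re (c f * (q f - p0 f)) + t\<^sup>2 * (cmod (q f - p0 f))\<^sup>2"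
        if "f \<in> F" for f
      proof -
        have "f \<in> I" using that F by auto
        then show ?thesis
          unfolding convex_comb_apply[OF \<open>f \<in> I\<close>] c_def cmod_power2
          by (simp add: power2_eq_square algebra_simps)
      qed
      then show ?thesis by (simp add: d_def a_def b_def sum.distrib sum_distrib_left Re_sum)
    qed
    \<comment> \<open>a step towards \<open>q\<close> short enough for the linear term to dominate\<close>
    define t where "t = min 1 (- a / (b + 1))"
    have t: "0 < t" "t \<le> 1" using a b by (auto simp: t_def divide_neg_pos)
    have "t \<le> - a / (b + 1)" by (simp add: t_def)
    then have "t * (b + 1) \<le> - a" using b by (subst (asm) pos_le_divide_eq) auto
    then have "2 * a + t * b < 0" using a t unfolding distrib_left by linarith
    then have "t * (2 * a + t * b) < 0" using t by (simp add: mult_less_0_iff)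
    then have "d (convex_comb I t p0 q) < d p0"
      unfolding expand by (simp add: power2_eq_square algebra_simps)
    moreover have "convex_comb I t p0 q \<in> C" using C(2) p0(1) q t by (intro convex_inD) auto
    ultimately show False using p0(2) by force
  qed
  moreover have "d p0 > 0"
  proof -
    obtain f where f: "f \<in> F" "p0 f \<noteq> e f" using ne[OF p0(1)] by blast
    then show ?thesis unfolding d_def using F(1) by (intro sum_pos2[of F f]) auto
  qed
  ultimately show ?thesis using gap F by (intro that[of F c "Re (\<Sum>f\<in>F. c f * p0 f)"]) auto
qed

lemma convex_weighted:
  assumes C: "convex_in I C" "C \<subseteq> extensional I" and p: "p \<in> C" "q \<in> C" and ab: "0 \<le> a" "0 \<le> b"
  obtains r where "r \<in> C" "\<And>f. f \<in> I \<Longrightarrow>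
    complex_of_real a * p f + complex_of_real b * q f = complex_of_real (a + b) * r f"
proof (cases "a + b = 0")
  case True
  then have "a = 0" "b = 0" using ab by auto
  then show ?thesis using that[of p] p by simp
next
  case False
  define t where "t = b / (a + b)"
  have t: "0 \<le> t" "t \<le> 1" using ab False by (auto simp: t_def)
  have eq: "(a + b) * t = b" "(a + b) * (1 - t) = a" using False by (simp_all add: t_def field_simps)
  show ?thesis
  proof (rule that)
    show "convex_comb I t p q \<in> C" using C p t by (intro convex_inD)
    show "complex_of_real a * p f + complex_of_real b * q f = complex_of_real (a + b) * convex_comb I t p q f"
      if "f \<in> I" for f
    proof -
      have "complex_of_real (a + b) * convex_comb I t p q f
          = complex_of_real ((a + b) * (1 - t)) * p f + complex_of_real ((a + b) * t) * q f"
        using that by (simp add: convex_comb_def algebra_simps)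
      then show ?thesis unfolding eq by simp
    qed
  qed
qed

text \<open>The convex hull of the union of two compact convex sets is the image of a compact set under a
  continuous map. The next lemma needs this explicit form of its points.\<close>

lemma compact_convex_join:
  fixes C D :: "('i \<Rightarrow> complex) set"
  assumes C: "compactin (pointwise_topology I) C" "convex_in I C"
    and D: "compactin (pointwise_topology I) D" "convex_in I D"
  defines "J \<equiv> (\<lambda>(t, p, q). convex_comb I t p q) ` ({0..1} \<times> C \<times> D)"
  shows "compactin (pointwise_topology I) J" "convex_in I J"
proof -
  let ?P = "prod_topology euclideanreal (prod_topology (pointwise_topology I) (pointwise_topology I))"
  have "compactin ?P ({0..1} \<times> C \<times> D)" using C D by (simp add: compactin_Times)
  moreover have "continuous_map ?P (pointwise_topology I) (\<lambda>(t, p, q). convex_comb I t p q)"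
    unfolding continuous_map_componentwise
  proof (intro conjI ballI)
    show "(\<lambda>(t, p, q). convex_comb I t p q) ` topspace ?P \<subseteq> extensional I"
      by (auto simp: convex_comb_def)
    fix f assume f: "f \<in> I"
    have 1: "continuous_map ?P euclidean (\<lambda>x. fst x)" by (rule continuous_map_fst)
    have pr: "continuous_map (pointwise_topology I) euclidean (\<lambda>p. p f)"
      using continuous_map_product_projection[of f I "\<lambda>_. euclidean"] f by simp
    have 2: "continuous_map ?P euclidean (\<lambda>x. fst (snd x) f)" "continuous_map ?P euclidean (\<lambda>x. snd (snd x) f)"
      using continuous_map_compose[OF continuous_map_compose[OF continuous_map_snd continuous_map_fst] pr]
        continuous_map_compose[OF continuous_map_compose[OF continuous_map_snd continuous_map_snd] pr]
      by (simp_all add: o_def)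
    have 3: "continuous_map ?P euclidean (\<lambda>x. (fst x, fst (snd x) f, snd (snd x) f))"
      using continuous_map_pairedI[OF 1 continuous_map_pairedI[OF 2]] by (simp add: euclidean_product_topology)
    have "continuous_map ?P euclidean
       ((\<lambda>(t, a, b). complex_of_real (1 - t) * a + complex_of_real t * b) \<circ> (\<lambda>x. (fst x, fst (snd x) f, snd (snd x) f)))"
      using 3 by (rule continuous_map_compose) (auto simp: case_prod_unfold intro!: continuous_intros)
    then show "continuous_map ?P euclidean (\<lambda>x. (case x of (t, p, q) \<Rightarrow> convex_comb I t p q) f)"
      using f by (simp add: convex_comb_def case_prod_unfold o_def)
  qed
  ultimately show "compactin (pointwise_topology I) J" unfolding J_def by (rule image_compactin)
  show "convex_in I J"
    unfolding convex_in_def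
  proof (intro ballI)
    fix x y s assume "x \<in> J" "y \<in> J" and s: "s \<in> {0..1::real}"
    then obtain t p q t' p' q' where x: "x = convex_comb I t p q" "t \<in> {0..1}" "p \<in> C" "q \<in> D"
        and y: "y = convex_comb I t' p' q'" "t' \<in> {0..1}" "p' \<in> C" "q' \<in> D"
      by (auto simp: J_def)
    obtain r where r: "r \<in> C" "\<And>f. f \<in> I \<Longrightarrow> complex_of_real ((1-s)*(1-t)) * p f + complex_of_real (s*(1-t')) * p' f
         = complex_of_real ((1-s)*(1-t) + s*(1-t')) * r f"
      using convex_weighted[OF C(2) pointwise_compact_extensional[OF C(1)] x(3) y(3), of "(1-s)*(1-t)" "s*(1-t')"] s x(2) y(2)
      by auto
    obtain r' where r': "r' \<in> D" "\<And>f. f \<in> I \<Longrightarrow> complex_of_real ((1-s)*t) * q f + complex_of_real (s*t') * q' f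
         = complex_of_real ((1-s)*t + s*t') * r' f"
      using convex_weighted[OF D(2) pointwise_compact_extensional[OF D(1)] x(4) y(4), of "(1-s)*t" "s*t'"] s x(2) y(2)
      by auto
    have w: "1 - ((1-s)*t + s*t') = (1-s)*(1-t) + s*(1-t')" by (simp add: algebra_simps)
    have "0 \<le> (1-s)*t + s*t'" using s x(2) y(2) by auto
    moreover have "0 \<le> (1-s)*(1-t) + s*(1-t')" using s x(2) y(2) by (intro add_nonneg_nonneg mult_nonneg_nonneg) auto
    ultimately have "(1-s)*t + s*t' \<in> {0..1}" using w by auto
    moreover have "convex_comb I s x y = convex_comb I ((1-s)*t + s*t') r r'"
    proof
      fix f show "convex_comb I s x y f = convex_comb I ((1-s)*t + s*t') r r' f"
      proof (cases "f \<in> I")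
        case True
        have "convex_comb I s x y f = (complex_of_real ((1-s)*(1-t)) * p f + complex_of_real (s*(1-t')) * p' f)
            + (complex_of_real ((1-s)*t) * q f + complex_of_real (s*t') * q' f)"
          using True by (simp add: x(1) y(1) convex_comb_def algebra_simps)
        also have "\<dots> = convex_comb I ((1-s)*t + s*t') r r' f"
          unfolding r(2)[OF True] r'(2)[OF True] using True by (simp add: convex_comb_def w)
        finally show ?thesis .
      qed (simp add: convex_comb_def)
    qed
    ultimately show "convex_comb I s x y \<in> J" using r(1) r'(1) by (force simp: J_def)
  qed
qed

text \<open>An extreme point outside two convex sets is also outside their join, since it would otherwise
  lie in the interior of a segment. So finitely many compact convex sets that miss \<open>e\<close> are contained
  in a single one.\<close>

lemma extreme_cover:
  assumes Q: "convex_in I Q" "Q \<subseteq> extensional I" and e: "extreme_in I Q e"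
    and "finite \<K>" "\<And>K. K \<in> \<K> \<Longrightarrow> compactin (pointwise_topology I) K \<and> convex_in I K \<and> K \<subseteq> Q \<and> e \<notin> K"
  shows "\<exists>C. compactin (pointwise_topology I) C \<and> convex_in I C \<and> C \<subseteq> Q \<and> e \<notin> C \<and> \<Union>\<K> \<subseteq> C"
  using assms(4,5)
proof (induction \<K> rule: finite_induct)
  case empty
  show ?case by (rule exI[of _ "{}"]) (simp add: convex_in_def)
next
  case (insert K \<K>)
  then obtain C where C: "compactin (pointwise_topology I) C" "convex_in I C" "C \<subseteq> Q" "e \<notin> C" "\<Union>\<K> \<subseteq> C" by auto
  have K: "compactin (pointwise_topology I) K" "convex_in I K" "K \<subseteq> Q" "e \<notin> K" using insert.prems by auto
  show ?case
  proof (cases "C = {} \<or> K = {}")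
    case True
    then show ?thesis using C K by (elim disjE) (rule exI[of _ K], force, rule exI[of _ C], force)
  next
    case False
    define J where "J = (\<lambda>(t, p, q). convex_comb I t p q) ` ({0..1} \<times> C \<times> K)"
    have J: "compactin (pointwise_topology I) J" "convex_in I J"
      unfolding J_def using compact_convex_join[OF C(1,2) K(1,2)] by auto
    have JQ: "J \<subseteq> Q" using C(3) K(3) Q(1) by (auto simp: J_def intro!: convex_inD)
    have "e \<notin> J"
    proof
      assume "e \<in> J"
      then obtain t p q where tpq: "e = convex_comb I t p q" "0 \<le> t" "t \<le> 1" "p \<in> C" "q \<in> K" by (auto simp: J_def)
      have ext: "p \<in> extensional I" "q \<in> extensional I" using tpq(4,5) C(3) K(3) Q(2) by auto
      have "t \<noteq> 0" using tpq ext C(4) convex_comb_0 by metis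
      moreover have "t \<noteq> 1" using tpq ext K(4) convex_comb_1 by metis
      ultimately have "0 < t" "t < 1" using tpq by auto
      then have "p = e" using e tpq C(3) K(3) unfolding extreme_in_def by blast
      then show False using tpq(4) C(4) by simp
    qed
    moreover have "C \<subseteq> J"
    proof
      fix p assume p: "p \<in> C"
      obtain q where "q \<in> K" using False by blast
      then have "convex_comb I 0 p q \<in> J" using p unfolding J_def by (intro image_eqI[of _ _ "(0, p, q)"]) auto
      then show "p \<in> J" using convex_comb_0[of p I q] p C(3) Q(2) by (metis subsetD)
    qed
    moreover have "K \<subseteq> J"
    proof
      fix q assume q: "q \<in> K"
      obtain p where "p \<in> C" using False by blast
      then have "convex_comb I 1 p q \<in> J" using q unfolding J_def by (intro image_eqI[of _ _ "(1, p, q)"]) auto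
      then show "q \<in> J" using convex_comb_1[of q I p] q K(3) Q(2) by (metis subsetD)
    qed
    ultimately show ?thesis using J JQ C(5) by (intro exI[of _ J]) auto
  qed
qed

lemma half_space:
  assumes Q: "compactin (pointwise_topology I) Q" "convex_in I Q" and F: "finite F" "F \<subseteq> I"
  shows "compactin (pointwise_topology I) {p \<in> Q. \<gamma> \<le> Re (\<Sum>f\<in>F. c f * p f)}"
    and "convex_in I {p \<in> Q. \<gamma> \<le> Re (\<Sum>f\<in>F. c f * p f)}"
proof -
  have "closedin (pointwise_topology I) {p \<in> topspace (pointwise_topology I). Re (\<Sum>f\<in>F. c f * p f) \<in> {\<gamma>..}}"
    using continuous_map_linear_functional[OF F] by (rule closedin_continuous_map_preimage) simp
  then have "compactin (pointwise_topology I) (Q \<inter> {p \<in> topspace (pointwise_topology I). Re (\<Sum>f\<in>F. c f * p f) \<in> {\<gamma>..}})"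
    using Q(1) compact_Int_closedin by blast
  moreover have "Q \<inter> {p \<in> topspace (pointwise_topology I). Re (\<Sum>f\<in>F. c f * p f) \<in> {\<gamma>..}}
      = {p \<in> Q. \<gamma> \<le> Re (\<Sum>f\<in>F. c f * p f)}"
    using compactin_subset_topspace[OF Q(1)] by auto
  ultimately show "compactin (pointwise_topology I) {p \<in> Q. \<gamma> \<le> Re (\<Sum>f\<in>F. c f * p f)}" by simp
  have lin: "Re (\<Sum>f\<in>F. c f * convex_comb I t p q f)
      = (1 - t) * Re (\<Sum>f\<in>F. c f * p f) + t * Re (\<Sum>f\<in>F. c f * q f)" for t p q
  proof -
    have "(\<Sum>f\<in>F. c f * convex_comb I t p q f)
        = (\<Sum>f\<in>F. complex_of_real (1 - t) * (c f * p f) + complex_of_real t * (c f * q f))"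
      using F(2) by (intro sum.cong) (auto simp: convex_comb_def algebra_simps)
    then show ?thesis by (simp add: sum.distrib flip: sum_distrib_left)
  qed
  show "convex_in I {p \<in> Q. \<gamma> \<le> Re (\<Sum>f\<in>F. c f * p f)}"
    unfolding convex_in_def
  proof (intro ballI)
    fix p q t assume p: "p \<in> {p \<in> Q. \<gamma> \<le> Re (\<Sum>f\<in>F. c f * p f)}" and q: "q \<in> {p \<in> Q. \<gamma> \<le> Re (\<Sum>f\<in>F. c f * p f)}"
      and t: "t \<in> {0..1::real}"
    have "(1 - t) * \<gamma> + t * \<gamma> \<le> (1 - t) * Re (\<Sum>f\<in>F. c f * p f) + t * Re (\<Sum>f\<in>F. c f * q f)"
      using p q t by (intro add_mono mult_left_mono) auto
    then show "convex_comb I t p q \<in> {p \<in> Q. \<gamma> \<le> Re (\<Sum>f\<in>F. c f * p f)}"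
      using p q t convex_inD[OF Q(2), of p q t] by (simp add: lin algebra_simps del: times_complex.sel Re_sum)
  qed
qed

text \<open>A version of Milman's theorem: the part of \<open>Q\<close> outside a neighbourhood of \<open>e\<close> is covered by
  finitely many half-spaces that miss \<open>e\<close>, hence is contained in a compact convex set that misses \<open>e\<close>.\<close>

lemma extreme_point_neighbourhood:
  assumes Q: "compactin (pointwise_topology I) Q" "convex_in I Q" and e: "extreme_in I Q e"
    and U: "openin (pointwise_topology I) U" "e \<in> U"
  shows "\<exists>C. compactin (pointwise_topology I) C \<and> convex_in I C \<and> C \<subseteq> Q \<and> e \<notin> C \<and> Q - U \<subseteq> C"
proof -
  have Qx: "Q \<subseteq> extensional I" using Q(1) by (rule pointwise_compact_extensional)
  obtain F V where F: "finite F" "F \<subseteq> I" and V: "\<And>i. i \<in> F \<Longrightarrow> open (V i) \<and> e i \<in> V i"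
      "\<And>p. p \<in> extensional I \<Longrightarrow> (\<And>i. i \<in> F \<Longrightarrow> p i \<in> V i) \<Longrightarrow> p \<in> U"
    using U by (rule pointwise_neighbourhood) blast
  have "\<exists>\<delta>>0. ball (e f) \<delta> \<subseteq> V f" if "f \<in> F" for f
    using V(1)[OF that] open_contains_ball by blast
  then obtain \<delta> where \<delta>: "\<And>f. f \<in> F \<Longrightarrow> \<delta> f > 0" "\<And>f. f \<in> F \<Longrightarrow> ball (e f) (\<delta> f) \<subseteq> V f" by metis
  \<comment> \<open>multiplying by \<open>1, -1, \<i>, -\<i>\<close> bounds the real and the imaginary part from both sides;
    one of the two parts is at least \<open>\<delta> f / 2\<close> if the modulus is at least \<open>\<delta> f\<close>\<close>
  define H where "H f \<rho> = {p \<in> Q. Re (\<rho> * e f) + \<delta> f / 2 \<le> Re (\<rho> * p f)}" for f \<rho>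
  define \<K> where "\<K> = (\<lambda>(f, \<rho>). H f \<rho>) ` (F \<times> {1, -1, \<i>, -\<i>})"
  have "\<exists>C. compactin (pointwise_topology I) C \<and> convex_in I C \<and> C \<subseteq> Q \<and> e \<notin> C \<and> \<Union>\<K> \<subseteq> C"
  proof (rule extreme_cover[OF Q(2) Qx e])
    show "finite \<K>" using F by (simp add: \<K>_def)
    fix K assume "K \<in> \<K>"
    then obtain f \<rho> where K: "K = H f \<rho>" "f \<in> F" by (auto simp: \<K>_def)
    then show "compactin (pointwise_topology I) K \<and> convex_in I K \<and> K \<subseteq> Q \<and> e \<notin> K"
      using half_space[OF Q, of "{f}" "Re (\<rho> * e f) + \<delta> f / 2" "\<lambda>f. \<rho>"] F(2) \<delta>(1)[OF K(2)] by (auto simp: H_def)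
  qed
  moreover have "Q - U \<subseteq> \<Union>\<K>"
  proof
    fix p assume p: "p \<in> Q - U"
    have "\<exists>f\<in>F. p f \<notin> V f" using V(2)[of p] p Qx by blast
    then obtain f where f: "f \<in> F" "p f \<notin> V f" by blast
    then have "\<delta> f \<le> cmod (p f - e f)" using \<delta>(2)[OF f(1)] by (force simp: dist_norm norm_minus_commute)
    also have "\<dots> \<le> \<bar>Re (p f - e f)\<bar> + \<bar>Im (p f - e f)\<bar>" by (rule cmod_le)
    finally have "\<delta> f / 2 \<le> \<bar>Re (p f - e f)\<bar> \<or> \<delta> f / 2 \<le> \<bar>Im (p f - e f)\<bar>" by linarith
    then have "p \<in> H f 1 \<or> p \<in> H f (-1) \<or> p \<in> H f \<i> \<or> p \<in> H f (-\<i>)" using p by (auto simp: H_def abs_if split: if_splits)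
    then show "p \<in> \<Union>\<K>" using f(1) by (auto simp: \<K>_def)
  qed
  ultimately show ?thesis by blast
qed

text \<open>The argument of Krein and Milman: a minimal closed face is a single point, because otherwise
  the points at which some coordinate functional attains its minimum form a smaller face.\<close>

lemma extreme_point_exists:
  assumes Q: "compactin (pointwise_topology I) Q" "Q \<noteq> {}"
  obtains e where "extreme_in I Q e"
proof -
  \<comment> \<open>faces in this sense are stable under intersection, and those that are single points are the extreme points\<close>
  define face where "face M \<longleftrightarrow> (\<forall>p\<in>Q. \<forall>q\<in>Q. \<forall>t. 0 < t \<longrightarrow> t < 1 \<longrightarrow> convex_comb I t p q \<in> M \<longrightarrow> p \<in> M \<and> q \<in> M)" for M
  have 1: "face Q" by (simp add: face_def)
  have 2: "face (\<Inter>\<D>)" if "\<And>D. D \<in> \<D> \<Longrightarrow> face D" for \<D>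
    using that unfolding face_def by fast
  obtain M where M: "compactin (pointwise_topology I) M" "M \<noteq> {}" "face M" "M \<subseteq> Q"
      "\<And>N. compactin (pointwise_topology I) N \<Longrightarrow> N \<noteq> {} \<Longrightarrow> face N \<Longrightarrow> N \<subseteq> M \<Longrightarrow> N = M"
    using minimal_compact_subset[where P = face, OF pointwise_Hausdorff Q 1 2] by metis
  obtain e where e: "e \<in> M" using M(2) by blast
  have "p = e" if p: "p \<in> M" for p
  proof (rule ccontr)
    assume "p \<noteq> e"
    have "p \<in> extensional I" "e \<in> extensional I"
      using p e pointwise_compact_extensional[OF M(1)] by auto
    then obtain f where f: "f \<in> I" "p f \<noteq> e f" using \<open>p \<noteq> e\<close> by (meson extensionalityI)
    then have "Re (p f) \<noteq> Re (e f) \<or> Re (\<i> * p f) \<noteq> Re (\<i> * e f)" by (auto simp: complex_eq_iff)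
    then obtain \<rho> where \<rho>: "Re (\<rho> * p f) \<noteq> Re (\<rho> * e f)" by (metis mult_1)
    have cont: "continuous_map (pointwise_topology I) euclideanreal (\<lambda>q. Re (\<rho> * q f))"
      using continuous_map_linear_functional[of "{f}" I "\<lambda>_. \<rho>"] f(1) by simp
    then obtain m where m: "m \<in> M" "\<And>q. q \<in> M \<Longrightarrow> Re (\<rho> * m f) \<le> Re (\<rho> * q f)"
      using compactin_attains_min[OF M(1,2)] by blast
    define N where "N = {q \<in> M. Re (\<rho> * q f) = Re (\<rho> * m f)}"
    have "closedin (pointwise_topology I) {q \<in> topspace (pointwise_topology I). Re (\<rho> * q f) \<in> {Re (\<rho> * m f)}}"
      using cont by (rule closedin_continuous_map_preimage) simp
    then have "compactin (pointwise_topology I) (M \<inter> {q \<in> topspace (pointwise_topology I). Re (\<rho> * q f) \<in> {Re (\<rho> * m f)}})"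
      using M(1) compact_Int_closedin by blast
    moreover have "M \<inter> {q \<in> topspace (pointwise_topology I). Re (\<rho> * q f) \<in> {Re (\<rho> * m f)}} = N"
      using compactin_subset_topspace[OF M(1)] by (auto simp: N_def)
    ultimately have "compactin (pointwise_topology I) N" by simp
    moreover have "face N"
      unfolding face_def
    proof (intro ballI allI impI)
      fix q r t assume qr: "q \<in> Q" "r \<in> Q" and t: "0 < t" "t < (1::real)" and N: "convex_comb I t q r \<in> N"
      then have qM: "q \<in> M" "r \<in> M" using M(3) unfolding face_def N_def by blast+
      have "Re (\<rho> * convex_comb I t q r f) = (1 - t) * Re (\<rho> * q f) + t * Re (\<rho> * r f)"
        using f(1) by (simp add: convex_comb_def algebra_simps)
      then have eq: "(1 - t) * (Re (\<rho> * q f) - Re (\<rho> * m f)) + t * (Re (\<rho> * r f) - Re (\<rho> * m f)) = 0"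
        using N by (simp add: N_def algebra_simps)
      have "0 \<le> (1 - t) * (Re (\<rho> * q f) - Re (\<rho> * m f))" "0 \<le> t * (Re (\<rho> * r f) - Re (\<rho> * m f))"
        using m(2)[OF qM(1)] m(2)[OF qM(2)] t by (simp_all del: times_complex.sel)
      then have "(1 - t) * (Re (\<rho> * q f) - Re (\<rho> * m f)) = 0" "t * (Re (\<rho> * r f) - Re (\<rho> * m f)) = 0"
        using eq by linarith+
      then show "q \<in> N \<and> r \<in> N" using t qM by (simp add: N_def del: times_complex.sel)
    qed
    moreover have "m \<in> N" "N \<subseteq> M" using m by (auto simp: N_def)
    ultimately have "N = M" using M(5) by blast
    then have "p \<in> N" "e \<in> N" using p e by auto
    then show False using \<rho> by (simp add: N_def del: times_complex.sel)
  qed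
  then have "M = {e}" using e by blast
  then have "extreme_in I Q e" using M(3,4) unfolding extreme_in_def face_def by simp
  then show ?thesis by (rule that)
qed

section \<open>The affine flow of states\<close>

context top_group
begin

abbreviation RG :: "('a \<Rightarrow> complex) set" where
  "RG \<equiv> ruc_group G T"

definition left_shift :: "'a \<Rightarrow> ('a \<Rightarrow> complex) \<Rightarrow> ('a \<Rightarrow> complex)" where
  "left_shift g f = (\<lambda>x\<in>carrier G. f (g \<otimes> x))"

definition states :: "(('a \<Rightarrow> complex) \<Rightarrow> complex) set" where
  "states = {p \<in> extensional RG. state_on (carrier G) RG p}"

text \<open>This is a left action, since \<open>left_shift h (left_shift g f) = left_shift (g h) f\<close>.\<close>

definition translate :: "'a \<Rightarrow> (('a \<Rightarrow> complex) \<Rightarrow> complex) \<Rightarrow> (('a \<Rightarrow> complex) \<Rightarrow> complex)" where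
  "translate g p = (\<lambda>f\<in>RG. p (left_shift g f))"

lemma left_shift_ruc: "f \<in> RG \<Longrightarrow> g \<in> carrier G \<Longrightarrow> left_shift g f \<in> RG"
  unfolding left_shift_def by (rule self.ruc_shift)

lemma left_shift_mult:
  "g \<in> carrier G \<Longrightarrow> h \<in> carrier G \<Longrightarrow> left_shift h (left_shift g f) = left_shift (g \<otimes> h) f"
  by (auto simp: left_shift_def m_assoc)

lemma left_shift_one: "f \<in> RG \<Longrightarrow> left_shift \<one> f = f"
  by (auto simp: left_shift_def fun_eq_iff self.ruc_undefined)

lemma states_extensional: "p \<in> states \<Longrightarrow> p \<in> extensional RG"
  and states_state: "p \<in> states \<Longrightarrow> state_on (carrier G) RG p"
  by (simp_all add: states_def)

lemma translate_state:
  assumes p: "p \<in> states" and g: "g \<in> carrier G"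
  shows "translate g p \<in> states"
proof -
  have s: "state_on (carrier G) RG p" using p by (rule states_state)
  have "left_shift g (\<lambda>x\<in>carrier G. 1) = (\<lambda>x\<in>carrier G. 1)"
    using g by (auto simp: left_shift_def)
  then have "translate g p (\<lambda>x\<in>carrier G. 1) = 1"
    using self.state_onD(1)[OF s] self.ruc_const[of 1] by (simp add: translate_def)
  moreover have "translate g p (\<lambda>x\<in>carrier G. f x + f' x) = translate g p f + translate g p f'"
    if f: "f \<in> RG" "f' \<in> RG" for f f'
  proof -
    have "left_shift g (\<lambda>x\<in>carrier G. f x + f' x) = (\<lambda>x\<in>carrier G. left_shift g f x + left_shift g f' x)"
      using g by (auto simp: left_shift_def)
    then show ?thesis
      using self.state_onD(2)[OF s left_shift_ruc[OF f(1) g] left_shift_ruc[OF f(2) g]] f self.ruc_add[OF f]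
      by (simp add: translate_def)
  qed
  moreover have "translate g p (\<lambda>x\<in>carrier G. c * f x) = c * translate g p f" if f: "f \<in> RG" for c f
  proof -
    have "left_shift g (\<lambda>x\<in>carrier G. c * f x) = (\<lambda>x\<in>carrier G. c * left_shift g f x)"
      using g by (auto simp: left_shift_def)
    then show ?thesis
      using self.state_onD(3)[OF s left_shift_ruc[OF f g], of c] f self.ruc_smult[OF f, of c]
      by (simp add: translate_def)
  qed
  moreover have "translate g p f \<in> \<real>\<^sub>\<ge>\<^sub>0" if f: "f \<in> RG" "\<forall>x\<in>carrier G. f x \<in> \<real>\<^sub>\<ge>\<^sub>0" for f
    using self.state_onD(4)[OF s left_shift_ruc[OF f(1) g]] f g by (simp add: translate_def left_shift_def)
  ultimately show ?thesis unfolding states_def state_on_def by (simp add: translate_def)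
qed

lemma translate_mult:
  assumes "p \<in> states" "g \<in> carrier G" "h \<in> carrier G"
  shows "translate (g \<otimes> h) p = translate g (translate h p)"
  using assms by (auto simp: translate_def left_shift_ruc left_shift_mult)

lemma translate_one: "p \<in> states \<Longrightarrow> translate \<one> p = p"
  by (auto simp: translate_def left_shift_one fun_eq_iff dest: states_extensional simp: extensional_def)

lemma states_nonempty: "states \<noteq> {}"
proof -
  have "(\<lambda>f\<in>RG. f \<one>) \<in> states"
    using self.ruc_const[of 1] self.ruc_add self.ruc_smult by (auto simp: states_def state_on_def)
  then show ?thesis by blast
qed

text \<open>All conditions that define a state are closed, and a state is bounded by twice the supremum
  norm; Tychonoff's theorem applies.\<close>

lemma states_compact: "compactin (pointwise_topology RG) states"
proof -
  define B where "B = (\<lambda>f. cball (0::complex) (2 * (SUP x\<in>carrier G. cmod (f x))))"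
  have "compactin (pointwise_topology RG) (PiE RG B)" by (simp add: compactin_PiE B_def)
  moreover have "states \<subseteq> PiE RG B"
  proof
    fix p assume p: "p \<in> states"
    have "cmod (p f) \<le> 2 * (SUP x\<in>carrier G. cmod (f x))" if "f \<in> RG" for f
      using self.state_on_bound[OF states_state[OF p] that self.sup_norm_upper[OF that]] by simp
    then show "p \<in> PiE RG B" using states_extensional[OF p] by (auto simp: B_def PiE_iff)
  qed
  moreover have "closedin (pointwise_topology RG) states"
  proof -
    let ?P = "pointwise_topology RG"
    have pr: "continuous_map ?P euclidean (\<lambda>p. p f)" if "f \<in> RG" for f
      using continuous_map_product_projection[of f RG "\<lambda>_. euclidean"] that by simp
    have cl: "closedin ?P {p \<in> topspace ?P. h p \<in> C}" if "continuous_map ?P euclidean h" "closed C" for h :: "_ \<Rightarrow> complex" and C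
      using that by (intro closedin_continuous_map_preimage) auto
    have 1: "closedin ?P {p \<in> topspace ?P. p (\<lambda>x\<in>carrier G. 1) \<in> {1}}"
      by (intro cl pr self.ruc_const) simp
    have 2: "closedin ?P {p \<in> topspace ?P. p (\<lambda>x\<in>carrier G. f x + g x) - (p f + p g) \<in> {0}}"
      if "f \<in> RG" "g \<in> RG" for f g
      using that by (intro cl continuous_map_diff continuous_map_add pr self.ruc_add) auto
    have 3: "closedin ?P {p \<in> topspace ?P. p (\<lambda>x\<in>carrier G. c * f x) - c * p f \<in> {0}}" if f: "f \<in> RG" for c f
    proof -
      have "continuous_map ?P euclidean (\<lambda>p. c * p f)"
        using continuous_map_compose[OF pr[OF f], of euclidean "\<lambda>z. c * z"] by (simp add: o_def continuous_on_mult_left)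
      then show ?thesis using f by (intro cl continuous_map_diff pr self.ruc_smult) auto
    qed
    have 4: "closedin ?P {p \<in> topspace ?P. p f \<in> \<real>\<^sub>\<ge>\<^sub>0}" if "f \<in> RG" for f
      using that by (intro cl pr) auto
    define \<K> where "\<K> = {K. closedin ?P K \<and> states \<subseteq> K}"
    have sub: "states \<subseteq> topspace ?P" unfolding pointwise_topspace using states_extensional by blast
    have "\<Inter>\<K> \<subseteq> states"
    proof
      fix p assume "p \<in> \<Inter>\<K>"
      then have K: "p \<in> K" if "closedin ?P K" "states \<subseteq> K" for K using that by (simp add: \<K>_def)
      note st = self.state_onD[OF states_state]
      show "p \<in> states"
        unfolding states_def state_on_def
      proof (intro CollectI conjI ballI allI impI)
        show "p \<in> extensional RG" using K[OF closedin_topspace sub] by (simp only: pointwise_topspace)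
        show "p (\<lambda>x\<in>carrier G. 1) = 1" using K[OF 1] sub st(1) by auto
        fix f assume f: "f \<in> RG"
        show "p (\<lambda>x\<in>carrier G. f x + g x) = p f + p g" if "g \<in> RG" for g
          using K[OF 2[OF f that]] sub st(2)[OF _ f that] by auto
        show "p (\<lambda>x\<in>carrier G. c * f x) = c * p f" for c
          using K[OF 3[OF f, of c]] sub st(3)[OF _ f, of _ c] by auto
        show "p f \<in> \<real>\<^sub>\<ge>\<^sub>0" if "\<forall>x\<in>carrier G. f x \<in> \<real>\<^sub>\<ge>\<^sub>0"
          using K[OF 4[OF f]] sub st(4)[OF _ f] that by blast
      qed
    qed
    then have "states = \<Inter>\<K>" by (auto simp: \<K>_def)
    moreover have "closedin ?P (\<Inter>\<K>)"
    proof (rule closedin_Inter)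
      show "\<K> \<noteq> {}" unfolding \<K>_def using sub closedin_topspace by blast
    qed (simp add: \<K>_def)
    ultimately show ?thesis by simp
  qed
  ultimately show ?thesis by (rule closed_compactin)
qed

lemma states_convex: "convex_in RG states"
  unfolding convex_in_def
proof (intro ballI)
  fix p q t assume p: "p \<in> states" and q: "q \<in> states" and t: "t \<in> {0..1::real}"
  note P = self.state_onD[OF states_state[OF p]] and Q = self.state_onD[OF states_state[OF q]]
  show "convex_comb RG t p q \<in> states"
    unfolding states_def state_on_def
  proof (intro CollectI conjI ballI allI impI)
    show "convex_comb RG t p q (\<lambda>x\<in>carrier G. 1) = 1"
      using P(1) Q(1) self.ruc_const[of 1] by (simp add: convex_comb_def)
    fix f assume f: "f \<in> RG"
    show "convex_comb RG t p q (\<lambda>x\<in>carrier G. f x + g x) = convex_comb RG t p q f + convex_comb RG t p q g"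
      if g: "g \<in> RG" for g
      using f g P(2)[OF f g] Q(2)[OF f g] self.ruc_add[OF f g] by (simp add: convex_comb_def algebra_simps)
    show "convex_comb RG t p q (\<lambda>x\<in>carrier G. c * f x) = c * convex_comb RG t p q f" for c
      using f P(3)[OF f, of c] Q(3)[OF f, of c] self.ruc_smult[OF f, of c] by (simp add: convex_comb_def algebra_simps)
    show "convex_comb RG t p q f \<in> \<real>\<^sub>\<ge>\<^sub>0" if "\<forall>x\<in>carrier G. f x \<in> \<real>\<^sub>\<ge>\<^sub>0"
      using P(4)[OF f] Q(4)[OF f] that f t by (auto simp: convex_comb_def complex_nonneg_Reals_iff)
  qed (simp add: convex_comb_def)
qed

text \<open>Right uniform continuity enters here: if \<open>g\<close> is close to \<open>g0\<close>, then the translates of \<open>f\<close> by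
  \<open>g\<close> and \<open>g0\<close> are uniformly close, and states are uniformly bounded.\<close>

lemma continuous_translate:
  "continuous_map (prod_topology T (subtopology (pointwise_topology RG) states)) (pointwise_topology RG)
     (\<lambda>(g, p). translate g p)"
  unfolding continuous_map_componentwise
proof (intro conjI ballI)
  let ?P = "prod_topology T (subtopology (pointwise_topology RG) states)"
  have top: "topspace ?P = carrier G \<times> states"
    using compactin_subset_topspace[OF states_compact] by (auto simp: topspace_eq)
  show "(\<lambda>(g, p). translate g p) ` topspace ?P \<subseteq> extensional RG"
    by (auto simp: translate_def)
  fix f assume f: "f \<in> RG"
  show "continuous_map ?P euclidean (\<lambda>x. (case x of (g, p) \<Rightarrow> translate g p) f)"
    unfolding continuous_map_def
  proof (intro conjI allI impI)
    fix W :: "complex set" assume "openin euclidean W"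
    then have W: "open W" by simp
    show "openin ?P {x \<in> topspace ?P. (case x of (g, p) \<Rightarrow> translate g p) f \<in> W}"
      unfolding openin_prod_topology_alt
    proof (intro allI impI)
      fix g0 p0 assume "(g0, p0) \<in> {x \<in> topspace ?P. (case x of (g, p) \<Rightarrow> translate g p) f \<in> W}"
      then have g0: "g0 \<in> carrier G" and p0: "p0 \<in> states" and w: "p0 (left_shift g0 f) \<in> W"
        using f top by (auto simp: translate_def)
      obtain \<epsilon> where \<epsilon>: "\<epsilon> > 0" "ball (p0 (left_shift g0 f)) \<epsilon> \<subseteq> W"
        using W w open_contains_ball by blast
      obtain U where U: "openin T U" "\<one> \<in> U"
          "\<And>u x. u \<in> U \<Longrightarrow> x \<in> carrier G \<Longrightarrow> cmod (f (u \<otimes> x) - f x) < \<epsilon>/4"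
        using self.ruc_nhd[OF f, of "\<epsilon>/4"] \<epsilon>(1) by auto
      define U' where "U' = {g \<in> topspace T. g \<otimes> inv g0 \<in> U}"
      have U': "openin T U'" unfolding U'_def
        using g0 by (intro openin_continuous_map_preimage[OF _ U(1)] continuous_mult') (auto simp: topspace_eq)
      have g0U': "g0 \<in> U'" using g0 U(2) by (simp add: U'_def topspace_eq)
      define V where "V = {p \<in> topspace (pointwise_topology RG). p (left_shift g0 f) \<in> ball (p0 (left_shift g0 f)) (\<epsilon>/2)} \<inter> states"
      have "openin (pointwise_topology RG) {p \<in> topspace (pointwise_topology RG). p (left_shift g0 f) \<in> ball (p0 (left_shift g0 f)) (\<epsilon>/2)}"
        by (rule openin_continuous_map_preimage[of _ euclidean])
           (use continuous_map_product_projection[of "left_shift g0 f" RG "\<lambda>_. euclidean"] left_shift_ruc[OF f g0] in auto)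
      then have V: "openin (subtopology (pointwise_topology RG) states) V"
        unfolding V_def by (rule openin_subtopology_Int)
      have p0V: "p0 \<in> V" using p0 \<epsilon>(1) compactin_subset_topspace[OF states_compact] by (auto simp: V_def)
      have "translate g p f \<in> W" if g: "g \<in> U'" and p: "p \<in> V" for g p
      proof -
        have gc: "g \<in> carrier G" and gU: "g \<otimes> inv g0 \<in> U" using g by (auto simp: U'_def topspace_eq)
        have ps: "p \<in> states" using p by (simp add: V_def)
        note st = states_state[OF ps]
        define d where "d = (\<lambda>x\<in>carrier G. -1 * left_shift g0 f x)"
        have d: "d \<in> RG" unfolding d_def using left_shift_ruc[OF f g0] by (rule self.ruc_smult)
        define k where "k = (\<lambda>x\<in>carrier G. left_shift g f x + d x)"
        have k: "k \<in> RG" unfolding k_def using left_shift_ruc[OF f gc] d by (rule self.ruc_add)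
        have "p k = p (left_shift g f) + p d"
          unfolding k_def using left_shift_ruc[OF f gc] d by (rule self.state_onD(2)[OF st])
        also have "p d = -1 * p (left_shift g0 f)"
          unfolding d_def by (rule self.state_onD(3)[OF st left_shift_ruc[OF f g0]])
        finally have pk: "p k = p (left_shift g f) - p (left_shift g0 f)" by simp
        have "cmod (k x) \<le> \<epsilon>/4" if x: "x \<in> carrier G" for x
        proof -
          have "g \<otimes> x = (g \<otimes> inv g0) \<otimes> (g0 \<otimes> x)" using gc g0 x by (simp add: m_assoc inv_solve_left)
          then show ?thesis using U(3)[OF gU, of "g0 \<otimes> x"] g0 x by (simp add: k_def d_def left_shift_def)
        qed
        then have "cmod (p k) \<le> 2 * (\<epsilon>/4)" by (rule self.state_on_bound[OF st k])
        moreover have "cmod (p0 (left_shift g0 f) - p (left_shift g0 f)) < \<epsilon>/2"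
          using p by (simp add: V_def dist_norm)
        ultimately have "dist (p0 (left_shift g0 f)) (p (left_shift g f)) < \<epsilon>"
          using dist_triangle[of "p0 (left_shift g0 f)" "p (left_shift g f)" "p (left_shift g0 f)"]
          by (simp add: pk dist_norm norm_minus_commute)
        then show ?thesis using \<epsilon>(2) f by (auto simp: translate_def)
      qed
      then have "U' \<times> V \<subseteq> {x \<in> topspace ?P. (case x of (g, p) \<Rightarrow> translate g p) f \<in> W}"
        unfolding top by (auto simp: U'_def V_def topspace_eq)
      then show "\<exists>U V. openin T U \<and> openin (subtopology (pointwise_topology RG) states) V \<and> g0 \<in> U \<and> p0 \<in> V \<and>
          U \<times> V \<subseteq> {x \<in> topspace ?P. (case x of (g, p) \<Rightarrow> translate g p) f \<in> W}"
        using U' V g0U' p0V by blast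
    qed
  qed simp
qed

definition invariant_states :: "(('a \<Rightarrow> complex) \<Rightarrow> complex) set \<Rightarrow> bool" where
  "invariant_states Q \<longleftrightarrow> (\<forall>g\<in>carrier G. \<forall>p\<in>Q. translate g p \<in> Q)"

definition affine_subflow :: "(('a \<Rightarrow> complex) \<Rightarrow> complex) set \<Rightarrow> bool" where
  "affine_subflow Q \<longleftrightarrow> Q \<subseteq> states \<and> convex_in RG Q \<and> invariant_states Q"

lemma minimal_affine_subflow:
  obtains Q where "compactin (pointwise_topology RG) Q" "Q \<noteq> {}" "affine_subflow Q"
    "\<And>N. compactin (pointwise_topology RG) N \<Longrightarrow> N \<noteq> {} \<Longrightarrow> affine_subflow N \<Longrightarrow> N \<subseteq> Q \<Longrightarrow> N = Q"
proof -
  have 1: "affine_subflow states"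
    by (simp add: affine_subflow_def invariant_states_def states_convex translate_state)
  have 2: "affine_subflow (\<Inter>\<D>)" if ne: "\<D> \<noteq> {}" and D: "\<And>D. D \<in> \<D> \<Longrightarrow> affine_subflow D" for \<D>
  proof -
    obtain D where "D \<in> \<D>" using ne by blast
    then have "\<Inter>\<D> \<subseteq> states" using D unfolding affine_subflow_def by blast
    moreover have "convex_in RG (\<Inter>\<D>)"
      unfolding convex_in_def
    proof (intro ballI InterI)
      fix p q and t :: real and E assume *: "p \<in> \<Inter>\<D>" "q \<in> \<Inter>\<D>" "t \<in> {0..1}" "E \<in> \<D>"
      then have "convex_in RG E" "p \<in> E" "q \<in> E" using D by (auto simp: affine_subflow_def)
      then show "convex_comb RG t p q \<in> E" using *(3) by (simp add: convex_in_def)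
    qed
    moreover have "invariant_states (\<Inter>\<D>)"
      unfolding invariant_states_def
    proof (intro ballI InterI)
      fix g p E assume *: "g \<in> carrier G" "p \<in> \<Inter>\<D>" "E \<in> \<D>"
      then have "invariant_states E" "p \<in> E" using D by (auto simp: affine_subflow_def)
      then show "translate g p \<in> E" using *(1) by (simp add: invariant_states_def)
    qed
    ultimately show ?thesis by (simp add: affine_subflow_def)
  qed
  show ?thesis
    by (rule minimal_compact_subset[where P = affine_subflow, OF pointwise_Hausdorff states_compact states_nonempty 1 2])
       (simp, simp, rule that)
qed

end

locale minimal_affine_flow = top_group G T for G :: "('a, 'm) monoid_scheme" (structure) and T +
  fixes Q :: "(('a \<Rightarrow> complex) \<Rightarrow> complex) set"
  assumes Q_compact: "compactin (pointwise_topology RG) Q" and Q_ne: "Q \<noteq> {}" and Q_affine: "affine_subflow Q"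
    and Q_minimal: "\<And>N. compactin (pointwise_topology RG) N \<Longrightarrow> N \<noteq> {} \<Longrightarrow> affine_subflow N \<Longrightarrow> N \<subseteq> Q \<Longrightarrow> N = Q"
begin

lemma Q_states: "Q \<subseteq> states" and Q_convex: "convex_in RG Q"
  and Q_translate: "\<lbrakk>g \<in> carrier G; p \<in> Q\<rbrakk> \<Longrightarrow> translate g p \<in> Q"
  using Q_affine by (auto simp: affine_subflow_def invariant_states_def)

abbreviation QT :: "(('a \<Rightarrow> complex) \<Rightarrow> complex) topology" where
  "QT \<equiv> subtopology (pointwise_topology RG) Q"

abbreviation tr :: "'a \<Rightarrow> (('a \<Rightarrow> complex) \<Rightarrow> complex) \<Rightarrow> (('a \<Rightarrow> complex) \<Rightarrow> complex)" where
  "tr g \<equiv> restrict (translate g) Q"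

lemma topspace_QT: "topspace QT = Q"
  using compactin_subset_topspace[OF Q_compact] by auto

lemma flow_QT: "flow G T QT tr"
  unfolding flow_def continuous_action_def topspace_QT
proof (intro conjI)
  show "Q \<noteq> {}" by (rule Q_ne)
  show "compact_space QT" using Q_compact by (simp add: compactin_subspace)
  show "Hausdorff_space QT" by (intro Hausdorff_space_subtopology pointwise_Hausdorff)
  have one: "translate \<one> p = p" if "p \<in> Q" for p using that Q_states translate_one by blast
  have mult: "translate (g \<otimes> h) p = translate g (translate h p)"
    if "p \<in> Q" "g \<in> carrier G" "h \<in> carrier G" for p g h
    using that Q_states translate_mult by blast
  have B: "tr g \<in> Bij Q" if g: "g \<in> carrier G" for g
  proof -
    have "bij_betw (tr g) Q Q"
      by (rule bij_betw_byWitness[where f' = "tr (inv g)"])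
         (use g in \<open>auto simp: Q_translate one simp flip: mult\<close>)
    then show ?thesis by (simp add: Bij_def)
  qed
  show "group_action G Q tr"
  proof (intro group_action.intro group_hom.intro group_hom_axioms.intro is_group group_BijGroup homI)
    fix g h assume "g \<in> carrier G" "h \<in> carrier G"
    then show "tr (g \<otimes> h) = tr g \<otimes>\<^bsub>BijGroup Q\<^esub> tr h"
      by (auto simp: BijGroup_def B compose_def mult Q_translate fun_eq_iff)
  qed (simp add: BijGroup_def B)
  have "continuous_map (prod_topology T QT) (pointwise_topology RG) snd"
    using continuous_map_snd continuous_map_into_fulltopology by blast
  then have "continuous_map (prod_topology T QT) (subtopology (pointwise_topology RG) states) snd"
    using Q_states by (auto simp: continuous_map_in_subtopology)
  then have "continuous_map (prod_topology T QT) (pointwise_topology RG)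
      ((\<lambda>(g, p). translate g p) \<circ> (\<lambda>x. (fst x, snd x)))"
    using continuous_translate by (intro continuous_map_compose[OF continuous_map_pairedI[OF continuous_map_fst]])
  then have "continuous_map (prod_topology T QT) QT (\<lambda>(g, p). translate g p)"
    using Q_translate by (auto simp: continuous_map_in_subtopology topspace_eq o_def case_prod_unfold)
  then show "continuous_map (prod_topology T QT) QT (\<lambda>(g, p). tr g p)"
    by (rule continuous_map_eq) (auto simp: topspace_eq)
qed

text \<open>The points of \<open>Q\<close> all of whose translates are at least \<open>\<gamma>\<close> at \<open>v\<close> form an affine subflow. If one
  point \<open>b\<close> has this property, then all of \<open>Q\<close> does.\<close>

lemma minimality_bound:
  assumes b: "b \<in> Q" and v: "v \<in> RG" and \<gamma>: "\<And>h. h \<in> carrier G \<Longrightarrow> \<gamma> \<le> Re (b (left_shift h v))" and q: "q \<in> Q"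
  shows "\<gamma> \<le> Re (q v)"
proof -
  define N where "N = (\<Inter>h\<in>carrier G. {p \<in> Q. \<gamma> \<le> Re (\<Sum>f\<in>{left_shift h v}. 1 * p f)})"
  have H: "compactin (pointwise_topology RG) {p \<in> Q. \<gamma> \<le> Re (\<Sum>f\<in>{left_shift h v}. 1 * p f)}"
          "convex_in RG {p \<in> Q. \<gamma> \<le> Re (\<Sum>f\<in>{left_shift h v}. 1 * p f)}" if "h \<in> carrier G" for h
    using half_space[OF Q_compact Q_convex, of "{left_shift h v}" \<gamma> "\<lambda>_. 1"] left_shift_ruc[OF v that] by auto
  have mem: "p \<in> N \<longleftrightarrow> p \<in> Q \<and> (\<forall>h\<in>carrier G. \<gamma> \<le> Re (p (left_shift h v)))" for p
    unfolding N_def using one_closed by auto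
  have "compactin (pointwise_topology RG) N"
    unfolding N_def
  proof (rule closed_compactin_Inter[OF H(1)[OF one_closed]])
    fix K assume "K \<in> (\<lambda>h. {p \<in> Q. \<gamma> \<le> Re (\<Sum>f\<in>{left_shift h v}. 1 * p f)}) ` carrier G"
    then show "closedin (pointwise_topology RG) K"
      using H(1) compactin_imp_closedin[OF pointwise_Hausdorff] by blast
  qed blast
  moreover have "N \<noteq> {}" using mem b \<gamma> by blast
  moreover have "affine_subflow N"
    unfolding affine_subflow_def
  proof (intro conjI)
    show "N \<subseteq> states" using mem Q_states by blast
    show "convex_in RG N"
      using H(2) unfolding convex_in_def N_def by blast
    show "invariant_states N"
      unfolding invariant_states_def
    proof (intro ballI)
      fix g p assume g: "g \<in> carrier G" and p: "p \<in> N"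
      have "translate g p (left_shift h v) = p (left_shift (h \<otimes> g) v)" if "h \<in> carrier G" for h
        using g v that by (simp add: translate_def left_shift_ruc left_shift_mult)
      then show "translate g p \<in> N" using p g mem Q_translate by simp
    qed
  qed
  moreover have "N \<subseteq> Q" using mem by blast
  ultimately have "N = Q" by (rule Q_minimal)
  then have "\<gamma> \<le> Re (q (left_shift \<one> v))" using q mem one_closed by blast
  then show ?thesis using v by (simp add: left_shift_one)
qed

end

section \<open>Minimal affine flows are strongly proximal\<close>

lemma integral_near_point:
  assumes X: "compact_space X" and \<kappa>: "\<kappa> \<in> regular_borel_prob_measures X" and e: "e \<in> topspace X"
    and f: "continuous_map X euclideanreal f" and M: "\<And>x. x \<in> topspace X \<Longrightarrow> \<bar>f x\<bar> \<le> M" and \<epsilon>: "\<epsilon> > 0"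
  defines "U \<equiv> {x \<in> topspace X. f x \<in> ball (f e) \<epsilon>}"
  shows "\<bar>(\<integral>x. f x \<partial>\<kappa>) - f e\<bar> \<le> \<epsilon> + 2 * M * measure \<kappa> (topspace X - U)"
proof -
  interpret prob_space \<kappa> using \<kappa> by (simp add: regular_borel_prob_measures_def)
  have s: "sets \<kappa> = sets (borel_of X)" using \<kappa> by (simp add: regular_borel_prob_measures_def)
  have sp: "space \<kappa> = topspace X" using sets_eq_imp_space_eq[OF s] by simp
  have U: "openin X U" unfolding U_def using f by (rule openin_continuous_map_preimage) simp
  then have m: "topspace X - U \<in> sets \<kappa>" using openin_borel_of[OF U] s sp sets.compl_sets by metis
  have fm: "f \<in> borel_measurable \<kappa>"
    using continuous_map_measurable_borel_of[OF f] by (simp add: measurable_cong_sets[OF s refl])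
  have int: "integrable \<kappa> f"
    by (rule integrable_const_bound[of _ M]) (use M fm sp in auto)
  have int': "integrable \<kappa> (\<lambda>x. \<epsilon> + 2 * M * indicator (topspace X - U) x)"
    using m by (auto simp: emeasure_eq_measure)
  have "(\<integral>x. f x \<partial>\<kappa>) - f e = (\<integral>x. f x - f e \<partial>\<kappa>)"
    using int by (simp add: prob_space)
  also have "\<bar>\<dots>\<bar> \<le> (\<integral>x. \<bar>f x - f e\<bar> \<partial>\<kappa>)"
    using integral_norm_bound[of \<kappa> "\<lambda>x. f x - f e"] by simp
  also have "\<dots> \<le> (\<integral>x. \<epsilon> + 2 * M * indicator (topspace X - U) x \<partial>\<kappa>)"
  proof (rule integral_mono)
    show "integrable \<kappa> (\<lambda>x. \<bar>f x - f e\<bar>)" using int by simp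
    fix x assume x: "x \<in> space \<kappa>"
    show "\<bar>f x - f e\<bar> \<le> \<epsilon> + 2 * M * indicator (topspace X - U) x"
    proof (cases "x \<in> U")
      case True
      then show ?thesis by (simp add: U_def dist_real_def abs_minus_commute)
    next
      case False
      then show ?thesis using x sp M[of x] M[OF e] \<epsilon> by (simp add: abs_le_iff)
    qed
  qed (rule int')
  also have "\<dots> = \<epsilon> + 2 * M * measure \<kappa> (topspace X - U)"
    using m by (simp add: prob_space emeasure_eq_measure)
  finally show ?thesis .
qed

text \<open>If two measures can be moved simultaneously so that nearly all of their mass lies near \<open>e\<close>, then
  the sets \<open>H (U, \<delta>)\<close> of group elements that do so generate a filter along which both converge to the
  point mass at \<open>e\<close>.\<close>

lemma (in group_flow) strongly_proximalI:
  assumes e: "e \<in> topspace X"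
    and contract: "\<And>\<mu> \<nu> U \<delta>. \<lbrakk>\<mu> \<in> regular_borel_prob_measures X; \<nu> \<in> regular_borel_prob_measures X;
        openin X U; e \<in> U; \<delta> > 0\<rbrakk> \<Longrightarrow>
      \<exists>h\<in>carrier G. measure (prob_action X \<phi> h \<mu>) (topspace X - U) \<le> \<delta> \<and>
                   measure (prob_action X \<phi> h \<nu>) (topspace X - U) \<le> (\<delta>::real)"
  shows "strongly_proximal G X \<phi>"
  unfolding strongly_proximal_def proximal_def topspace_prob_topology
proof (intro ballI)
  fix \<mu> \<nu> assume \<mu>: "\<mu> \<in> regular_borel_prob_measures X" and \<nu>: "\<nu> \<in> regular_borel_prob_measures X"
  define B where "B = {(U, \<delta>). openin X U \<and> e \<in> U \<and> (\<delta>::real) > 0}"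
  define H where "H = (\<lambda>(U, \<delta>). {h\<in>carrier G. measure (prob_action X \<phi> h \<mu>) (topspace X - U) \<le> \<delta> \<and>
                   measure (prob_action X \<phi> h \<nu>) (topspace X - U) \<le> (\<delta>::real)})"
  define F where "F = (INF b\<in>B. principal (H b))"
  have ev: "eventually P F \<longleftrightarrow> (\<exists>b\<in>B. \<forall>h\<in>H b. P h)" for P
  proof -
    have "eventually P F \<longleftrightarrow> (\<exists>b\<in>B. eventually P (principal (H b)))"
      unfolding F_def
    proof (rule eventually_INF_base)
      show "B \<noteq> {}" using e by (auto simp: B_def intro!: exI[of _ "topspace X"] exI[of _ "1::real"])
      fix a b assume ab: "a \<in> B" "b \<in> B"
      obtain U \<delta> V \<eta> where UV: "a = (U, \<delta>)" "b = (V, \<eta>)" by (metis surj_pair)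
      have UVp: "openin X U" "openin X V" "e \<in> U" "e \<in> V" "\<delta> > 0" "\<eta> > 0" using ab by (auto simp: B_def UV)
      have sub: "measure (prob_action X \<phi> h \<kappa>) (topspace X - W) \<le> measure (prob_action X \<phi> h \<kappa>) (topspace X - U \<inter> V)"
        if "\<kappa> \<in> regular_borel_prob_measures X" "h \<in> carrier G" "W = U \<or> W = V" for \<kappa> h W
      proof -
        have P: "prob_action X \<phi> h \<kappa> \<in> regular_borel_prob_measures X" using that by (intro prob_action_apply)
        then interpret prob_space "prob_action X \<phi> h \<kappa>" by (simp add: regular_borel_prob_measures_def)
        have "topspace X - U \<inter> V \<in> sets (prob_action X \<phi> h \<kappa>)"
          using P UVp by (auto simp: regular_borel_prob_measures_def intro!: closedin_borel_of)
        then show ?thesis using that(3) by (intro finite_measure_mono) auto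
      qed
      have "(U \<inter> V, min \<delta> \<eta>) \<in> B" using UVp by (auto simp: B_def)
      moreover have "H (U \<inter> V, min \<delta> \<eta>) \<subseteq> H a \<inter> H b"
      proof
        fix h assume h: "h \<in> H (U \<inter> V, min \<delta> \<eta>)"
        then have "h \<in> carrier G" by (simp add: H_def)
        then show "h \<in> H a \<inter> H b"
          using h sub[OF \<mu>, of h U] sub[OF \<mu>, of h V] sub[OF \<nu>, of h U] sub[OF \<nu>, of h V]
          by (auto simp: H_def UV)
      qed
      ultimately show "\<exists>x\<in>B. principal (H x) \<le> inf (principal (H a)) (principal (H b))"
        by (intro bexI[of _ "(U \<inter> V, min \<delta> \<eta>)"]) auto
    qed
    then show ?thesis by (simp add: eventually_principal)
  qed
  have "H b \<noteq> {}" if "b \<in> B" for b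
    using contract[OF \<mu> \<nu>] that by (fastforce simp: B_def H_def)
  then have "F \<noteq> bot" unfolding trivial_limit_def ev by blast
  moreover have inC: "eventually (\<lambda>h. h \<in> carrier G) F"
    unfolding ev using e by (intro bexI[of _ "(topspace X, 1)"]) (auto simp: H_def B_def)
  moreover have "limitin (prob_topology X) (\<lambda>g. prob_action X \<phi> g \<kappa>) (return (borel_of X) e) F"
    if \<kappa>: "\<kappa> = \<mu> \<or> \<kappa> = \<nu>" for \<kappa>
    unfolding limitin_prob_topology
  proof (intro conjI allI impI)
    have \<kappa>P: "\<kappa> \<in> regular_borel_prob_measures X" using \<kappa> \<mu> \<nu> by auto
    show "return (borel_of X) e \<in> regular_borel_prob_measures X" using X(1,2) e by (rule return_regular)
    show "eventually (\<lambda>g. prob_action X \<phi> g \<kappa> \<in> regular_borel_prob_measures X) F"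
      using inC by (rule eventually_mono) (rule prob_action_apply[OF \<kappa>P])
    fix f assume f: "continuous_map X euclideanreal f"
    have "compact (f ` topspace X)"
      using image_compactin[of X "topspace X" euclideanreal f] X f by (simp add: compact_space_def)
    then obtain M where M: "M > 0" "\<And>x. x \<in> topspace X \<Longrightarrow> \<bar>f x\<bar> \<le> M"
      using bounded_pos[of "f ` topspace X"] compact_imp_bounded by (auto simp: real_norm_def)
    show "((\<lambda>g. \<integral>x. f x \<partial>(prob_action X \<phi> g \<kappa>)) \<longlongrightarrow> (\<integral>x. f x \<partial>(return (borel_of X) e))) F"
      unfolding integral_return_borel_of[OF f e]
    proof (rule tendstoI)
      fix \<epsilon> :: real assume \<epsilon>: "\<epsilon> > 0"
      define U where "U = {x \<in> topspace X. f x \<in> ball (f e) (\<epsilon>/2)}"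
      have U: "openin X U" unfolding U_def using f by (rule openin_continuous_map_preimage) simp
      have b: "(U, \<epsilon> / (8 * M)) \<in> B" using U e \<epsilon> M(1) by (auto simp: B_def U_def)
      have "dist (\<integral>x. f x \<partial>(prob_action X \<phi> h \<kappa>)) (f e) < \<epsilon>" if h: "h \<in> H (U, \<epsilon> / (8 * M))" for h
      proof -
        have hc: "h \<in> carrier G" and le: "measure (prob_action X \<phi> h \<kappa>) (topspace X - U) \<le> \<epsilon> / (8 * M)"
          using h \<kappa> by (auto simp: H_def)
        have "\<bar>(\<integral>x. f x \<partial>(prob_action X \<phi> h \<kappa>)) - f e\<bar> \<le> \<epsilon>/2 + 2 * M * measure (prob_action X \<phi> h \<kappa>) (topspace X - U)"
          unfolding U_def using X(1) prob_action_apply(1)[OF \<kappa>P hc] e f M(2) \<epsilon>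
          by (intro integral_near_point) auto
        also have "\<dots> \<le> \<epsilon>/2 + 2 * M * (\<epsilon> / (8 * M))"
          using le M(1) by (intro add_left_mono mult_left_mono) auto
        also have "\<dots> < \<epsilon>" using M(1) \<epsilon> by simp
        finally show ?thesis by (simp add: dist_real_def)
      qed
      then show "eventually (\<lambda>h. dist (\<integral>x. f x \<partial>(prob_action X \<phi> h \<kappa>)) (f e) < \<epsilon>) F"
        unfolding ev using b by blast
    qed
  qed
  ultimately show "\<exists>F z. F \<noteq> bot \<and> eventually (\<lambda>g. g \<in> carrier G) F \<and>
      limitin (prob_topology X) (\<lambda>g. prob_action X \<phi> g \<mu>) z F \<and>
      limitin (prob_topology X) (\<lambda>g. prob_action X \<phi> g \<nu>) z F"
    by blast
qed

context top_group
begin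

lemma state_linear_combination:
  assumes p: "state_on (carrier G) RG p" and "finite F" "F \<subseteq> RG"
  shows "(\<lambda>x\<in>carrier G. \<Sum>f\<in>F. c f * f x) \<in> RG \<and> p (\<lambda>x\<in>carrier G. \<Sum>f\<in>F. c f * f x) = (\<Sum>f\<in>F. c f * p f)"
  using assms(2,3)
proof (induction F rule: finite_induct)
  case empty
  show ?case using self.ruc_const[of 0] self.state_on_const[OF p, of 0] by (simp add: restrict_def)
next
  case (insert f F)
  let ?r = "\<lambda>x\<in>carrier G. \<Sum>f\<in>F. c f * f x"
  have r: "?r \<in> RG" "p ?r = (\<Sum>f\<in>F. c f * p f)" using insert.IH insert.prems by blast+
  have f: "f \<in> RG" using insert by simp
  have cf: "(\<lambda>x\<in>carrier G. c f * f x) \<in> RG" using f by (rule self.ruc_smult)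
  have eq: "(\<lambda>x\<in>carrier G. \<Sum>f\<in>insert f F. c f * f x) = (\<lambda>x\<in>carrier G. (\<lambda>x\<in>carrier G. c f * f x) x + ?r x)"
    using insert.hyps by auto
  have 1: "(\<lambda>x\<in>carrier G. (\<lambda>x\<in>carrier G. c f * f x) x + ?r x) \<in> RG" using cf r(1) by (rule self.ruc_add)
  have 2: "p (\<lambda>x\<in>carrier G. (\<lambda>x\<in>carrier G. c f * f x) x + ?r x) = p (\<lambda>x\<in>carrier G. c f * f x) + p ?r"
    using cf r(1) by (rule self.state_onD(2)[OF p])
  show ?case
  proof
    show "(\<lambda>x\<in>carrier G. \<Sum>f\<in>insert f F. c f * f x) \<in> RG" using 1 by (simp only: eq)
    show "p (\<lambda>x\<in>carrier G. \<Sum>f\<in>insert f F. c f * f x) = (\<Sum>f\<in>insert f F. c f * p f)"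
      unfolding eq 2 self.state_onD(3)[OF p f] r(2) using insert.hyps by simp
  qed
qed

end

context minimal_affine_flow
begin

sublocale group_flow G T QT tr
  by unfold_locales (rule flow_QT)

lemma coordinate_continuous: "f \<in> RG \<Longrightarrow> continuous_map QT euclidean (\<lambda>p. p f)"
  using continuous_map_product_projection[of f RG "\<lambda>_. euclidean"] by (auto intro: continuous_map_from_subtopology)

lemma coordinate_Re_continuous: "f \<in> RG \<Longrightarrow> continuous_map QT euclideanreal (\<lambda>p. Re (p f))"
  using continuous_map_compose[OF coordinate_continuous, of f euclideanreal Re] by (simp add: o_def continuous_on_Re continuous_on_id)

lemma coordinate_integrable:
  assumes \<mu>: "\<mu> \<in> regular_borel_prob_measures QT" and f: "f \<in> RG"
  shows "integrable \<mu> (\<lambda>p. p f)"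
proof -
  interpret prob_space \<mu> using \<mu> by (simp add: regular_borel_prob_measures_def)
  have s: "sets \<mu> = sets (borel_of QT)" using \<mu> by (simp add: regular_borel_prob_measures_def)
  have sp: "space \<mu> = Q" using sets_eq_imp_space_eq[OF s] topspace_QT by simp
  have fm: "(\<lambda>p. p f) \<in> borel_measurable \<mu>"
    using continuous_map_measurable_borel_of[OF coordinate_continuous[OF f]] by (simp add: measurable_cong_sets[OF s refl])
  have "cmod (p f) \<le> 2 * (SUP x\<in>carrier G. cmod (f x))" if "p \<in> Q" for p
    using self.state_on_bound[OF states_state f self.sup_norm_upper[OF f]] that Q_states by blast
  then show ?thesis using fm sp by (intro integrable_const_bound) auto
qed

text \<open>The barycentre of \<open>(\<mu> + \<nu>) / 2\<close>. Averaging the two measures allows one group element to treat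
  both of them. The types of \<open>\<mu>\<close> and \<open>\<nu>\<close> are inferred from the body.\<close>

definition mean_point :: "_ \<Rightarrow> _ \<Rightarrow> ('a \<Rightarrow> complex) \<Rightarrow> complex" where
  "mean_point \<mu> \<nu> = (\<lambda>f\<in>RG. ((\<integral>p. p f \<partial>\<mu>) + (\<integral>p. p f \<partial>\<nu>)) / 2)"

lemma integral_linear_functional_ge:
  assumes \<mu>: "\<mu> \<in> regular_borel_prob_measures QT" and F: "finite F" "F \<subseteq> RG"
    and ge: "\<And>p. p \<in> Q \<Longrightarrow> \<gamma> \<le> Re (\<Sum>f\<in>F. c f * p f)"
  shows "\<gamma> \<le> Re (\<Sum>f\<in>F. c f * (\<integral>p. p f \<partial>\<mu>))"
proof -
  interpret prob_space \<mu> using \<mu> by (simp add: regular_borel_prob_measures_def)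
  have s: "sets \<mu> = sets (borel_of QT)" using \<mu> by (simp add: regular_borel_prob_measures_def)
  have sp: "space \<mu> = Q" using sets_eq_imp_space_eq[OF s] topspace_QT by simp
  have int: "integrable \<mu> (\<lambda>p. c f * p f)" if "f \<in> F" for f
    using coordinate_integrable[OF \<mu>] F that by auto
  have ints: "integrable \<mu> (\<lambda>p. \<Sum>f\<in>F. c f * p f)" using int by (rule Bochner_Integration.integrable_sum)
  have "(\<Sum>f\<in>F. c f * (\<integral>p. p f \<partial>\<mu>)) = (\<integral>p. (\<Sum>f\<in>F. c f * p f) \<partial>\<mu>)"
    using int F coordinate_integrable[OF \<mu>] by (subst Bochner_Integration.integral_sum) (auto intro!: sum.cong)
  also have "Re \<dots> = (\<integral>p. Re (\<Sum>f\<in>F. c f * p f) \<partial>\<mu>)"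
    using ints by (rule integral_Re[symmetric])
  also have "\<dots> \<ge> (\<integral>p. \<gamma> \<partial>\<mu>)"
    using ints ge sp by (intro integral_mono integrable_Re) auto
  finally show ?thesis by (simp add: prob_space)
qed

text \<open>A point outside a compact convex set would be separated from it by a functional, but the
  barycentre satisfies every linear inequality that holds throughout the set.\<close>

lemma mean_point_in:
  assumes "\<mu> \<in> regular_borel_prob_measures QT" "\<nu> \<in> regular_borel_prob_measures QT"
  shows "mean_point \<mu> \<nu> \<in> Q"
proof (rule ccontr)
  assume "mean_point \<mu> \<nu> \<notin> Q"
  moreover have "mean_point \<mu> \<nu> \<in> extensional RG" by (simp add: mean_point_def)
  ultimately obtain F c \<gamma> where F: "finite F" "F \<subseteq> RG" "Re (\<Sum>f\<in>F. c f * mean_point \<mu> \<nu> f) < \<gamma>"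
      "\<And>p. p \<in> Q \<Longrightarrow> \<gamma> \<le> Re (\<Sum>f\<in>F. c f * p f)"
    using separate_point_from_compact_convex[OF Q_compact Q_convex] by blast
  have eq: "(\<Sum>f\<in>F. c f * mean_point \<mu> \<nu> f) = ((\<Sum>f\<in>F. c f * (\<integral>p. p f \<partial>\<mu>)) + (\<Sum>f\<in>F. c f * (\<integral>p. p f \<partial>\<nu>))) / 2"
    using F(2) unfolding sum.distrib[symmetric] sum_divide_distrib
    by (intro sum.cong) (auto simp: mean_point_def algebra_simps)
  then have "Re (\<Sum>f\<in>F. c f * mean_point \<mu> \<nu> f)
      = (Re (\<Sum>f\<in>F. c f * (\<integral>p. p f \<partial>\<mu>)) + Re (\<Sum>f\<in>F. c f * (\<integral>p. p f \<partial>\<nu>))) / 2"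
    unfolding eq by (simp only: Re_divide_numeral plus_complex.sel)
  then show False
    using integral_linear_functional_ge[OF assms(1) F(1,2), where \<gamma> = \<gamma> and c = c] integral_linear_functional_ge[OF assms(2) F(1,2), where \<gamma> = \<gamma> and c = c] F(3,4)
    by (simp del: Re_sum times_complex.sel)
qed

text \<open>Separate \<open>e\<close> by a function \<open>v\<close> from the compact convex set that contains \<open>Q - U\<close>: then
  \<open>Re (p v) \<ge> \<gamma>\<close> for all \<open>p\<close> in \<open>Q - U\<close>, while the minimum \<open>\<alpha>\<close> of \<open>Re (p v)\<close> over \<open>Q\<close> is below \<open>\<gamma>\<close>. By
  minimality of \<open>Q\<close>, the barycentre of \<open>(\<mu> + \<nu>) / 2\<close> has a translate whose value is nearly \<open>\<alpha>\<close>. Markov's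
  inequality then bounds the mass that the translated measures give to \<open>Q - U\<close>.\<close>

lemma contract_to_extreme_point:
  assumes \<mu>: "\<mu> \<in> regular_borel_prob_measures QT" and \<nu>: "\<nu> \<in> regular_borel_prob_measures QT"
    and e: "extreme_in RG Q e" and U: "openin QT U" "e \<in> U" and \<delta>: "(\<delta>::real) > 0"
  shows "\<exists>h\<in>carrier G. measure (prob_action QT tr h \<mu>) (topspace QT - U) \<le> \<delta> \<and>
                   measure (prob_action QT tr h \<nu>) (topspace QT - U) \<le> \<delta>"
proof -
  have eQ: "e \<in> Q" using e by (simp add: extreme_in_def)
  obtain U' where U': "openin (pointwise_topology RG) U'" "U = U' \<inter> Q" using U(1) by (auto simp: openin_subtopology)
  then have "e \<in> U'" using U(2) by simp
  then obtain C where C: "compactin (pointwise_topology RG) C" "convex_in RG C" "C \<subseteq> Q" "e \<notin> C" "Q - U' \<subseteq> C"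
    using extreme_point_neighbourhood[OF Q_compact Q_convex e U'(1)] by blast
  have "e \<in> extensional RG" using eQ Q_states states_extensional by blast
  then obtain F c \<gamma> where F: "finite F" "F \<subseteq> RG" "Re (\<Sum>f\<in>F. c f * e f) < \<gamma>"
      "\<And>p. p \<in> C \<Longrightarrow> \<gamma> \<le> Re (\<Sum>f\<in>F. c f * p f)"
    using separate_point_from_compact_convex[OF C(1,2) _ C(4)] by blast
  define v where "v = (\<lambda>x\<in>carrier G. \<Sum>f\<in>F. c f * f x)"
  have pv: "p v = (\<Sum>f\<in>F. c f * p f)" if "p \<in> Q" for p
    unfolding v_def using state_linear_combination[OF states_state F(1,2)] that Q_states by blast
  have v: "v \<in> RG"
    unfolding v_def using state_linear_combination[OF states_state F(1,2)] eQ Q_states by blast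
  have ev: "Re (e v) < \<gamma>" using F(3) pv[OF eQ] by simp
  have Uv: "\<gamma> \<le> Re (p v)" if "p \<in> Q - U" for p
    using that F(4)[of p] pv[of p] C(5) U'(2) by auto
  have "continuous_map (pointwise_topology RG) euclideanreal (\<lambda>p. Re (p v))"
    using continuous_map_linear_functional[of "{v}" RG "\<lambda>_. 1"] v by simp
  then obtain q0 where q0: "q0 \<in> Q" "\<And>p. p \<in> Q \<Longrightarrow> Re (q0 v) \<le> Re (p v)"
    using compactin_attains_min[OF Q_compact Q_ne] by blast
  define \<alpha> where "\<alpha> = Re (q0 v)"
  have \<alpha>: "\<alpha> < \<gamma>" using q0(2)[OF eQ] ev by (simp add: \<alpha>_def)
  \<comment> \<open>the factor 1/2 accounts for the average of two measures\<close>
  define \<eta> where "\<eta> = \<delta> * (\<gamma> - \<alpha>) / 2"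
  have \<eta>: "\<eta> > 0" using \<delta> \<alpha> by (simp add: \<eta>_def)
  have "\<exists>h\<in>carrier G. Re (mean_point \<mu> \<nu> (left_shift h v)) < \<alpha> + \<eta>"
  proof (rule ccontr)
    assume "\<not> ?thesis"
    then have "\<alpha> + \<eta> \<le> Re (q0 v)"
      using minimality_bound[OF mean_point_in[OF \<mu> \<nu>] v _ q0(1), of "\<alpha> + \<eta>"] by force
    then show False using \<eta> by (simp add: \<alpha>_def)
  qed
  then obtain h where h: "h \<in> carrier G" "Re (mean_point \<mu> \<nu> (left_shift h v)) < \<alpha> + \<eta>" by blast
  have shift: "Re (\<integral>p. p (left_shift h v) \<partial>\<kappa>) = (\<integral>p. Re (p v) \<partial>(prob_action QT tr h \<kappa>))"
    and markov: "\<alpha> + (\<gamma> - \<alpha>) * measure (prob_action QT tr h \<kappa>) (topspace QT - U)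
        \<le> (\<integral>p. Re (p v) \<partial>(prob_action QT tr h \<kappa>))"
    if \<kappa>: "\<kappa> \<in> regular_borel_prob_measures QT" for \<kappa>
  proof -
    have s: "sets \<kappa> = sets (borel_of QT)" using \<kappa> by (simp add: regular_borel_prob_measures_def)
    have sp: "space \<kappa> = Q" using sets_eq_imp_space_eq[OF s] topspace_QT by simp
    have "Re (\<integral>p. p (left_shift h v) \<partial>\<kappa>) = (\<integral>p. Re (p (left_shift h v)) \<partial>\<kappa>)"
      using coordinate_integrable[OF \<kappa> left_shift_ruc[OF v h(1)]] by (rule integral_Re[symmetric])
    also have "\<dots> = (\<integral>p. Re (tr h p v) \<partial>\<kappa>)"
      using v h(1) by (intro Bochner_Integration.integral_cong) (auto simp: sp translate_def)
    also have "\<dots> = (\<integral>p. Re (p v) \<partial>(prob_action QT tr h \<kappa>))"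
      using prob_action_apply(2)[OF \<kappa> h(1) coordinate_Re_continuous[OF v]] by simp
    finally show "Re (\<integral>p. p (left_shift h v) \<partial>\<kappa>) = (\<integral>p. Re (p v) \<partial>(prob_action QT tr h \<kappa>))" .
    define \<rho> where "\<rho> = prob_action QT tr h \<kappa>"
    have \<rho>: "\<rho> \<in> regular_borel_prob_measures QT" unfolding \<rho>_def using \<kappa> h(1) by (rule prob_action_apply)
    then interpret prob_space \<rho> by (simp add: regular_borel_prob_measures_def)
    have s: "sets \<rho> = sets (borel_of QT)" using \<rho> by (simp add: regular_borel_prob_measures_def)
    have sp: "space \<rho> = Q" using sets_eq_imp_space_eq[OF s] topspace_QT by simp
    have m: "topspace QT - U \<in> sets \<rho>" unfolding s by (rule closedin_borel_of[OF closedin_diff[OF closedin_topspace U(1)]])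
    have "(\<integral>p. \<alpha> + (\<gamma> - \<alpha>) * indicator (topspace QT - U) p \<partial>\<rho>) \<le> (\<integral>p. Re (p v) \<partial>\<rho>)"
    proof (rule integral_mono)
      show "integrable \<rho> (\<lambda>p. \<alpha> + (\<gamma> - \<alpha>) * indicator (topspace QT - U) p)"
        using m by (auto simp: emeasure_eq_measure)
      show "integrable \<rho> (\<lambda>p. Re (p v))" using coordinate_integrable[OF \<rho> v] by (rule integrable_Re)
      show "\<alpha> + (\<gamma> - \<alpha>) * indicator (topspace QT - U) p \<le> Re (p v)" if "p \<in> space \<rho>" for p
        using that q0(2)[of p] Uv[of p] by (auto simp: sp \<alpha>_def indicator_def)
    qed
    then show "\<alpha> + (\<gamma> - \<alpha>) * measure (prob_action QT tr h \<kappa>) (topspace QT - U)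
        \<le> (\<integral>p. Re (p v) \<partial>(prob_action QT tr h \<kappa>))"
      using m by (simp add: \<rho>_def[symmetric] prob_space emeasure_eq_measure)
  qed
  have arith: "k * a + k * b \<le> k * \<delta>"
    if "m = (I + J) / 2" "m < \<alpha> + \<delta> * k / 2" "\<alpha> + k * a \<le> I" "\<alpha> + k * b \<le> J" for k a b I J m :: real
    using that by (simp add: mult.commute[of \<delta>])
  have mean: "Re (mean_point \<mu> \<nu> (left_shift h v))
      = ((\<integral>p. Re (p v) \<partial>(prob_action QT tr h \<mu>)) + (\<integral>p. Re (p v) \<partial>(prob_action QT tr h \<nu>))) / 2"
    using shift[OF \<mu>] shift[OF \<nu>] left_shift_ruc[OF v h(1)] by (simp add: mean_point_def)
  have sum: "(\<gamma> - \<alpha>) * measure (prob_action QT tr h \<mu>) (topspace QT - U)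
      + (\<gamma> - \<alpha>) * measure (prob_action QT tr h \<nu>) (topspace QT - U) \<le> (\<gamma> - \<alpha>) * \<delta>"
    using mean h(2)[unfolded \<eta>_def] markov[OF \<mu>] markov[OF \<nu>] by (rule arith)
  have "0 \<le> (\<gamma> - \<alpha>) * measure \<kappa> (topspace QT - U)" for \<kappa> using \<alpha> by simp
  then have "(\<gamma> - \<alpha>) * measure (prob_action QT tr h \<mu>) (topspace QT - U) \<le> (\<gamma> - \<alpha>) * \<delta>"
      "(\<gamma> - \<alpha>) * measure (prob_action QT tr h \<nu>) (topspace QT - U) \<le> (\<gamma> - \<alpha>) * \<delta>"
    using sum by (smt (verit))+
  then show ?thesis using h(1) \<alpha> by (intro bexI[of _ h]) auto
qed

lemma strongly_proximal_QT: "strongly_proximal G QT tr"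
proof -
  obtain e where e: "extreme_in RG Q e" using extreme_point_exists[OF Q_compact Q_ne] .
  then have "e \<in> topspace QT" unfolding topspace_QT by (simp add: extreme_in_def)
  then show ?thesis
    by (rule strongly_proximalI) (rule contract_to_extreme_point[OF _ _ e])
qed

end

theorem invariant_mean_of_amenable:
  fixes G :: "('a, 'm) monoid_scheme"
  assumes "topological_group G T" "amenable TYPE(('a \<Rightarrow> complex) \<Rightarrow> complex) G T"
  shows "\<exists>m. invariant_mean G T m"
proof -
  interpret top_group G T using assms by unfold_locales
  obtain Q where Q: "compactin (pointwise_topology RG) Q" "Q \<noteq> {}" "affine_subflow Q"
    "\<And>N. compactin (pointwise_topology RG) N \<Longrightarrow> N \<noteq> {} \<Longrightarrow> affine_subflow N \<Longrightarrow> N \<subseteq> Q \<Longrightarrow> N = Q"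
    using minimal_affine_subflow by metis
  interpret minimal_affine_flow G T Q using Q by unfold_locales
  obtain m where m: "m \<in> topspace QT" "\<forall>g\<in>carrier G. tr g m = m"
    using assms(2) flow_QT strongly_proximal_QT unfolding amenable_def by blast
  have mQ: "m \<in> Q" using m topspace_QT by simp
  have "m (\<lambda>x\<in>carrier G. f (g \<otimes>\<^bsub>G\<^esub> x)) = m f" if "g \<in> carrier G" "f \<in> RG" for g f
  proof -
    have "translate g m f = m f" using m(2) that(1) mQ by simp
    then show ?thesis using that(2) by (simp add: translate_def left_shift_def)
  qed
  then have "invariant_mean G T m"
    using states_state mQ Q_states by (auto simp: invariant_mean_def)
  then show ?thesis by blast
qed

section \<open>A Hahn-Banach theorem for sublinear functionals on a carrier\<close>

text \<open>The self-adjoint part of a function system is a real vector space on a subset of a type that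
  carries no algebraic structure, so the operations are parameters.\<close>

locale real_vector_on =
  fixes V :: "'v set" and add :: "'v \<Rightarrow> 'v \<Rightarrow> 'v" and sc :: "real \<Rightarrow> 'v \<Rightarrow> 'v" and zero :: 'v
  assumes add_closed: "\<lbrakk>x \<in> V; y \<in> V\<rbrakk> \<Longrightarrow> add x y \<in> V"
    and sc_closed: "x \<in> V \<Longrightarrow> sc r x \<in> V"
    and zero_closed: "zero \<in> V"
    and add_assoc: "\<lbrakk>x \<in> V; y \<in> V; z \<in> V\<rbrakk> \<Longrightarrow> add (add x y) z = add x (add y z)"
    and add_comm: "\<lbrakk>x \<in> V; y \<in> V\<rbrakk> \<Longrightarrow> add x y = add y x"
    and add_zero: "x \<in> V \<Longrightarrow> add x zero = x"
    and sc_zero: "x \<in> V \<Longrightarrow> sc 0 x = zero"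
    and sc_one: "x \<in> V \<Longrightarrow> sc 1 x = x"
    and sc_add: "x \<in> V \<Longrightarrow> sc (r + s) x = add (sc r x) (sc s x)"
    and sc_distrib: "\<lbrakk>x \<in> V; y \<in> V\<rbrakk> \<Longrightarrow> sc r (add x y) = add (sc r x) (sc r y)"
    and sc_assoc: "x \<in> V \<Longrightarrow> sc r (sc s x) = sc (r * s) x"
begin

definition sublinear :: "('v \<Rightarrow> real) \<Rightarrow> bool" where
  "sublinear p \<longleftrightarrow> (\<forall>x\<in>V. \<forall>y\<in>V. p (add x y) \<le> p x + p y) \<and> (\<forall>x\<in>V. \<forall>r>0. p (sc r x) \<le> r * p x)"

lemma sublinear_add: "\<lbrakk>sublinear p; x \<in> V; y \<in> V\<rbrakk> \<Longrightarrow> p (add x y) \<le> p x + p y"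
  by (simp add: sublinear_def)

lemma sublinear_sc:
  assumes "sublinear p" "x \<in> V" "r > 0" shows "p (sc r x) = r * p x"
proof (rule antisym)
  show "p (sc r x) \<le> r * p x" using assms by (simp add: sublinear_def)
  have "p (sc (1 / r) (sc r x)) \<le> 1 / r * p (sc r x)"
    using assms sc_closed[of x r] unfolding sublinear_def by (meson zero_less_divide_1_iff)
  then show "r * p x \<le> p (sc r x)"
    using assms by (simp add: sc_assoc sc_one field_simps)
qed

lemma sublinear_zero: "sublinear p \<Longrightarrow> p zero = 0"
  using sublinear_sc[of p zero 2] sc_zero[OF zero_closed] sc_assoc[OF zero_closed, of 2 0] zero_closed by simp

lemma sublinear_neg: "\<lbrakk>sublinear p; x \<in> V\<rbrakk> \<Longrightarrow> 0 \<le> p x + p (sc (-1) x)"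
  using sublinear_add[of p x "sc (-1) x"] sublinear_zero[of p] sc_closed[of x "-1"] sc_add[of x 1 "-1"]
  by (simp add: sc_one sc_zero)

definition minimal_sublinear :: "('v \<Rightarrow> real) \<Rightarrow> bool" where
  "minimal_sublinear p \<longleftrightarrow> sublinear p \<and>
     (\<forall>q. sublinear q \<longrightarrow> (\<forall>x\<in>V. q x \<le> p x) \<longrightarrow> (\<forall>x\<in>V. q x = p x))"

text \<open>Zorn's lemma for inclusion of epigraphs, which reverses the pointwise order. The infimum of a
  chain is sublinear, because two members of the chain can be replaced by the smaller one.\<close>

lemma minimal_sublinear_exists:
  assumes p0: "sublinear p0"
  obtains p where "minimal_sublinear p" "\<And>x. x \<in> V \<Longrightarrow> p x \<le> p0 x"
proof -
  define ep where "ep p = {(x, r). x \<in> V \<and> p x \<le> r}" for p :: "'v \<Rightarrow> real"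
  define \<A> where "\<A> = ep ` {p. sublinear p \<and> (\<forall>x\<in>V. p x \<le> p0 x)}"
  have sub: "ep p \<subseteq> ep q \<longleftrightarrow> (\<forall>x\<in>V. q x \<le> p x)" for p q
    by (force simp: ep_def)
  have "\<exists>M\<in>\<A>. \<forall>X\<in>\<A>. M \<subseteq> X \<longrightarrow> X = M"
  proof (rule subset_Zorn)
    fix \<C> assume \<C>: "subset.chain \<A> \<C>"
    show "\<exists>U\<in>\<A>. \<forall>X\<in>\<C>. X \<subseteq> U"
    proof (cases "\<C> = {}")
      case True
      then show ?thesis using p0 by (auto simp: \<A>_def)
    next
      case False
      define P where "P = {p. sublinear p \<and> (\<forall>x\<in>V. p x \<le> p0 x) \<and> ep p \<in> \<C>}"
      have P\<C>: "X \<in> ep ` P" if "X \<in> \<C>" for X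
        using that \<C> by (auto simp: subset_chain_def \<A>_def P_def)
      then have Pne: "P \<noteq> {}" using False by auto
      have chain: "(\<forall>x\<in>V. p x \<le> q x) \<or> (\<forall>x\<in>V. q x \<le> p x)" if "p \<in> P" "q \<in> P" for p q
      proof -
        have "ep p \<subseteq> ep q \<or> ep q \<subseteq> ep p" using that \<C> by (auto simp: P_def subset_chain_def)
        then show ?thesis unfolding sub by blast
      qed
      have bound: "- p0 (sc (-1) x) \<le> p x" if "p \<in> P" "x \<in> V" for p x
        using that sublinear_neg[of p x] sc_closed[of x "-1"] by (force simp: P_def)
      define q where "q x = (INF p\<in>P. p x)" for x
      have q_le: "q x \<le> p x" if "p \<in> P" "x \<in> V" for p x
        unfolding q_def using that bound by (intro cINF_lower) (auto intro!: bdd_belowI2)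
      have q_ge: "c \<le> q x" if "\<And>p. p \<in> P \<Longrightarrow> c \<le> p x" for c x
        unfolding q_def using that Pne by (intro cINF_greatest) auto
      have "sublinear q"
        unfolding sublinear_def
      proof (intro conjI ballI allI impI)
        fix x y assume x: "x \<in> V" and y: "y \<in> V"
        have "q (add x y) - p' y \<le> q x" if p': "p' \<in> P" for p'
        proof (rule q_ge)
          fix p assume p: "p \<in> P"
          obtain r where r: "r \<in> P" "r x \<le> p x" "r y \<le> p' y"
            using chain[OF p p'] p p' x y by blast
          have "q (add x y) \<le> r x + r y"
            using q_le[OF r(1) add_closed[OF x y]] sublinear_add[of r x y] r(1) x y by (simp add: P_def)
          then show "q (add x y) - p' y \<le> p x" using r by simp
        qed
        then have "q (add x y) - q x \<le> q y" by (intro q_ge) (simp add: algebra_simps)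
        then show "q (add x y) \<le> q x + q y" by simp
      next
        fix x and r :: real assume x: "x \<in> V" and r: "r > 0"
        have "q (sc r x) / r \<le> q x"
        proof (rule q_ge)
          fix p assume p: "p \<in> P"
          have "q (sc r x) \<le> r * p x"
            using q_le[OF p sc_closed[OF x, of r]] sublinear_sc[of p x r] p x r by (simp add: P_def)
          then show "q (sc r x) / r \<le> p x" using r by (simp add: field_simps)
        qed
        then show "q (sc r x) \<le> r * q x" using r by (simp add: field_simps)
      qed
      moreover have "\<forall>x\<in>V. q x \<le> p0 x" using Pne q_le by (force simp: P_def)
      ultimately have "ep q \<in> \<A>" by (auto simp: \<A>_def)
      moreover have "X \<subseteq> ep q" if X: "X \<in> \<C>" for X
      proof -
        obtain p where "p \<in> P" "X = ep p" using P\<C>[OF X] by blast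
        then show ?thesis by (simp add: sub q_le)
      qed
      ultimately show ?thesis by blast
    qed
  qed
  then obtain p where p: "sublinear p" "\<forall>x\<in>V. p x \<le> p0 x"
      "\<And>q. sublinear q \<Longrightarrow> \<forall>x\<in>V. q x \<le> p0 x \<Longrightarrow> ep p \<subseteq> ep q \<Longrightarrow> ep q = ep p"
    by (auto simp: \<A>_def)
  show ?thesis
  proof (rule that)
    show "minimal_sublinear p"
      unfolding minimal_sublinear_def
    proof (intro conjI allI impI ballI)
      fix q x assume q: "sublinear q" "\<forall>x\<in>V. q x \<le> p x" "x \<in> V"
      have "ep p \<subseteq> ep q" unfolding sub by (rule q(2))
      moreover have "\<forall>x\<in>V. q x \<le> p0 x" using q(2) p(2) by force
      ultimately have "ep q \<subseteq> ep p" using p(3)[OF q(1)] by blast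
      then show "q x = p x" unfolding sub using q(2,3) by (intro antisym) auto
    qed (rule p(1))
  qed (use p in auto)
qed

text \<open>The functional \<open>q z = inf {p (z + t y) - t p y | t \<ge> 0}\<close> is sublinear and below \<open>p\<close>, so it equals
  \<open>p\<close>; the choice \<open>t = 1\<close> gives the missing inequality.\<close>

lemma minimal_sublinear_additive:
  assumes min: "minimal_sublinear p" and x: "x \<in> V" and y: "y \<in> V"
  shows "p (add x y) = p x + p y"
proof (rule antisym)
  have p: "sublinear p" using min by (simp add: minimal_sublinear_def)
  then show "p (add x y) \<le> p x + p y" using x y by (rule sublinear_add)
  define q where "q z = (INF t\<in>{0..}. p (add z (sc t y)) - t * p y)" for z
  have py: "p (sc t y) = t * p y" if "t \<ge> 0" for t
    using that sublinear_sc[OF p y, of t] sublinear_zero[OF p] by (cases "t = 0") (simp_all add: sc_zero[OF y])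
  have bound: "- p (sc (-1) z) \<le> p (add z (sc t y)) - t * p y" if z: "z \<in> V" and t: "t \<ge> 0" for z t
  proof -
    have "sc t y = add (add z (sc t y)) (sc (-1) z)"
    proof -
      have "add (add z (sc t y)) (sc (-1) z) = add (sc t y) (add z (sc (-1) z))"
        using z y by (simp add: add_comm[of z "sc t y"] add_assoc sc_closed)
      also have "add z (sc (-1) z) = zero" using sc_add[OF z, of 1 "-1"] z by (simp add: sc_one sc_zero)
      finally show ?thesis using y by (simp add: add_zero sc_closed)
    qed
    then have "p (sc t y) \<le> p (add z (sc t y)) + p (sc (-1) z)"
      using sublinear_add[OF p, of "add z (sc t y)" "sc (-1) z"] z y by (simp add: add_closed sc_closed)
    then show ?thesis using py[OF t] by simp
  qed
  have q_le: "q z \<le> p (add z (sc t y)) - t * p y" if "z \<in> V" "t \<ge> 0" for z t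
    unfolding q_def using that bound by (intro cINF_lower) (auto intro!: bdd_belowI2)
  have q_ge: "c \<le> q z" if "\<And>t. t \<ge> 0 \<Longrightarrow> c \<le> p (add z (sc t y)) - t * p y" for c z
    unfolding q_def using that by (intro cINF_greatest) auto
  have "sublinear q"
    unfolding sublinear_def
  proof (intro conjI ballI allI impI)
    fix u v assume u: "u \<in> V" and v: "v \<in> V"
    have "q (add u v) - (p (add v (sc s y)) - s * p y) \<le> q u" if s: "s \<ge> 0" for s
    proof (rule q_ge)
      fix t :: real assume t: "t \<ge> 0"
      have "add (add u v) (sc (t + s) y) = add (add u (sc t y)) (add v (sc s y))"
        using u v y by (simp add: sc_add add_assoc add_closed sc_closed)
          (metis add_assoc add_comm sc_closed)
      then have "p (add (add u v) (sc (t + s) y)) \<le> p (add u (sc t y)) + p (add v (sc s y))"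
        using sublinear_add[OF p, of "add u (sc t y)" "add v (sc s y)"] u v y by (simp add: add_closed sc_closed)
      then show "q (add u v) - (p (add v (sc s y)) - s * p y) \<le> p (add u (sc t y)) - t * p y"
        using q_le[OF add_closed[OF u v], of "t + s"] s t by (simp add: algebra_simps)
    qed
    then have "q (add u v) - q u \<le> q v" by (intro q_ge) (simp add: algebra_simps)
    then show "q (add u v) \<le> q u + q v" by simp
  next
    fix u and r :: real assume u: "u \<in> V" and r: "r > 0"
    have "q (sc r u) / r \<le> q u"
    proof (rule q_ge)
      fix t :: real assume t: "t \<ge> 0"
      have "add (sc r u) (sc (r * t) y) = sc r (add u (sc t y))"
        using u y by (simp add: sc_distrib sc_assoc sc_closed)
      then have "p (add (sc r u) (sc (r * t) y)) = r * p (add u (sc t y))"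
        using sublinear_sc[OF p, of "add u (sc t y)" r] u y r by (simp add: add_closed sc_closed)
      then have "q (sc r u) \<le> r * p (add u (sc t y)) - r * t * p y"
        using q_le[OF sc_closed[OF u], of "r * t" r] r t by simp
      then show "q (sc r u) / r \<le> p (add u (sc t y)) - t * p y" using r by (simp add: field_simps)
    qed
    then show "q (sc r u) \<le> r * q u" using r by (simp add: field_simps)
  qed
  moreover have "q z \<le> p z" if "z \<in> V" for z
    using q_le[OF that, of 0] that y by (simp add: sc_zero add_zero)
  ultimately have "q x = p x" using min x unfolding minimal_sublinear_def by blast
  then show "p x + p y \<le> p (add x y)" using q_le[OF x, of 1] y by (simp add: sc_one)
qed

theorem Hahn_Banach_sublinear:
  assumes p0: "sublinear p0"
  obtains p where "\<And>x y. x \<in> V \<Longrightarrow> y \<in> V \<Longrightarrow> p (add x y) = p x + p y"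
    "\<And>x r. x \<in> V \<Longrightarrow> p (sc r x) = r * p x" "\<And>x. x \<in> V \<Longrightarrow> p x \<le> p0 x"
proof -
  obtain p where min: "minimal_sublinear p" and p0: "\<And>x. x \<in> V \<Longrightarrow> p x \<le> p0 x"
    using minimal_sublinear_exists[OF p0] by blast
  then have p: "sublinear p" by (simp add: minimal_sublinear_def)
  have add: "p (add x y) = p x + p y" if "x \<in> V" "y \<in> V" for x y
    using minimal_sublinear_additive[OF min that] .
  have "p (sc r x) = r * p x" if x: "x \<in> V" for x r
  proof -
    consider "r > 0" | "r = 0" | "r < 0" by linarith
    then show ?thesis
    proof cases
      case 1
      then show ?thesis using sublinear_sc[OF p x] by simp
    next
      case 2
      then show ?thesis using sublinear_zero[OF p] sc_zero[OF x] by simp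
    next
      case 3
      have "p (add (sc r x) (sc (- r) x)) = 0" using sc_add[OF x, of r "-r"] sc_zero[OF x] sublinear_zero[OF p] by simp
      then show ?thesis using add[OF sc_closed[OF x] sc_closed[OF x], of r "-r"] sublinear_sc[OF p x, of "-r"] 3 by simp
    qed
  qed
  then show ?thesis using that add p0 by blast
qed

end

section \<open>Positive elements of commutative C*-algebras\<close>

context normed_star_algebra
begin

lemma smult_in [simp, intro]: "x \<in> carrier B \<Longrightarrow> c \<odot> x \<in> carrier B"
  by (rule smult_closed) (simp_all add: complex_ring_def)

lemma smult_add_left: "x \<in> carrier B \<Longrightarrow> (a + b) \<odot> x = a \<odot> x \<oplus> b \<odot> x"
  using smult_l_distr[of a b x] by (simp add: complex_ring_def)

lemma smult_add_right: "\<lbrakk>x \<in> carrier B; y \<in> carrier B\<rbrakk> \<Longrightarrow> c \<odot> (x \<oplus> y) = c \<odot> x \<oplus> c \<odot> y"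
  using smult_r_distr[of c x y] by (simp add: complex_ring_def)

lemma smult_smult: "x \<in> carrier B \<Longrightarrow> a \<odot> (b \<odot> x) = (a * b) \<odot> x"
  using smult_assoc1[of a b x] by (simp add: complex_ring_def)

lemma smult_1 [simp]: "x \<in> carrier B \<Longrightarrow> 1 \<odot> x = x"
  using smult_one[of x] by (simp add: complex_ring_def)

lemma smult_0 [simp]: "x \<in> carrier B \<Longrightarrow> 0 \<odot> x = \<zero>"
  using smult_l_null[of x] by (simp add: complex_ring_def)

lemma smult_zero [simp]: "c \<odot> \<zero> = \<zero>"
  using smult_r_null[of c] by (simp add: complex_ring_def)

lemma smult_mult_left: "\<lbrakk>x \<in> carrier B; y \<in> carrier B\<rbrakk> \<Longrightarrow> (c \<odot> x) \<otimes> y = c \<odot> (x \<otimes> y)"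
  using smult_assoc2[of c x y] by (simp add: complex_ring_def)

lemma smult_mult_right: "\<lbrakk>x \<in> carrier B; y \<in> carrier B\<rbrakk> \<Longrightarrow> x \<otimes> (c \<odot> y) = c \<odot> (x \<otimes> y)"
  using smult_mult_left[of y x c] by (simp add: m_comm)

lemma uminus_smult: "x \<in> carrier B \<Longrightarrow> \<ominus> x = (-1) \<odot> x"
proof -
  assume x: "x \<in> carrier B"
  have "(-1) \<odot> x \<oplus> x = \<zero>"
    using smult_add_left[OF x, of "-1" 1] x by simp
  then show ?thesis using x by (intro M.minus_equality) auto
qed

lemma minus_smult: "\<lbrakk>x \<in> carrier B; y \<in> carrier B\<rbrakk> \<Longrightarrow> x \<ominus> y = x \<oplus> (-1) \<odot> y"
  by (simp add: M.minus_eq uminus_smult)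

lemma smult_minus_right: "\<lbrakk>x \<in> carrier B; y \<in> carrier B\<rbrakk> \<Longrightarrow> c \<odot> (x \<ominus> y) = c \<odot> x \<ominus> c \<odot> y"
  by (simp add: minus_smult smult_add_right smult_smult)

lemma cnorm_minus_triangle:
  "\<lbrakk>x \<in> carrier B; y \<in> carrier B\<rbrakk> \<Longrightarrow> cnorm B (x \<ominus> y) \<le> cnorm B x + cnorm B y"
  using cnorm_triangle[of x "(-1) \<odot> y"] cnorm_smult[of y "-1"] by (simp add: minus_smult)

lemma cnorm_zero [simp]: "cnorm B \<zero> = 0"
  by (simp add: cnorm_eq_0)

lemma eq_of_cnorm_minus: "\<lbrakk>x \<in> carrier B; y \<in> carrier B; cnorm B (x \<ominus> y) = 0\<rbrakk> \<Longrightarrow> x = y"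
  using zero[of x y] by (simp add: cdist_def)

lemma cstar_one [simp]: "cstar B \<one> = \<one>"
proof -
  have "cstar B \<one> \<otimes> \<one> = cstar B (cstar B \<one> \<otimes> \<one>)"
    using cstar_mult[of "cstar B \<one>" \<one>] by (simp add: cstar_closed cstar_cstar m_comm)
  then show ?thesis by (simp add: cstar_closed cstar_cstar)
qed

lemma cstar_minus: "\<lbrakk>x \<in> carrier B; y \<in> carrier B\<rbrakk> \<Longrightarrow> cstar B (x \<ominus> y) = cstar B x \<ominus> cstar B y"
  by (simp add: minus_smult cstar_add cstar_smult cstar_closed)

lemma cnorm_one_le: "cnorm B \<one> \<le> 1"
proof -
  have "cnorm B \<one> = (cnorm B \<one>)\<^sup>2" using cstar_identity[of \<one>] by simp
  then have "cnorm B \<one> = 0 \<or> cnorm B \<one> = 1" by (simp add: power2_eq_square)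
  then show ?thesis by auto
qed

lemma cnorm_cstar: "x \<in> carrier B \<Longrightarrow> cnorm B (cstar B x) = cnorm B x"
proof -
  have le: "cnorm B x \<le> cnorm B (cstar B x)" if x: "x \<in> carrier B" for x
  proof (cases "cnorm B x = 0")
    case True
    then show ?thesis using x by (simp add: cnorm_nonneg cstar_closed)
  next
    case False
    then have "cnorm B x > 0" using x cnorm_nonneg[of x] by simp
    moreover have "cnorm B x * cnorm B x \<le> cnorm B (cstar B x) * cnorm B x"
      using cstar_identity[of x] cnorm_mult[of "cstar B x" x] x by (simp add: cstar_closed power2_eq_square)
    ultimately show ?thesis by simp
  qed
  assume x: "x \<in> carrier B"
  show ?thesis using le[OF x] le[of "cstar B x"] x by (simp add: cstar_closed cstar_cstar)
qed

lemma mult_expand: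
  assumes "a \<in> carrier B" "s \<in> carrier B"
  shows "(a \<oplus> c \<odot> s) \<otimes> (a \<oplus> d \<odot> s) = a \<otimes> a \<oplus> (c + d) \<odot> (a \<otimes> s) \<oplus> (c * d) \<odot> (s \<otimes> s)"
  using assms
  by (simp add: l_distr r_distr smult_mult_left smult_mult_right smult_smult smult_add_left smult_add_right m_comm[of s a] M.a_ac mult.commute)

definition self_adjoint :: "'e \<Rightarrow> bool" where
  "self_adjoint x \<longleftrightarrow> x \<in> carrier B \<and> cstar B x = x"

lemma self_adjoint_intros:
  "self_adjoint \<one>" "self_adjoint \<zero>"
  "self_adjoint x \<Longrightarrow> self_adjoint y \<Longrightarrow> self_adjoint (x \<oplus> y)"
  "self_adjoint x \<Longrightarrow> self_adjoint y \<Longrightarrow> self_adjoint (x \<ominus> y)"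
  "self_adjoint x \<Longrightarrow> self_adjoint y \<Longrightarrow> self_adjoint (x \<otimes> y)"
  "self_adjoint x \<Longrightarrow> self_adjoint (complex_of_real r \<odot> x)"
proof -
  have "cstar B \<zero> = \<zero>" using cstar_smult[of \<zero> 0] by (simp add: cstar_closed)
  then show "self_adjoint \<zero>" by (simp add: self_adjoint_def)
qed (simp_all add: self_adjoint_def cstar_add cstar_minus cstar_mult cstar_smult m_comm)

definition re_part :: "'e \<Rightarrow> 'e" where
  "re_part x = (1/2) \<odot> (x \<oplus> cstar B x)"

definition im_part :: "'e \<Rightarrow> 'e" where
  "im_part x = (- \<i>/2) \<odot> (x \<ominus> cstar B x)"

lemma self_adjoint_re_part: "x \<in> carrier B \<Longrightarrow> self_adjoint (re_part x)"
  by (simp add: self_adjoint_def re_part_def cstar_smult cstar_add cstar_closed cstar_cstar M.a_comm)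

lemma self_adjoint_im_part: "x \<in> carrier B \<Longrightarrow> self_adjoint (im_part x)"
  by (simp add: self_adjoint_def im_part_def cstar_smult cstar_minus cstar_closed cstar_cstar)
     (simp add: minus_smult cstar_closed smult_add_right smult_smult M.a_comm)

lemma re_im_decomp: "x \<in> carrier B \<Longrightarrow> x = re_part x \<oplus> \<i> \<odot> im_part x"
proof -
  assume x: "x \<in> carrier B"
  have "re_part x \<oplus> \<i> \<odot> im_part x
      = ((1/2) \<odot> x \<oplus> (1/2) \<odot> cstar B x) \<oplus> ((1/2) \<odot> x \<oplus> (-1/2) \<odot> cstar B x)"
    using x by (simp add: re_part_def im_part_def minus_smult smult_add_right smult_smult cstar_closed)
  also have "\<dots> = ((1/2) \<odot> x \<oplus> (1/2) \<odot> x) \<oplus> ((1/2) \<odot> cstar B x \<oplus> (-1/2) \<odot> cstar B x)"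
    using x by (simp add: M.a_ac cstar_closed)
  also have "\<dots> = x" using x by (simp add: cstar_closed flip: smult_add_left)
  finally show ?thesis by simp
qed

lemma cnorm_re_part: "x \<in> carrier B \<Longrightarrow> cnorm B (re_part x) \<le> cnorm B x"
  using cnorm_triangle[of x "cstar B x"] by (simp add: re_part_def cnorm_smult cstar_closed cnorm_cstar)

lemma cnorm_im_part: "x \<in> carrier B \<Longrightarrow> cnorm B (im_part x) \<le> cnorm B x"
  using cnorm_minus_triangle[of x "cstar B x"] by (simp add: im_part_def cnorm_smult cstar_closed cnorm_cstar)

lemma parts_of_combination:
  assumes "self_adjoint a" "self_adjoint b"
  shows "re_part (a \<oplus> \<i> \<odot> b) = a" "im_part (a \<oplus> \<i> \<odot> b) = b"
proof -
  have ab: "a \<in> carrier B" "b \<in> carrier B" "cstar B a = a" "cstar B b = b"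
    using assms by (auto simp: self_adjoint_def)
  have st: "cstar B (a \<oplus> \<i> \<odot> b) = a \<oplus> (- \<i>) \<odot> b" using ab by (simp add: cstar_add cstar_smult)
  have "re_part (a \<oplus> \<i> \<odot> b) = ((1/2) \<odot> a \<oplus> (1/2) \<odot> a) \<oplus> ((\<i>/2) \<odot> b \<oplus> (-\<i>/2) \<odot> b)"
    unfolding re_part_def st using ab by (simp add: smult_add_right smult_smult M.a_ac)
  also have "\<dots> = a" using ab by (simp flip: smult_add_left)
  finally show "re_part (a \<oplus> \<i> \<odot> b) = a" .
  have "im_part (a \<oplus> \<i> \<odot> b) = ((-\<i>/2) \<odot> a \<oplus> (\<i>/2) \<odot> a) \<oplus> ((1/2) \<odot> b \<oplus> (1/2) \<odot> b)"
    unfolding im_part_def st using ab by (simp add: minus_smult smult_add_right smult_smult M.a_ac)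
  also have "\<dots> = b" using ab by (simp flip: smult_add_left)
  finally show "im_part (a \<oplus> \<i> \<odot> b) = b" .
qed

end

context comm_cstar_algebra
begin

text \<open>The solution of \<open>2 w = z + w\<^sup>2\<close> is the limit of the iteration \<open>w \<mapsto> (z + w\<^sup>2) / 2\<close>. Its norms and
  increments are dominated by those of the scalar iteration \<open>t \<mapsto> (1 + t\<^sup>2) / 2\<close>, which increases and is
  bounded by 1, so the sequence is Cauchy. This avoids the continuous functional calculus.\<close>

lemma sqrt_one_minus:
  assumes z: "self_adjoint z" "cnorm B z \<le> 1"
  obtains w where "self_adjoint w" "(\<one> \<ominus> w) \<otimes> (\<one> \<ominus> w) = \<one> \<ominus> z"
proof -
  define w where "w = rec_nat \<zero> (\<lambda>_ v. (1/2) \<odot> (z \<oplus> v \<otimes> v))"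
  \<comment> \<open>the scalar majorant\<close>
  define t where "t = rec_nat (0::real) (\<lambda>_ v. (1 + v * v) / 2)"
  have w0: "w 0 = \<zero>" and wS: "w (Suc n) = (1/2) \<odot> (z \<oplus> w n \<otimes> w n)" for n by (simp_all add: w_def)
  have t0: "t 0 = 0" and tS: "t (Suc n) = (1 + t n * t n) / 2" for n by (simp_all add: t_def)
  have zc: "z \<in> carrier B" using z by (simp add: self_adjoint_def)
  have wsa: "self_adjoint (w n)" for n
  proof (induction n)
    case 0
    then show ?case by (simp add: w0 self_adjoint_intros)
  next
    case (Suc n)
    then have "self_adjoint (complex_of_real (1/2) \<odot> (z \<oplus> w n \<otimes> w n))" using z by (intro self_adjoint_intros)
    then show ?case by (simp add: wS)
  qed
  then have wc [simp]: "w n \<in> carrier B" for n by (simp add: self_adjoint_def)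
  have t01: "0 \<le> t n \<and> t n \<le> 1" for n
  proof (induction n)
    case (Suc n)
    then have "t n * t n \<le> 1" using mult_le_one[of "t n" "t n"] by auto
    then show ?case using Suc by (simp add: tS)
  qed (simp add: t0)
  have tmono: "t n \<le> t (Suc n)" for n
  proof -
    have "0 \<le> (1 - t n) * (1 - t n)" by simp
    then show ?thesis by (simp add: tS algebra_simps)
  qed
  have diff: "(1/2) \<odot> (z \<oplus> x \<otimes> x) \<ominus> (1/2) \<odot> (z \<oplus> y \<otimes> y) = (1/2) \<odot> ((x \<ominus> y) \<otimes> (x \<oplus> y))"
    if x: "x \<in> carrier B" and y: "y \<in> carrier B" for x y
  proof -
    have "(z \<oplus> x \<otimes> x) \<ominus> (z \<oplus> y \<otimes> y) = (x \<ominus> y) \<otimes> (x \<oplus> y)" using x y zc by algebra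
    then show ?thesis using x y zc by (simp add: smult_minus_right[symmetric])
  qed
  have bd: "cnorm B (w n) \<le> t n" for n
  proof (induction n)
    case (Suc n)
    have "cnorm B (w (Suc n)) = cnorm B (z \<oplus> w n \<otimes> w n) / 2" using zc by (simp add: wS cnorm_smult)
    also have "\<dots> \<le> (cnorm B z + cnorm B (w n) * cnorm B (w n)) / 2"
      using cnorm_triangle[of z "w n \<otimes> w n"] cnorm_mult[of "w n" "w n"] zc by simp
    also have "\<dots> \<le> (1 + t n * t n) / 2"
      using z(2) Suc cnorm_nonneg[of "w n"] mult_mono[of "cnorm B (w n)" "t n" "cnorm B (w n)" "t n"] t01[of n] by simp
    finally show ?case by (simp add: tS)
  qed (simp add: w0 t0)
  have step: "cnorm B (w (Suc n) \<ominus> w n) \<le> t (Suc n) - t n" for n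
  proof (induction n)
    case 0
    have "cnorm B (w 1) \<le> t 1" by (rule bd)
    then show ?case by (simp add: w0 t0 M.minus_eq)
  next
    case (Suc n)
    have "w (Suc (Suc n)) \<ominus> w (Suc n) = (1/2) \<odot> ((w (Suc n) \<ominus> w n) \<otimes> (w (Suc n) \<oplus> w n))"
      unfolding wS[of "Suc n"] by (subst (2) wS) (rule diff, auto)
    then have "cnorm B (w (Suc (Suc n)) \<ominus> w (Suc n)) = cnorm B ((w (Suc n) \<ominus> w n) \<otimes> (w (Suc n) \<oplus> w n)) / 2"
      by (simp add: cnorm_smult)
    also have "\<dots> \<le> cnorm B (w (Suc n) \<ominus> w n) * cnorm B (w (Suc n) \<oplus> w n) / 2"
      using cnorm_mult[of "w (Suc n) \<ominus> w n" "w (Suc n) \<oplus> w n"] by simp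
    also have "\<dots> \<le> (t (Suc n) - t n) * (t (Suc n) + t n) / 2"
      using Suc cnorm_triangle[of "w (Suc n)" "w n"] bd[of n] bd[of "Suc n"] tmono[of n]
      by (intro divide_right_mono mult_mono) (auto intro: cnorm_nonneg order_trans)
    also have "\<dots> = t (Suc (Suc n)) - t (Suc n)"
    proof -
      have "(b - a) * (b + a) / 2 = (1 + b * b) / 2 - (1 + a * a) / 2" for a b :: real
        by (simp add: field_simps)
      then show ?thesis using tS[of n] tS[of "Suc n"] by presburger
    qed
    finally show ?case .
  qed
  have dist: "cnorm B (w (n + k) \<ominus> w n) \<le> t (n + k) - t n" for n k
  proof (induction k)
    case 0
    then show ?case by (simp add: M.minus_eq M.r_neg)
  next
    case (Suc k)
    have "w (n + Suc k) \<ominus> w n = (w (Suc (n + k)) \<ominus> w (n + k)) \<oplus> (w (n + k) \<ominus> w n)"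
      by (simp add: M.minus_eq M.a_assoc M.r_neg1)
    then show ?case
      using cnorm_triangle[of "w (Suc (n + k)) \<ominus> w (n + k)" "w (n + k) \<ominus> w n"] step[of "n + k"] Suc by simp
  qed
  have "convergent t"
    using t01 tmono by (intro Bseq_mono_convergent BseqI'[of t 1]) (auto simp: incseq_SucI intro: lift_Suc_mono_le)
  then have Ct: "Cauchy t" by (rule convergent_Cauchy)
  have "MCauchy w"
    unfolding MCauchy_def
  proof (intro conjI allI impI)
    show "range w \<subseteq> carrier B" by auto
    fix \<epsilon> :: real assume "\<epsilon> > 0"
    then obtain N where N: "\<And>m n. m \<ge> N \<Longrightarrow> n \<ge> N \<Longrightarrow> \<bar>t m - t n\<bar> < \<epsilon>"
      using Ct unfolding Cauchy_iff by force
    have le: "cdist B (w n) (w m) < \<epsilon>" if "N \<le> n" "n \<le> m" for n m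
      using dist[of n "m - n"] that N[of m n] by (simp add: cdist_def cnorm_minus_commute[of "w n" "w m"] abs_less_iff)
    have "cdist B (w n) (w m) < \<epsilon>" if "N \<le> n" "N \<le> m" for n m
      using le[of n m] le[of m n] that commute[of "w n" "w m"] by (cases "n \<le> m") auto
    then show "\<exists>N. \<forall>n n'. N \<le> n \<longrightarrow> N \<le> n' \<longrightarrow> cdist B (w n) (w n') < \<epsilon>" by blast
  qed
  then obtain l where l: "limitin mtopology w l sequentially" using complete by (auto simp: mcomplete_def)
  then have lc: "l \<in> carrier B" and conv: "\<And>\<epsilon>. \<epsilon> > 0 \<Longrightarrow> \<exists>N. \<forall>n\<ge>N. cnorm B (w n \<ominus> l) < \<epsilon>"
    by (auto simp: limit_metric_sequentially cdist_def)
  have d0: "(\<lambda>n. cnorm B (w n \<ominus> l)) \<longlonglongrightarrow> 0"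
    using conv lc by (intro LIMSEQ_I) (auto simp: cnorm_nonneg)
  have lsa: "cstar B l = l"
  proof -
    have "cnorm B (cstar B l \<ominus> l) \<le> cnorm B (w n \<ominus> l) + cnorm B (w n \<ominus> l)" for n
    proof -
      have "cnorm B (w n \<ominus> cstar B l) = cnorm B (w n \<ominus> l)"
        using cnorm_cstar[of "w n \<ominus> l"] lc wsa[of n] by (simp add: cstar_minus self_adjoint_def)
      moreover have "cstar B l \<ominus> l = (w n \<ominus> l) \<ominus> (w n \<ominus> cstar B l)"
      proof -
        have "cstar B l \<in> carrier B" "w n \<in> carrier B" using lc by (auto simp: cstar_closed)
        then show ?thesis using lc by algebra
      qed
      ultimately show ?thesis
        using cnorm_minus_triangle[of "w n \<ominus> l" "w n \<ominus> cstar B l"] lc by (simp add: cstar_closed)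
    qed
    then have "cnorm B (cstar B l \<ominus> l) \<le> 0 + 0"
      by (intro LIMSEQ_le_const[OF tendsto_add[OF d0 d0]]) auto
    then have "cnorm B (cstar B l \<ominus> l) = 0" using cnorm_nonneg[of "cstar B l \<ominus> l"] lc by (simp add: cstar_closed)
    then show ?thesis using lc by (intro eq_of_cnorm_minus) (simp_all add: cstar_closed)
  qed
  define l' where "l' = (1/2) \<odot> (z \<oplus> l \<otimes> l)"
  have l'c: "l' \<in> carrier B" using zc lc by (simp add: l'_def)
  have l_fix: "l = l'"
  proof -
    have "cnorm B (l' \<ominus> l) \<le> cnorm B (w n \<ominus> l) * (1 + cnorm B l) / 2 + cnorm B (w (Suc n) \<ominus> l)" for n
    proof -
      have "w (Suc n) \<ominus> l' = (1/2) \<odot> ((w n \<ominus> l) \<otimes> (w n \<oplus> l))" unfolding wS l'_def using lc by (intro diff) auto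
      then have "cnorm B (w (Suc n) \<ominus> l') = cnorm B ((w n \<ominus> l) \<otimes> (w n \<oplus> l)) / 2" using lc by (simp add: cnorm_smult)
      also have "\<dots> \<le> cnorm B (w n \<ominus> l) * cnorm B (w n \<oplus> l) / 2" using lc by (simp add: cnorm_mult)
      also have "\<dots> \<le> cnorm B (w n \<ominus> l) * (1 + cnorm B l) / 2"
        using cnorm_triangle[of "w n" l] bd[of n] t01[of n] lc
        by (intro divide_right_mono mult_left_mono) (auto simp: cnorm_nonneg)
      finally have "cnorm B (w (Suc n) \<ominus> l') \<le> cnorm B (w n \<ominus> l) * (1 + cnorm B l) / 2" .
      moreover have "l' \<ominus> l = (w (Suc n) \<ominus> l) \<ominus> (w (Suc n) \<ominus> l')"
      proof -
        have "w (Suc n) \<in> carrier B" by simp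
        then show ?thesis using lc l'c by algebra
      qed
      ultimately show ?thesis
        using cnorm_minus_triangle[of "w (Suc n) \<ominus> l" "w (Suc n) \<ominus> l'"] lc l'c by simp
    qed
    then have "cnorm B (l' \<ominus> l) \<le> 0 * (1 + cnorm B l) / 2 + 0"
      by (intro LIMSEQ_le_const[OF tendsto_add[OF tendsto_divide[OF tendsto_mult[OF d0 tendsto_const] tendsto_const] LIMSEQ_Suc[OF d0]]]) auto
    then have "cnorm B (l' \<ominus> l) = 0" using cnorm_nonneg[of "l' \<ominus> l"] lc l'c by simp
    then show ?thesis using lc l'c eq_of_cnorm_minus[of l' l] by simp
  qed
  have "l \<oplus> l = z \<oplus> l \<otimes> l"
  proof -
    have "l \<oplus> l = (1/2) \<odot> (z \<oplus> l \<otimes> l) \<oplus> (1/2) \<odot> (z \<oplus> l \<otimes> l)" using l_fix by (simp add: l'_def)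
    also have "\<dots> = z \<oplus> l \<otimes> l" using zc lc by (simp flip: smult_add_left)
    finally show ?thesis .
  qed
  then have "l \<otimes> l = (l \<oplus> l) \<ominus> z" using zc lc by algebra
  then have "(\<one> \<ominus> l) \<otimes> (\<one> \<ominus> l) = \<one> \<ominus> z"
  proof -
    assume *: "l \<otimes> l = (l \<oplus> l) \<ominus> z"
    have "(\<one> \<ominus> l) \<otimes> (\<one> \<ominus> l) = \<one> \<ominus> (l \<oplus> l) \<oplus> l \<otimes> l" using lc by algebra
    then show ?thesis unfolding * using lc zc by algebra
  qed
  then show ?thesis using lsa lc by (intro that[of l]) (simp_all add: self_adjoint_def)
qed

text \<open>For a real function \<open>x\<close> this says \<open>0 \<le> x \<le> 2 t\<close>. Unlike the existence of a square root, it is visibly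
  preserved by sums.\<close>

definition near_scalar :: "'a \<Rightarrow> bool" where
  "near_scalar x \<longleftrightarrow> self_adjoint x \<and> (\<exists>t\<ge>0. cnorm B (complex_of_real t \<odot> \<one> \<ominus> x) \<le> t)"

lemma near_scalar_add:
  assumes "near_scalar x" "near_scalar y" shows "near_scalar (x \<oplus> y)"
proof -
  obtain s t where st: "s \<ge> 0" "t \<ge> 0" "cnorm B (complex_of_real s \<odot> \<one> \<ominus> x) \<le> s" "cnorm B (complex_of_real t \<odot> \<one> \<ominus> y) \<le> t"
    using assms by (auto simp: near_scalar_def)
  have c: "x \<in> carrier B" "y \<in> carrier B" using assms by (auto simp: near_scalar_def self_adjoint_def)
  have "complex_of_real (s + t) \<odot> \<one> \<ominus> (x \<oplus> y) = (complex_of_real s \<odot> \<one> \<ominus> x) \<oplus> (complex_of_real t \<odot> \<one> \<ominus> y)"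
  proof -
    have "complex_of_real s \<odot> \<one> \<in> carrier B" "complex_of_real t \<odot> \<one> \<in> carrier B" by auto
    then have "(complex_of_real s \<odot> \<one> \<oplus> complex_of_real t \<odot> \<one>) \<ominus> (x \<oplus> y) = (complex_of_real s \<odot> \<one> \<ominus> x) \<oplus> (complex_of_real t \<odot> \<one> \<ominus> y)"
      using c by algebra
    then show ?thesis by (simp add: smult_add_left)
  qed
  then have "cnorm B (complex_of_real (s + t) \<odot> \<one> \<ominus> (x \<oplus> y)) \<le> s + t"
    using cnorm_triangle[of "complex_of_real s \<odot> \<one> \<ominus> x" "complex_of_real t \<odot> \<one> \<ominus> y"] st c by simp
  then show ?thesis using assms st by (auto simp: near_scalar_def intro!: self_adjoint_intros exI[of _ "s + t"])
qed

text \<open>For \<open>b\<close> of norm at most 1 let \<open>s\<close> be a self-adjoint square root of \<open>1 - b\<^sup>2\<close>. Then \<open>u = b + \<i> s\<close>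
  satisfies \<open>u* u = b\<^sup>2 + s\<^sup>2 = 1\<close>, so it has norm at most 1. Its imaginary part \<open>s\<close> therefore has norm
  at most 1, and so has \<open>s\<^sup>2 = 1 - b\<^sup>2\<close>.\<close>

lemma near_scalar_square:
  assumes a: "self_adjoint a" shows "near_scalar (a \<otimes> a)"
proof -
  have unit: "cnorm B (\<one> \<ominus> b \<otimes> b) \<le> 1" if b: "self_adjoint b" "cnorm B b \<le> 1" for b
  proof -
    have bc: "b \<in> carrier B" using b by (simp add: self_adjoint_def)
    have "cnorm B (b \<otimes> b) \<le> 1"
      using cnorm_mult[of b b] b(2) bc cnorm_nonneg[of b] mult_le_one[of "cnorm B b" "cnorm B b"] by simp
    then obtain w where w: "self_adjoint w" "(\<one> \<ominus> w) \<otimes> (\<one> \<ominus> w) = \<one> \<ominus> b \<otimes> b"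
      using sqrt_one_minus[of "b \<otimes> b"] b(1) self_adjoint_intros(5) by blast
    define s where "s = \<one> \<ominus> w"
    have s: "self_adjoint s" unfolding s_def using w(1) by (intro self_adjoint_intros)
    have sc: "s \<in> carrier B" using s by (simp add: self_adjoint_def)
    define u where "u = b \<oplus> \<i> \<odot> s"
    have uc: "u \<in> carrier B" using bc sc by (simp add: u_def)
    have star: "cstar B u = b \<oplus> (- \<i>) \<odot> s"
      using b(1) s by (simp add: u_def self_adjoint_def cstar_add cstar_smult)
    have "cstar B u \<otimes> u = b \<otimes> b \<oplus> s \<otimes> s"
      unfolding star using mult_expand[OF bc sc, of "- \<i>" \<i>] bc sc by (simp add: u_def)
    also have "\<dots> = b \<otimes> b \<oplus> (\<one> \<ominus> b \<otimes> b)" using w(2) by (simp add: s_def)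
    also have "\<dots> = \<one>" using bc by algebra
    finally have "(cnorm B u)\<^sup>2 \<le> 1" using cstar_identity[OF uc] cnorm_one_le by simp
    then have u1: "cnorm B u \<le> 1" using power2_le_imp_le[of "cnorm B u" 1] by simp
    have "im_part u = s" unfolding u_def using b(1) s by (rule parts_of_combination)
    then have "cnorm B s \<le> 1" using cnorm_im_part[OF uc] u1 by simp
    then have "cnorm B (s \<otimes> s) \<le> 1"
      using cnorm_mult[of s s] sc cnorm_nonneg[of s] mult_le_one[of "cnorm B s" "cnorm B s"] by simp
    then show ?thesis using w(2) by (simp add: s_def)
  qed
  have ac: "a \<in> carrier B" using a by (simp add: self_adjoint_def)
  define r where "r = cnorm B a"
  have r0: "r \<ge> 0" using ac by (simp add: r_def cnorm_nonneg)
  have "cnorm B (complex_of_real (r\<^sup>2) \<odot> \<one> \<ominus> a \<otimes> a) \<le> r\<^sup>2"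
  proof (cases "r = 0")
    case True
    then have "a = \<zero>" using ac by (simp add: r_def cnorm_eq_0)
    then show ?thesis using True by (simp add: M.minus_eq)
  next
    case False
    define b where "b = complex_of_real (1 / r) \<odot> a"
    have b: "self_adjoint b" unfolding b_def using a by (rule self_adjoint_intros)
    have "cnorm B b \<le> 1" using ac False r0 unfolding b_def by (subst cnorm_smult) (simp_all add: r_def norm_divide)
    then have "cnorm B (\<one> \<ominus> b \<otimes> b) \<le> 1" by (rule unit[OF b])
    moreover have "complex_of_real (r\<^sup>2) \<odot> (\<one> \<ominus> b \<otimes> b) = complex_of_real (r\<^sup>2) \<odot> \<one> \<ominus> a \<otimes> a"
    proof -
      have "complex_of_real (r\<^sup>2) \<odot> (b \<otimes> b) = a \<otimes> a"
        using ac False by (simp add: b_def smult_mult_left smult_mult_right smult_smult power2_eq_square)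
      then show ?thesis using ac by (simp add: smult_minus_right b_def)
    qed
    moreover have "cnorm B (complex_of_real (r\<^sup>2) \<odot> (\<one> \<ominus> b \<otimes> b)) = r\<^sup>2 * cnorm B (\<one> \<ominus> b \<otimes> b)"
      using b by (subst cnorm_smult) (auto simp: self_adjoint_def norm_power)
    ultimately show ?thesis using mult_left_le[of "cnorm B (\<one> \<ominus> b \<otimes> b)" "r\<^sup>2"] by simp
  qed
  then show ?thesis using a unfolding near_scalar_def
    by (intro conjI exI[of _ "r\<^sup>2"]) (auto intro: self_adjoint_intros)
qed

text \<open>If \<open>y = a + \<i> b\<close> with \<open>a\<close> and \<open>b\<close> self-adjoint, then \<open>y* y = a\<^sup>2 + b\<^sup>2\<close>. Conversely, if \<open>x\<close> is within
  \<open>t\<close> of \<open>t 1\<close>, then \<open>x = t (1 - z)\<close> with \<open>z\<close> of norm at most 1, and \<open>1 - z\<close> has a square root.\<close>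

lemma cstar_nonneg_iff_near_scalar: "cstar_nonneg B x \<longleftrightarrow> near_scalar x"
proof
  assume "cstar_nonneg B x"
  then obtain y where y: "y \<in> carrier B" "x = cstar B y \<otimes> y" by (auto simp: cstar_nonneg_def)
  define a where "a = re_part y"
  define b where "b = im_part y"
  have a: "self_adjoint a" and b: "self_adjoint b"
    using y by (auto simp: a_def b_def self_adjoint_re_part self_adjoint_im_part)
  have yab: "y = a \<oplus> \<i> \<odot> b" using re_im_decomp[OF y(1)] by (simp add: a_def b_def)
  have star: "cstar B y = a \<oplus> (- \<i>) \<odot> b"
    unfolding yab using a b by (simp add: self_adjoint_def cstar_add cstar_smult)
  have "x = a \<otimes> a \<oplus> b \<otimes> b"
    unfolding y(2) star by (subst yab) (use mult_expand[of a b "- \<i>" \<i>] a b in \<open>simp add: self_adjoint_def\<close>)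
  then show "near_scalar x" using near_scalar_add near_scalar_square a b by simp
next
  assume x: "near_scalar x"
  then obtain t where t: "t \<ge> 0" "cnorm B (complex_of_real t \<odot> \<one> \<ominus> x) \<le> t" and sa: "self_adjoint x"
    by (auto simp: near_scalar_def)
  have xc: "x \<in> carrier B" using sa by (simp add: self_adjoint_def)
  show "cstar_nonneg B x"
  proof (cases "t = 0")
    case True
    then have "cnorm B (\<zero> \<ominus> x) = 0" using t(2) cnorm_nonneg[of "\<zero> \<ominus> x"] xc by simp
    then have "x = \<zero>" using eq_of_cnorm_minus[of \<zero> x] xc by simp
    then show ?thesis unfolding cstar_nonneg_def by (intro bexI[of _ \<zero>]) (auto simp: cstar_closed)
  next
    case False
    then have tp: "t > 0" using t(1) by simp
    define z where "z = complex_of_real (1 / t) \<odot> (complex_of_real t \<odot> \<one> \<ominus> x)"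
    have z: "self_adjoint z" unfolding z_def using sa by (intro self_adjoint_intros)
    have "cnorm B z = (1 / t) * cnorm B (complex_of_real t \<odot> \<one> \<ominus> x)"
      unfolding z_def using xc tp by (subst cnorm_smult) (simp_all add: norm_divide)
    then have "cnorm B z \<le> 1" using t(2) tp by (simp add: divide_le_eq_1_pos)
    then obtain w where w: "self_adjoint w" "(\<one> \<ominus> w) \<otimes> (\<one> \<ominus> w) = \<one> \<ominus> z"
      using sqrt_one_minus[OF z] by blast
    define s where "s = \<one> \<ominus> w"
    have s: "self_adjoint s" unfolding s_def using w(1) by (intro self_adjoint_intros)
    have sc: "s \<in> carrier B" using s by (simp add: self_adjoint_def)
    define y where "y = complex_of_real (sqrt t) \<odot> s"
    have sq: "complex_of_real (sqrt t) * complex_of_real (sqrt t) = complex_of_real t"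
      using t(1) by (simp flip: of_real_mult)
    have "cstar B y \<otimes> y = (complex_of_real (sqrt t) * complex_of_real (sqrt t)) \<odot> (s \<otimes> s)"
      using s sc by (simp add: y_def self_adjoint_def cstar_smult smult_mult_left smult_mult_right smult_smult)
    also have "\<dots> = complex_of_real t \<odot> (\<one> \<ominus> z)" using w(2) by (simp add: s_def sq)
    also have "\<dots> = x"
    proof -
      have "complex_of_real t \<odot> z = complex_of_real t \<odot> \<one> \<ominus> x"
        using xc tp by (simp add: z_def smult_smult)
      moreover have "z \<in> carrier B" using z by (simp add: self_adjoint_def)
      ultimately have "complex_of_real t \<odot> (\<one> \<ominus> z) = complex_of_real t \<odot> \<one> \<ominus> (complex_of_real t \<odot> \<one> \<ominus> x)"
        by (simp add: smult_minus_right)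
      moreover have "complex_of_real t \<odot> \<one> \<in> carrier B" by simp
      then have "complex_of_real t \<odot> \<one> \<ominus> (complex_of_real t \<odot> \<one> \<ominus> x) = x" using xc by algebra
      ultimately show ?thesis by simp
    qed
    finally show ?thesis unfolding cstar_nonneg_def using sc by (intro bexI[of _ y]) (auto simp: y_def)
  qed
qed

lemma minus_add_cancel: "\<lbrakk>e \<in> carrier B; x \<in> carrier B; r \<in> carrier B\<rbrakk> \<Longrightarrow> (e \<ominus> x) \<oplus> (r \<oplus> x) = e \<oplus> r"
  by algebra

lemma add_minus_add:
  "\<lbrakk>e \<in> carrier B; f \<in> carrier B; x \<in> carrier B; y \<in> carrier B\<rbrakk> \<Longrightarrow> (e \<oplus> f) \<ominus> (x \<oplus> y) = (e \<ominus> x) \<oplus> (f \<ominus> y)"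
  by algebra

lemma cstar_nonneg_self_adjoint: "cstar_nonneg B x \<Longrightarrow> self_adjoint x"
  by (simp add: cstar_nonneg_iff_near_scalar near_scalar_def)

lemma cstar_nonneg_add: "cstar_nonneg B x \<Longrightarrow> cstar_nonneg B y \<Longrightarrow> cstar_nonneg B (x \<oplus> y)"
  by (simp add: cstar_nonneg_iff_near_scalar near_scalar_add)

lemma cstar_nonneg_scale:
  assumes "cstar_nonneg B x" "r \<ge> 0" shows "cstar_nonneg B (complex_of_real r \<odot> x)"
proof -
  obtain y where y: "y \<in> carrier B" "x = cstar B y \<otimes> y" using assms by (auto simp: cstar_nonneg_def)
  have "complex_of_real r = complex_of_real (sqrt r) * complex_of_real (sqrt r)"
    using assms(2) by (simp flip: of_real_mult)
  then have "complex_of_real r \<odot> x = cstar B (complex_of_real (sqrt r) \<odot> y) \<otimes> (complex_of_real (sqrt r) \<odot> y)"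
    using y by (simp add: cstar_smult smult_mult_left smult_mult_right smult_smult cstar_closed)
  then show ?thesis unfolding cstar_nonneg_def using y(1) by (intro bexI[of _ "complex_of_real (sqrt r) \<odot> y"]) auto
qed

lemma cstar_nonneg_norm_minus:
  assumes x: "self_adjoint x" and r: "cnorm B x \<le> r"
  shows "cstar_nonneg B (complex_of_real r \<odot> \<one> \<ominus> x)" "cstar_nonneg B (complex_of_real r \<odot> \<one> \<oplus> x)"
proof -
  have xc: "x \<in> carrier B" using x by (simp add: self_adjoint_def)
  have r0: "r \<ge> 0" using r cnorm_nonneg[OF xc] by simp
  have rc: "complex_of_real r \<odot> \<one> \<in> carrier B" by simp
  have "complex_of_real r \<odot> \<one> \<ominus> (complex_of_real r \<odot> \<one> \<ominus> x) = x" using rc xc by algebra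
  then show "cstar_nonneg B (complex_of_real r \<odot> \<one> \<ominus> x)"
    unfolding cstar_nonneg_iff_near_scalar near_scalar_def using x r r0
    by (intro conjI exI[of _ r]) (auto intro!: self_adjoint_intros)
  have "complex_of_real r \<odot> \<one> \<ominus> (complex_of_real r \<odot> \<one> \<oplus> x) = \<ominus> x" using rc xc by algebra
  then have "cnorm B (complex_of_real r \<odot> \<one> \<ominus> (complex_of_real r \<odot> \<one> \<oplus> x)) \<le> r"
    using r cnorm_smult[of x "-1"] xc by (simp add: uminus_smult)
  then show "cstar_nonneg B (complex_of_real r \<odot> \<one> \<oplus> x)"
    unfolding cstar_nonneg_iff_near_scalar near_scalar_def using x r0
    by (intro conjI exI[of _ r]) (auto intro!: self_adjoint_intros)
qed

end

section \<open>States on function systems and their extension\<close>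

definition functional_state :: "('e, 'm) cstar_algebra_scheme \<Rightarrow> 'e set \<Rightarrow> ('e \<Rightarrow> complex) \<Rightarrow> bool" where
  "functional_state B E \<phi> \<longleftrightarrow>
     \<phi> \<one>\<^bsub>B\<^esub> = 1 \<and> (\<forall>x\<in>E. \<forall>y\<in>E. \<phi> (x \<oplus>\<^bsub>B\<^esub> y) = \<phi> x + \<phi> y) \<and>
     (\<forall>c. \<forall>x\<in>E. \<phi> (c \<odot>\<^bsub>B\<^esub> x) = c * \<phi> x) \<and>
     (\<forall>x\<in>E. cstar_nonneg B x \<longrightarrow> \<phi> x \<in> \<real>\<^sub>\<ge>\<^sub>0)"

locale function_system_in = comm_cstar_algebra B for B :: "('e, 'm) cstar_algebra_scheme" (structure) +
  fixes E :: "'e set"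
  assumes function_system: "function_system B E"
begin

lemma submodule_E: "submodule E complex_ring B"
  using function_system by (simp add: function_system_def)

lemma E_carrier: "x \<in> E \<Longrightarrow> x \<in> carrier B"
  using submoduleE(1)[OF submodule_E] by blast

lemma E_one: "\<one> \<in> E" and E_cstar: "x \<in> E \<Longrightarrow> cstar B x \<in> E"
  using function_system by (simp_all add: function_system_def)

lemma E_add: "\<lbrakk>x \<in> E; y \<in> E\<rbrakk> \<Longrightarrow> x \<oplus> y \<in> E"
  using submoduleE(5)[OF submodule_E] by blast

lemma E_smult: "x \<in> E \<Longrightarrow> c \<odot> x \<in> E"
  using submoduleE(4)[OF submodule_E, of c x] by (simp add: complex_ring_def)

lemma E_minus: "\<lbrakk>x \<in> E; y \<in> E\<rbrakk> \<Longrightarrow> x \<ominus> y \<in> E"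
  by (simp add: minus_smult E_carrier E_add E_smult)

lemma E_zero: "\<zero> \<in> E"
  using E_smult[OF E_one, of 0] by simp

lemma E_re_part: "x \<in> E \<Longrightarrow> re_part x \<in> E" and E_im_part: "x \<in> E \<Longrightarrow> im_part x \<in> E"
  by (simp_all add: re_part_def im_part_def E_smult E_add E_minus E_cstar)

context
  fixes \<phi> assumes \<phi>: "functional_state B E \<phi>"
begin

lemma functional_one: "\<phi> \<one> = 1"
  and functional_add: "\<lbrakk>x \<in> E; y \<in> E\<rbrakk> \<Longrightarrow> \<phi> (x \<oplus> y) = \<phi> x + \<phi> y"
  and functional_smult: "x \<in> E \<Longrightarrow> \<phi> (c \<odot> x) = c * \<phi> x"
  and functional_nonneg: "\<lbrakk>x \<in> E; cstar_nonneg B x\<rbrakk> \<Longrightarrow> \<phi> x \<in> \<real>\<^sub>\<ge>\<^sub>0"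
  using \<phi> by (auto simp: functional_state_def)

lemma functional_minus: "\<lbrakk>x \<in> E; y \<in> E\<rbrakk> \<Longrightarrow> \<phi> (x \<ominus> y) = \<phi> x - \<phi> y"
  using functional_add[of x "(-1) \<odot> y"] functional_smult[of y "-1"] by (simp add: minus_smult E_carrier E_smult)

lemma functional_self_adjoint:
  assumes x: "x \<in> E" "self_adjoint x"
  shows "Im (\<phi> x) = 0" "\<bar>Re (\<phi> x)\<bar> \<le> cnorm B x"
proof -
  let ?r = "cnorm B x"
  have r: "complex_of_real ?r \<odot> \<one> \<in> E" using E_one by (rule E_smult)
  have "\<phi> (complex_of_real ?r \<odot> \<one> \<ominus> x) \<in> \<real>\<^sub>\<ge>\<^sub>0" "\<phi> (complex_of_real ?r \<odot> \<one> \<oplus> x) \<in> \<real>\<^sub>\<ge>\<^sub>0"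
    using cstar_nonneg_norm_minus[OF x(2) order_refl] x(1) r by (auto intro!: functional_nonneg E_minus E_add)
  then have "complex_of_real ?r - \<phi> x \<in> \<real>\<^sub>\<ge>\<^sub>0" "complex_of_real ?r + \<phi> x \<in> \<real>\<^sub>\<ge>\<^sub>0"
    using x(1) r by (simp_all add: functional_minus functional_add functional_smult E_one functional_one)
  then show "Im (\<phi> x) = 0" "\<bar>Re (\<phi> x)\<bar> \<le> ?r" by (auto simp: complex_nonneg_Reals_iff)
qed

lemma functional_bound:
  assumes x: "x \<in> E" shows "cmod (\<phi> x) \<le> 2 * cnorm B x"
proof -
  have xc: "x \<in> carrier B" using x by (rule E_carrier)
  have sa: "self_adjoint (re_part x)" "self_adjoint (im_part x)"
    using xc by (simp_all add: self_adjoint_re_part self_adjoint_im_part)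
  have c: "cmod (\<phi> y) \<le> cnorm B y" if "y \<in> E" "self_adjoint y" for y
    using functional_self_adjoint[OF that] by (simp add: cmod_def)
  have "\<phi> x = \<phi> (re_part x \<oplus> \<i> \<odot> im_part x)" using re_im_decomp[OF xc] by simp
  also have "\<dots> = \<phi> (re_part x) + \<i> * \<phi> (im_part x)"
    using x by (simp add: functional_add functional_smult E_re_part E_im_part E_smult)
  also have "cmod \<dots> \<le> cmod (\<phi> (re_part x)) + cmod (\<phi> (im_part x))"
    using norm_triangle_ineq[of "\<phi> (re_part x)" "\<i> * \<phi> (im_part x)"] by (simp add: norm_mult)
  also have "\<dots> \<le> cnorm B x + cnorm B x"
    using c[OF E_re_part[OF x] sa(1)] c[OF E_im_part[OF x] sa(2)] cnorm_re_part[OF xc] cnorm_im_part[OF xc] by simp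
  finally show ?thesis by simp
qed

end

end

text \<open>On the self-adjoint part, \<open>p0 x\<close> is the infimum of \<open>\<phi> e\<close> over the self-adjoint \<open>e \<ge> x\<close> in \<open>E1\<close>. A
  linear functional \<open>p\<close> below \<open>p0\<close> agrees with \<open>\<phi>\<close> on \<open>E1\<close>, where an element dominates itself, and it
  is positive because \<open>0\<close> dominates \<open>- x\<close> for positive \<open>x\<close>. Finally \<open>p\<close> is extended complex-linearly.\<close>

lemma state_extension:
  assumes E1: "function_system_in B E1" and E2: "function_system_in B E2" and sub: "E1 \<subseteq> E2"
    and \<phi>: "functional_state B E1 \<phi>"
  obtains \<Phi> where "functional_state B E2 \<Phi>" "\<And>x. x \<in> E1 \<Longrightarrow> \<Phi> x = \<phi> x"
proof -
  interpret C: comm_cstar_algebra B using E1 by (rule function_system_in.axioms)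
  interpret E1: function_system_in B E1 by fact
  interpret E2: function_system_in B E2 by fact
  define V where "V = {x \<in> E2. C.self_adjoint x}"
  interpret V: real_vector_on V "\<lambda>x y. x \<oplus>\<^bsub>B\<^esub> y" "\<lambda>r x. complex_of_real r \<odot>\<^bsub>B\<^esub> x" "\<zero>\<^bsub>B\<^esub>"
    by unfold_locales
       (auto simp: V_def E2.E_add E2.E_smult E2.E_zero E2.E_carrier C.smult_add_left C.smult_add_right C.smult_smult
          C.M.a_ac intro: C.self_adjoint_intros)
  define up where "up x = {e \<in> E1. C.self_adjoint e \<and> cstar_nonneg B (e \<ominus>\<^bsub>B\<^esub> x)}" for x
  define p0 where "p0 x = (INF e\<in>up x. Re (\<phi> e))" for x
  have upI: "complex_of_real (cnorm B x) \<odot>\<^bsub>B\<^esub> \<one>\<^bsub>B\<^esub> \<in> up x" if "x \<in> V" for x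
    using that C.cstar_nonneg_norm_minus(1)[of x "cnorm B x"]
    by (auto simp: up_def V_def intro!: E1.E_smult E1.E_one C.self_adjoint_intros)
  have lower: "- cnorm B x \<le> Re (\<phi> e)" if x: "x \<in> V" and e: "e \<in> up x" for x e
  proof -
    let ?r = "complex_of_real (cnorm B x) \<odot>\<^bsub>B\<^esub> \<one>\<^bsub>B\<^esub>"
    have c: "e \<in> carrier B" "x \<in> carrier B" "?r \<in> carrier B"
      using x e by (auto simp: V_def up_def E1.E_carrier E2.E_carrier)
    have "cstar_nonneg B ((e \<ominus>\<^bsub>B\<^esub> x) \<oplus>\<^bsub>B\<^esub> (?r \<oplus>\<^bsub>B\<^esub> x))"
      using x e C.cstar_nonneg_norm_minus(2)[of x "cnorm B x"]
      by (intro C.cstar_nonneg_add[of "e \<ominus>\<^bsub>B\<^esub> x"]) (auto simp: V_def up_def)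
    moreover have "(e \<ominus>\<^bsub>B\<^esub> x) \<oplus>\<^bsub>B\<^esub> (?r \<oplus>\<^bsub>B\<^esub> x) = e \<oplus>\<^bsub>B\<^esub> ?r" using c by (rule C.minus_add_cancel)
    ultimately have "\<phi> (e \<oplus>\<^bsub>B\<^esub> ?r) \<in> \<real>\<^sub>\<ge>\<^sub>0"
      using e by (intro E1.functional_nonneg[OF \<phi>] E1.E_add E1.E_smult E1.E_one) (auto simp: up_def)
    then show ?thesis
      using e by (simp add: E1.functional_add[OF \<phi>] E1.functional_smult[OF \<phi>] E1.functional_one[OF \<phi>] E1.E_smult E1.E_one up_def complex_nonneg_Reals_iff)
  qed
  have p0_le: "p0 x \<le> Re (\<phi> e)" if "x \<in> V" "e \<in> up x" for x e
    unfolding p0_def using that lower by (intro cINF_lower) (auto intro!: bdd_belowI2)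
  have p0_ge: "c \<le> p0 x" if "x \<in> V" "\<And>e. e \<in> up x \<Longrightarrow> c \<le> Re (\<phi> e)" for c x
    unfolding p0_def using that upI by (intro cINF_greatest) auto
  have "V.sublinear p0"
    unfolding V.sublinear_def
  proof (intro conjI ballI allI impI)
    fix x y assume x: "x \<in> V" and y: "y \<in> V"
    have "p0 (x \<oplus>\<^bsub>B\<^esub> y) - Re (\<phi> f) \<le> p0 x" if f: "f \<in> up y" for f
    proof (rule p0_ge[OF x])
      fix e assume e: "e \<in> up x"
      have c: "e \<in> carrier B" "f \<in> carrier B" "x \<in> carrier B" "y \<in> carrier B"
        using x y e f by (auto simp: V_def up_def E1.E_carrier E2.E_carrier)
      have "(e \<oplus>\<^bsub>B\<^esub> f) \<ominus>\<^bsub>B\<^esub> (x \<oplus>\<^bsub>B\<^esub> y) = (e \<ominus>\<^bsub>B\<^esub> x) \<oplus>\<^bsub>B\<^esub> (f \<ominus>\<^bsub>B\<^esub> y)" using c by (rule C.add_minus_add)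
      then have "e \<oplus>\<^bsub>B\<^esub> f \<in> up (x \<oplus>\<^bsub>B\<^esub> y)"
        using e f by (auto simp: up_def intro!: E1.E_add C.self_adjoint_intros C.cstar_nonneg_add)
      then show "p0 (x \<oplus>\<^bsub>B\<^esub> y) - Re (\<phi> f) \<le> Re (\<phi> e)"
        using p0_le[OF V.add_closed[OF x y]] e f by (force simp: up_def E1.functional_add[OF \<phi>])
    qed
    then have "p0 (x \<oplus>\<^bsub>B\<^esub> y) - p0 x \<le> p0 y" by (intro p0_ge[OF y]) (simp add: algebra_simps)
    then show "p0 (x \<oplus>\<^bsub>B\<^esub> y) \<le> p0 x + p0 y" by simp
  next
    fix x and r :: real assume x: "x \<in> V" and r: "r > 0"
    have "p0 (complex_of_real r \<odot>\<^bsub>B\<^esub> x) / r \<le> p0 x"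
    proof (rule p0_ge[OF x])
      fix e assume e: "e \<in> up x"
      have c: "e \<in> carrier B" "x \<in> carrier B" using x e by (auto simp: V_def up_def E1.E_carrier E2.E_carrier)
      have "complex_of_real r \<odot>\<^bsub>B\<^esub> e \<in> up (complex_of_real r \<odot>\<^bsub>B\<^esub> x)"
        using e r c C.cstar_nonneg_scale[of "e \<ominus>\<^bsub>B\<^esub> x" r]
        by (auto simp: up_def C.smult_minus_right intro!: E1.E_smult C.self_adjoint_intros)
      then have "p0 (complex_of_real r \<odot>\<^bsub>B\<^esub> x) \<le> r * Re (\<phi> e)"
        using p0_le[OF V.sc_closed[OF x]] e by (force simp: up_def E1.functional_smult[OF \<phi>])
      then show "p0 (complex_of_real r \<odot>\<^bsub>B\<^esub> x) / r \<le> Re (\<phi> e)" using r by (simp add: field_simps)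
    qed
    then show "p0 (complex_of_real r \<odot>\<^bsub>B\<^esub> x) \<le> r * p0 x" using r by (simp add: field_simps)
  qed
  then obtain p where p: "\<And>x y. x \<in> V \<Longrightarrow> y \<in> V \<Longrightarrow> p (x \<oplus>\<^bsub>B\<^esub> y) = p x + p y"
      "\<And>x r. x \<in> V \<Longrightarrow> p (complex_of_real r \<odot>\<^bsub>B\<^esub> x) = r * p x" "\<And>x. x \<in> V \<Longrightarrow> p x \<le> p0 x"
    using V.Hahn_Banach_sublinear by metis
  have p_E1: "p x = Re (\<phi> x)" if x: "x \<in> E1" "C.self_adjoint x" for x
  proof -
    have V: "x \<in> V" "complex_of_real (-1) \<odot>\<^bsub>B\<^esub> x \<in> V" using x sub by (auto simp: V_def intro: E2.E_smult C.self_adjoint_intros(6)[of x "-1", simplified])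
    have z: "cstar_nonneg B \<zero>\<^bsub>B\<^esub>" unfolding cstar_nonneg_def by (intro bexI[of _ "\<zero>\<^bsub>B\<^esub>"]) (auto simp: C.cstar_closed)
    have up: "y \<in> up y" if "y \<in> E1" "C.self_adjoint y" for y
      using that z E1.E_carrier[of y] by (simp add: up_def C.M.minus_eq C.M.r_neg)
    have "p x \<le> Re (\<phi> x)" using p(3)[OF V(1)] p0_le[OF V(1) up[OF x]] by simp
    moreover have m: "complex_of_real (-1) \<odot>\<^bsub>B\<^esub> x \<in> E1" "C.self_adjoint (complex_of_real (-1) \<odot>\<^bsub>B\<^esub> x)"
      using E1.E_smult[OF x(1)] C.self_adjoint_intros(6)[OF x(2)] .
    have "p (complex_of_real (-1) \<odot>\<^bsub>B\<^esub> x) \<le> Re (\<phi> (complex_of_real (-1) \<odot>\<^bsub>B\<^esub> x))"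
      using p(3)[OF V(2)] p0_le[OF V(2) up[OF m]] by simp
    then have "- p x \<le> - Re (\<phi> x)" using p(2)[OF V(1), of "-1"] x(1) by (simp add: E1.functional_smult[OF \<phi>])
    ultimately show ?thesis by simp
  qed
  have p_pos: "0 \<le> p x" if x: "x \<in> E2" "cstar_nonneg B x" for x
  proof -
    have sa: "C.self_adjoint x" using x(2) by (rule C.cstar_nonneg_self_adjoint)
    have V: "x \<in> V" "complex_of_real (-1) \<odot>\<^bsub>B\<^esub> x \<in> V" using x sa by (auto simp: V_def intro: E2.E_smult C.self_adjoint_intros(6)[of x "-1", simplified])
    have "\<zero>\<^bsub>B\<^esub> \<ominus>\<^bsub>B\<^esub> complex_of_real (-1) \<odot>\<^bsub>B\<^esub> x = x"
      using E2.E_carrier[OF x(1)] by (simp add: C.minus_smult C.smult_smult)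
    then have "\<zero>\<^bsub>B\<^esub> \<in> up (complex_of_real (-1) \<odot>\<^bsub>B\<^esub> x)"
      using x(2) by (simp add: up_def E1.E_zero C.self_adjoint_intros)
    then have "p (complex_of_real (-1) \<odot>\<^bsub>B\<^esub> x) \<le> Re (\<phi> \<zero>\<^bsub>B\<^esub>)" using p(3)[OF V(2)] p0_le[OF V(2)] by force
    moreover have "\<phi> \<zero>\<^bsub>B\<^esub> = 0" using E1.functional_smult[OF \<phi> E1.E_zero, of 0] by simp
    ultimately show ?thesis using p(2)[OF V(1), of "-1"] by simp
  qed
  define \<Phi> where "\<Phi> x = Complex (p (C.re_part x)) (p (C.im_part x))" for x
  have V_parts: "C.re_part x \<in> V" "C.im_part x \<in> V" if "x \<in> E2" for x
    using that by (auto simp: V_def E2.E_re_part E2.E_im_part C.self_adjoint_re_part C.self_adjoint_im_part E2.E_carrier)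
  have \<Phi>_comb: "\<Phi> (a \<oplus>\<^bsub>B\<^esub> \<i> \<odot>\<^bsub>B\<^esub> b) = Complex (p a) (p b)" if "a \<in> V" "b \<in> V" for a b
    unfolding \<Phi>_def using that C.parts_of_combination[of a b] by (simp add: V_def)
  have decomp: "x = C.re_part x \<oplus>\<^bsub>B\<^esub> \<i> \<odot>\<^bsub>B\<^esub> C.im_part x" if "x \<in> E2" for x
    using C.re_im_decomp E2.E_carrier that by blast
  have V_carrier: "a \<in> carrier B" if "a \<in> V" for a using that by (simp add: V_def E2.E_carrier)
  have add: "\<Phi> (x \<oplus>\<^bsub>B\<^esub> y) = \<Phi> x + \<Phi> y" if x: "x \<in> E2" and y: "y \<in> E2" for x y
  proof -
    let ?a = "C.re_part x" and ?b = "C.im_part x" and ?c = "C.re_part y" and ?d = "C.im_part y"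
    have V: "?a \<in> V" "?b \<in> V" "?c \<in> V" "?d \<in> V" using V_parts x y by auto
    have "x \<oplus>\<^bsub>B\<^esub> y = (?a \<oplus>\<^bsub>B\<^esub> \<i> \<odot>\<^bsub>B\<^esub> ?b) \<oplus>\<^bsub>B\<^esub> (?c \<oplus>\<^bsub>B\<^esub> \<i> \<odot>\<^bsub>B\<^esub> ?d)" using decomp[OF x] decomp[OF y] by simp
    also have "\<dots> = (?a \<oplus>\<^bsub>B\<^esub> ?c) \<oplus>\<^bsub>B\<^esub> \<i> \<odot>\<^bsub>B\<^esub> (?b \<oplus>\<^bsub>B\<^esub> ?d)"
      using V by (simp add: V_carrier C.smult_add_right C.M.a_ac)
    finally have "\<Phi> (x \<oplus>\<^bsub>B\<^esub> y) = Complex (p (?a \<oplus>\<^bsub>B\<^esub> ?c)) (p (?b \<oplus>\<^bsub>B\<^esub> ?d))"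
      using \<Phi>_comb[OF V.add_closed[OF V(1,3)] V.add_closed[OF V(2,4)]] by simp
    then show ?thesis using V by (simp add: p(1) \<Phi>_def complex_eq_iff)
  qed
  have smult: "\<Phi> (c \<odot>\<^bsub>B\<^esub> x) = c * \<Phi> x" if x: "x \<in> E2" for c x
  proof -
    let ?a = "C.re_part x" and ?b = "C.im_part x"
    define d where "d = - Im c"
    let ?r = "complex_of_real (Re c)" and ?s = "complex_of_real (Im c)" and ?t = "complex_of_real d"
    have V: "?a \<in> V" "?b \<in> V" using V_parts x by auto
    have cc: "c = ?r + \<i> * ?s" by (rule complex_eq)
    have "c \<odot>\<^bsub>B\<^esub> x = c \<odot>\<^bsub>B\<^esub> (?a \<oplus>\<^bsub>B\<^esub> \<i> \<odot>\<^bsub>B\<^esub> ?b)" using decomp[OF x] by simp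
    also have "\<dots> = c \<odot>\<^bsub>B\<^esub> ?a \<oplus>\<^bsub>B\<^esub> (c * \<i>) \<odot>\<^bsub>B\<^esub> ?b"
      using V by (simp add: V_carrier C.smult_add_right C.smult_smult)
    also have "c \<odot>\<^bsub>B\<^esub> ?a = ?r \<odot>\<^bsub>B\<^esub> ?a \<oplus>\<^bsub>B\<^esub> (\<i> * ?s) \<odot>\<^bsub>B\<^esub> ?a"
      using C.smult_add_left[OF V_carrier[OF V(1)], of ?r "\<i> * ?s"] cc by simp
    also have "(c * \<i>) \<odot>\<^bsub>B\<^esub> ?b = (\<i> * ?r) \<odot>\<^bsub>B\<^esub> ?b \<oplus>\<^bsub>B\<^esub> ?t \<odot>\<^bsub>B\<^esub> ?b"
    proof -
      have "c * \<i> = \<i> * ?r + ?t" by (simp add: complex_eq_iff d_def)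
      then show ?thesis using C.smult_add_left[OF V_carrier[OF V(2)], of "\<i> * ?r" ?t] by simp
    qed
    also have "(?r \<odot>\<^bsub>B\<^esub> ?a \<oplus>\<^bsub>B\<^esub> (\<i> * ?s) \<odot>\<^bsub>B\<^esub> ?a) \<oplus>\<^bsub>B\<^esub> ((\<i> * ?r) \<odot>\<^bsub>B\<^esub> ?b \<oplus>\<^bsub>B\<^esub> ?t \<odot>\<^bsub>B\<^esub> ?b)
        = (?r \<odot>\<^bsub>B\<^esub> ?a \<oplus>\<^bsub>B\<^esub> ?t \<odot>\<^bsub>B\<^esub> ?b) \<oplus>\<^bsub>B\<^esub> \<i> \<odot>\<^bsub>B\<^esub> (?s \<odot>\<^bsub>B\<^esub> ?a \<oplus>\<^bsub>B\<^esub> ?r \<odot>\<^bsub>B\<^esub> ?b)"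
      using V by (simp add: V_carrier C.smult_add_right C.smult_smult C.M.a_ac)
    finally have "\<Phi> (c \<odot>\<^bsub>B\<^esub> x) = Complex (p (?r \<odot>\<^bsub>B\<^esub> ?a \<oplus>\<^bsub>B\<^esub> ?t \<odot>\<^bsub>B\<^esub> ?b)) (p (?s \<odot>\<^bsub>B\<^esub> ?a \<oplus>\<^bsub>B\<^esub> ?r \<odot>\<^bsub>B\<^esub> ?b))"
      using \<Phi>_comb[OF V.add_closed[OF V.sc_closed V.sc_closed] V.add_closed[OF V.sc_closed V.sc_closed]] V by simp
    then have "\<Phi> (c \<odot>\<^bsub>B\<^esub> x) = Complex (Re c * p ?a + d * p ?b) (Im c * p ?a + Re c * p ?b)"
      using V by (simp add: p V.sc_closed)
    then show ?thesis by (simp add: \<Phi>_def complex_eq_iff d_def)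
  qed
  have sa_val: "\<Phi> x = complex_of_real (p x)" if "x \<in> V" for x
  proof -
    have "x = x \<oplus>\<^bsub>B\<^esub> \<i> \<odot>\<^bsub>B\<^esub> \<zero>\<^bsub>B\<^esub>" using V_carrier[OF that] by simp
    then have "\<Phi> x = Complex (p x) (p \<zero>\<^bsub>B\<^esub>)" using \<Phi>_comb[OF that V.zero_closed] by simp
    moreover have "p \<zero>\<^bsub>B\<^esub> = 0" using p(2)[OF V.zero_closed, of 0] by simp
    ultimately show ?thesis by (simp add: complex_of_real_def)
  qed
  have ext: "\<Phi> x = \<phi> x" if x: "x \<in> E1" for x
  proof -
    have sa: "C.self_adjoint (C.re_part x)" "C.self_adjoint (C.im_part x)"
      using E1.E_carrier[OF x] by (simp_all add: C.self_adjoint_re_part C.self_adjoint_im_part)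
    have E: "C.re_part x \<in> E1" "C.im_part x \<in> E1" using x by (simp_all add: E1.E_re_part E1.E_im_part)
    have "\<phi> x = \<phi> (C.re_part x \<oplus>\<^bsub>B\<^esub> \<i> \<odot>\<^bsub>B\<^esub> C.im_part x)" using C.re_im_decomp[OF E1.E_carrier[OF x]] by simp
    also have "\<dots> = \<phi> (C.re_part x) + \<i> * \<phi> (C.im_part x)"
      using E by (simp add: E1.functional_add[OF \<phi>] E1.functional_smult[OF \<phi>] E1.E_smult)
    finally show ?thesis
      using p_E1[OF E(1) sa(1)] p_E1[OF E(2) sa(2)] E1.functional_self_adjoint(1)[OF \<phi> E(1) sa(1)] E1.functional_self_adjoint(1)[OF \<phi> E(2) sa(2)]
      by (simp add: \<Phi>_def complex_eq_iff)
  qed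
  have "functional_state B E2 \<Phi>"
    unfolding functional_state_def
  proof (intro conjI ballI allI impI add smult)
    show "\<Phi> \<one>\<^bsub>B\<^esub> = 1" using ext[OF E1.E_one] E1.functional_one[OF \<phi>] by simp
    show "\<Phi> x \<in> \<real>\<^sub>\<ge>\<^sub>0" if "x \<in> E2" "cstar_nonneg B x" for x
      using sa_val[of x] p_pos[OF that] that C.cstar_nonneg_self_adjoint[OF that(2)] by (simp add: V_def)
  qed
  then show ?thesis using ext by (rule that)
qed

section \<open>Extension of equivariant maps by means of an invariant mean\<close>

locale G_system = top_group G T for G :: "('a, 'k) monoid_scheme" (structure) and T +
  fixes B :: "('e, 'm) cstar_algebra_scheme" and E :: "'e set" and \<alpha> :: "'a \<Rightarrow> 'e \<Rightarrow> 'e"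
  assumes G_function_system: "G_function_system G T B E \<alpha>"
begin

sublocale sys: function_system_in B E
proof (intro function_system_in.intro function_system_in_axioms.intro)
  show fs: "function_system B E" using G_function_system by (simp add: G_function_system_def)
  show "comm_cstar_algebra B" using fs by (simp add: function_system_def)
qed

lemma topspace_E: "topspace (subtopology sys.mtopology E) = E"
  using sys.E_carrier by auto

sublocale act: group_action G E \<alpha>
  using G_function_system topspace_E by (simp add: G_function_system_def continuous_action_def)

lemma alpha_closed: "\<lbrakk>g \<in> carrier G; x \<in> E\<rbrakk> \<Longrightarrow> \<alpha> g x \<in> E"
  using act.element_image by blast

lemma alpha_one: "x \<in> E \<Longrightarrow> \<alpha> \<one> x = x"
  using act.id_eq_one by (metis restrict_apply')

lemma alpha_mult: "\<lbrakk>g \<in> carrier G; h \<in> carrier G; x \<in> E\<rbrakk> \<Longrightarrow> \<alpha> (g \<otimes> h) x = \<alpha> g (\<alpha> h x)"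
  using act.composition_rule by blast

lemma alpha_unit: "g \<in> carrier G \<Longrightarrow> \<alpha> g \<one>\<^bsub>B\<^esub> = \<one>\<^bsub>B\<^esub>"
  and alpha_add: "\<lbrakk>g \<in> carrier G; x \<in> E; y \<in> E\<rbrakk> \<Longrightarrow> \<alpha> g (x \<oplus>\<^bsub>B\<^esub> y) = \<alpha> g x \<oplus>\<^bsub>B\<^esub> \<alpha> g y"
  and alpha_smult: "\<lbrakk>g \<in> carrier G; x \<in> E\<rbrakk> \<Longrightarrow> \<alpha> g (c \<odot>\<^bsub>B\<^esub> x) = c \<odot>\<^bsub>B\<^esub> \<alpha> g x"
  and alpha_nonneg: "\<lbrakk>g \<in> carrier G; x \<in> E; cstar_nonneg B x\<rbrakk> \<Longrightarrow> cstar_nonneg B (\<alpha> g x)"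
  using G_function_system by (auto simp: G_function_system_def unital_order_iso_def unital_linear_map_def)

lemma functional_state_alpha:
  assumes "functional_state B E \<phi>" "g \<in> carrier G"
  shows "functional_state B E (\<lambda>x. \<phi> (\<alpha> g x))"
  using assms unfolding functional_state_def
  by (simp add: alpha_unit alpha_add alpha_smult alpha_nonneg alpha_closed)

lemma alpha_near:
  assumes x: "x \<in> E" and \<epsilon>: "\<epsilon> > 0"
  obtains U where "openin T U" "\<one> \<in> U" "\<And>u. u \<in> U \<Longrightarrow> cnorm B (\<alpha> (inv u) x \<ominus>\<^bsub>B\<^esub> x) < \<epsilon>"
proof -
  let ?E = "subtopology sys.mtopology E"
  have xc: "x \<in> carrier B" using x by (rule sys.E_carrier)
  have "continuous_map (prod_topology T ?E) ?E (\<lambda>(g, x). \<alpha> g x)"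
    using G_function_system by (simp add: G_function_system_def continuous_action_def)
  then have "continuous_map T ?E ((\<lambda>(g, x). \<alpha> g x) \<circ> (\<lambda>g. (inv g, x)))"
    using x topspace_E continuous_inv by (intro continuous_map_compose[OF continuous_map_pairedI]) auto
  then have c: "continuous_map T ?E (\<lambda>g. \<alpha> (inv g) x)" by (simp add: o_def)
  have "openin ?E (sys.mball x \<epsilon> \<inter> E)" by (intro openin_subtopology_Int sys.openin_mball)
  with c have "openin T {u \<in> topspace T. \<alpha> (inv u) x \<in> sys.mball x \<epsilon> \<inter> E}"
    by (rule openin_continuous_map_preimage)
  moreover have "\<one> \<in> {u \<in> topspace T. \<alpha> (inv u) x \<in> sys.mball x \<epsilon> \<inter> E}"
    using x xc \<epsilon> by (simp add: topspace_eq alpha_one)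
  moreover have "cnorm B (\<alpha> (inv u) x \<ominus>\<^bsub>B\<^esub> x) < \<epsilon>" if "u \<in> {u \<in> topspace T. \<alpha> (inv u) x \<in> sys.mball x \<epsilon> \<inter> E}" for u
    using that sys.cnorm_minus_commute[of x "\<alpha> (inv u) x"] by (auto simp: cdist_def)
  ultimately show ?thesis using that by blast
qed

text \<open>The estimate is uniform in \<open>g\<close>, because \<open>x \<mapsto> \<phi> (g\<inverse> x)\<close> is again a state.\<close>

lemma functional_state_near:
  assumes \<phi>: "functional_state B E \<phi>" and g: "g \<in> carrier G" and u: "u \<in> carrier G" and x: "x \<in> E"
  shows "cmod (\<phi> (\<alpha> (inv (u \<otimes> g)) x) - \<phi> (\<alpha> (inv g) x)) \<le> 2 * cnorm B (\<alpha> (inv u) x \<ominus>\<^bsub>B\<^esub> x)"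
proof -
  have \<phi>g: "functional_state B E (\<lambda>x. \<phi> (\<alpha> (inv g) x))" using \<phi> g by (intro functional_state_alpha) auto
  have ux: "\<alpha> (inv u) x \<in> E" using u x by (intro alpha_closed) auto
  have "\<phi> (\<alpha> (inv (u \<otimes> g)) x) - \<phi> (\<alpha> (inv g) x) = \<phi> (\<alpha> (inv g) (\<alpha> (inv u) x \<ominus>\<^bsub>B\<^esub> x))"
    using sys.functional_minus[OF \<phi>g ux x] g u x by (simp add: inv_mult_group alpha_mult)
  then show ?thesis using sys.functional_bound[OF \<phi>g sys.E_minus[OF ux x]] by simp
qed

end

lemma topological_group_subgroup:
  assumes G: "topological_group G T" and H: "subgroup H G"
  shows "topological_group (G\<lparr>carrier := H\<rparr>) (subtopology T H)"
  unfolding topological_group_def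
proof (intro conjI)
  interpret top_group G T using G by unfold_locales
  have sub: "H \<subseteq> carrier G" using H by (rule subgroup.subset)
  show "group (G\<lparr>carrier := H\<rparr>)" using H by (rule subgroup.subgroup_is_group) (rule is_group)
  show "topspace (subtopology T H) = carrier (G\<lparr>carrier := H\<rparr>)" using sub by (auto simp: topspace_eq)
  have c: "continuous_map (subtopology T H) T (\<lambda>x. x)" by (simp add: continuous_map_from_subtopology)
  have "continuous_map (prod_topology (subtopology T H) (subtopology T H)) T (\<lambda>p. fst p \<otimes>\<^bsub>G\<^esub> snd p)"
    by (intro continuous_mult' continuous_map_into_fulltopology[of _ T H] continuous_map_fst continuous_map_snd)
  then show "continuous_map (prod_topology (subtopology T H) (subtopology T H)) (subtopology T H)
     (\<lambda>(x, y). x \<otimes>\<^bsub>G\<lparr>carrier := H\<rparr>\<^esub> y)"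
    using subgroup.m_closed[OF H] by (auto simp: continuous_map_in_subtopology case_prod_unfold)
  have "continuous_map (subtopology T H) T (\<lambda>x. inv\<^bsub>G\<^esub> x)"
    using continuous_inv by (rule continuous_map_from_subtopology)
  then have "continuous_map (subtopology T H) (subtopology T H) (\<lambda>x. inv\<^bsub>G\<^esub> x)"
    using subgroup.m_inv_closed[OF H] by (auto simp: continuous_map_in_subtopology)
  then show "continuous_map (subtopology T H) (subtopology T H) (\<lambda>x. inv\<^bsub>G\<lparr>carrier := H\<rparr>\<^esub> x)"
    by (rule continuous_map_eq) (simp add: m_inv_consistent[OF H])
qed

locale top_group_subgroup = top_group G T for G :: "('a, 'm) monoid_scheme" (structure) and T +
  fixes H :: "'a set"
  assumes H: "subgroup H G"
begin

lemma H_carrier: "h \<in> H \<Longrightarrow> h \<in> carrier G"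
  using subgroup.subset[OF H] by blast

lemma H_closed: "h \<in> H \<Longrightarrow> k \<in> H \<Longrightarrow> h \<otimes> k \<in> H" "h \<in> H \<Longrightarrow> inv h \<in> H" "\<one> \<in> H"
  using subgroup.m_closed[OF H] subgroup.m_inv_closed[OF H] subgroup.one_closed[OF H] by auto

abbreviation K where "K \<equiv> G\<lparr>carrier := H\<rparr>"

sublocale sub: top_group "G\<lparr>carrier := H\<rparr>" "subtopology T H"
  by unfold_locales (rule topological_group_subgroup[OF topological_group H])

lemma subgroup_rucI:
  assumes "f \<in> extensional H" "\<And>h. h \<in> H \<Longrightarrow> cmod (f h) \<le> M"
    "\<And>\<epsilon>. \<epsilon> > 0 \<Longrightarrow> \<exists>U. openin (subtopology T H) U \<and> \<one> \<in> U \<and> (\<forall>u\<in>U. \<forall>h\<in>H. cmod (f (u \<otimes> h) - f h) < \<epsilon>)"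
  shows "f \<in> ruc_group K (subtopology T H)"
  by (rule sub.self.rucI[where M = M]) (use assms in simp_all)

lemma coset_in: "g \<in> carrier G \<Longrightarrow> g <#\<^bsub>G\<^esub> H \<in> lcosets H"
  by (auto simp: LCOSETS_def)

lemma coset_cases: "C \<in> lcosets H \<Longrightarrow> (\<And>g. g \<in> carrier G \<Longrightarrow> C = g <#\<^bsub>G\<^esub> H \<Longrightarrow> P) \<Longrightarrow> P"
  by (auto simp: LCOSETS_def)

lemma coset_mult: "g \<in> carrier G \<Longrightarrow> h \<in> carrier G \<Longrightarrow> g <#\<^bsub>G\<^esub> (h <#\<^bsub>G\<^esub> H) = (g \<otimes> h) <#\<^bsub>G\<^esub> H"
  by (rule lcos_m_assoc) (use subgroup.subset[OF H] in auto)

lemma coset_one: "\<one> <#\<^bsub>G\<^esub> H = H"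
  by (rule lcos_mult_one) (rule subgroup.subset[OF H])

lemma H_coset: "H \<in> lcosets H"
  using coset_in[OF one_closed] coset_one by simp

lemma coset_absorb: "h \<in> H \<Longrightarrow> h <#\<^bsub>G\<^esub> H = H"
  using coset_join3[OF _ H] H_carrier by blast

lemma coset_eqD:
  assumes "g \<in> carrier G" "k \<in> carrier G" "g <#\<^bsub>G\<^esub> H = k <#\<^bsub>G\<^esub> H"
  shows "\<exists>h\<in>H. k = g \<otimes> h"
proof -
  have "k \<in> g <#\<^bsub>G\<^esub> H" using assms lcos_self[OF assms(2) H] by simp
  then show ?thesis by (auto simp: l_coset_def)
qed

sublocale cos: top_group_on_set G T "lcosets H" "\<lambda>u x. u <#\<^bsub>G\<^esub> x"
proof unfold_locales
  show "lcosets H \<noteq> {}" using H_coset by blast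
  show "g <#\<^bsub>G\<^esub> x \<in> lcosets H" if "g \<in> carrier G" "x \<in> lcosets H" for g x
    using that(2) by (rule coset_cases) (simp add: that(1) coset_mult coset_in)
  show "\<one> <#\<^bsub>G\<^esub> x = x" if "x \<in> lcosets H" for x
    using that by (rule coset_cases) (simp add: coset_mult)
  show "(g \<otimes> h) <#\<^bsub>G\<^esub> x = g <#\<^bsub>G\<^esub> (h <#\<^bsub>G\<^esub> x)" if "g \<in> carrier G" "h \<in> carrier G" "x \<in> lcosets H" for g h x
    using that(3) by (rule coset_cases) (simp add: that coset_mult m_assoc)
qed

lemma RUC_system: "G_function_system G T (RUC G T H) (carrier (RUC G T H)) (RUC_action G T H)"
  using cos.G_function_system_alg by (simp add: RUC_eq RUC_action_eq cos.carrier_alg)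

end

text \<open>The situation in the definition of injectivity, together with a mean on \<open>H\<close>.\<close>

locale injectivity_test = top_group_subgroup G T H + E2: G_system G T B E2 \<alpha>
  for G :: "('a, 'm) monoid_scheme" (structure) and T H
    and B :: "('e, 'n) cstar_algebra_scheme" and E1 E2 :: "'e set" and \<alpha> :: "'a \<Rightarrow> 'e \<Rightarrow> 'e" +
  fixes \<psi> :: "'e \<Rightarrow> ('a set \<Rightarrow> complex)" and m :: "('a \<Rightarrow> complex) \<Rightarrow> complex"
  assumes E1: "function_system B E1" "E1 \<subseteq> E2" "\<And>g x. g \<in> carrier G \<Longrightarrow> x \<in> E1 \<Longrightarrow> \<alpha> g x \<in> E1"
    and \<psi>: "unital_positive_map B E1 cos.alg cos.A \<psi>" "equivariant_map G E1 \<alpha> (ruc_action G T (lcosets H) (\<lambda>u x. u <#\<^bsub>G\<^esub> x)) \<psi>"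
    and m: "invariant_mean (G\<lparr>carrier := H\<rparr>) (subtopology T H) m"
begin

lemma E1_in: "function_system_in B E1"
  using E2.sys.comm_cstar_algebra_axioms E1(1) by (intro function_system_in.intro function_system_in_axioms.intro)

lemma psi_closed: "x \<in> E1 \<Longrightarrow> \<psi> x \<in> cos.A"
  using \<psi>(1) by (auto simp: unital_positive_map_def unital_linear_map_def)

lemma psi_equivariant: "\<lbrakk>g \<in> carrier G; x \<in> E1; C \<in> lcosets H\<rbrakk> \<Longrightarrow> \<psi> (\<alpha> g x) C = \<psi> x (inv g <#\<^bsub>G\<^esub> C)"
  using \<psi>(2) psi_closed[of x] by (simp add: equivariant_map_def cos.ruc_action_apply)

lemma base_state: "functional_state B E1 (\<lambda>x. \<psi> x H)"
  unfolding functional_state_def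
proof (intro conjI ballI allI impI)
  have L: "unital_linear_map B E1 cos.alg cos.A \<psi>" using \<psi>(1) by (simp add: unital_positive_map_def)
  show "\<psi> \<one>\<^bsub>B\<^esub> H = 1" using L H_coset by (simp add: unital_linear_map_def ruc_algebra_def)
  show "\<psi> (x \<oplus>\<^bsub>B\<^esub> y) H = \<psi> x H + \<psi> y H" if "x \<in> E1" "y \<in> E1" for x y
    using L H_coset that by (simp add: unital_linear_map_def ruc_algebra_def)
  show "\<psi> (c \<odot>\<^bsub>B\<^esub> x) H = c * \<psi> x H" if "x \<in> E1" for c x
    using L H_coset that by (simp add: unital_linear_map_def ruc_algebra_def)
  show "\<psi> x H \<in> \<real>\<^sub>\<ge>\<^sub>0" if "x \<in> E1" "cstar_nonneg B x" for x
    using \<psi>(1) that cos.cstar_nonneg_alg[OF psi_closed[OF that(1)]] H_coset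
    by (simp add: unital_positive_map_def)
qed

lemma orbit_ruc:
  assumes \<phi>: "functional_state B E2 \<phi>" and x: "x \<in> E2"
  shows "(\<lambda>h\<in>H. \<phi> (\<alpha> (inv h) x)) \<in> ruc_group K (subtopology T H)"
proof (rule subgroup_rucI[where M = "2 * cnorm B x"])
  show "cmod ((\<lambda>h\<in>H. \<phi> (\<alpha> (inv h) x)) h) \<le> 2 * cnorm B x" if "h \<in> H" for h
    using that E2.sys.functional_bound[OF E2.functional_state_alpha[OF \<phi>, of "inv h"] x] H_carrier by simp
  fix \<epsilon> :: real assume "\<epsilon> > 0"
  then obtain U where U: "openin T U" "\<one> \<in> U" "\<And>u. u \<in> U \<Longrightarrow> cnorm B (\<alpha> (inv u) x \<ominus>\<^bsub>B\<^esub> x) < \<epsilon>/2"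
    using E2.alpha_near[OF x, of "\<epsilon>/2"] by auto
  have "cmod (\<phi> (\<alpha> (inv (u \<otimes> h)) x) - \<phi> (\<alpha> (inv h) x)) < \<epsilon>" if "u \<in> U \<inter> H" "h \<in> H" for u h
    using E2.functional_state_near[OF \<phi>, of h u x] U(3)[of u] that x H_carrier by fastforce
  then show "\<exists>U. openin (subtopology T H) U \<and> \<one> \<in> U \<and>
      (\<forall>u\<in>U. \<forall>h\<in>H. cmod ((\<lambda>h\<in>H. \<phi> (\<alpha> (inv h) x)) (u \<otimes> h) - (\<lambda>h\<in>H. \<phi> (\<alpha> (inv h) x)) h) < \<epsilon>)"
    using U(1,2) H_closed by (intro exI[of _ "U \<inter> H"]) (auto intro: openin_subtopology_Int)
qed auto

text \<open>Averaging \<open>h \<mapsto> \<phi> (h\<inverse> x)\<close> makes an extension \<open>\<phi>\<close> of the state \<open>x \<mapsto> \<psi> x H\<close> invariant. It remains an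
  extension, because for \<open>x\<close> in \<open>E1\<close> equivariance of \<open>\<psi>\<close> makes the averaged function constant.\<close>

lemma averaged_state:
  obtains \<Phi> where "functional_state B E2 \<Phi>" "\<And>x. x \<in> E1 \<Longrightarrow> \<Phi> x = \<psi> x H"
    "\<And>h x. h \<in> H \<Longrightarrow> x \<in> E2 \<Longrightarrow> \<Phi> (\<alpha> h x) = \<Phi> x"
proof -
  obtain \<phi> where \<phi>: "functional_state B E2 \<phi>" "\<And>x. x \<in> E1 \<Longrightarrow> \<phi> x = \<psi> x H"
    using state_extension[OF E1_in E2.sys.function_system_in_axioms E1(2) base_state] by blast
  define F where "F x = (\<lambda>h\<in>H. \<phi> (\<alpha> (inv h) x))" for x
  have F: "F x \<in> ruc_group K (subtopology T H)" if "x \<in> E2" for x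
    unfolding F_def using \<phi>(1) that by (rule orbit_ruc)
  have st: "state_on (carrier K) (ruc_group K (subtopology T H)) m"
    and inv: "\<And>k f. k \<in> H \<Longrightarrow> f \<in> ruc_group K (subtopology T H) \<Longrightarrow> m (\<lambda>h\<in>H. f (k \<otimes> h)) = m f"
    using m by (simp_all add: invariant_mean_def)
  note \<phi>h = E2.functional_state_alpha[OF \<phi>(1)]
  have st1: "m (\<lambda>h\<in>H. 1) = 1" and stc: "\<And>c. m (\<lambda>h\<in>H. c) = c"
    using sub.self.state_onD(1)[OF st] sub.self.state_on_const[OF st] by simp_all
  have st2: "m (\<lambda>h\<in>H. f h + g h) = m f + m g"
    if "f \<in> ruc_group K (subtopology T H)" "g \<in> ruc_group K (subtopology T H)" for f g
    using sub.self.state_onD(2)[OF st that] by simp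
  have st3: "m (\<lambda>h\<in>H. c * f h) = c * m f" if "f \<in> ruc_group K (subtopology T H)" for c f
    using sub.self.state_onD(3)[OF st that] by simp
  have st4: "m f \<in> \<real>\<^sub>\<ge>\<^sub>0" if "f \<in> ruc_group K (subtopology T H)" "\<And>h. h \<in> H \<Longrightarrow> f h \<in> \<real>\<^sub>\<ge>\<^sub>0" for f
    using sub.self.state_onD(4)[OF st that(1)] that(2) by simp
  define \<Phi> where "\<Phi> x = m (F x)" for x
  have "functional_state B E2 \<Phi>"
    unfolding functional_state_def
  proof (intro conjI ballI allI impI)
    have "F \<one>\<^bsub>B\<^esub> = (\<lambda>h\<in>H. 1)"
      using H_carrier by (auto simp: F_def E2.alpha_unit E2.sys.functional_one[OF \<phi>(1)])
    then show "\<Phi> \<one>\<^bsub>B\<^esub> = 1" using st1 by (simp add: \<Phi>_def)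
    fix x assume x: "x \<in> E2"
    show "\<Phi> (x \<oplus>\<^bsub>B\<^esub> y) = \<Phi> x + \<Phi> y" if y: "y \<in> E2" for y
    proof -
      have "F (x \<oplus>\<^bsub>B\<^esub> y) = (\<lambda>h\<in>H. F x h + F y h)"
        using E2.sys.functional_add[OF \<phi>h x y] H_carrier by (auto simp: F_def)
      then show ?thesis using st2[OF F[OF x] F[OF y]] by (simp add: \<Phi>_def)
    qed
    show "\<Phi> (c \<odot>\<^bsub>B\<^esub> x) = c * \<Phi> x" for c
    proof -
      have "F (c \<odot>\<^bsub>B\<^esub> x) = (\<lambda>h\<in>H. c * F x h)"
        using E2.sys.functional_smult[OF \<phi>h x] H_carrier by (auto simp: F_def)
      then show ?thesis using st3[OF F[OF x], of c] by (simp add: \<Phi>_def)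
    qed
    show "\<Phi> x \<in> \<real>\<^sub>\<ge>\<^sub>0" if "cstar_nonneg B x"
      unfolding \<Phi>_def
      using E2.sys.functional_nonneg[OF \<phi>h x that] H_carrier by (intro st4[OF F[OF x]]) (auto simp: F_def)
  qed
  moreover have "\<Phi> x = \<psi> x H" if x: "x \<in> E1" for x
  proof -
    have "\<phi> (\<alpha> (inv h) x) = \<psi> x H" if h: "h \<in> H" for h
    proof -
      have "\<phi> (\<alpha> (inv h) x) = \<psi> (\<alpha> (inv h) x) H" using h x H_carrier by (intro \<phi>(2) E1(3)) auto
      also have "\<dots> = \<psi> x (h <#\<^bsub>G\<^esub> H)" using h x H_carrier H_coset by (simp add: psi_equivariant)
      finally show ?thesis using h by (simp add: coset_absorb)
    qed
    then have "F x = (\<lambda>h\<in>H. \<psi> x H)" by (auto simp: F_def)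
    then show ?thesis using stc by (simp add: \<Phi>_def)
  qed
  moreover have "\<Phi> (\<alpha> k x) = \<Phi> x" if k: "k \<in> H" and x: "x \<in> E2" for k x
  proof -
    have "F (\<alpha> k x) = (\<lambda>h\<in>H. F x (inv k \<otimes> h))"
      using k x H_carrier H_closed by (auto simp: F_def inv_mult_group E2.alpha_mult)
    then show ?thesis using inv[OF H_closed(2)[OF k] F[OF x]] by (simp add: \<Phi>_def)
  qed
  ultimately show ?thesis by (rule that)
qed

text \<open>The formula \<open>\<Psi> x (gH) = \<Phi> (g\<inverse> x)\<close> does not depend on the representative \<open>g\<close>, because \<open>\<Phi>\<close> is
  \<open>H\<close>-invariant.\<close>

lemma extension:
  "\<exists>\<Psi>. unital_positive_map B E2 cos.alg cos.A \<Psi> \<and>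
     equivariant_map G E2 \<alpha> (ruc_action G T (lcosets H) (\<lambda>u x. u <#\<^bsub>G\<^esub> x)) \<Psi> \<and> (\<forall>x \<in> E1. \<Psi> x = \<psi> x)"
proof -
  obtain \<Phi> where \<Phi>: "functional_state B E2 \<Phi>" "\<And>x. x \<in> E1 \<Longrightarrow> \<Phi> x = \<psi> x H"
    "\<And>h x. h \<in> H \<Longrightarrow> x \<in> E2 \<Longrightarrow> \<Phi> (\<alpha> h x) = \<Phi> x"
    using averaged_state by metis
  define rep where "rep C = (SOME g. g \<in> carrier G \<and> C = g <#\<^bsub>G\<^esub> H)" for C
  have rep: "rep C \<in> carrier G" "C = rep C <#\<^bsub>G\<^esub> H" if "C \<in> lcosets H" for C
  proof -
    have "\<exists>g. g \<in> carrier G \<and> C = g <#\<^bsub>G\<^esub> H" using that by (rule coset_cases) blast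
    then have "rep C \<in> carrier G \<and> C = rep C <#\<^bsub>G\<^esub> H" unfolding rep_def by (rule someI_ex)
    then show "rep C \<in> carrier G" "C = rep C <#\<^bsub>G\<^esub> H" by blast+
  qed
  define \<Psi> where "\<Psi> x = (\<lambda>C\<in>lcosets H. \<Phi> (\<alpha> (inv (rep C)) x))" for x
  have \<Psi>_coset: "\<Psi> x (g <#\<^bsub>G\<^esub> H) = \<Phi> (\<alpha> (inv g) x)" if x: "x \<in> E2" and g: "g \<in> carrier G" for x g
  proof -
    have C: "g <#\<^bsub>G\<^esub> H \<in> lcosets H" using g by (rule coset_in)
    obtain h where h: "h \<in> H" "rep (g <#\<^bsub>G\<^esub> H) = g \<otimes> h"
      using coset_eqD[OF g rep(1)[OF C]] rep(2)[OF C] by auto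
    have "\<alpha> (inv (g \<otimes> h)) x = \<alpha> (inv h) (\<alpha> (inv g) x)"
      using g h x H_carrier by (simp add: inv_mult_group E2.alpha_mult)
    then show ?thesis using C h g x \<Phi>(3)[OF H_closed(2)[OF h(1)] E2.alpha_closed[of "inv g" x]] by (simp add: \<Psi>_def)
  qed
  note \<Phi>g = E2.functional_state_alpha[OF \<Phi>(1)]
  have \<Psi>_A: "\<Psi> x \<in> cos.A" if x: "x \<in> E2" for x
  proof (rule cos.rucI[where M = "2 * cnorm B x"])
    show "\<Psi> x \<in> extensional (lcosets H)" by (simp add: \<Psi>_def)
    show "cmod (\<Psi> x C) \<le> 2 * cnorm B x" if "C \<in> lcosets H" for C
      using that by (rule coset_cases) (use E2.sys.functional_bound[OF \<Phi>g x] \<Psi>_coset[OF x] in simp)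
    fix \<epsilon> :: real assume "\<epsilon> > 0"
    then obtain U where U: "openin T U" "\<one> \<in> U" "\<And>u. u \<in> U \<Longrightarrow> cnorm B (\<alpha> (inv u) x \<ominus>\<^bsub>B\<^esub> x) < \<epsilon>/2"
      using E2.alpha_near[OF x, of "\<epsilon>/2"] by auto
    have "cmod (\<Psi> x (u <#\<^bsub>G\<^esub> C) - \<Psi> x C) < \<epsilon>" if u: "u \<in> U" and C: "C \<in> lcosets H" for u C
    proof -
      obtain g where g: "g \<in> carrier G" "C = g <#\<^bsub>G\<^esub> H" using C by (rule coset_cases)
      have uc: "u \<in> carrier G" using U(1) u by (rule nhd_subset)
      show ?thesis
        using E2.functional_state_near[OF \<Phi>(1) g(1) uc x] U(3)[OF u] \<Psi>_coset[OF x g(1)] \<Psi>_coset[OF x, of "u \<otimes> g"] g uc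
        by (simp add: coset_mult)
    qed
    then show "\<exists>U. openin T U \<and> \<one> \<in> U \<and> (\<forall>u\<in>U. \<forall>C\<in>lcosets H. cmod (\<Psi> x (u <#\<^bsub>G\<^esub> C) - \<Psi> x C) < \<epsilon>)"
      using U by blast
  qed
  have eqI: "f = f'" if "f \<in> cos.A" "f' \<in> cos.A" "\<And>g. g \<in> carrier G \<Longrightarrow> f (g <#\<^bsub>G\<^esub> H) = f' (g <#\<^bsub>G\<^esub> H)" for f f'
    using that(1,2) by (rule cos.ruc_eqI) (erule coset_cases, simp add: that(3))
  have "unital_positive_map B E2 cos.alg cos.A \<Psi>"
    unfolding unital_positive_map_def unital_linear_map_def
  proof (intro conjI ballI allI impI)
    show "\<Psi> \<in> E2 \<rightarrow> cos.A" using \<Psi>_A by blast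
    have "\<Psi> \<one>\<^bsub>B\<^esub> = (\<lambda>x\<in>lcosets H. 1)"
      using \<Psi>_A[OF E2.sys.E_one] cos.ruc_const
      by (rule eqI) (simp add: \<Psi>_coset E2.sys.E_one E2.alpha_unit E2.sys.functional_one[OF \<Phi>(1)] coset_in)
    then show "\<Psi> \<one>\<^bsub>B\<^esub> = \<one>\<^bsub>cos.alg\<^esub>" by (simp add: ruc_algebra_def)
    fix x assume x: "x \<in> E2"
    show "\<Psi> (x \<oplus>\<^bsub>B\<^esub> y) = \<Psi> x \<oplus>\<^bsub>cos.alg\<^esub> \<Psi> y" if y: "y \<in> E2" for y
    proof -
      have "\<Psi> (x \<oplus>\<^bsub>B\<^esub> y) = (\<lambda>C\<in>lcosets H. \<Psi> x C + \<Psi> y C)"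
        using \<Psi>_A[OF E2.sys.E_add[OF x y]] cos.ruc_add[OF \<Psi>_A[OF x] \<Psi>_A[OF y]]
        by (rule eqI) (simp add: \<Psi>_coset x y E2.sys.E_add E2.sys.functional_add[OF \<Phi>g x y] coset_in)
      then show ?thesis by (simp add: ruc_algebra_def)
    qed
    show "\<Psi> (c \<odot>\<^bsub>B\<^esub> x) = c \<odot>\<^bsub>cos.alg\<^esub> \<Psi> x" for c
    proof -
      have "\<Psi> (c \<odot>\<^bsub>B\<^esub> x) = (\<lambda>C\<in>lcosets H. c * \<Psi> x C)"
        using \<Psi>_A[OF E2.sys.E_smult[OF x]] cos.ruc_smult[OF \<Psi>_A[OF x]]
        by (rule eqI) (simp add: \<Psi>_coset x E2.sys.E_smult E2.sys.functional_smult[OF \<Phi>g x] coset_in)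
      then show ?thesis by (simp add: ruc_algebra_def)
    qed
    show "cstar_nonneg cos.alg (\<Psi> x)" if "cstar_nonneg B x"
      unfolding cos.cstar_nonneg_alg[OF \<Psi>_A[OF x]]
      by (rule ballI, erule coset_cases) (simp add: \<Psi>_coset x E2.sys.functional_nonneg[OF \<Phi>g x that])
  qed
  moreover have "equivariant_map G E2 \<alpha> (ruc_action G T (lcosets H) (\<lambda>u x. u <#\<^bsub>G\<^esub> x)) \<Psi>"
    unfolding equivariant_map_def
  proof (intro ballI)
    fix k x assume k: "k \<in> carrier G" and x: "x \<in> E2"
    show "\<Psi> (\<alpha> k x) = ruc_action G T (lcosets H) (\<lambda>u x. u <#\<^bsub>G\<^esub> x) k (\<Psi> x)"
      using \<Psi>_A[OF E2.alpha_closed[OF k x]] cos.ruc_action_closed[OF \<Psi>_A[OF x] k]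
    proof (rule eqI)
      fix g assume g: "g \<in> carrier G"
      show "\<Psi> (\<alpha> k x) (g <#\<^bsub>G\<^esub> H) = ruc_action G T (lcosets H) (\<lambda>u x. u <#\<^bsub>G\<^esub> x) k (\<Psi> x) (g <#\<^bsub>G\<^esub> H)"
        using g k x \<Psi>_A[OF x]
        by (simp add: cos.ruc_action_apply coset_in coset_mult \<Psi>_coset E2.alpha_closed inv_mult_group E2.alpha_mult)
    qed
  qed
  moreover have "\<Psi> x = \<psi> x" if x: "x \<in> E1" for x
  proof -
    have x2: "x \<in> E2" using x E1(2) by blast
    show ?thesis using \<Psi>_A[OF x2] psi_closed[OF x]
    proof (rule eqI)
      fix g assume g: "g \<in> carrier G"
      have "\<Psi> x (g <#\<^bsub>G\<^esub> H) = \<psi> (\<alpha> (inv g) x) H" using g x2 x E1(3)[of "inv g" x] by (simp add: \<Psi>_coset \<Phi>(2))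
      then show "\<Psi> x (g <#\<^bsub>G\<^esub> H) = \<psi> x (g <#\<^bsub>G\<^esub> H)" using g x H_coset by (simp add: psi_equivariant)
    qed
  qed
  ultimately show ?thesis by blast
qed

end

theorem injective_of_invariant_mean:
  fixes G :: "('a, 'm) monoid_scheme"
  assumes G: "topological_group G T" and H: "subgroup H G"
    and m: "invariant_mean (G\<lparr>carrier := H\<rparr>) (subtopology T H) m"
  shows "G_injective TYPE('e) G T (RUC G T H) (carrier (RUC G T H)) (RUC_action G T H)"
proof -
  interpret top_group_subgroup G T H
    by (intro top_group_subgroup.intro top_group.intro top_group_subgroup_axioms.intro G H)
  show ?thesis
    unfolding G_injective_def
  proof (intro conjI allI impI RUC_system)
    fix B :: "'e cstar_algebra" and E1 E2 \<alpha> \<psi>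
    assume *: "G_function_system G T B E2 \<alpha> \<and> function_system B E1 \<and> E1 \<subseteq> E2 \<and>
        (\<forall>g\<in>carrier G. \<forall>x\<in>E1. \<alpha> g x \<in> E1) \<and>
        unital_positive_map B E1 (RUC G T H) (carrier (RUC G T H)) \<psi> \<and>
        equivariant_map G E1 \<alpha> (RUC_action G T H) \<psi>"
    interpret injectivity_test G T H B E1 E2 \<alpha> \<psi> m
      using * m by unfold_locales (auto simp: RUC_eq RUC_action_eq cos.carrier_alg)
    show "\<exists>\<Psi>. unital_positive_map B E2 (RUC G T H) (carrier (RUC G T H)) \<Psi> \<and>
        equivariant_map G E2 \<alpha> (RUC_action G T H) \<Psi> \<and> (\<forall>x\<in>E1. \<Psi> x = \<psi> x)"
      using extension by (simp add: RUC_eq RUC_action_eq cos.carrier_alg)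
  qed
qed

section \<open>Uniformly continuous functions on a subgroup and on its coset space\<close>

text \<open>Take for \<open>z\<close> the first element after which a sum of at most \<open>d\<close> remains. If it is not the head of
  the list, then it and its successors sum to more than \<open>d\<close>, which leaves less than \<open>c\<close> for \<open>ys\<close>.\<close>

lemma split_list_sum_le:
  fixes l :: "'a \<Rightarrow> real"
  assumes "xs \<noteq> []" "sum_list (map l xs) \<le> c + d" "0 \<le> c" "0 \<le> d"
  obtains ys z zs where "xs = ys @ z # zs" "sum_list (map l ys) \<le> c" "sum_list (map l zs) \<le> d"
proof -
  have "\<exists>ys z zs. xs = ys @ z # zs \<and> sum_list (map l ys) \<le> c \<and> sum_list (map l zs) \<le> d"
    using assms(1-3)
  proof (induction xs arbitrary: c)
    case (Cons x xs)
    show ?case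
    proof (cases "sum_list (map l xs) \<le> d")
      case True
      then have "x # xs = [] @ x # xs \<and> sum_list (map l []) \<le> c \<and> sum_list (map l xs) \<le> d"
        using Cons.prems(3) by simp
      then show ?thesis by blast
    next
      case False
      then have "xs \<noteq> []" using assms(4) by auto
      moreover have "sum_list (map l xs) \<le> (c - l x) + d" "0 \<le> c - l x"
        using Cons.prems(2) False by auto
      ultimately obtain ys z zs where "xs = ys @ z # zs" "sum_list (map l ys) \<le> c - l x" "sum_list (map l zs) \<le> d"
        using Cons.IH by blast
      then have "x # xs = (x # ys) @ z # zs \<and> sum_list (map l (x # ys)) \<le> c \<and> sum_list (map l zs) \<le> d"
        by simp
      then show ?thesis by blast
    qed
  qed simp
  then show ?thesis using that by blast
qed

context top_group
begin

lemma nhd_symmetric_cubed: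
  assumes "openin T U" "\<one> \<in> U"
  obtains V where "openin T V" "\<one> \<in> V" "V \<subseteq> U" "\<And>x. x \<in> V \<Longrightarrow> inv x \<in> V"
    "\<And>x y z. \<lbrakk>x \<in> V; y \<in> V; z \<in> V\<rbrakk> \<Longrightarrow> x \<otimes> y \<otimes> z \<in> U"
proof -
  obtain V1 where V1: "openin T V1" "\<one> \<in> V1" "\<And>x y. x \<in> V1 \<Longrightarrow> y \<in> V1 \<Longrightarrow> x \<otimes> y \<in> U"
    using nhd_mult[OF assms] by blast
  obtain V2 where V2: "openin T V2" "\<one> \<in> V2" "\<And>x y. x \<in> V2 \<Longrightarrow> y \<in> V2 \<Longrightarrow> x \<otimes> y \<in> V1"
    using nhd_mult[OF V1(1,2)] by blast
  define V where "V = V1 \<inter> V2 \<inter> U \<inter> {x \<in> topspace T. inv x \<in> V1 \<inter> V2 \<inter> U}"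
  have W: "openin T (V1 \<inter> V2 \<inter> U)" using V1 V2 assms by blast
  show ?thesis
  proof (rule that)
    show "openin T V" unfolding V_def
      using W openin_continuous_map_preimage[OF continuous_inv W] by blast
    show "\<one> \<in> V" using V1 V2 assms by (simp add: V_def topspace_eq)
    show "inv x \<in> V" if "x \<in> V" for x using that by (auto simp: V_def topspace_eq)
    show "x \<otimes> y \<otimes> z \<in> U" if "x \<in> V" "y \<in> V" "z \<in> V" for x y z
      using that V1(3) V2(3) by (simp add: V_def)
  qed (auto simp: V_def)
qed

lemma nhd_chain:
  assumes W: "\<And>n::nat. openin T (W n) \<and> \<one> \<in> W n"
  obtains U where "U 0 = carrier G" "\<And>n::nat. openin T (U n)" "\<And>n. \<one> \<in> U n" "\<And>n. U (Suc n) \<subseteq> U n"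
    "\<And>n. U (Suc n) \<subseteq> W n" "\<And>n x. x \<in> U n \<Longrightarrow> inv x \<in> U n"
    "\<And>n x y z. \<lbrakk>x \<in> U (Suc n); y \<in> U (Suc n); z \<in> U (Suc n)\<rbrakk> \<Longrightarrow> x \<otimes> y \<otimes> z \<in> U n"
proof -
  let ?P = "\<lambda>n U. openin T U \<and> \<one> \<in> U \<and> (\<forall>x\<in>U. inv x \<in> U) \<and> (n = (0::nat) \<longrightarrow> U = carrier G)"
  let ?Q = "\<lambda>n U V. V \<subseteq> U \<and> V \<subseteq> W n \<and> (\<forall>x\<in>V. \<forall>y\<in>V. \<forall>z\<in>V. x \<otimes> y \<otimes> z \<in> U)"
  have "\<exists>U. \<forall>n. ?P n (U n) \<and> ?Q n (U n) (U (Suc n))"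
  proof (rule dependent_nat_choice)
    show "\<exists>U. ?P 0 U" by (auto intro!: exI[of _ "carrier G"] simp: openin_carrier)
    fix U n assume U: "?P n U"
    have UW: "openin T (U \<inter> W n)" "\<one> \<in> U \<inter> W n" using U W by auto
    obtain V where V: "openin T V" "\<one> \<in> V" "V \<subseteq> U \<inter> W n" "\<And>x. x \<in> V \<Longrightarrow> inv x \<in> V"
      "\<And>x y z. \<lbrakk>x \<in> V; y \<in> V; z \<in> V\<rbrakk> \<Longrightarrow> x \<otimes> y \<otimes> z \<in> U \<inter> W n"
      using nhd_symmetric_cubed[OF UW] by blast
    then show "\<exists>V. ?P (Suc n) V \<and> ?Q n U V" by (intro exI[of _ V]) auto
  qed
  then obtain U where U: "\<forall>n. ?P n (U n) \<and> ?Q n (U n) (U (Suc n))" by blast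
  show ?thesis by (rule that[of U]) (use U in blast)+
qed

definition list_prod :: "'a list \<Rightarrow> 'a" where
  "list_prod xs = foldr (\<otimes>) xs \<one>"

lemma list_prod_simps [simp]: "list_prod [] = \<one>" "list_prod (x # xs) = x \<otimes> list_prod xs"
  by (simp_all add: list_prod_def)

lemma list_prod_closed [simp]: "set xs \<subseteq> carrier G \<Longrightarrow> list_prod xs \<in> carrier G"
  by (induction xs) auto

lemma list_prod_append:
  "set xs \<subseteq> carrier G \<Longrightarrow> set ys \<subseteq> carrier G \<Longrightarrow> list_prod (xs @ ys) = list_prod xs \<otimes> list_prod ys"
  by (induction xs) (auto simp: m_assoc)

lemma list_prod_inv:
  "set xs \<subseteq> carrier G \<Longrightarrow> list_prod (map (\<lambda>x. inv x) (rev xs)) = inv (list_prod xs)"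
proof (induction xs)
  case (Cons x xs)
  then have "set (map (\<lambda>x. inv x) (rev xs)) \<subseteq> carrier G" by auto
  then show ?case using Cons by (simp add: list_prod_append inv_mult_group)
qed simp

text \<open>The construction of Birkhoff and Kakutani. Shrink the given neighbourhoods to symmetric
  neighbourhoods \<open>U n\<close> such that a product of three elements of \<open>U (n + 1)\<close> lies in \<open>U n\<close>, and give an
  element that lies in \<open>U n\<close> a weight of at most \<open>2\<^sup>-\<^sup>n\<close>. The length \<open>N x\<close> is the infimum of the total
  weights of the factorisations of \<open>x\<close>. The key point is that a product of total weight below \<open>2\<^sup>-\<^sup>n\<close>
  lies in \<open>U n\<close>: split the factors into two groups of at most half the weight and a single factor
  between them, and use induction on the number of factors.\<close>

lemma continuous_length_function:
  assumes W: "\<And>n::nat. openin T (W n) \<and> \<one> \<in> W n"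
  obtains N :: "'a \<Rightarrow> real" where "\<And>x. x \<in> carrier G \<Longrightarrow> 0 \<le> N x" "\<And>x. x \<in> carrier G \<Longrightarrow> N x \<le> 1" "N \<one> = 0"
    "\<And>x y. \<lbrakk>x \<in> carrier G; y \<in> carrier G\<rbrakk> \<Longrightarrow> N (x \<otimes> y) \<le> N x + N y"
    "\<And>x. x \<in> carrier G \<Longrightarrow> N (inv x) = N x"
    "\<And>\<epsilon>. \<epsilon> > 0 \<Longrightarrow> \<exists>U. openin T U \<and> \<one> \<in> U \<and> (\<forall>u\<in>U. N u < \<epsilon>)"
    "\<And>n x. \<lbrakk>x \<in> carrier G; N x < (1/2) ^ Suc n\<rbrakk> \<Longrightarrow> x \<in> W n"
proof -
  obtain U where U0: "U 0 = carrier G" and Uo: "\<And>n. openin T (U n)" and U1: "\<And>n. \<one> \<in> U n"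
    and Udec: "\<And>n. U (Suc n) \<subseteq> U n" and UW: "\<And>n. U (Suc n) \<subseteq> W n" and Uinv: "\<And>n x. x \<in> U n \<Longrightarrow> inv x \<in> U n"
    and Ucube: "\<And>n x y z. \<lbrakk>x \<in> U (Suc n); y \<in> U (Suc n); z \<in> U (Suc n)\<rbrakk> \<Longrightarrow> x \<otimes> y \<otimes> z \<in> U n"
  proof (rule nhd_chain[of W, OF W], goal_cases)
    case (1 U)
    from 1(2-) show ?case by (rule 1(1))
  qed
  have Umono: "U n \<subseteq> U m" if "m \<le> n" for m n using that Udec by (rule lift_Suc_antimono_le[rotated])
  define l :: "'a \<Rightarrow> real" where "l x = (INF n\<in>{n. x \<in> U n}. (1/2) ^ n)" for x
  have bdd: "bdd_below ((\<lambda>n. (1/2::real) ^ n) ` X)" for X by (rule bdd_belowI2[of _ 0]) simp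
  have l_le: "l x \<le> (1/2) ^ n" if "x \<in> U n" for n x
    unfolding l_def using that by (intro cINF_lower bdd) simp
  have l_ge: "0 \<le> l x" if "x \<in> carrier G" for x
    unfolding l_def using that U0 by (intro cINF_greatest) auto
  have l_less: "x \<in> U (Suc n)" if x: "x \<in> carrier G" "l x < (1/2) ^ n" for n x
  proof -
    have "{n. x \<in> U n} \<noteq> {}" using x(1) U0 by auto
    then obtain k where k: "x \<in> U k" "(1/2::real) ^ k < (1/2) ^ n"
      using x(2) unfolding l_def by (auto simp: cINF_less_iff[OF _ bdd])
    then have "Suc n \<le> k" using power_strict_decreasing_iff[of "1/2::real" k n] by simp
    then show ?thesis using Umono k(1) by blast
  qed
  have l_inv: "l (inv x) = l x" if "x \<in> carrier G" for x
  proof -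
    have "inv x \<in> U n \<longleftrightarrow> x \<in> U n" for n using Uinv[of x n] Uinv[of "inv x" n] that by auto
    then show ?thesis by (simp add: l_def)
  qed
  have sum_l_ge: "0 \<le> sum_list (map l xs)" if "set xs \<subseteq> carrier G" for xs
    using that by (induction xs) (auto simp: l_ge)
  have key: "list_prod xs \<in> U n" if "set xs \<subseteq> carrier G" "sum_list (map l xs) < (1/2) ^ n" for xs n
    using that
  proof (induction xs arbitrary: n rule: length_induct)
    case (1 xs)
    show ?case
    proof (cases "xs = []")
      case False
      define s where "s = sum_list (map l xs)"
      have s0: "0 \<le> s" unfolding s_def using 1(2) by (rule sum_l_ge)
      obtain ys z zs where xs: "xs = ys @ z # zs" "sum_list (map l ys) \<le> s/2" "sum_list (map l zs) \<le> s/2"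
        by (rule split_list_sum_le[of xs l "s/2" "s/2"])
           (use False s0 in \<open>simp_all add: s_def\<close>)
      have sub: "set ys \<subseteq> carrier G" "z \<in> carrier G" "set zs \<subseteq> carrier G" using 1(2) xs(1) by auto
      have half: "s/2 < (1/2) ^ Suc n" using 1(3) by (simp add: s_def)
      have "list_prod ys \<in> U (Suc n)" "list_prod zs \<in> U (Suc n)"
        using 1(1) sub xs half by auto
      moreover have "z \<in> U (Suc n)"
      proof (rule l_less[OF sub(2)])
        have "l z \<le> s"
          using sum_l_ge[OF sub(1)] sum_l_ge[OF sub(3)] by (simp add: s_def xs(1))
        then show "l z < (1/2) ^ n" using 1(3) by (simp add: s_def)
      qed
      ultimately have "list_prod ys \<otimes> z \<otimes> list_prod zs \<in> U n" by (intro Ucube)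
      then show ?thesis using sub by (simp add: xs(1) list_prod_append m_assoc)
    qed (simp add: U1)
  qed
  \<comment> \<open>the factorisations of \<open>x\<close>; the empty one makes the length of the identity 0\<close>
  define R where "R x = {xs. set xs \<subseteq> carrier G \<and> list_prod xs = x}" for x
  define N where "N x = (INF xs\<in>R x. sum_list (map l xs))" for x
  have sum_ge: "0 \<le> sum_list (map l xs)" if "xs \<in> R x" for xs x
    using that by (simp add: R_def sum_l_ge)
  have bddN: "bdd_below ((\<lambda>xs. sum_list (map l xs)) ` R x)" for x
    using sum_ge by (intro bdd_belowI2[of _ 0])
  have R1: "[x] \<in> R x" if "x \<in> carrier G" for x using that by (simp add: R_def)
  have N_le: "N x \<le> sum_list (map l xs)" if "xs \<in> R x" for x xs
    unfolding N_def using bddN that by (rule cINF_lower)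
  have N_less: "\<exists>xs\<in>R x. sum_list (map l xs) < c" if "x \<in> carrier G" "N x < c" for x c
  proof -
    have "R x \<noteq> {}" using R1[OF that(1)] by blast
    then show ?thesis using that(2) unfolding N_def by (simp add: cINF_less_iff[OF _ bddN])
  qed
  have N_l: "N x \<le> l x" if "x \<in> carrier G" for x using N_le[OF R1[OF that]] by simp
  have N_ge: "0 \<le> N x" if "x \<in> carrier G" for x
    unfolding N_def using R1[OF that] sum_ge by (intro cINF_greatest) auto
  have N_inv_le: "N (inv x) \<le> N x" if x: "x \<in> carrier G" for x
  proof (rule dense_ge)
    fix c assume "N x < c"
    then obtain xs where xs: "xs \<in> R x" "sum_list (map l xs) < c" using N_less[OF x] by blast
    then have sub: "set xs \<subseteq> carrier G" by (simp add: R_def)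
    have "map l (map (\<lambda>x. inv x) (rev xs)) = rev (map l xs)"
      using sub l_inv by (auto simp: rev_map)
    then have "sum_list (map l (map (\<lambda>x. inv x) (rev xs))) = sum_list (map l xs)"
      by (metis sum_list_rev)
    moreover have "map (\<lambda>x. inv x) (rev xs) \<in> R (inv x)"
      using xs(1) by (auto simp: R_def list_prod_inv)
    ultimately show "N (inv x) \<le> c" using N_le xs(2) by fastforce
  qed
  show ?thesis
  proof (rule that[of N])
    show "0 \<le> N x" if "x \<in> carrier G" for x using that by (rule N_ge)
    show "N x \<le> 1" if "x \<in> carrier G" for x using N_l[OF that] l_le[of x 0] that by (simp add: U0)
    show "N \<one> = 0" using N_le[of "[]" \<one>] N_ge[of \<one>] by (simp add: R_def)
    show "N (x \<otimes> y) \<le> N x + N y" if x: "x \<in> carrier G" and y: "y \<in> carrier G" for x y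
    proof (rule field_le_epsilon)
      fix e :: real assume "0 < e"
      then obtain xs ys where xs: "xs \<in> R x" "sum_list (map l xs) < N x + e/2"
        and ys: "ys \<in> R y" "sum_list (map l ys) < N y + e/2"
        using N_less[OF x, of "N x + e/2"] N_less[OF y, of "N y + e/2"] by auto
      have "xs @ ys \<in> R (x \<otimes> y)" using xs(1) ys(1) by (auto simp: R_def list_prod_append)
      then show "N (x \<otimes> y) \<le> N x + N y + e" using N_le xs(2) ys(2) by fastforce
    qed
    show "N (inv x) = N x" if "x \<in> carrier G" for x
      using N_inv_le[of x] N_inv_le[of "inv x"] that by simp
    show "\<exists>U. openin T U \<and> \<one> \<in> U \<and> (\<forall>u\<in>U. N u < \<epsilon>)" if \<epsilon>: "\<epsilon> > 0" for \<epsilon> :: real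
    proof -
      obtain n where n: "(1/2::real) ^ n < \<epsilon>" using real_arch_pow_inv[OF \<epsilon>, of "1/2"] by auto
      have "N u < \<epsilon>" if "u \<in> U n" for u
        using N_l[OF nhd_subset[OF Uo that]] l_le[OF that] n by linarith
      then show ?thesis using Uo U1 by blast
    qed
    show "x \<in> W n" if x: "x \<in> carrier G" "N x < (1/2) ^ Suc n" for n x
    proof -
      obtain xs where "xs \<in> R x" "sum_list (map l xs) < (1/2) ^ Suc n" using N_less[OF x] by blast
      then have "x \<in> U (Suc n)" using key[of xs "Suc n"] by (auto simp: R_def)
      then show ?thesis using UW by blast
    qed
  qed
qed

end

context top_group_subgroup
begin

text \<open>Take a length function adapted to neighbourhoods \<open>W n\<close> on which \<open>f\<close> oscillates by less than
  \<open>2\<^sup>-\<^sup>n\<close>. If the length of \<open>h k\<inverse>\<close> is below \<open>2\<^sup>-\<^sup>n\<^sup>-\<^sup>1\<close>, then \<open>f h\<close> and \<open>f k\<close> differ by less than \<open>2\<^sup>-\<^sup>n\<close>, and for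
  lengths of at least 1/2 the bound on \<open>f\<close> suffices.\<close>

lemma lipschitz_of_ruc_real:
  fixes f :: "'a \<Rightarrow> real"
  assumes f: "(\<lambda>h\<in>H. complex_of_real (f h)) \<in> ruc_group K (subtopology T H)"
  obtains N :: "'a \<Rightarrow> real" and C where "C \<ge> 0" "\<And>x. x \<in> carrier G \<Longrightarrow> 0 \<le> N x"
    "\<And>x. x \<in> carrier G \<Longrightarrow> N x \<le> 1" "N \<one> = 0"
    "\<And>x y. \<lbrakk>x \<in> carrier G; y \<in> carrier G\<rbrakk> \<Longrightarrow> N (x \<otimes> y) \<le> N x + N y"
    "\<And>x. x \<in> carrier G \<Longrightarrow> N (inv x) = N x"
    "\<And>\<epsilon>. \<epsilon> > 0 \<Longrightarrow> \<exists>U. openin T U \<and> \<one> \<in> U \<and> (\<forall>u\<in>U. N u < \<epsilon>)"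
    "\<And>h k. \<lbrakk>h \<in> H; k \<in> H\<rbrakk> \<Longrightarrow> \<bar>f h - f k\<bar> \<le> C * N (h \<otimes> inv k)"
proof -
  have "\<exists>M>0. \<forall>h\<in>carrier K. cmod ((\<lambda>h\<in>H. complex_of_real (f h)) h) \<le> M"
    by (rule sub.self.ruc_bounded[OF f])
  then obtain M where M: "M > 0" "\<And>h. h \<in> H \<Longrightarrow> \<bar>f h\<bar> \<le> M" by auto
  have "\<exists>W. openin T W \<and> \<one> \<in> W \<and> (\<forall>u\<in>W \<inter> H. \<forall>h\<in>H. \<bar>f (u \<otimes> h) - f h\<bar> < (1/2) ^ n)" for n :: nat
  proof -
    obtain U where U: "openin (subtopology T H) U" "\<one>\<^bsub>K\<^esub> \<in> U"
      "\<And>u h. u \<in> U \<Longrightarrow> h \<in> carrier K \<Longrightarrow>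
        cmod ((\<lambda>h\<in>H. complex_of_real (f h)) (u \<otimes>\<^bsub>K\<^esub> h) - (\<lambda>h\<in>H. complex_of_real (f h)) h) < (1/2) ^ n"
      using sub.self.ruc_nhd[OF f, of "(1/2) ^ n"] by auto
    then obtain W where W: "openin T W" "U = W \<inter> H" by (auto simp: openin_subtopology)
    have "\<bar>f (u \<otimes> h) - f h\<bar> < (1/2) ^ n" if "u \<in> W \<inter> H" "h \<in> H" for u h
      using U(3)[of u h] that W(2) H_closed by (simp flip: of_real_diff)
    then show ?thesis using W U(2) by auto
  qed
  then obtain W where W: "\<And>n::nat. openin T (W n) \<and> \<one> \<in> W n"
    and Wf: "\<And>n u h. u \<in> W n \<inter> H \<Longrightarrow> h \<in> H \<Longrightarrow> \<bar>f (u \<otimes> h) - f h\<bar> < (1/2) ^ n"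
    by metis
  show ?thesis
  proof (rule continuous_length_function[of W, OF W], goal_cases)
    case (1 N)
    note N = 1
    \<comment> \<open>\<open>4 M\<close> serves lengths of at least 1/2, where \<open>f\<close> changes by at most \<open>2 M\<close>; the other bound 4 is
      the ratio of \<open>2\<^sup>-\<^sup>m\<close> to \<open>2\<^sup>-\<^sup>m\<^sup>-\<^sup>2\<close>, where the length lies between \<open>2\<^sup>-\<^sup>m\<^sup>-\<^sup>2\<close> and \<open>2\<^sup>-\<^sup>m\<^sup>-\<^sup>1\<close>\<close>
    define C where "C = max 4 (4 * M)"
    have lip: "\<bar>f h - f k\<bar> \<le> C * N (h \<otimes> inv k)" if h: "h \<in> H" and k: "k \<in> H" for h k
    proof -
      define u where "u = h \<otimes> inv k"
      have u: "u \<in> H" "u \<in> carrier G" "u \<otimes> k = h"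
        using h k H_closed H_carrier by (auto simp: u_def m_assoc)
      have small: "\<bar>f h - f k\<bar> < (1/2) ^ n" if "N u < (1/2) ^ Suc n" for n
        using Wf[of u n k] N(7)[OF u(2) that] u k by simp
      have "\<bar>f h - f k\<bar> \<le> 2 * M" using M(2)[OF h] M(2)[OF k] by linarith
      show ?thesis
      proof (cases "N u = 0")
        case True
        have "\<bar>f h - f k\<bar> \<le> e" if "e > 0" for e :: real
        proof -
          obtain n where "(1/2::real) ^ n < e" using real_arch_pow_inv[OF \<open>e > 0\<close>, of "1/2"] by auto
          then show ?thesis using small[of n] True by simp
        qed
        then have "\<bar>f h - f k\<bar> \<le> 0" using field_le_epsilon[of "\<bar>f h - f k\<bar>" 0] by simp
        then show ?thesis using True by (simp add: u_def)
      next
        case False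
        then have pos: "N u > 0" using N(1)[OF u(2)] by simp
        define n where "n = (LEAST n. (1/2) ^ Suc n \<le> N u)"
        have "\<exists>n. (1/2) ^ Suc n \<le> N u"
        proof -
          obtain n where "(1/2::real) ^ n < N u" using real_arch_pow_inv[OF pos, of "1/2"] by auto
          then have "(1/2) ^ Suc n \<le> N u" using pos by simp
          then show ?thesis by blast
        qed
        then have n: "(1/2) ^ Suc n \<le> N u" unfolding n_def by (rule LeastI_ex)
        have "\<bar>f h - f k\<bar> \<le> C * N u"
        proof (cases n)
          case 0
          have "\<bar>f h - f k\<bar> \<le> (4 * M) * (1/2)" using \<open>\<bar>f h - f k\<bar> \<le> 2 * M\<close> by simp
          also have "\<dots> \<le> C * N u" using n 0 M(1) by (intro mult_mono) (auto simp: C_def)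
          finally show ?thesis .
        next
          case (Suc m)
          have "\<not> (1/2) ^ Suc m \<le> N u"
            using not_less_Least[of m "\<lambda>n. (1/2) ^ Suc n \<le> N u"] Suc by (simp add: n_def)
          then have "\<bar>f h - f k\<bar> < (1/2) ^ m" by (intro small) simp
          also have "\<dots> = 4 * (1/2) ^ Suc n" using Suc by simp
          also have "\<dots> \<le> C * N u" using n pos by (intro mult_mono) (auto simp: C_def)
          finally show ?thesis by simp
        qed
        then show ?thesis by (simp add: u_def)
      qed
    qed
    have C: "C \<ge> 0" by (simp add: C_def)
    from C N(1-6) lip show ?case by (rule that)
  qed
qed

text \<open>McShane's extension of a Lipschitz function, for the right invariant pseudometric given by a
  length function on the whole group; being Lipschitz for it implies right uniform continuity.\<close>

lemma ruc_extend_real: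
  fixes f :: "'a \<Rightarrow> real"
  assumes f: "(\<lambda>h\<in>H. complex_of_real (f h)) \<in> ruc_group K (subtopology T H)"
  shows "\<exists>F\<in>self.A. \<forall>h\<in>H. F h = complex_of_real (f h)"
proof (rule lipschitz_of_ruc_real[OF f], goal_cases)
  case (1 N C)
  note N = 1
  have "\<exists>M>0. \<forall>h\<in>carrier K. cmod ((\<lambda>h\<in>H. complex_of_real (f h)) h) \<le> M"
    by (rule sub.self.ruc_bounded[OF f])
  then obtain M where M: "\<And>h. h \<in> H \<Longrightarrow> \<bar>f h\<bar> \<le> M" by auto
  define F where "F g = (INF h\<in>H. f h + C * N (g \<otimes> inv h))" for g
  have CN: "0 \<le> C * N x" "C * N x \<le> C" if "x \<in> carrier G" for x
    using N(1-3) that by (auto intro: mult_left_le)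
  have ne: "H \<noteq> {}" using H_closed(3) by blast
  have low: "- M \<le> f h + C * N (g \<otimes> inv h)" if "g \<in> carrier G" "h \<in> H" for g h
    using M[OF that(2)] CN(1)[of "g \<otimes> inv h"] that H_carrier[OF that(2)] by (simp add: abs_le_iff)
  have bdd: "bdd_below ((\<lambda>h. f h + C * N (g \<otimes> inv h)) ` H)" if "g \<in> carrier G" for g
    using low[OF that] by (rule bdd_belowI2)
  have F_le: "F g \<le> f h + C * N (g \<otimes> inv h)" if "g \<in> carrier G" "h \<in> H" for g h
    unfolding F_def using bdd[OF that(1)] that(2) by (rule cINF_lower)
  have F_ge: "c \<le> F g" if "\<And>h. h \<in> H \<Longrightarrow> c \<le> f h + C * N (g \<otimes> inv h)" for c g
    unfolding F_def using ne that by (rule cINF_greatest)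
  have F_eq: "F k = f k" if k: "k \<in> H" for k
  proof (rule antisym)
    show "F k \<le> f k" using F_le[of k k] k H_carrier N(4) by simp
    show "f k \<le> F k"
    proof (rule F_ge)
      fix h assume "h \<in> H"
      then show "f k \<le> f h + C * N (k \<otimes> inv h)" using N(8)[OF k, of h] by linarith
    qed
  qed
  have F_bound: "\<bar>F g\<bar> \<le> M + C" if g: "g \<in> carrier G" for g
    using F_ge[of "- M" g] low[OF g] F_le[OF g H_closed(3)] M[OF H_closed(3)] CN(2)[of "g \<otimes> inv \<one>"] g N(1)
    by (auto simp: abs_le_iff)
  have F_lip1: "F (u \<otimes> g) \<le> F g + C * N u" if u: "u \<in> carrier G" and g: "g \<in> carrier G" for u g
  proof -
    have "F (u \<otimes> g) - C * N u \<le> f h + C * N (g \<otimes> inv h)" if h: "h \<in> H" for h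
    proof -
      have hc: "inv h \<in> carrier G" using h H_carrier by simp
      have "N (u \<otimes> g \<otimes> inv h) \<le> N u + N (g \<otimes> inv h)"
        using N(5)[of u "g \<otimes> inv h"] u g hc by (simp add: m_assoc)
      then have "C * N (u \<otimes> g \<otimes> inv h) \<le> C * N u + C * N (g \<otimes> inv h)"
        using N(1) by (simp add: mult_left_mono flip: distrib_left)
      then show ?thesis using F_le[OF m_closed[OF u g] h] by simp
    qed
    then show ?thesis using F_ge[of "F (u \<otimes> g) - C * N u" g] by simp
  qed
  have F_lip: "\<bar>F (u \<otimes> g) - F g\<bar> \<le> C * N u" if u: "u \<in> carrier G" and g: "g \<in> carrier G" for u g
    using F_lip1[OF u g] F_lip1[of "inv u" "u \<otimes> g"] u g N(6)[OF u]
    by (simp add: m_assoc[symmetric] abs_le_iff)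
  have "(\<lambda>g\<in>carrier G. complex_of_real (F g)) \<in> self.A"
  proof (rule self.rucI[where M = "M + C"])
    fix \<epsilon> :: real assume \<epsilon>: "\<epsilon> > 0"
    obtain U where U: "openin T U" "\<one> \<in> U" "\<forall>u\<in>U. N u < \<epsilon> / (C + 1)" using N(7)[of "\<epsilon> / (C + 1)"] \<epsilon> N(1) by auto
    have "\<bar>F (u \<otimes> g) - F g\<bar> < \<epsilon>" if u: "u \<in> U" and g: "g \<in> carrier G" for u g
    proof -
      have uc: "u \<in> carrier G" using U(1) u by (rule nhd_subset)
      have "C * N u \<le> C * (\<epsilon> / (C + 1))" using U(3) u N(1) by (intro mult_left_mono) auto
      also have "\<dots> < \<epsilon>" using \<epsilon> N(1) by (simp add: field_simps)
      finally show ?thesis using F_lip[OF uc g] by simp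
    qed
    then show "\<exists>U. openin T U \<and> \<one> \<in> U \<and> (\<forall>u\<in>U. \<forall>x\<in>carrier G.
        cmod ((\<lambda>g\<in>carrier G. complex_of_real (F g)) (u \<otimes> x) - (\<lambda>g\<in>carrier G. complex_of_real (F g)) x) < \<epsilon>)"
      using U(1,2) nhd_subset by (intro exI[of _ U]) (auto simp flip: of_real_diff)
  qed (auto simp: F_bound)
  then show ?case using F_eq H_carrier by (intro bexI[of _ "\<lambda>g\<in>carrier G. complex_of_real (F g)"]) auto
qed

lemma ruc_extend:
  assumes f: "f \<in> ruc_group K (subtopology T H)"
  shows "\<exists>F\<in>self.A. \<forall>h\<in>H. F h = f h"
proof -
  have "(\<lambda>h\<in>H. complex_of_real (Re (f h))) \<in> ruc_group K (subtopology T H)"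
    using sub.self.ruc_Re[OF f] by simp
  then obtain F1 where F1: "F1 \<in> self.A" "\<forall>h\<in>H. F1 h = complex_of_real (Re (f h))"
    using ruc_extend_real[of "\<lambda>h. Re (f h)"] by blast
  have "(\<lambda>h\<in>H. complex_of_real (Im (f h))) \<in> ruc_group K (subtopology T H)"
    using sub.self.ruc_Im[OF f] by simp
  then obtain F2 where F2: "F2 \<in> self.A" "\<forall>h\<in>H. F2 h = complex_of_real (Im (f h))"
    using ruc_extend_real[of "\<lambda>h. Im (f h)"] by blast
  have "(\<lambda>g\<in>carrier G. F1 g + (\<lambda>g\<in>carrier G. \<i> * F2 g) g) \<in> self.A"
    by (rule self.ruc_add[OF F1(1) self.ruc_smult[OF F2(1), of \<i>]])
  moreover have "(\<lambda>g\<in>carrier G. F1 g + (\<lambda>g\<in>carrier G. \<i> * F2 g) g) h = f h" if "h \<in> H" for h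
    using that F1(2) F2(2) H_carrier by (simp flip: complex_eq)
  ultimately show ?thesis by blast
qed

text \<open>The distance of a coset from the identity, measured by a length function that is at least 1/2
  outside \<open>U\<close>, changes by at most the length of \<open>u\<close> under translation by \<open>u\<close>. The bump is 1 minus twice
  this distance, cut off at 0.\<close>

lemma coset_bump:
  assumes U: "openin T U" "\<one> \<in> U"
  obtains \<rho> :: "'a set \<Rightarrow> real" where "(\<lambda>C\<in>lcosets H. complex_of_real (\<rho> C)) \<in> cos.A" "\<rho> H = 1"
    "\<And>C. C \<in> lcosets H \<Longrightarrow> 0 \<le> \<rho> C \<and> \<rho> C \<le> 1"
    "\<And>C. C \<in> lcosets H \<Longrightarrow> \<rho> C \<noteq> 0 \<Longrightarrow> C \<inter> U \<noteq> {}"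
proof (rule continuous_length_function[of "\<lambda>_. U"], goal_cases)
  case 1 then show ?case using U by blast
next
  case (2 N)
  note N = 2(2-)
  define D where "D C = (INF x\<in>C. N x)" for C
  have CG: "C \<subseteq> carrier G" "C \<noteq> {}" if "C \<in> lcosets H" for C
    using coset_cases[OF that, of "C \<subseteq> carrier G"] coset_cases[OF that, of "C \<noteq> {}"] H_carrier H_closed(3)
    by (force simp: l_coset_def)+
  have bdd: "bdd_below (N ` C)" if "C \<in> lcosets H" for C
    using CG[OF that] N(1) by (intro bdd_belowI2[of _ 0]) auto
  have D_ge: "0 \<le> D C" if "C \<in> lcosets H" for C
    unfolding D_def using CG[OF that] N(1) by (intro cINF_greatest) auto
  have D_lip1: "D (u <#\<^bsub>G\<^esub> C) \<le> D C + N u" if u: "u \<in> carrier G" and C: "C \<in> lcosets H" for u C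
  proof -
    have "D (u <#\<^bsub>G\<^esub> C) - N u \<le> N y" if y: "y \<in> C" for y
    proof -
      have "u \<otimes> y \<in> u <#\<^bsub>G\<^esub> C" using y by (auto simp: l_coset_def)
      then have "D (u <#\<^bsub>G\<^esub> C) \<le> N (u \<otimes> y)"
        unfolding D_def using bdd[OF cos.act_closed[OF u C]] by (intro cINF_lower)
      then show ?thesis using N(4)[OF u, of y] y CG(1)[OF C] by auto
    qed
    then have "D (u <#\<^bsub>G\<^esub> C) - N u \<le> D C"
      using CG(2)[OF C] unfolding D_def[of C] by (intro cINF_greatest)
    then show ?thesis by simp
  qed
  have D_lip: "\<bar>D (u <#\<^bsub>G\<^esub> C) - D C\<bar> \<le> N u" if u: "u \<in> carrier G" and C: "C \<in> lcosets H" for u C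
  proof -
    have "inv u <#\<^bsub>G\<^esub> (u <#\<^bsub>G\<^esub> C) = C" using u C cos.act_mult[of "inv u" u C] by simp
    then show ?thesis
      using D_lip1[OF u C] D_lip1[OF inv_closed[OF u] cos.act_closed[OF u C]] N(5)[OF u] by simp
  qed
  define \<rho> where "\<rho> C = max 0 (1 - 2 * D C)" for C
  have \<rho>_ge: "0 \<le> \<rho> C" for C by (simp add: \<rho>_def)
  have \<rho>_le: "\<rho> C \<le> 1" if "C \<in> lcosets H" for C using D_ge[OF that] by (simp add: \<rho>_def)
  have \<rho>_lip: "\<bar>\<rho> (u <#\<^bsub>G\<^esub> C) - \<rho> C\<bar> \<le> 2 * N u" if "u \<in> carrier G" "C \<in> lcosets H" for u C
    using D_lip[OF that] by (auto simp: \<rho>_def max_def)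
  have "(\<lambda>C\<in>lcosets H. complex_of_real (\<rho> C)) \<in> cos.A"
  proof (rule cos.rucI[where M = 1])
    fix \<epsilon> :: real assume \<epsilon>: "\<epsilon> > 0"
    obtain V where V: "openin T V" "\<one> \<in> V" "\<forall>u\<in>V. N u < \<epsilon>/2" using N(6)[of "\<epsilon>/2"] \<epsilon> by auto
    have "\<bar>\<rho> (u <#\<^bsub>G\<^esub> C) - \<rho> C\<bar> < \<epsilon>" if u: "u \<in> V" and C: "C \<in> lcosets H" for u C
      using \<rho>_lip[OF nhd_subset[OF V(1) u] C] V(3) u by force
    then show "\<exists>U. openin T U \<and> \<one> \<in> U \<and> (\<forall>u\<in>U. \<forall>x\<in>lcosets H.
        cmod ((\<lambda>C\<in>lcosets H. complex_of_real (\<rho> C)) (u <#\<^bsub>G\<^esub> x) - (\<lambda>C\<in>lcosets H. complex_of_real (\<rho> C)) x) < \<epsilon>)"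
      using V(1,2) nhd_subset by (intro exI[of _ V]) (auto simp flip: of_real_diff)
  qed (use \<rho>_ge \<rho>_le in auto)
  moreover have "\<rho> H = 1"
  proof -
    have "D H \<le> N \<one>" unfolding D_def using bdd[OF H_coset] H_closed(3) by (rule cINF_lower)
    then show ?thesis using D_ge[OF H_coset] N(3) by (simp add: \<rho>_def)
  qed
  moreover have "0 \<le> \<rho> C \<and> \<rho> C \<le> 1" if "C \<in> lcosets H" for C
    using \<rho>_ge \<rho>_le[OF that] by simp
  moreover have "C \<inter> U \<noteq> {}" if C: "C \<in> lcosets H" and ne: "\<rho> C \<noteq> 0" for C
  proof -
    have "D C < 1/2" using ne by (simp add: \<rho>_def max_def split: if_splits)
    then obtain x where x: "x \<in> C" "N x < 1/2"
      unfolding D_def using cINF_less_iff[OF CG(2)[OF C] bdd[OF C]] by blast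
    then have "x \<in> U" using N(7)[of x 0] CG(1)[OF C] by auto
    then show ?thesis using x(1) by blast
  qed
  ultimately show ?thesis by (rule that)
qed

end

section \<open>Invariant means from injectivity\<close>

context top_group_subgroup
begin

definition lift :: "('a set \<Rightarrow> complex) \<Rightarrow> 'a \<Rightarrow> complex" where
  "lift f = (\<lambda>g\<in>carrier G. f (g <#\<^bsub>G\<^esub> H))"

text \<open>Meant for right \<open>H\<close>-invariant functions, for which the choice of the representative is
  immaterial.\<close>

definition descend :: "('a \<Rightarrow> complex) \<Rightarrow> 'a set \<Rightarrow> complex" where
  "descend F = (\<lambda>C\<in>lcosets H. F (SOME g. g \<in> C))"

definition right_invariant :: "('a \<Rightarrow> complex) set" where
  "right_invariant = {F \<in> self.A. \<forall>g\<in>carrier G. \<forall>h\<in>H. F (g \<otimes> h) = F g}"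

lemma lift_ruc:
  assumes f: "f \<in> cos.A"
  shows "lift f \<in> self.A"
proof -
  have "\<exists>M>0. \<forall>x\<in>lcosets H. cmod (f x) \<le> M" by (rule cos.ruc_bounded[OF f])
  then obtain M where M: "\<forall>x\<in>lcosets H. cmod (f x) \<le> M" by blast
  show ?thesis
  proof (rule self.rucI[where M = M])
    show "cmod (lift f g) \<le> M" if "g \<in> carrier G" for g using M coset_in[OF that] that by (simp add: lift_def)
    fix \<epsilon> :: real assume \<epsilon>: "\<epsilon> > 0"
    obtain U where U: "openin T U" "\<one> \<in> U"
      "\<And>u x. u \<in> U \<Longrightarrow> x \<in> lcosets H \<Longrightarrow> cmod (f (u <#\<^bsub>G\<^esub> x) - f x) < \<epsilon>"
      using cos.ruc_nhd[OF f \<epsilon>] by blast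
    have "cmod (lift f (u \<otimes> g) - lift f g) < \<epsilon>" if "u \<in> U" "g \<in> carrier G" for u g
      using U(3)[OF that(1) coset_in[OF that(2)]] that nhd_subset[OF U(1) that(1)] by (simp add: lift_def coset_mult)
    then show "\<exists>U. openin T U \<and> \<one> \<in> U \<and> (\<forall>u\<in>U. \<forall>g\<in>carrier G. cmod (lift f (u \<otimes> g) - lift f g) < \<epsilon>)"
      using U(1,2) by blast
  qed (simp add: lift_def)
qed

lemma lift_right_invariant: "f \<in> cos.A \<Longrightarrow> lift f \<in> right_invariant"
  using lift_ruc H_carrier by (auto simp: right_invariant_def lift_def coset_mult[symmetric] coset_absorb)

lemma descend_coset:
  assumes F: "F \<in> right_invariant" and g: "g \<in> carrier G"
  shows "descend F (g <#\<^bsub>G\<^esub> H) = F g"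
proof -
  have "g \<in> g <#\<^bsub>G\<^esub> H" using lcos_self[OF g H] .
  then have "(SOME k. k \<in> g <#\<^bsub>G\<^esub> H) \<in> g <#\<^bsub>G\<^esub> H" by (rule someI)
  then obtain h where "h \<in> H" "(SOME k. k \<in> g <#\<^bsub>G\<^esub> H) = g \<otimes> h" by (auto simp: l_coset_def)
  then show ?thesis using F g by (simp add: descend_def right_invariant_def coset_in)
qed

lemma descend_lift: "f \<in> cos.A \<Longrightarrow> C \<in> lcosets H \<Longrightarrow> descend (lift f) C = f C"
  by (erule coset_cases) (simp add: descend_coset lift_right_invariant, simp add: lift_def)

lemma descend_ruc:
  assumes F: "F \<in> right_invariant"
  shows "descend F \<in> cos.A"
proof -
  have FA: "F \<in> self.A" using F by (simp add: right_invariant_def)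
  have "\<exists>M>0. \<forall>x\<in>carrier G. cmod (F x) \<le> M" by (rule self.ruc_bounded[OF FA])
  then obtain M where M: "\<forall>x\<in>carrier G. cmod (F x) \<le> M" by blast
  show ?thesis
  proof (rule cos.rucI[where M = M])
    show "cmod (descend F C) \<le> M" if "C \<in> lcosets H" for C
      using that M by (elim coset_cases) (simp add: descend_coset[OF F])
    fix \<epsilon> :: real assume \<epsilon>: "\<epsilon> > 0"
    obtain U where U: "openin T U" "\<one> \<in> U" "\<And>u x. u \<in> U \<Longrightarrow> x \<in> carrier G \<Longrightarrow> cmod (F (u \<otimes> x) - F x) < \<epsilon>"
      using self.ruc_nhd[OF FA \<epsilon>] by blast
    have "cmod (descend F (u <#\<^bsub>G\<^esub> C) - descend F C) < \<epsilon>" if u: "u \<in> U" and C: "C \<in> lcosets H" for u C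
    proof -
      obtain g where g: "g \<in> carrier G" "C = g <#\<^bsub>G\<^esub> H" using C by (rule coset_cases)
      have uc: "u \<in> carrier G" using U(1) u by (rule nhd_subset)
      show ?thesis using U(3)[OF u g(1)] descend_coset[OF F g(1)] descend_coset[OF F m_closed[OF uc g(1)]] g uc
        by (simp add: coset_mult)
    qed
    then show "\<exists>U. openin T U \<and> \<one> \<in> U \<and> (\<forall>u\<in>U. \<forall>C\<in>lcosets H. cmod (descend F (u <#\<^bsub>G\<^esub> C) - descend F C) < \<epsilon>)"
      using U(1,2) by blast
  qed (simp add: descend_def)
qed

lemma right_invariant_system: "function_system self.alg right_invariant"
proof (rule self.function_system_algI)
  show "(\<lambda>x\<in>carrier G. 1) \<in> right_invariant"
    using self.ruc_const[of 1] H_carrier by (auto simp: right_invariant_def)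
  show "(\<lambda>x\<in>carrier G. F x + F' x) \<in> right_invariant" if "F \<in> right_invariant" "F' \<in> right_invariant" for F F'
    using that self.ruc_add[of F F'] H_carrier by (auto simp: right_invariant_def)
  show "(\<lambda>x\<in>carrier G. c * F x) \<in> right_invariant" if "F \<in> right_invariant" for F c
    using that self.ruc_smult[of F c] H_carrier by (auto simp: right_invariant_def)
  show "(\<lambda>x\<in>carrier G. cnj (F x)) \<in> right_invariant" if "F \<in> right_invariant" for F
    using that self.ruc_cnj[of F] H_carrier by (auto simp: right_invariant_def)
  show "l \<in> right_invariant" if \<sigma>: "\<And>n::nat. \<sigma> n \<in> right_invariant" and l: "l \<in> self.A"
    and lim: "\<And>x. x \<in> carrier G \<Longrightarrow> (\<lambda>n. \<sigma> n x) \<longlonglongrightarrow> l x" for \<sigma> l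
  proof -
    have "l (g \<otimes> h) = l g" if g: "g \<in> carrier G" and h: "h \<in> H" for g h
    proof -
      have "(\<lambda>n. \<sigma> n (g \<otimes> h)) = (\<lambda>n. \<sigma> n g)" using \<sigma> g h by (auto simp: right_invariant_def)
      then show ?thesis using lim[OF g] lim[OF m_closed[OF g H_carrier[OF h]]] by (simp add: LIMSEQ_unique)
    qed
    then show ?thesis using l by (simp add: right_invariant_def)
  qed
qed (auto simp: right_invariant_def)

lemma descend_unital_positive: "unital_positive_map self.alg right_invariant cos.alg cos.A descend"
  unfolding unital_positive_map_def unital_linear_map_def
proof (intro conjI ballI allI impI)
  show "descend \<in> right_invariant \<rightarrow> cos.A" using descend_ruc by blast
  have some_in: "(SOME g. g \<in> C) \<in> carrier G" if C: "C \<in> lcosets H" for C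
  proof -
    obtain g where g: "g \<in> carrier G" "C = g <#\<^bsub>G\<^esub> H" using C by (rule coset_cases)
    then have "(SOME k. k \<in> C) \<in> C" using lcos_self[OF g(1) H] by (metis someI)
    then show ?thesis using g H_carrier by (auto simp: l_coset_def)
  qed
  show "descend \<one>\<^bsub>self.alg\<^esub> = \<one>\<^bsub>cos.alg\<^esub>" by (auto simp: descend_def ruc_algebra_def some_in)
  show "descend (F \<oplus>\<^bsub>self.alg\<^esub> F') = descend F \<oplus>\<^bsub>cos.alg\<^esub> descend F'" for F F'
    by (auto simp: descend_def ruc_algebra_def some_in)
  show "descend (c \<odot>\<^bsub>self.alg\<^esub> F) = c \<odot>\<^bsub>cos.alg\<^esub> descend F" for c F
    by (auto simp: descend_def ruc_algebra_def some_in)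
  show "cstar_nonneg cos.alg (descend F)" if F: "F \<in> right_invariant" "cstar_nonneg self.alg F" for F
  proof -
    have "F \<in> self.A" using F(1) by (simp add: right_invariant_def)
    then show ?thesis using F(2) some_in self.cstar_nonneg_alg cos.cstar_nonneg_alg[OF descend_ruc[OF F(1)]]
      by (auto simp: descend_def)
  qed
qed

lemma right_invariant_action:
  assumes g: "g \<in> carrier G" and F: "F \<in> right_invariant"
  shows "ruc_action G T (carrier G) (mult G) g F \<in> right_invariant"
proof -
  have FA: "F \<in> self.A" using F by (simp add: right_invariant_def)
  have "ruc_action G T (carrier G) (mult G) g F (k \<otimes> h) = ruc_action G T (carrier G) (mult G) g F k"
    if "k \<in> carrier G" "h \<in> H" for k h
    using F that g H_carrier[OF that(2)] FA by (simp add: self.ruc_action_apply right_invariant_def flip: m_assoc)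
  then show ?thesis using self.ruc_action_closed[OF FA g] by (simp add: right_invariant_def)
qed

lemma descend_equivariant:
  "equivariant_map G right_invariant (ruc_action G T (carrier G) (mult G))
     (ruc_action G T (lcosets H) (\<lambda>u x. u <#\<^bsub>G\<^esub> x)) descend"
  unfolding equivariant_map_def
proof (intro ballI)
  fix g F assume g: "g \<in> carrier G" and F: "F \<in> right_invariant"
  have FA: "F \<in> self.A" using F by (simp add: right_invariant_def)
  show "descend (ruc_action G T (carrier G) (mult G) g F) = ruc_action G T (lcosets H) (\<lambda>u x. u <#\<^bsub>G\<^esub> x) g (descend F)"
    using descend_ruc[OF right_invariant_action[OF g F]] cos.ruc_action_closed[OF descend_ruc[OF F] g]
  proof (rule cos.ruc_eqI)
    fix C assume "C \<in> lcosets H"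
    then obtain k where k: "k \<in> carrier G" "C = k <#\<^bsub>G\<^esub> H" by (rule coset_cases)
    show "descend (ruc_action G T (carrier G) (mult G) g F) C
        = ruc_action G T (lcosets H) (\<lambda>u x. u <#\<^bsub>G\<^esub> x) g (descend F) C"
      using g k FA
      by (simp add: descend_coset[OF right_invariant_action[OF g F]] self.ruc_action_apply
          cos.ruc_action_apply[OF descend_ruc[OF F]] coset_in coset_mult descend_coset[OF F])
  qed
qed

text \<open>Injectivity extends the map \<open>descend\<close>, which identifies the right \<open>H\<close>-invariant functions with
  the functions on the cosets, to all uniformly continuous functions on \<open>G\<close>. The state is the value of
  the extension at the base coset, which the elements of \<open>H\<close> fix.\<close>

lemma localized_state:
  assumes inj: "G_injective TYPE('a \<Rightarrow> complex) G T (RUC G T H) (carrier (RUC G T H)) (RUC_action G T H)"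
  obtains m where "state_on (carrier G) self.A m"
    "\<And>h F. \<lbrakk>h \<in> H; F \<in> self.A\<rbrakk> \<Longrightarrow> m (\<lambda>x\<in>carrier G. F (h \<otimes> x)) = m F"
    "\<forall>f\<in>cos.A. m (lift f) = f H"
proof -
  let ?\<alpha> = "ruc_action G T (carrier G) (mult G)" and ?\<beta> = "ruc_action G T (lcosets H) (\<lambda>u x. u <#\<^bsub>G\<^esub> x)"
  have sub: "right_invariant \<subseteq> self.A" by (auto simp: right_invariant_def)
  obtain \<Psi> where \<Psi>: "unital_positive_map self.alg self.A cos.alg cos.A \<Psi>"
    "equivariant_map G self.A ?\<alpha> ?\<beta> \<Psi>" "\<forall>F\<in>right_invariant. \<Psi> F = descend F"
    using inj self.G_function_system_alg right_invariant_system sub right_invariant_action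
      descend_unital_positive descend_equivariant
    unfolding G_injective_def RUC_eq RUC_action_eq cos.carrier_alg by blast
  have L: "unital_linear_map self.alg self.A cos.alg cos.A \<Psi>" using \<Psi>(1) by (simp add: unital_positive_map_def)
  have \<Psi>A: "\<Psi> F \<in> cos.A" if "F \<in> self.A" for F using L that by (auto simp: unital_linear_map_def)
  show ?thesis
  proof (rule that[of "\<lambda>F. \<Psi> F H"])
    show "state_on (carrier G) self.A (\<lambda>F. \<Psi> F H)"
      unfolding state_on_def
    proof (intro conjI ballI allI impI)
      show "\<Psi> (\<lambda>x\<in>carrier G. 1) H = 1" using L H_coset by (simp add: unital_linear_map_def ruc_algebra_def)
      show "\<Psi> (\<lambda>x\<in>carrier G. f x + g x) H = \<Psi> f H + \<Psi> g H" if "f \<in> self.A" "g \<in> self.A" for f g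
        using L H_coset that by (simp add: unital_linear_map_def ruc_algebra_def)
      show "\<Psi> (\<lambda>x\<in>carrier G. c * f x) H = c * \<Psi> f H" if "f \<in> self.A" for c f
        using L H_coset that by (simp add: unital_linear_map_def ruc_algebra_def)
      show "\<Psi> f H \<in> \<real>\<^sub>\<ge>\<^sub>0" if "f \<in> self.A" "\<forall>x\<in>carrier G. f x \<in> \<real>\<^sub>\<ge>\<^sub>0" for f
        using \<Psi>(1) that cos.cstar_nonneg_alg[OF \<Psi>A[OF that(1)]] self.cstar_nonneg_alg[OF that(1)] H_coset
        by (simp add: unital_positive_map_def)
    qed
    show "\<Psi> (\<lambda>x\<in>carrier G. F (h \<otimes> x)) H = \<Psi> F H" if h: "h \<in> H" and F: "F \<in> self.A" for h F
    proof -
      have hc: "inv h \<in> carrier G" "h \<in> carrier G" using h H_carrier by auto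
      have "(\<lambda>x\<in>carrier G. F (h \<otimes> x)) = ?\<alpha> (inv h) F" using F hc by (simp add: ruc_action_def)
      then have "\<Psi> (\<lambda>x\<in>carrier G. F (h \<otimes> x)) = ?\<beta> (inv h) (\<Psi> F)"
        using \<Psi>(2) hc(1) F by (simp add: equivariant_map_def)
      then show ?thesis using cos.ruc_action_apply[OF \<Psi>A[OF F] H_coset] hc h by (simp add: coset_absorb)
    qed
    show "\<forall>f\<in>cos.A. \<Psi> (lift f) H = f H"
      using \<Psi>(3) lift_right_invariant descend_lift H_coset by simp
  qed
qed

text \<open>A function that vanishes on \<open>H\<close> is small on a set \<open>U H\<close>. A bump function \<open>\<rho>\<close> on the cosets that is
  supported there gives \<open>F \<le> \<epsilon> + M (1 - \<rho>)\<close>, and the state takes the value \<open>\<epsilon>\<close> at the right-hand side,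
  since \<open>\<rho> H = 1\<close>.\<close>

lemma localized_state_support_real:
  assumes m: "state_on (carrier G) self.A m" and loc: "\<forall>f\<in>cos.A. m (lift f) = f H"
    and F: "(\<lambda>x\<in>carrier G. complex_of_real (F x)) \<in> self.A" and zero: "\<forall>h\<in>H. F h = 0"
  shows "Re (m (\<lambda>x\<in>carrier G. complex_of_real (F x))) \<le> 0" "Im (m (\<lambda>x\<in>carrier G. complex_of_real (F x))) = 0"
proof -
  let ?F = "\<lambda>x\<in>carrier G. complex_of_real (F x)"
  have "\<exists>M>0. \<forall>x\<in>carrier G. cmod (?F x) \<le> M" by (rule self.ruc_bounded[OF F])
  then obtain M where M: "M > 0" "\<And>x. x \<in> carrier G \<Longrightarrow> F x \<le> M" by (auto simp: abs_le_iff)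
  have "Re (m ?F) \<le> \<epsilon> \<and> Im (m ?F) = 0" if \<epsilon>: "\<epsilon> > 0" for \<epsilon>
  proof -
    obtain U where U: "openin T U" "\<one> \<in> U" "\<And>u x. u \<in> U \<Longrightarrow> x \<in> carrier G \<Longrightarrow> cmod (?F (u \<otimes> x) - ?F x) < \<epsilon>"
      using self.ruc_nhd[OF F \<epsilon>] by blast
    obtain \<rho> :: "'a set \<Rightarrow> real" where \<rho>: "(\<lambda>C\<in>lcosets H. complex_of_real (\<rho> C)) \<in> cos.A" "\<rho> H = 1"
      "\<And>C. C \<in> lcosets H \<Longrightarrow> 0 \<le> \<rho> C \<and> \<rho> C \<le> 1"
      "\<And>C. C \<in> lcosets H \<Longrightarrow> \<rho> C \<noteq> 0 \<Longrightarrow> C \<inter> U \<noteq> {}"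
      using coset_bump[OF U(1,2)] by blast
    define b where "b = (\<lambda>C\<in>lcosets H. complex_of_real (\<epsilon> + M * (1 - \<rho> C)))"
    have "(\<lambda>C\<in>lcosets H. complex_of_real (\<epsilon> + M) + (\<lambda>C\<in>lcosets H. - complex_of_real M * (\<lambda>C\<in>lcosets H. complex_of_real (\<rho> C)) C) C) \<in> cos.A"
      by (rule cos.ruc_compose2[OF cos.ruc_const[of 0] cos.ruc_smult[OF \<rho>(1), of "- complex_of_real M"],
            of "\<lambda>a c. complex_of_real (\<epsilon> + M) + c"])
         (auto simp: case_prod_unfold intro!: continuous_intros)
    also have "(\<lambda>C\<in>lcosets H. complex_of_real (\<epsilon> + M) + (\<lambda>C\<in>lcosets H. - complex_of_real M * (\<lambda>C\<in>lcosets H. complex_of_real (\<rho> C)) C) C) = b"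
      by (auto simp: b_def algebra_simps)
    finally have b: "b \<in> cos.A" .
    have le: "F x \<le> \<epsilon> + M * (1 - \<rho> (x <#\<^bsub>G\<^esub> H))" if x: "x \<in> carrier G" for x
    proof (cases "\<rho> (x <#\<^bsub>G\<^esub> H) = 0")
      case True
      then show ?thesis using M(2)[OF x] \<epsilon> by simp
    next
      case False
      then obtain h where h: "h \<in> H" "x \<otimes> h \<in> U" using \<rho>(4)[OF coset_in[OF x]] by (auto simp: l_coset_def)
      have hc: "h \<in> carrier G" using h(1) by (rule H_carrier)
      have "x \<otimes> h \<otimes> inv h = x" using x hc by (simp add: m_assoc)
      then have "\<bar>F x\<bar> < \<epsilon>" using U(3)[OF h(2), of "inv h"] zero H_closed(2)[OF h(1)] x hc by simp
      moreover have "0 \<le> M * (1 - \<rho> (x <#\<^bsub>G\<^esub> H))" using M(1) \<rho>(3)[OF coset_in[OF x]] by simp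
      ultimately show ?thesis by linarith
    qed
    have nonneg: "lift b x - ?F x \<in> \<real>\<^sub>\<ge>\<^sub>0" if "x \<in> carrier G" for x
      using le[OF that] that by (simp add: lift_def b_def coset_in complex_nonneg_Reals_iff)
    have "Re (m ?F) \<le> Re (m (lift b))" "Im (m ?F) = Im (m (lift b))"
      using self.state_on_mono[OF m F lift_ruc[OF b] nonneg] by blast+
    then show ?thesis using bspec[OF loc b] \<rho>(2) H_coset by (simp add: b_def)
  qed
  then show "Re (m ?F) \<le> 0" "Im (m ?F) = 0" using field_le_epsilon[of "Re (m ?F)" 0] zero_less_one by (simp, blast)
qed

lemma localized_state_support:
  assumes m: "state_on (carrier G) self.A m" and loc: "\<forall>f\<in>cos.A. m (lift f) = f H"
    and F: "F \<in> self.A" "F' \<in> self.A" and eq: "\<forall>h\<in>H. F h = F' h"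
  shows "m F = m F'"
proof -
  have real: "m (\<lambda>x\<in>carrier G. complex_of_real (k x)) = 0"
    if k: "(\<lambda>x\<in>carrier G. complex_of_real (k x)) \<in> self.A" and z: "\<forall>h\<in>H. k h = 0" for k
  proof -
    let ?k = "\<lambda>x\<in>carrier G. complex_of_real (k x)"
    have neg: "(\<lambda>x\<in>carrier G. -1 * ?k x) = (\<lambda>x\<in>carrier G. complex_of_real (- k x))" by auto
    have "m (\<lambda>x\<in>carrier G. complex_of_real (- k x)) = - m ?k"
      using self.state_onD(3)[OF m k, of "-1"] unfolding neg by simp
    moreover have "Re (m (\<lambda>x\<in>carrier G. complex_of_real (- k x))) \<le> 0"
      using self.ruc_smult[OF k, of "-1"] unfolding neg
      by (intro localized_state_support_real(1)[OF m loc]) (simp_all add: z)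
    moreover have "Re (m ?k) \<le> 0" "Im (m ?k) = 0"
      by (rule localized_state_support_real[OF m loc k z])+
    ultimately show ?thesis by (simp add: complex_eq_iff)
  qed
  define D where "D = (\<lambda>x\<in>carrier G. F x - F' x)"
  have D: "D \<in> self.A" unfolding D_def using F by (rule self.ruc_diff)
  define R where "R = (\<lambda>x\<in>carrier G. complex_of_real (Re (D x)))"
  define J where "J = (\<lambda>x\<in>carrier G. complex_of_real (Im (D x)))"
  have R: "R \<in> self.A" and J: "J \<in> self.A" unfolding R_def J_def using D by (rule self.ruc_Re self.ruc_Im)+
  have D0: "D h = 0" if "h \<in> H" for h using eq that H_carrier[OF that] by (simp add: D_def)
  have "m R = 0" unfolding R_def by (rule real) (use R D0 in \<open>simp_all add: R_def\<close>)
  moreover have "m J = 0" unfolding J_def by (rule real) (use J D0 in \<open>simp_all add: J_def\<close>)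
  moreover have "F = (\<lambda>x\<in>carrier G. F' x + (\<lambda>x\<in>carrier G. R x + (\<lambda>x\<in>carrier G. \<i> * J x) x) x)"
  proof (rule self.ruc_eqI[OF F(1)])
    show "(\<lambda>x\<in>carrier G. F' x + (\<lambda>x\<in>carrier G. R x + (\<lambda>x\<in>carrier G. \<i> * J x) x) x) \<in> self.A"
      by (rule self.ruc_add[OF F(2) self.ruc_add[OF R self.ruc_smult[OF J]]])
    show "F x = (\<lambda>x\<in>carrier G. F' x + (\<lambda>x\<in>carrier G. R x + (\<lambda>x\<in>carrier G. \<i> * J x) x) x) x" if "x \<in> carrier G" for x
      using that by (simp add: R_def J_def D_def complex_eq_iff)
  qed
  moreover have "m (\<lambda>x\<in>carrier G. F' x + (\<lambda>x\<in>carrier G. R x + (\<lambda>x\<in>carrier G. \<i> * J x) x) x) = m F' + (m R + \<i> * m J)"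
    using self.state_onD(2)[OF m F(2) self.ruc_add[OF R self.ruc_smult[OF J]]]
      self.state_onD(2)[OF m R self.ruc_smult[OF J]] self.state_onD(3)[OF m J, of \<i>] by simp
  ultimately show ?thesis by simp
qed

text \<open>The mean of \<open>f\<close> is the value of the state at any extension of \<open>f\<close>; as this does not depend on the
  extension, convenient extensions can be used to verify each property. For a nonnegative function the
  modulus of an extension is a nonnegative extension.\<close>

lemma invariant_mean_of_localized_state:
  assumes m: "state_on (carrier G) self.A m" and loc: "\<forall>f\<in>cos.A. m (lift f) = f H"
    and inv: "\<And>h F. \<lbrakk>h \<in> H; F \<in> self.A\<rbrakk> \<Longrightarrow> m (\<lambda>x\<in>carrier G. F (h \<otimes> x)) = m F"
  shows "\<exists>m. invariant_mean K (subtopology T H) m"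
proof -
  define ext where "ext f = (SOME F. F \<in> self.A \<and> (\<forall>h\<in>H. F h = f h))" for f
  have ext: "ext f \<in> self.A" "\<And>h. h \<in> H \<Longrightarrow> ext f h = f h" if "f \<in> ruc_group K (subtopology T H)" for f
  proof -
    have "\<exists>F. F \<in> self.A \<and> (\<forall>h\<in>H. F h = f h)" using ruc_extend[OF that] by blast
    then have "ext f \<in> self.A \<and> (\<forall>h\<in>H. ext f h = f h)" unfolding ext_def by (rule someI_ex)
    then show "ext f \<in> self.A" "\<And>h. h \<in> H \<Longrightarrow> ext f h = f h" by blast+
  qed
  have m_ext: "m (ext f) = m F" if "f \<in> ruc_group K (subtopology T H)" "F \<in> self.A" "\<And>h. h \<in> H \<Longrightarrow> F h = f h" for f F
    by (rule localized_state_support[OF m loc]) (use ext[OF that(1)] that in auto)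
  have const: "(\<lambda>h\<in>H. c) \<in> ruc_group K (subtopology T H)" for c using sub.self.ruc_const[of c] by simp
  have add: "(\<lambda>h\<in>H. f h + g h) \<in> ruc_group K (subtopology T H)"
    if "f \<in> ruc_group K (subtopology T H)" "g \<in> ruc_group K (subtopology T H)" for f g
    using sub.self.ruc_add[OF that] by simp
  have smult: "(\<lambda>h\<in>H. c * f h) \<in> ruc_group K (subtopology T H)" if "f \<in> ruc_group K (subtopology T H)" for c f
    using sub.self.ruc_smult[OF that] by simp
  have "invariant_mean K (subtopology T H) (\<lambda>f. m (ext f))"
    unfolding invariant_mean_def state_on_def
  proof (intro conjI ballI allI impI)
    have "m (ext (\<lambda>h\<in>H. 1)) = m (\<lambda>x\<in>carrier G. 1)"
      using const self.ruc_const by (rule m_ext) (simp add: H_carrier)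
    then show "m (ext (\<lambda>x\<in>carrier K. 1)) = 1" using self.state_onD(1)[OF m] by simp
    fix f assume f: "f \<in> ruc_group K (subtopology T H)"
    show "m (ext (\<lambda>x\<in>carrier K. f x + g x)) = m (ext f) + m (ext g)" if g: "g \<in> ruc_group K (subtopology T H)" for g
    proof -
      have "m (ext (\<lambda>h\<in>H. f h + g h)) = m (\<lambda>x\<in>carrier G. ext f x + ext g x)"
        using add[OF f g] self.ruc_add[OF ext(1)[OF f] ext(1)[OF g]]
        by (rule m_ext) (simp add: H_carrier ext(2)[OF f] ext(2)[OF g])
      then show ?thesis using self.state_onD(2)[OF m ext(1)[OF f] ext(1)[OF g]] by simp
    qed
    show "m (ext (\<lambda>x\<in>carrier K. c * f x)) = c * m (ext f)" for c
    proof -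
      have "m (ext (\<lambda>h\<in>H. c * f h)) = m (\<lambda>x\<in>carrier G. c * ext f x)"
        using smult[OF f] self.ruc_smult[OF ext(1)[OF f]]
        by (rule m_ext) (simp add: H_carrier ext(2)[OF f])
      then show ?thesis using self.state_onD(3)[OF m ext(1)[OF f], of c] by simp
    qed
    show "m (ext f) \<in> \<real>\<^sub>\<ge>\<^sub>0" if pos: "\<forall>x\<in>carrier K. f x \<in> \<real>\<^sub>\<ge>\<^sub>0"
    proof -
      have A: "(\<lambda>x\<in>carrier G. complex_of_real (cmod (ext f x))) \<in> self.A"
        using ext(1)[OF f] by (rule self.ruc_compose) (auto intro!: continuous_intros)
      have "m (ext f) = m (\<lambda>x\<in>carrier G. complex_of_real (cmod (ext f x)))"
        using f A by (rule m_ext) (use pos in \<open>auto simp: H_carrier ext(2)[OF f] nonneg_Reals_def\<close>)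
      also have "\<dots> \<in> \<real>\<^sub>\<ge>\<^sub>0" using A by (rule self.state_onD(4)[OF m]) simp
      finally show ?thesis .
    qed
    show "m (ext (\<lambda>x\<in>carrier K. f (k \<otimes>\<^bsub>K\<^esub> x))) = m (ext f)" if k: "k \<in> carrier K" for k
    proof -
      have kH: "k \<in> H" using k by simp
      have "m (ext (\<lambda>h\<in>H. f (k \<otimes> h))) = m (\<lambda>x\<in>carrier G. ext f (k \<otimes> x))"
      proof (rule m_ext)
        show "(\<lambda>h\<in>H. f (k \<otimes> h)) \<in> ruc_group K (subtopology T H)" using sub.self.ruc_shift[OF f k] by simp
        show "(\<lambda>x\<in>carrier G. ext f (k \<otimes> x)) \<in> self.A" by (rule self.ruc_shift[OF ext(1)[OF f] H_carrier[OF kH]])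
      qed (simp add: H_carrier ext(2)[OF f] H_closed(1)[OF kH])
      then show ?thesis using inv[OF kH ext(1)[OF f]] by simp
    qed
  qed
  then show ?thesis by blast
qed

end

theorem invariant_mean_of_injective:
  fixes G :: "('a, 'm) monoid_scheme"
  assumes G: "topological_group G T" and H: "subgroup H G"
    and inj: "G_injective TYPE('a \<Rightarrow> complex) G T (RUC G T H) (carrier (RUC G T H)) (RUC_action G T H)"
  shows "\<exists>m. invariant_mean (G\<lparr>carrier := H\<rparr>) (subtopology T H) m"
proof -
  interpret top_group_subgroup G T H
    by (intro top_group_subgroup.intro top_group.intro top_group_subgroup_axioms.intro G H)
  show ?thesis
  proof (rule localized_state[OF inj])
    fix m assume m: "state_on (carrier G) self.A m" "\<forall>f\<in>cos.A. m (lift f) = f H"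
      and inv: "\<And>h F. h \<in> H \<Longrightarrow> F \<in> self.A \<Longrightarrow> m (\<lambda>x\<in>carrier G. F (h \<otimes>\<^bsub>G\<^esub> x)) = m F"
    show ?thesis using m inv by (rule invariant_mean_of_localized_state)
  qed
qed

theorem corollary4p7:
  fixes G :: "('a, 'm) monoid_scheme" and T :: "'a topology" and H :: "'a set"
  assumes "polish_group G T"
    and "subgroup H G" and "closedin T H"
  shows
    "(amenable TYPE(('a \<Rightarrow> complex) \<Rightarrow> complex) (G\<lparr>carrier := H\<rparr>) (subtopology T H) \<longleftrightarrow>
      G_injective TYPE('a \<Rightarrow> complex) G T (RUC G T H) (carrier (RUC G T H)) (RUC_action G T H)) \<and>
     (amenable TYPE(('a \<Rightarrow> complex) \<Rightarrow> complex) (G\<lparr>carrier := H\<rparr>) (subtopology T H) \<longrightarrow>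
      amenable TYPE('x) (G\<lparr>carrier := H\<rparr>) (subtopology T H)) \<and>
     (G_injective TYPE('a \<Rightarrow> complex) G T (RUC G T H) (carrier (RUC G T H)) (RUC_action G T H) \<longrightarrow>
      G_injective TYPE('e) G T (RUC G T H) (carrier (RUC G T H)) (RUC_action G T H))"
proof -
  have G: "topological_group G T" using assms(1) by (simp add: polish_group_def)
  have K: "topological_group (G\<lparr>carrier := H\<rparr>) (subtopology T H)"
    using G assms(2) by (rule topological_group_subgroup)
  let ?M = "\<exists>m. invariant_mean (G\<lparr>carrier := H\<rparr>) (subtopology T H) m"
  have 1: "?M" if "amenable TYPE(('a \<Rightarrow> complex) \<Rightarrow> complex) (G\<lparr>carrier := H\<rparr>) (subtopology T H)"
    using K that by (rule invariant_mean_of_amenable)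
  have 2: "?M" if "G_injective TYPE('a \<Rightarrow> complex) G T (RUC G T H) (carrier (RUC G T H)) (RUC_action G T H)"
    using G assms(2) that by (rule invariant_mean_of_injective)
  have 3: "amenable TYPE(('a \<Rightarrow> complex) \<Rightarrow> complex) (G\<lparr>carrier := H\<rparr>) (subtopology T H)"
    "amenable TYPE('x) (G\<lparr>carrier := H\<rparr>) (subtopology T H)" if "?M"
    using that amenable_of_invariant_mean[OF K] by blast+
  have 4: "G_injective TYPE('a \<Rightarrow> complex) G T (RUC G T H) (carrier (RUC G T H)) (RUC_action G T H)"
    "G_injective TYPE('e) G T (RUC G T H) (carrier (RUC G T H)) (RUC_action G T H)" if "?M"
    using that injective_of_invariant_mean[OF G assms(2)] by blast+
  show ?thesis using 1 2 3 4 by blast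
qed

end
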